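(* Let $N\ge 2$ be an integer and $\bar N=\frac{2(2N-1)}{2N-3}$. Let $h\in C^1(\mathbb{R})$ with $h(0)=0$, put $H(t)=\int_0^t h(r)\,dr$, and assume: (1) for some $p\in(1,\bar N-1)$, $\lim_{|t|\to+\infty}\frac{h(t)}{|t|^p}=0$; (2) $h'(0)=0$; (3) there exists $\xi>0$ such that $2H(\xi)-\xi^2>0$. Then the problem $$\left(-u_{xx}+u+D_x^{-2}\Delta_y u-h(u)\right)_x=0\quad\text{in }\mathbb{R}^N$$ possesses at least one nontrivial solution; that is, there exists $u\in X$, $u\neq 0$, which is a critical point of the functional $I:X\to\mathbb{R}$ defined in the context.
   Context: Points of $\mathbb{R}^N$ are written $(x,y)\in\mathbb{R}\times\mathbb{R}^{N-1}$, $dV=dx\,dy$, $\nabla_y=(\partial_{y_1},\dots,\partial_{y_{N-1}})$, $\Delta_y=\sum_{i=1}^{N-1}\partial_{y_i}^2$, and $D_x^{-1}f(x,y)=\int_{-\infty}^x f(s,y)\,ds$. Let $Y=\{g_x: g\in C_0^\infty(\mathbb{R}^N)\}$ (so for $u=g_x\in Y$, $D_x^{-1}\nabla_y u=\nabla_y g$), with inner product $(u,v)=\int_{\mathbb{R}^N}(u_xv_x+D_x^{-1}\nabla_y u\cdot D_x^{-1}\nabla_y v+uv)\,dV$ and norm $\|u\|=\left(\int_{\mathbb{R}^N}(|u_x|^2+|D_x^{-1}\nabla_y u|^2+|u|^2)\,dV\right)^{1/2}$. The space $X$ is the set of functions $u:\mathbb{R}^N\to\mathbb{R}$ for which there is a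 sequence $\{u_n\}\subset Y$ with $u_n\to u$ a.e. on $\mathbb{R}^N$ and $\|u_j-u_k\|\to 0$ as $j,k\to\infty$. With the inner product and norm extended by continuity, $X$ is a Hilbert space, continuously embedded in $L^q(\mathbb{R}^N)$ for $2\le q\le\bar N$; for $u\in X$, $u_x$ and $D_x^{-1}\nabla_y u$ denote the corresponding $L^2$ limits. Solutions of the equation are understood as critical points of the energy functional $I:X\to\mathbb{R}$, $I(u)=\frac12\|u\|^2-\int_{\mathbb{R}^N}H(u)\,dV$; that is, $u\in X$ with $\int_{\mathbb{R}^N}(u_x\varphi_x+D_x^{-1}\nabla_y u\cdot D_x^{-1}\nabla_y\varphi+u\varphi)\,dV=\int_{\mathbb{R}^N}h(u)\varphi\,dV$ for all $\varphi\in X$. *)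

theory Defs
  imports "HOL-Analysis.Analysis"
begin

text \<open>
  Points of \<open>\<real>\<^sup>N = \<real> \<times> \<real>\<^sup>N\<^sup>-\<^sup>1\<close> are pairs \<open>(x, y)\<close> of type \<open>real \<times> (real ^ 'n)\<close>, so that
  \<open>N = CARD('n) + 1 \<ge> 2\<close>. Integrals over \<open>\<real>\<^sup>N\<close> are taken with respect to \<open>lebesgue\<close>, the completion
  of \<open>lborel\<close>: an almost everywhere limit of Borel functions need not be Borel measurable,
  and would then have the default integral 0 with respect to \<open>lborel\<close>.
\<close>

definition critical_exponent :: "nat \<Rightarrow> real" where
  "critical_exponent N = 2 * (2 * real N - 1) / (2 * real N - 3)"


subsection \<open>The space \<open>Y\<close>\<close>

primrec C_k :: "nat \<Rightarrow> ('a::euclidean_space \<Rightarrow> real) \<Rightarrow> bool" where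
  "C_k 0 f \<longleftrightarrow> continuous_on UNIV f"
| "C_k (Suc k) f \<longleftrightarrow> (\<forall>z. f differentiable (at z)) \<and> (\<forall>v. C_k k (\<lambda>z. frechet_derivative f (at z) v))"

definition test_functions :: "('a::euclidean_space \<Rightarrow> real) set" where
  "test_functions = {g. (\<forall>k. C_k k g) \<and> compact (closure {z. g z \<noteq> 0})}"

definition dx :: "(real \<times> (real ^ 'n) \<Rightarrow> real) \<Rightarrow> real \<times> (real ^ 'n) \<Rightarrow> real" where
  "dx f z = frechet_derivative f (at z) (1, 0)"

definition grad_y :: "(real \<times> (real ^ 'n) \<Rightarrow> real) \<Rightarrow> real \<times> (real ^ 'n) \<Rightarrow> real ^ 'n" where
  "grad_y f z = (\<chi> i. frechet_derivative f (at z) (0, axis i 1))"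

definition Dx_inv :: "(real \<times> (real ^ 'n) \<Rightarrow> 'b::euclidean_space) \<Rightarrow> real \<times> (real ^ 'n) \<Rightarrow> 'b" where
  "Dx_inv f = (\<lambda>(x, y). LINT s:{..x}|lebesgue. f (s, y))"

definition Y_space :: "(real \<times> (real ^ 'n) \<Rightarrow> real) set" where
  "Y_space = dx ` test_functions"

definition Y_norm :: "(real \<times> (real ^ 'n) \<Rightarrow> real) \<Rightarrow> real" where
  "Y_norm u = sqrt (LINT z|lebesgue. \<bar>dx u z\<bar>\<^sup>2 + (norm (Dx_inv (grad_y u) z))\<^sup>2 + \<bar>u z\<bar>\<^sup>2)"


subsection \<open>The space \<open>X\<close>\<close>

definition approximates :: "(nat \<Rightarrow> real \<times> (real ^ 'n) \<Rightarrow> real) \<Rightarrow> (real \<times> (real ^ 'n) \<Rightarrow> real) \<Rightarrow> bool" where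
  "approximates us u \<longleftrightarrow>
     (\<forall>n. us n \<in> Y_space) \<and>
     (AE z in lebesgue. (\<lambda>n. us n z) \<longlonglongrightarrow> u z) \<and>
     (\<forall>e>0. \<exists>M. \<forall>j\<ge>M. \<forall>k\<ge>M. Y_norm (\<lambda>z. us j z - us k z) < e)"

text \<open>Elements of \<open>X_space\<close> are functions; as elements of the Hilbert space \<open>X\<close>, functions
  that agree almost everywhere are identified.\<close>

definition X_space :: "(real \<times> (real ^ 'n) \<Rightarrow> real) set" where
  "X_space = {u. \<exists>us. approximates us u}"

text \<open>The extension by continuity of the norm of \<open>Y\<close> to \<open>X\<close>.\<close>

definition X_norm :: "(real \<times> (real ^ 'n) \<Rightarrow> real) \<Rightarrow> real" where
  "X_norm u = (THE c. \<forall>us. approximates us u \<longrightarrow> (\<lambda>n. Y_norm (us n)) \<longlonglongrightarrow> c)"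

definition L2_limit ::
    "(nat \<Rightarrow> real \<times> (real ^ 'n) \<Rightarrow> 'b::euclidean_space) \<Rightarrow> (real \<times> (real ^ 'n) \<Rightarrow> 'b) \<Rightarrow> bool" where
  "L2_limit fs f \<longleftrightarrow>
     f \<in> borel_measurable lebesgue \<and>
     integrable lebesgue (\<lambda>z. (norm (f z))\<^sup>2) \<and>
     (\<lambda>n. LINT z|lebesgue. (norm (fs n z - f z))\<^sup>2) \<longlonglongrightarrow> 0"

text \<open>For \<open>u \<in> X\<close>, the functions \<open>u\<^sub>x\<close> and \<open>D\<^sub>x\<^sup>-\<^sup>1 \<nabla>\<^sub>y u\<close> are the \<open>L\<^sup>2\<close> limits along approximating
  sequences; they are determined up to null sets.\<close>

definition X_dx :: "(real \<times> (real ^ 'n) \<Rightarrow> real) \<Rightarrow> real \<times> (real ^ 'n) \<Rightarrow> real" where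
  "X_dx u = (SOME w. \<exists>us. approximates us u \<and> L2_limit (\<lambda>n. dx (us n)) w)"

definition X_Dx_inv_grad :: "(real \<times> (real ^ 'n) \<Rightarrow> real) \<Rightarrow> real \<times> (real ^ 'n) \<Rightarrow> real ^ 'n" where
  "X_Dx_inv_grad u =
     (SOME w. \<exists>us. approximates us u \<and> L2_limit (\<lambda>n. Dx_inv (grad_y (us n))) w)"


subsection \<open>The energy functional and its critical points\<close>

text \<open>The interval integral is oriented, as needed for \<open>t < 0\<close>.\<close>

definition primitive :: "(real \<Rightarrow> real) \<Rightarrow> real \<Rightarrow> real" where
  "primitive h t = (LBINT r=0..t. h r)"

definition energy :: "(real \<Rightarrow> real) \<Rightarrow> (real \<times> (real ^ 'n) \<Rightarrow> real) \<Rightarrow> real" where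
  "energy h u = 1 / 2 * (X_norm u)\<^sup>2 - (LINT z|lebesgue. primitive h (u z))"

text \<open>\<open>u\<close> is a critical point of \<open>F : X \<rightarrow> \<real>\<close> if the Frechet derivative of \<open>F\<close> at \<open>u\<close> exists
  and is zero.\<close>

definition critical_point ::
    "((real \<times> (real ^ 'n) \<Rightarrow> real) \<Rightarrow> real) \<Rightarrow> (real \<times> (real ^ 'n) \<Rightarrow> real) \<Rightarrow> bool" where
  "critical_point F u \<longleftrightarrow>
     u \<in> X_space \<and>
     (\<forall>e>0. \<exists>d>0. \<forall>\<phi>\<in>X_space. X_norm \<phi> < d \<longrightarrow>
        \<bar>F (\<lambda>z. u z + \<phi> z) - F u\<bar> \<le> e * X_norm \<phi>)"

definition weak_solution :: "(real \<Rightarrow> real) \<Rightarrow> (real \<times> (real ^ 'n) \<Rightarrow> real) \<Rightarrow> bool" where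
  "weak_solution h u \<longleftrightarrow>
     u \<in> X_space \<and>
     (\<forall>\<phi>\<in>X_space.
        integrable lebesgue (\<lambda>z. h (u z) * \<phi> z) \<and>
        (LINT z|lebesgue. X_dx u z * X_dx \<phi> z + X_Dx_inv_grad u z \<bullet> X_Dx_inv_grad \<phi> z + u z * \<phi> z)
          = (LINT z|lebesgue. h (u z) * \<phi> z))"

end

theory Submission
  imports Defs "HOL-Complex_Analysis.Great_Picard"
begin

text \<open>
  With \<open>T(u) = \<integral> u\<^sub>x\<^sup>2 + |D\<^sub>x\<^sup>-\<^sup>1\<nabla>\<^sub>yu|\<^sup>2\<close> and \<open>V(u) = \<integral> H(u) - u\<^sup>2/2\<close>, the dilation \<open>u(x/a, y/a\<^sup>2)\<close> multiplies
  \<open>T\<close> by \<open>a\<^sup>D\<^sup>-\<^sup>2\<close> and \<open>V\<close> by \<open>a\<^sup>D\<close>, where \<open>D = 2N - 1\<close>. So the problem behaves like a scalar field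
  equation in dimension \<open>D\<close>, and one minimizes \<open>T / V\<^sup>\<theta>\<close>, \<open>\<theta> = (D - 2)/D\<close>, over functions in \<open>Y\<close> with
  \<open>V > 0\<close>. Dilating, one gets a sequence along which \<open>V\<close> is constant and, \<open>T/2 - \<Phi>(V)\<close> being
  nonnegative with \<open>\<Phi>' = 1\<close> at that value, the derivative of the energy tends to 0.

  Everything rests on the translation estimate \<open>\<parallel>u(\<cdot> + (s, \<eta>)) - u\<parallel> \<le> (|s| + (2|\<eta>|)\<^sup>1\<^sup>/\<^sup>2) T(u)\<^sup>1\<^sup>/\<^sup>2\<close> in \<open>L\<^sup>2\<close>:
  for \<open>u = g\<^sub>x\<close> the increment \<open>k\<close> of \<open>g\<close> in a \<open>y\<close> direction satisfies \<open>\<parallel>k\<^sub>x\<parallel>\<^sup>2 = - \<integral> k k\<^sub>x\<^sub>x\<close>. Comparing \<open>u\<close> with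
  its averages over boxes of size \<open>t \<times> t\<^sup>2\<close>, it bounds the superlevel sets of \<open>u\<close>, and iterating gives
  the embedding into \<open>L\<^sup>q\<close>; it shows that a sequence with \<open>V\<close> fixed does not vanish, and it gives local
  compactness in \<open>L\<^sup>2\<close>. After recentring, suitable convex combinations of the sequence converge in
  norm to a nonzero \<open>u\<close>, while the sequence itself converges to \<open>u\<close> locally, so \<open>u\<close> solves the equation.
\<close>

section \<open>Smooth functions with compact support\<close>

text \<open>The obstacle is translation invariance: an almost minimizing sequence may drift to
  infinity or split. Drifting is repaired by recentring. Splitting is not excluded at all, because
  the local limit only has to be a critical point, not a minimizer; so the equation is passed to the
  limit and not the minimum. This explains why a sequence along which the derivative tends to 0 is
  wanted. In general a constrained problem yields a Lagrange multiplier. Here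
  \<open>\<Phi>(v) = (m/2) v powr \<theta>\<close>, with \<open>m\<close> the infimum of
  \<open>T / V powr \<theta>\<close>, has slope 1 at exactly one level, and the dilations bring
  every competitor to that level, which absorbs the multiplier. All of this takes place among the
  smooth functions of \<open>Y\<close>. The space \<open>X\<close> enters at the end; its norm and
  derivatives are given by \<open>THE\<close> and \<open>SOME\<close>, so it must be shown that a
  Cauchy sequence of \<open>Y\<close> tending to 0 almost everywhere tends to 0 in norm
  (closability).\<close>

definition pd :: "'a::euclidean_space \<Rightarrow> ('a \<Rightarrow> real) \<Rightarrow> 'a \<Rightarrow> real" where
  "pd v f z = frechet_derivative f (at z) v"

definition smooth :: "('a::euclidean_space \<Rightarrow> real) \<Rightarrow> bool" where
  "smooth f \<longleftrightarrow> (\<forall>k. C_k k f)"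

lemma pd_eqI: "(f has_derivative f') (at z) \<Longrightarrow> pd v f z = f' v"
  unfolding pd_def using frechet_derivative_at by metis

lemma has_derivative_pd: "f differentiable (at z) \<Longrightarrow> (f has_derivative (\<lambda>v. pd v f z)) (at z)"
  unfolding pd_def by (simp add: frechet_derivative_works[symmetric])

lemma C_k_Suc_iff: "C_k (Suc k) f \<longleftrightarrow> (\<forall>z. f differentiable (at z)) \<and> (\<forall>v. C_k k (pd v f))"
  by (simp add: pd_def[abs_def])

lemma C_k_continuous: "C_k k f \<Longrightarrow> continuous_on UNIV f"
  by (cases k) (auto intro!: continuous_at_imp_continuous_on differentiable_imp_continuous_within)

lemma C_k_SucD: "C_k (Suc k) f \<Longrightarrow> C_k k f"
proof (induction k arbitrary: f)
  case 0
  then show ?case using C_k_continuous[OF 0] by simp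
next
  case (Suc k)
  then show ?case by (simp only: C_k_Suc_iff[of "Suc k"] C_k_Suc_iff[of k]) blast
qed

lemma C_k_add:
  assumes "C_k k f" "C_k k g" shows "C_k k (\<lambda>z. f z + g z)"
  using assms
proof (induction k arbitrary: f g)
  case 0
  then show ?case by (auto intro: continuous_intros)
next
  case (Suc k)
  have "pd v (\<lambda>z. f z + g z) = (\<lambda>z. pd v f z + pd v g z)" for v
    using Suc.prems unfolding C_k_Suc_iff
    by (intro ext pd_eqI[OF has_derivative_add]) (auto intro: has_derivative_pd)
  then show ?case using Suc unfolding C_k_Suc_iff by auto
qed

lemma C_k_mult:
  assumes "C_k k f" "C_k k g" shows "C_k k (\<lambda>z. f z * g z)"
  using assms
proof (induction k arbitrary: f g)
  case 0
  then show ?case by (auto intro: continuous_intros)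
next
  case (Suc k)
  have eq: "pd v (\<lambda>z. f z * g z) = (\<lambda>z. f z * pd v g z + pd v f z * g z)" for v
    using Suc.prems unfolding C_k_Suc_iff
    by (intro ext pd_eqI[OF has_derivative_mult]) (auto intro: has_derivative_pd)
  have "C_k k (\<lambda>z. f z * pd v g z + pd v f z * g z)" for v
    using Suc.prems C_k_SucD[OF Suc.prems(1)] C_k_SucD[OF Suc.prems(2)]
    unfolding C_k_Suc_iff by (intro C_k_add Suc.IH) auto
  then show ?case using Suc.prems unfolding C_k_Suc_iff eq by auto
qed

lemma C_k_const: "C_k k (\<lambda>z. c)"
proof (induction k arbitrary: c)
  case (Suc k)
  have "pd v (\<lambda>z. c) = (\<lambda>z. 0)" for v :: 'a
    by (intro ext) (auto simp: pd_def)
  with Suc show ?case unfolding C_k_Suc_iff by auto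
qed auto

lemma pd_affine:
  assumes "f differentiable (at (L z + a))" "bounded_linear L"
  shows "pd v (\<lambda>z. f (L z + a)) z = pd (L v) f (L z + a)"
proof (rule pd_eqI)
  have "((\<lambda>z. L z + a) has_derivative L) (at z)"
    using assms(2) by (auto intro!: derivative_eq_intros bounded_linear_imp_has_derivative)
  from diff_chain_at[OF this, of f "\<lambda>v. pd v f (L z + a)"]
  show "((\<lambda>z. f (L z + a)) has_derivative (\<lambda>v. pd (L v) f (L z + a))) (at z)"
    using has_derivative_pd[OF assms(1)] by (simp add: o_def)
qed

lemma C_k_affine:
  assumes "C_k k f" "bounded_linear L" shows "C_k k (\<lambda>z. f (L z + a))"
  using assms(1)
proof (induction k arbitrary: f)
  case 0
  have "continuous_on UNIV (\<lambda>z. L z + a)"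
    using assms(2) by (intro continuous_intros linear_continuous_on) 
  with 0 show ?case by (simp add: continuous_on_compose2[of UNIV f])
next
  case (Suc k)
  have "((\<lambda>z. L z + a) has_derivative L) (at z)" for z
    using assms(2) by (auto intro!: derivative_eq_intros bounded_linear_imp_has_derivative)
  then have "(\<lambda>z. L z + a) differentiable (at z)" for z
    by (rule differentiableI)
  then have 1: "(\<lambda>z. f (L z + a)) differentiable (at z)" for z
    using Suc.prems unfolding C_k_Suc_iff by (auto intro: differentiable_compose)
  have "pd v (\<lambda>z. f (L z + a)) = (\<lambda>z. pd (L v) f (L z + a))" for v
    using Suc.prems assms(2) unfolding C_k_Suc_iff by (intro ext pd_affine) auto
  with 1 Suc show ?case unfolding C_k_Suc_iff by auto
qed

lemma smooth_continuous: "smooth f \<Longrightarrow> continuous_on UNIV f"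
  using C_k_continuous unfolding smooth_def by blast

lemma smooth_differentiable: "smooth f \<Longrightarrow> f differentiable (at z)"
  unfolding smooth_def using C_k_Suc_iff[of 0 f] by blast

lemma smooth_pd: "smooth f \<Longrightarrow> smooth (pd v f)"
  unfolding smooth_def using C_k_Suc_iff by blast

lemma smooth_add: "smooth f \<Longrightarrow> smooth g \<Longrightarrow> smooth (\<lambda>z. f z + g z)"
  and smooth_mult: "smooth f \<Longrightarrow> smooth g \<Longrightarrow> smooth (\<lambda>z. f z * g z)"
  and smooth_const: "smooth (\<lambda>z. c)"
  and smooth_affine: "smooth f' \<Longrightarrow> bounded_linear L \<Longrightarrow> smooth (\<lambda>z. f' (L z + a))"
  unfolding smooth_def by (auto intro: C_k_add C_k_mult C_k_const C_k_affine)

lemma smooth_compose_linear: "smooth f \<Longrightarrow> bounded_linear L \<Longrightarrow> smooth (\<lambda>z. f (L z))"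
  using smooth_affine[of f L 0] by simp

lemma smooth_translate: "smooth f \<Longrightarrow> smooth (\<lambda>z. f (z + a))"
  using smooth_affine[of f "\<lambda>z. z" a] by (simp add: bounded_linear_ident)

lemma pd_translate: "smooth f \<Longrightarrow> pd v (\<lambda>z. f (z + a)) z = pd v f (z + a)"
  using pd_affine[of f "\<lambda>z. z" z a v] by (simp add: bounded_linear_ident smooth_differentiable)

lemma pd_compose_linear:
  "smooth f \<Longrightarrow> bounded_linear L \<Longrightarrow> pd v (\<lambda>z. f (L z)) z = pd (L v) f (L z)"
  using pd_affine[of f L z 0 v] by (simp add: smooth_differentiable)

lemma smooth_cmult: "smooth f \<Longrightarrow> smooth (\<lambda>z. c * f z)"
  by (intro smooth_mult smooth_const)

lemma pd_add: "smooth f \<Longrightarrow> smooth g \<Longrightarrow> pd v (\<lambda>z. f z + g z) z = pd v f z + pd v g z"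
  by (intro pd_eqI[OF has_derivative_add]) (auto intro: has_derivative_pd smooth_differentiable)

lemma pd_cmult: "smooth f \<Longrightarrow> pd v (\<lambda>z. c * f z) z = c * pd v f z"
  by (intro pd_eqI[OF has_derivative_mult_right]) (auto intro: has_derivative_pd smooth_differentiable)

lemma pd_mult: "smooth f \<Longrightarrow> smooth g \<Longrightarrow> pd v (\<lambda>z. f z * g z) z = f z * pd v g z + pd v f z * g z"
  by (intro pd_eqI[OF has_derivative_mult]) (auto intro: has_derivative_pd smooth_differentiable)

lemma smooth_diff: "smooth f \<Longrightarrow> smooth g \<Longrightarrow> smooth (\<lambda>z. f z - g z)"
  using smooth_add[of f "\<lambda>z. (-1) * g z"] smooth_cmult[of g "-1"] by simp

lemma pd_diff: "smooth f \<Longrightarrow> smooth g \<Longrightarrow> pd v (\<lambda>z. f z - g z) z = pd v f z - pd v g z"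
  using pd_add[of f "\<lambda>z. (-1) * g z"] smooth_cmult[of g "-1"] pd_cmult[of g v "-1"] by simp

lemma pd_direction:
  assumes "smooth f"
  shows "pd (v + w) f z = pd v f z + pd w f z" "pd (c *\<^sub>R v) f z = c * pd v f z" "pd 0 f z = 0"
proof -
  interpret bounded_linear "\<lambda>v. pd v f z"
    using has_derivative_pd[OF smooth_differentiable[OF assms]] by (rule has_derivative_bounded_linear)
  show "pd (v + w) f z = pd v f z + pd w f z" "pd (c *\<^sub>R v) f z = c * pd v f z" "pd 0 f z = 0"
    by (auto simp: add scaleR zero)
qed

lemma DERIV_along_line:
  assumes "smooth f"
  shows "((\<lambda>s. f (z + s *\<^sub>R v)) has_real_derivative pd v f (z + s *\<^sub>R v)) (at s within S)"
proof -
  have "((\<lambda>s. z + s *\<^sub>R v) has_derivative (\<lambda>t. t *\<^sub>R v)) (at s)"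
    by (auto intro!: derivative_eq_intros)
  from diff_chain_at[OF this has_derivative_pd[OF smooth_differentiable[OF assms]]]
  have "((\<lambda>s. f (z + s *\<^sub>R v)) has_derivative (\<lambda>t. t * pd v f (z + s *\<^sub>R v))) (at s)"
    by (simp add: o_def pd_direction[OF assms])
  then have "((\<lambda>s. f (z + s *\<^sub>R v)) has_real_derivative pd v f (z + s *\<^sub>R v)) (at s)"
    by (simp add: has_field_derivative_def mult.commute[of _ "pd v f (z + s *\<^sub>R v)"])
  then show ?thesis by (rule has_field_derivative_at_within)
qed

text \<open>The second difference of \<open>f\<close> along \<open>v\<close> and \<open>w\<close> is
  symmetric in \<open>v\<close> and \<open>w\<close>, and two applications of the mean value theorem
  turn it into \<open>t\<^sup>2\<close> times a mixed derivative at a point close to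
  \<open>z\<close>. Dividing by \<open>t\<^sup>2\<close> and letting \<open>t\<close> tend to 0 in
  both orders gives the same limit.\<close>

lemma pd_commute:
  assumes "smooth f" shows "pd v (pd w f) z = pd w (pd v f) z"
proof -
  have key: "\<exists>r s. \<bar>r\<bar> \<le> t \<and> \<bar>s\<bar> \<le> t \<and>
      f (z + t *\<^sub>R v + t *\<^sub>R w) - f (z + t *\<^sub>R v) - f (z + t *\<^sub>R w) + f z
        = t\<^sup>2 * pd w (pd v f) (z + r *\<^sub>R v + s *\<^sub>R w)" if tpos: "t > 0" for t v w
  proof -
    let ?h = "\<lambda>s. f ((z + t *\<^sub>R w) + s *\<^sub>R v) - f (z + s *\<^sub>R v)"
    let ?h' = "\<lambda>s. pd v f ((z + t *\<^sub>R w) + s *\<^sub>R v) - pd v f (z + s *\<^sub>R v)"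
    have "(?h has_real_derivative ?h' s) (at s)" for s
      by (intro DERIV_diff DERIV_along_line assms)
    then obtain r where r: "0 < r" "r < t" "?h t - ?h 0 = (t - 0) * ?h' r"
      using MVT2[OF tpos, of ?h ?h'] by blast
    let ?k = "\<lambda>s. pd v f ((z + r *\<^sub>R v) + s *\<^sub>R w)"
    have "(?k has_real_derivative pd w (pd v f) ((z + r *\<^sub>R v) + s *\<^sub>R w)) (at s)" for s
      by (intro DERIV_along_line assms smooth_pd)
    then obtain s where s: "0 < s" "s < t"
      "?k t - ?k 0 = (t - 0) * pd w (pd v f) ((z + r *\<^sub>R v) + s *\<^sub>R w)"
      using MVT2[OF tpos, of ?k "\<lambda>s. pd w (pd v f) ((z + r *\<^sub>R v) + s *\<^sub>R w)"] by blast
    from r s show ?thesis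
      by (intro exI[of _ r] exI[of _ s]) (auto simp: algebra_simps power2_eq_square)
  qed
  let ?Q = "\<lambda>t. (f (z + t *\<^sub>R v + t *\<^sub>R w) - f (z + t *\<^sub>R v) - f (z + t *\<^sub>R w) + f z) / t\<^sup>2"
  have lim: "((\<lambda>t. (f (z + t *\<^sub>R v + t *\<^sub>R w) - f (z + t *\<^sub>R v) - f (z + t *\<^sub>R w) + f z) / t\<^sup>2)
      \<longlongrightarrow> pd w (pd v f) z) (at_right 0)" for v w
  proof -
    obtain r s where rs: "\<And>t. t > 0 \<Longrightarrow> \<bar>r t\<bar> \<le> t" "\<And>t. t > 0 \<Longrightarrow> \<bar>s t\<bar> \<le> t"
      "\<And>t. t > 0 \<Longrightarrow> f (z + t *\<^sub>R v + t *\<^sub>R w) - f (z + t *\<^sub>R v) - f (z + t *\<^sub>R w) + f z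
        = t\<^sup>2 * pd w (pd v f) (z + r t *\<^sub>R v + s t *\<^sub>R w)"
      using key[of _ v w] by metis
    have pos: "eventually (\<lambda>t::real. t > 0) (at_right 0)"
      by (simp add: eventually_at_right_less)
    have id: "((\<lambda>t::real. t) \<longlongrightarrow> 0) (at_right 0)" by (rule tendsto_ident_at)
    have r0: "(r \<longlongrightarrow> 0) (at_right 0)"
      by (rule Lim_null_comparison[OF _ id]) (use pos rs(1) in \<open>auto elim!: eventually_mono\<close>)
    have s0: "(s \<longlongrightarrow> 0) (at_right 0)"
      by (rule Lim_null_comparison[OF _ id]) (use pos rs(2) in \<open>auto elim!: eventually_mono\<close>)
    have "isCont (pd w (pd v f)) z"
      using smooth_continuous[of "pd w (pd v f)"] assms
      by (simp add: smooth_pd continuous_on_eq_continuous_at)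
    moreover have "((\<lambda>t. z + r t *\<^sub>R v + s t *\<^sub>R w) \<longlongrightarrow> z + 0 *\<^sub>R v + 0 *\<^sub>R w) (at_right 0)"
      by (intro tendsto_intros r0 s0)
    ultimately have "((\<lambda>t. pd w (pd v f) (z + r t *\<^sub>R v + s t *\<^sub>R w)) \<longlongrightarrow> pd w (pd v f) z) (at_right 0)"
      by (auto intro: isCont_tendsto_compose[where g = "pd w (pd v f)"])
    then show ?thesis
      by (rule Lim_transform_eventually) (use pos rs(3) in \<open>auto elim!: eventually_mono\<close>)
  qed
  have "(?Q \<longlongrightarrow> pd v (pd w f) z) (at_right 0)"
    using lim[of w v] by (simp add: algebra_simps)
  from tendsto_unique[OF _ this lim[of v w]] show ?thesis by simp
qed

section \<open>Continuous functions of bounded support, integration by parts\<close>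

definition Cc :: "('a::euclidean_space \<Rightarrow> 'b::real_normed_vector) \<Rightarrow> bool" where
  "Cc f \<longleftrightarrow> continuous_on UNIV f \<and> (\<exists>R. \<forall>z. norm z > R \<longrightarrow> f z = 0)"

lemma Cc_combine:
  assumes "Cc f" "Cc g" "continuous_on UNIV (\<lambda>z. F (f z) (g z))" "F 0 0 = 0"
  shows "Cc (\<lambda>z. F (f z) (g z))"
proof -
  obtain R1 R2 where "\<And>z. norm z > R1 \<Longrightarrow> f z = 0" "\<And>z. norm z > R2 \<Longrightarrow> g z = 0"
    using assms unfolding Cc_def by blast
  then have "\<forall>z. norm z > max R1 R2 \<longrightarrow> F (f z) (g z) = 0" using assms(4) by auto
  then show ?thesis using assms(3) unfolding Cc_def by blast
qed

lemma Cc_compose: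
  assumes "Cc f" "continuous_on UNIV F" "F 0 = 0"
  shows "Cc (\<lambda>z. F (f z))"
  using Cc_combine[OF assms(1,1), of "\<lambda>a b. F a"] assms
  by (auto simp: Cc_def intro: continuous_on_compose2)

lemma Cc_mult_right:
  fixes f g :: "'a::euclidean_space \<Rightarrow> real"
  assumes "Cc f" "continuous_on UNIV g" shows "Cc (\<lambda>z. f z * g z)" "Cc (\<lambda>z. g z * f z)"
  using assms unfolding Cc_def by (auto intro!: continuous_intros)

lemma Cc_translate: assumes "Cc f" shows "Cc (\<lambda>z. f (z + a))"
proof -
  obtain R where R: "\<And>z. norm z > R \<Longrightarrow> f z = 0" using assms unfolding Cc_def by blast
  have "f (z + a) = 0" if "norm z > R + norm a" for z
    using that norm_triangle_ineq4[of "z + a" a] by (intro R) auto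
  moreover have "continuous_on UNIV (\<lambda>z. f (z + a))"
    using assms unfolding Cc_def by (auto intro!: continuous_on_compose2[of UNIV f] continuous_intros)
  ultimately show ?thesis unfolding Cc_def by blast
qed

lemma Cc_bounded: assumes "Cc f" obtains M where "M \<ge> 0" "\<And>z. norm (f z) \<le> M"
proof -
  obtain R where R: "\<And>z. norm z > R \<Longrightarrow> f z = 0" using assms unfolding Cc_def by blast
  have "compact (f ` cball 0 R)" 
    using assms unfolding Cc_def by (intro compact_continuous_image) (auto intro: continuous_on_subset)
  then obtain M where M: "\<And>z. z \<in> cball 0 R \<Longrightarrow> norm (f z) \<le> M"
    by (meson bounded_iff compact_imp_bounded imageI)
  have "norm (f z) \<le> max M 0" for z
    using M[of z] R[of z] by (cases "norm z \<le> R") auto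
  then show thesis using that[of "max M 0"] by auto
qed

lemma Cc_integrable:
  fixes f :: "'a::euclidean_space \<Rightarrow> 'b::euclidean_space"
  assumes "Cc f" shows "integrable lborel f"
proof -
  obtain R where R: "\<And>z. norm z > R \<Longrightarrow> f z = 0" using assms unfolding Cc_def by blast
  have "integrable lborel (\<lambda>z. indicator (cball 0 R) z *\<^sub>R f z)"
    using assms unfolding Cc_def by (intro borel_integrable_compact) (auto intro: continuous_on_subset)
  moreover have "(\<lambda>z. indicator (cball 0 R) z *\<^sub>R f z) = f"
    using R by (auto simp: indicator_def fun_eq_iff not_le)
  ultimately show ?thesis by simp
qed

lemma Cc_measurable: "Cc f \<Longrightarrow> f \<in> borel_measurable borel"
  unfolding Cc_def by (auto intro: borel_measurable_continuous_onI)

text \<open>Translations and Tonelli are handled over \<open>lborel\<close>, while the definitions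
  integrate over \<open>lebesgue\<close>. For the functions of \<open>Y\<close> the two integrals
  agree, and this is the bridge; elements of \<open>X\<close> live over \<open>lebesgue\<close>
  only.\<close>

lemma Cc_lebesgue:
  fixes f :: "'a::euclidean_space \<Rightarrow> 'b::euclidean_space"
  assumes "Cc f"
  shows "integrable lebesgue f" "integral\<^sup>L lebesgue f = integral\<^sup>L lborel f"
  using Cc_integrable[OF assms] Cc_measurable[OF assms]
  by (simp_all add: integrable_completion integral_completion)

lemma Cc_arith:
  fixes f g :: "'a::euclidean_space \<Rightarrow> 'b::real_normed_vector"
  assumes "Cc f" "Cc g" 
  shows "Cc (\<lambda>z. f z + g z)" "Cc (\<lambda>z. f z - g z)" "Cc (\<lambda>z. c *\<^sub>R f z)"
  using Cc_combine[OF assms, of "(+)"] Cc_combine[OF assms, of "(-)"] Cc_compose[OF assms(1), of "\<lambda>x. c *\<^sub>R x"] assms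
  by (auto intro!: continuous_intros simp: Cc_def)

lemma lborel_integral_translate:
  fixes f :: "'a::euclidean_space \<Rightarrow> 'b::{banach, second_countable_topology}"
  assumes "f \<in> borel_measurable borel"
  shows "(LINT z|lborel. f (z + a)) = (LINT z|lborel. f z)"
proof -
  have "(LINT z|lborel. f z) = integral\<^sup>L (distr lborel borel ((+) a)) f"
    by (simp add: lborel_distr_plus)
  also have "\<dots> = (LINT z|lborel. f (a + z))"
    using assms by (subst integral_distr) auto
  finally show ?thesis by (simp add: add.commute)
qed

lemma test_functions_iff:
  "g \<in> test_functions \<longleftrightarrow> smooth g \<and> Cc g"
proof -
  have eq: "compact (closure {z. g z \<noteq> 0}) \<longleftrightarrow> (\<exists>R. \<forall>z. norm z > R \<longrightarrow> g z = 0)"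
    unfolding compact_closure bounded_iff mem_Collect_eq Ball_def
    by (intro ex_cong1 iff_allI) (auto simp: not_le[symmetric])
  show ?thesis
    unfolding test_functions_def mem_Collect_eq eq Cc_def smooth_def[symmetric]
    using smooth_continuous[of g] by blast
qed

lemma smooth_Cc_pd: assumes "smooth f" "Cc f" shows "Cc (pd v f)"
proof -
  obtain R where R: "\<And>z. norm z > R \<Longrightarrow> f z = 0" using assms unfolding Cc_def by blast
  have "pd v f z = 0" if "norm z > R" for z
  proof -
    have op: "open {z::'a. norm z > R}" by (intro open_Collect_less continuous_intros)
    have "(f has_derivative (\<lambda>_. 0)) (at z)"
      by (rule has_derivative_transform_within_open[OF has_derivative_const op]) (use that R in auto)
    then show ?thesis by (rule pd_eqI)
  qed
  then show ?thesis unfolding Cc_def using smooth_continuous[OF smooth_pd[OF assms(1)]] by blast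
qed

lemma test_pd: "g \<in> test_functions \<Longrightarrow> pd v g \<in> test_functions"
  by (simp add: test_functions_iff smooth_pd smooth_Cc_pd)

lemma test_add: "f \<in> test_functions \<Longrightarrow> g \<in> test_functions \<Longrightarrow> (\<lambda>z. f z + g z) \<in> test_functions"
  and test_diff: "f \<in> test_functions \<Longrightarrow> g \<in> test_functions \<Longrightarrow> (\<lambda>z. f z - g z) \<in> test_functions"
  and test_cmult: "f \<in> test_functions \<Longrightarrow> (\<lambda>z. c * f z) \<in> test_functions"
  and test_translate: "f \<in> test_functions \<Longrightarrow> (\<lambda>z. f (z + a)) \<in> test_functions"
  using Cc_arith(3)[of f, where c = c]
  by (auto simp: test_functions_iff smooth_add smooth_diff smooth_cmult smooth_translate Cc_arith(1,2) Cc_translate)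

text \<open>Every difference quotient has integral 0 by translation invariance, and the quotients
  converge dominatedly, being values of the derivative at nearby points. The argument treats all
  directions \<open>v\<close> alike, without coordinates.\<close>

lemma integral_pd_zero:
  assumes "f \<in> test_functions" shows "(LINT z|lborel. pd v f z) = 0"
proof -
  have f: "smooth f" "Cc f" using assms by (auto simp: test_functions_iff)
  obtain R where R: "\<And>z. norm z > R \<Longrightarrow> f z = 0" using f unfolding Cc_def by blast
  obtain M where M: "M \<ge> 0" "\<And>z. norm (pd v f z) \<le> M" using Cc_bounded[OF smooth_Cc_pd[OF f]] by blast
  define q where "q n z = real (Suc n) * (f (z + (1 / real (Suc n)) *\<^sub>R v) - f z)" for n z
  \<comment> \<open>The shifts used in \<open>q\<close> have length at most \<open>norm v\<close>,
    so outside this ball both terms of the quotient vanish.\<close>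
  let ?R = "R + norm v"
  have "(\<lambda>n. LINT z|lborel. q n z) \<longlonglongrightarrow> (LINT z|lborel. pd v f z)"
  proof (rule integral_dominated_convergence[where w = "\<lambda>z. M * indicator (cball 0 ?R) z"])
    show "pd v f \<in> borel_measurable lborel"
      using Cc_measurable[OF smooth_Cc_pd[OF f]] by simp
    show "q n \<in> borel_measurable lborel" for n
      unfolding q_def using Cc_measurable[OF f(2)] Cc_measurable[OF Cc_translate[OF f(2)]] by simp
    show "integrable lborel (\<lambda>z. M * indicator (cball 0 ?R) z)"
      using emeasure_compact_finite[OF compact_cball, of 0 ?R]
      by (intro integrable_mult_right integrable_real_indicator) auto
    have "(\<lambda>n. q n z) \<longlonglongrightarrow> pd v f z" for z
    proof -
      have "((\<lambda>s. f (z + s *\<^sub>R v)) has_real_derivative pd v f z) (at 0)"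
        using DERIV_along_line[OF f(1), of z v 0 UNIV] by simp
      then have "((\<lambda>s. (f (z + s *\<^sub>R v) - f z) / s) \<longlongrightarrow> pd v f z) (at 0)"
        by (simp add: DERIV_def)
      moreover have "filterlim (\<lambda>n. 1 / real (Suc n)) (at 0) sequentially"
        using LIMSEQ_inverse_real_of_nat[unfolded inverse_eq_divide]
        unfolding filterlim_at by (simp del: of_nat_Suc)
      ultimately have "((\<lambda>n. (f (z + (1 / real (Suc n)) *\<^sub>R v) - f z) / (1 / real (Suc n))) \<longlongrightarrow> pd v f z) sequentially"
        by (rule filterlim_compose)
      then show ?thesis by (simp add: q_def mult.commute)
    qed
    then show "AE z in lborel. (\<lambda>n. q n z) \<longlonglongrightarrow> pd v f z" by simp
    have "norm (q n z) \<le> M * indicator (cball 0 ?R) z" for n z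
    proof (cases "norm z \<le> ?R")
      case True
      let ?s = "1 / real (Suc n)"
      have "?s > 0" by simp
      from MVT2[OF this DERIV_along_line[OF f(1)], of z v]
      obtain c where "f (z + ?s *\<^sub>R v) - f (z + 0 *\<^sub>R v) = (?s - 0) * pd v f (z + c *\<^sub>R v)"
        by blast
      then have "q n z = pd v f (z + c *\<^sub>R v)" unfolding q_def by (simp add: field_simps)
      then show ?thesis using M(2) True by (simp add: indicator_def)
    next
      case False
      have "norm z - norm ((1 / real (Suc n)) *\<^sub>R v) \<le> norm (z + (1 / real (Suc n)) *\<^sub>R v)"
        by (metis norm_diff_ineq)
      moreover have "norm ((1 / real (Suc n)) *\<^sub>R v) \<le> norm v"
        using mult_right_mono[of "1 / real (Suc n)" 1 "norm v"] by simp
      ultimately have "f (z + (1 / real (Suc n)) *\<^sub>R v) = 0" "f z = 0"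
        using False norm_ge_zero[of v] by (auto intro!: R simp del: norm_ge_zero)
      then show ?thesis using M by (simp add: q_def)
    qed
    then show "AE z in lborel. norm (q n z) \<le> M * indicator (cball 0 ?R) z" for n by simp
  qed
  moreover have "(LINT z|lborel. q n z) = 0" for n
    unfolding q_def using Cc_integrable[OF f(2)] Cc_integrable[OF Cc_translate[OF f(2)]]
      lborel_integral_translate[OF Cc_measurable[OF f(2)]] by simp
  ultimately show ?thesis by (simp add: LIMSEQ_const_iff)
qed

lemma integral_by_parts:
  assumes "f \<in> test_functions" "g \<in> test_functions"
  shows "(LINT z|lborel. pd v f z * g z) = - (LINT z|lborel. f z * pd v g z)"
proof -
  have s: "smooth f" "smooth g" "Cc f" "Cc g" using assms by (auto simp: test_functions_iff)
  have c: "continuous_on UNIV (pd v f)" "continuous_on UNIV (pd v g)"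
    using s by (auto intro: smooth_continuous smooth_pd)
  have "(\<lambda>z. f z * g z) \<in> test_functions"
    using s by (auto simp: test_functions_iff smooth_mult smooth_continuous intro: Cc_mult_right)
  from integral_pd_zero[OF this, of v]
  have "(LINT z|lborel. f z * pd v g z + pd v f z * g z) = 0"
    using s by (simp add: pd_mult)
  moreover have "integrable lborel (\<lambda>z. f z * pd v g z)" "integrable lborel (\<lambda>z. pd v f z * g z)"
    using s c by (auto intro!: Cc_integrable Cc_mult_right(1)[of f "pd v g"] Cc_mult_right(2)[of g "pd v f"])
  ultimately show ?thesis by simp
qed

section \<open>Square integrable functions\<close>

definition sq_int :: "'a measure \<Rightarrow> ('a \<Rightarrow> 'b::euclidean_space) \<Rightarrow> bool" where
  "sq_int M f \<longleftrightarrow> f \<in> borel_measurable M \<and> integrable M (\<lambda>z. (norm (f z))\<^sup>2)"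

text \<open>The integral of a non-integrable function is 0 by default, so this is the norm of
  \<open>L\<^sup>2\<close> only together with \<open>sq_int\<close>; \<open>l2_mono\<close> makes
  use of the default.\<close>

definition l2 :: "'a measure \<Rightarrow> ('a \<Rightarrow> 'b::euclidean_space) \<Rightarrow> real" where
  "l2 M f = sqrt (LINT z|M. (norm (f z))\<^sup>2)"

lemma sq_int_measurable: "sq_int M f \<Longrightarrow> f \<in> borel_measurable M"
  by (simp add: sq_int_def)

lemma sq_int_integrable: "sq_int M f \<Longrightarrow> integrable M (\<lambda>z. (norm (f z))\<^sup>2)"
  by (simp add: sq_int_def)

lemma l2_nonneg: "l2 M f \<ge> 0"
  by (simp add: l2_def)

lemma l2_square: "(l2 M f)\<^sup>2 = (LINT z|M. (norm (f z))\<^sup>2)"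
  by (simp add: l2_def)

lemma sq_int_bound:
  assumes "f \<in> borel_measurable M" "integrable M w" "\<And>z. (norm (f z))\<^sup>2 \<le> w z"
  shows "sq_int M f"
proof -
  have "integrable M (\<lambda>z. (norm (f z))\<^sup>2)"
    by (rule Bochner_Integration.integrable_bound[OF assms(2)])
      (use assms in \<open>auto intro!: AE_I2 order.trans[OF assms(3)]\<close>)
  with assms(1) show ?thesis by (simp add: sq_int_def)
qed

lemma sq_int_inner:
  assumes "sq_int M f" "sq_int M g"
  shows "integrable M (\<lambda>z. f z \<bullet> g z)" "integrable M (\<lambda>z. norm (f z) * norm (g z))"
proof -
  note [measurable] = sq_int_measurable[OF assms(1)] sq_int_measurable[OF assms(2)]
  have le: "norm (f z) * norm (g z) \<le> (norm (f z))\<^sup>2 + (norm (g z))\<^sup>2" for z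
    using sum_squares_bound[of "norm (f z)" "norm (g z)"] mult_nonneg_nonneg[OF norm_ge_zero norm_ge_zero, of "f z" "g z"]
    by linarith
  have i: "integrable M (\<lambda>z. (norm (f z))\<^sup>2 + (norm (g z))\<^sup>2)"
    using assms by (simp add: sq_int_def)
  show "integrable M (\<lambda>z. norm (f z) * norm (g z))"
    by (rule Bochner_Integration.integrable_bound[OF i]) (use le in \<open>auto intro!: AE_I2\<close>)
  show "integrable M (\<lambda>z. f z \<bullet> g z)"
  proof (rule Bochner_Integration.integrable_bound[OF i])
    show "AE z in M. norm (f z \<bullet> g z) \<le> norm ((norm (f z))\<^sup>2 + (norm (g z))\<^sup>2)"
    proof (rule AE_I2)
      fix z show "norm (f z \<bullet> g z) \<le> norm ((norm (f z))\<^sup>2 + (norm (g z))\<^sup>2)"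
        using Cauchy_Schwarz_ineq2[of "f z" "g z"] le[of z] by simp
    qed
  qed simp
qed

lemma sq_int_add: 
  assumes "sq_int M f" "sq_int M g" shows "sq_int M (\<lambda>z. f z + g z)"
proof (rule sq_int_bound)
  show "(\<lambda>z. f z + g z) \<in> borel_measurable M"
    using assms by (auto simp: sq_int_def)
  show "integrable M (\<lambda>z. 2 * (norm (f z))\<^sup>2 + 2 * (norm (g z))\<^sup>2)"
    using assms by (simp add: sq_int_def)
  fix z
  have "(norm (f z + g z))\<^sup>2 \<le> (norm (f z) + norm (g z))\<^sup>2"
    by (intro power_mono norm_triangle_ineq norm_ge_zero)
  also have "\<dots> \<le> 2 * (norm (f z))\<^sup>2 + 2 * (norm (g z))\<^sup>2"
    using sum_squares_bound[of "norm (f z)" "norm (g z)"] by (simp add: power2_sum)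
  finally show "(norm (f z + g z))\<^sup>2 \<le> 2 * (norm (f z))\<^sup>2 + 2 * (norm (g z))\<^sup>2" .
qed

lemma sq_int_scale: "sq_int M f \<Longrightarrow> sq_int M (\<lambda>z. c *\<^sub>R f z)"
  by (auto simp: sq_int_def power_mult_distrib)

lemma sq_int_cmult: "sq_int M f \<Longrightarrow> sq_int M (\<lambda>z. c * f z)" for f :: "_ \<Rightarrow> real"
  using sq_int_scale[of M f c] by simp

lemma sq_int_diff: 
  assumes "sq_int M f" "sq_int M g" shows "sq_int M (\<lambda>z. f z - g z)"
  using sq_int_add[OF assms(1) sq_int_scale[OF assms(2), of "-1"]] by simp

lemma sq_int_mult: "sq_int M f \<Longrightarrow> sq_int M g \<Longrightarrow> integrable M (\<lambda>z. f z * g z)" for f g :: "_ \<Rightarrow> real"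
  using sq_int_inner(1)[of M f g] by simp

lemma l2_scale: "l2 M (\<lambda>z. c *\<^sub>R f z) = \<bar>c\<bar> * l2 M f"
  by (simp add: l2_def power_mult_distrib real_sqrt_mult)

lemma l2_cmult: "l2 M (\<lambda>z. c * f z) = \<bar>c\<bar> * l2 M f" for f :: "_ \<Rightarrow> real"
  using l2_scale[of M c f] by simp

lemma l2_Cauchy_Schwarz:
  assumes "sq_int M f" "sq_int M g"
  shows "\<bar>LINT z|M. f z \<bullet> g z\<bar> \<le> l2 M f * l2 M g"
proof -
  let ?a = "LINT z|M. (norm (f z))\<^sup>2" and ?b = "LINT z|M. f z \<bullet> g z" and ?c = "LINT z|M. (norm (g z))\<^sup>2"
  have quad: "0 \<le> s\<^sup>2 * ?a + 2 * s * t * ?b + t\<^sup>2 * ?c" for s t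
  proof -
    have "0 \<le> (LINT z|M. (norm (s *\<^sub>R f z + t *\<^sub>R g z))\<^sup>2)" by simp
    also have "\<dots> = (LINT z|M. s\<^sup>2 * (norm (f z))\<^sup>2 + 2 * s * t * (f z \<bullet> g z) + t\<^sup>2 * (norm (g z))\<^sup>2)"
      by (intro Bochner_Integration.integral_cong refl)
        (simp add: power2_norm_eq_inner inner_add_left inner_add_right inner_commute algebra_simps
          power2_eq_square[of s] power2_eq_square[of t])
    also have "\<dots> = s\<^sup>2 * ?a + 2 * s * t * ?b + t\<^sup>2 * ?c"
      using assms sq_int_inner[OF assms] by (simp add: sq_int_def)
    finally show ?thesis .
  qed
  have a: "?a \<ge> 0" and c: "?c \<ge> 0" by simp_all
  have "?b\<^sup>2 \<le> ?a * ?c"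
  proof (cases "?a = 0")
    case True
    have "?b = 0"
    proof (rule ccontr)
      assume b: "?b \<noteq> 0"
      \<comment> \<open>When the coefficient of \<open>s\<^sup>2\<close> is 0 the form is affine in
        \<open>s\<close>; this \<open>s\<close> would bring it down to -1.\<close>
      have "0 \<le> 2 * (- (?c + 1) / (2 * ?b)) * ?b + ?c"
        using quad[of "- (?c + 1) / (2 * ?b)" 1] True by simp
      also have "2 * (- (?c + 1) / (2 * ?b)) * ?b + ?c = -1" using b by (simp add: field_simps)
      finally show False by simp
    qed
    with True show ?thesis by simp
  next
    case False
    with a have "?a > 0" by linarith
    have "0 \<le> (-?b)\<^sup>2 * ?a + 2 * (-?b) * ?a * ?b + ?a\<^sup>2 * ?c" by (rule quad)
    also have "\<dots> = ?a * (?a * ?c - ?b\<^sup>2)" by (simp add: power2_eq_square algebra_simps)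
    finally show ?thesis using \<open>?a > 0\<close> by (simp add: zero_le_mult_iff)
  qed
  then have "sqrt (?b\<^sup>2) \<le> sqrt (?a * ?c)" by (rule real_sqrt_le_mono)
  then show ?thesis by (simp add: l2_def real_sqrt_mult)
qed

lemma l2_Cauchy_Schwarz_real:
  fixes f g :: "_ \<Rightarrow> real"
  assumes "sq_int M f" "sq_int M g"
  shows "\<bar>LINT z|M. f z * g z\<bar> \<le> l2 M f * l2 M g"
  using l2_Cauchy_Schwarz[OF assms] by simp

lemma l2_add_square:
  assumes "sq_int M f" "sq_int M g"
  shows "(l2 M (\<lambda>z. f z + g z))\<^sup>2 = (l2 M f)\<^sup>2 + 2 * (LINT z|M. f z \<bullet> g z) + (l2 M g)\<^sup>2"
proof -
  have "(LINT z|M. (norm (f z + g z))\<^sup>2) = (LINT z|M. (norm (f z))\<^sup>2 + 2 * (f z \<bullet> g z) + (norm (g z))\<^sup>2)"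
    by (intro Bochner_Integration.integral_cong refl)
      (simp add: power2_norm_eq_inner inner_add_left inner_add_right inner_commute)
  also have "\<dots> = (LINT z|M. (norm (f z))\<^sup>2) + 2 * (LINT z|M. f z \<bullet> g z) + (LINT z|M. (norm (g z))\<^sup>2)"
    using assms sq_int_inner[OF assms] by (simp add: sq_int_def)
  finally show ?thesis by (simp add: l2_square)
qed

lemma l2_triangle:
  assumes "sq_int M f" "sq_int M g"
  shows "l2 M (\<lambda>z. f z + g z) \<le> l2 M f + l2 M g"
proof (rule power2_le_imp_le)
  show "(l2 M (\<lambda>z. f z + g z))\<^sup>2 \<le> (l2 M f + l2 M g)\<^sup>2"
    using l2_Cauchy_Schwarz[OF assms] by (simp add: l2_add_square[OF assms] power2_sum)
qed (simp add: l2_nonneg)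

lemma l2_minus: "l2 M (\<lambda>z. f z - g z) = l2 M (\<lambda>z. g z - f z)"
  by (simp add: l2_def norm_minus_commute)

lemma l2_triangle_diff:
  assumes "sq_int M f" "sq_int M g"
  shows "l2 M (\<lambda>z. f z - g z) \<le> l2 M f + l2 M g"
  using l2_triangle[OF assms(1) sq_int_scale[OF assms(2), of "-1"]] l2_scale[of M "-1" g] by simp

lemma l2_triangle3:
  assumes "sq_int M f" "sq_int M g" "sq_int M h"
  shows "l2 M (\<lambda>z. f z - h z) \<le> l2 M (\<lambda>z. f z - g z) + l2 M (\<lambda>z. g z - h z)"
  using l2_triangle[OF sq_int_diff[OF assms(1,2)] sq_int_diff[OF assms(2,3)]] by simp

lemma l2_reverse_triangle:
  assumes "sq_int M f" "sq_int M g"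
  shows "\<bar>l2 M f - l2 M g\<bar> \<le> l2 M (\<lambda>z. f z - g z)"
proof -
  have "l2 M f \<le> l2 M (\<lambda>z. f z - g z) + l2 M g"
    using l2_triangle[OF sq_int_diff[OF assms] assms(2)] by simp
  moreover have "l2 M g \<le> l2 M (\<lambda>z. g z - f z) + l2 M f"
    using l2_triangle[OF sq_int_diff[OF assms(2,1)] assms(1)] by simp
  ultimately show ?thesis using l2_minus[of M f g] by linarith
qed

lemma l2_mono:
  assumes "sq_int M g" "\<And>z. norm (f z) \<le> norm (g z)"
  shows "l2 M f \<le> l2 M g"
proof (cases "integrable M (\<lambda>z. (norm (f z))\<^sup>2)")
  case True
  then show ?thesis unfolding l2_def using assms
    by (auto intro!: real_sqrt_le_mono integral_mono power_mono simp: sq_int_def)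
next
  case False
  then show ?thesis by (simp add: l2_def not_integrable_integral_eq)
qed

lemma Cc_norm_square: "Cc f \<Longrightarrow> Cc (\<lambda>z. (norm (f z))\<^sup>2)"
  by (rule Cc_compose[of f "\<lambda>x. (norm x)\<^sup>2"]) (auto intro!: continuous_intros)

lemma Cc_sq_int:
  fixes f :: "'a::euclidean_space \<Rightarrow> 'b::euclidean_space"
  assumes "Cc f" shows "sq_int lborel f"
  using Cc_integrable[OF Cc_norm_square[OF assms]] Cc_measurable[OF assms] by (simp add: sq_int_def)

lemma Cc_sq_int_lebesgue:
  fixes f :: "'a::euclidean_space \<Rightarrow> 'b::euclidean_space"
  assumes "Cc f" shows "sq_int lebesgue f" "l2 lebesgue f = l2 lborel f"
  using Cc_lebesgue[OF Cc_norm_square[OF assms]] Cc_measurable[OF assms]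
  by (simp_all add: sq_int_def l2_def measurable_completion)

lemma l2_translate:
  assumes "f \<in> borel_measurable borel"
  shows "l2 lborel (\<lambda>z. f (z + a)) = l2 lborel f"
  unfolding l2_def using assms lborel_integral_translate[of "\<lambda>z. (norm (f z))\<^sup>2" a] by simp

lemma nn_integral_translate:
  fixes f :: "'a::euclidean_space \<Rightarrow> ennreal"
  assumes "f \<in> borel_measurable borel"
  shows "(\<integral>\<^sup>+ z. f (z + a) \<partial>lborel) = (\<integral>\<^sup>+ z. f z \<partial>lborel)"
proof -
  have "(\<integral>\<^sup>+ z. f z \<partial>lborel) = integral\<^sup>N (distr lborel borel ((+) a)) f"
    by (simp add: lborel_distr_plus)
  also have "\<dots> = (\<integral>\<^sup>+ z. f (a + z) \<partial>lborel)"
    using assms by (subst nn_integral_distr) auto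
  finally show ?thesis by (simp add: add.commute)
qed

lemma nn_integral_sq_int:
  assumes "sq_int M f" shows "(\<integral>\<^sup>+ z. ennreal ((norm (f z))\<^sup>2) \<partial>M) = ennreal ((l2 M f)\<^sup>2)"
  unfolding l2_square using assms by (intro nn_integral_eq_integral) (auto simp: sq_int_def)

text \<open>The fundamental theorem of calculus on the segment from \<open>z\<close> to
  \<open>z + v\<close>, Cauchy-Schwarz in its parameter, then Tonelli; all translates of
  \<open>pd v g\<close> have the same norm. Working with \<open>nn_integral\<close> makes the
  exchange of integrals a matter of measurability alone.\<close>

lemma l2_increment:
  fixes g :: "'a::euclidean_space \<Rightarrow> real"
  assumes "g \<in> test_functions"
  shows "l2 lborel (\<lambda>z. g (z + v) - g z) \<le> l2 lborel (pd v g)"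
proof -
  have g: "smooth g" "Cc g" using assms by (auto simp: test_functions_iff)
  have c: "Cc (pd v g)" "continuous_on UNIV (pd v g)"
    using smooth_Cc_pd[OF g] by (auto simp: Cc_def)
  note [measurable] = Cc_measurable[OF c(1)]
  let ?F = "\<lambda>s z. (indicator {0..1} s * pd v g (z + s *\<^sub>R v))\<^sup>2"
  have pt: "ennreal ((g (z + v) - g z)\<^sup>2) \<le> (\<integral>\<^sup>+ s. ennreal (?F s z) \<partial>lborel)" for z
  proof -
    have cont: "continuous_on A (\<lambda>s. pd v g (z + s *\<^sub>R v))" for A
      by (rule continuous_on_compose2[OF c(2)]) (auto intro!: continuous_intros)
    have "integral\<^sup>L lborel (\<lambda>s. indicator {0..1} s *\<^sub>R pd v g (z + s *\<^sub>R v)) = g (z + 1 *\<^sub>R v) - g (z + 0 *\<^sub>R v)"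
      using DERIV_along_line[OF g(1), of z v _ "{0..1}"]
      by (intro integral_FTC_atLeastAtMost cont) (auto simp: has_real_derivative_iff_has_vector_derivative)
    then have eq: "g (z + v) - g z = (LINT s|lborel. indicator {0..1} s * (indicator {0..1} s * pd v g (z + s *\<^sub>R v)))"
      by (simp add: mult.assoc[symmetric] indicator_inter_arith[symmetric])
    have s1: "sq_int lborel (indicator {0..1::real} :: real \<Rightarrow> real)"
      by (auto simp: sq_int_def power2_eq_square indicator_inter_arith[symmetric])
    have "integrable lborel (\<lambda>s. indicator {0..1} s *\<^sub>R (pd v g (z + s *\<^sub>R v))\<^sup>2)"
      by (intro borel_integrable_compact continuous_intros cont) auto
    moreover have "indicator {0..1} s *\<^sub>R (pd v g (z + s *\<^sub>R v))\<^sup>2 = ?F s z" for s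
      by (auto simp: indicator_def)
    ultimately have s2: "sq_int lborel (\<lambda>s. indicator {0..1} s * pd v g (z + s *\<^sub>R v))"
      by (simp add: sq_int_def)
    have "\<bar>g (z + v) - g z\<bar> \<le> l2 lborel (indicator {0..1::real} :: real \<Rightarrow> real) * l2 lborel (\<lambda>s. indicator {0..1} s * pd v g (z + s *\<^sub>R v))"
      unfolding eq by (rule l2_Cauchy_Schwarz_real[OF s1 s2])
    also have "l2 lborel (indicator {0..1::real} :: real \<Rightarrow> real) = 1"
      by (simp add: l2_def power2_eq_square indicator_inter_arith[symmetric])
    finally have "\<bar>g (z + v) - g z\<bar>\<^sup>2 \<le> (l2 lborel (\<lambda>s. indicator {0..1} s * pd v g (z + s *\<^sub>R v)))\<^sup>2"
      by (intro power_mono) auto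
    then show ?thesis using nn_integral_sq_int[OF s2] by (simp add: ennreal_leI)
  qed
  have "ennreal ((l2 lborel (\<lambda>z. g (z + v) - g z))\<^sup>2) = (\<integral>\<^sup>+ z. ennreal ((g (z + v) - g z)\<^sup>2) \<partial>lborel)"
    using nn_integral_sq_int[OF Cc_sq_int[OF Cc_arith(2)[OF Cc_translate[OF g(2), of v] g(2)]]] by simp
  also have "\<dots> \<le> (\<integral>\<^sup>+ z. \<integral>\<^sup>+ s. ennreal (?F s z) \<partial>lborel \<partial>lborel)"
    by (intro nn_integral_mono pt)
  also have "\<dots> = (\<integral>\<^sup>+ s. \<integral>\<^sup>+ z. ennreal (?F s z) \<partial>lborel \<partial>lborel)"
    by (rule lborel_pair.Fubini') simp
  also have "\<dots> = (\<integral>\<^sup>+ s. indicator {0..1} s * ennreal ((l2 lborel (pd v g))\<^sup>2) \<partial>(lborel::real measure))"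
  proof (intro nn_integral_cong)
    fix s :: real
    have "(\<integral>\<^sup>+ z. ennreal (?F s z) \<partial>lborel) = (\<integral>\<^sup>+ z. indicator {0..1} s * ennreal ((pd v g (z + s *\<^sub>R v))\<^sup>2) \<partial>lborel)"
      by (intro nn_integral_cong) (auto simp: indicator_def)
    also have "\<dots> = indicator {0..1} s * (\<integral>\<^sup>+ z. ennreal ((pd v g (z + s *\<^sub>R v))\<^sup>2) \<partial>lborel)"
      by (rule nn_integral_cmult) simp
    also have "(\<integral>\<^sup>+ z. ennreal ((pd v g (z + s *\<^sub>R v))\<^sup>2) \<partial>lborel) = ennreal ((l2 lborel (pd v g))\<^sup>2)"
      using nn_integral_translate[of "\<lambda>z. ennreal ((pd v g z)\<^sup>2)" "s *\<^sub>R v"] nn_integral_sq_int[OF Cc_sq_int[OF c(1)]] by simp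
    finally show "(\<integral>\<^sup>+ z. ennreal (?F s z) \<partial>lborel) = indicator {0..1} s * ennreal ((l2 lborel (pd v g))\<^sup>2)" .
  qed
  also have "\<dots> = ennreal ((l2 lborel (pd v g))\<^sup>2)"
    by (subst nn_integral_multc) auto
  finally have "(l2 lborel (\<lambda>z. g (z + v) - g z))\<^sup>2 \<le> (l2 lborel (pd v g))\<^sup>2"
    by simp
  then show ?thesis using l2_nonneg by (rule power2_le_imp_le)
qed

section \<open>Translation estimates\<close>

lemma dx_pd: "dx f = pd (1, 0) f"
  by (auto simp: dx_def pd_def)

lemma grad_y_nth: "grad_y f z $ i = pd (0, axis i 1) f z"
  by (simp add: grad_y_def pd_def)

lemma pd_y:
  assumes "smooth f" shows "pd (0, \<eta>) f z = \<eta> \<bullet> grad_y f z"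
proof -
  interpret linear "\<lambda>\<eta>. pd (0, \<eta>) f z"
  proof (rule linearI)
    show "pd (0, a + b) f z = pd (0, a) f z + pd (0, b) f z" for a b
      using pd_direction(1)[OF assms, of "(0, a)" "(0, b)" z] by simp
    show "pd (0, c *\<^sub>R a) f z = c *\<^sub>R pd (0, a) f z" for c a
      using pd_direction(2)[OF assms, of c "(0, a)" z] by simp
  qed
  have "pd (0, \<eta>) f z = pd (0, \<Sum>i\<in>UNIV. (\<eta> $ i) *\<^sub>R axis i 1) f z"
    using basis_expansion[of \<eta>] by (simp add: scalar_mult_eq_scaleR)
  also have "\<dots> = (\<Sum>i\<in>UNIV. \<eta> $ i * pd (0, axis i 1) f z)"
    by (simp add: sum scale)
  finally show ?thesis by (simp add: inner_vec_def grad_y_nth)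
qed

lemma Cc_grad_y: assumes "smooth f" "Cc f" shows "Cc (grad_y f)"
proof -
  have "\<forall>i. \<exists>R. \<forall>z. norm z > R \<longrightarrow> pd (0, axis i 1) f z = 0"
    using smooth_Cc_pd[OF assms] unfolding Cc_def by blast
  from choice[OF this] obtain R where R: "\<And>i z. norm z > R i \<Longrightarrow> pd (0, axis i 1) f z = 0"
    by blast
  have "grad_y f z = 0" if "norm z > Max (range R)" for z
  proof -
    have "R i < norm z" for i using that Max_ge[of "range R" "R i"] by simp
    then show ?thesis by (simp add: vec_eq_iff grad_y_nth R)
  qed
  moreover have "continuous_on UNIV (grad_y f)"
    using smooth_continuous[OF smooth_pd[OF assms(1)]]
    by (auto simp: grad_y_nth[abs_def, symmetric] grad_y_def[abs_def] pd_def[abs_def] intro!: continuous_on_vec_lambda)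
  ultimately show ?thesis unfolding Cc_def by blast
qed

lemma grad_y_dx: "smooth g \<Longrightarrow> grad_y (dx g) z $ i = pd (1, 0) (pd (0, axis i 1) g) z"
  by (simp add: grad_y_nth dx_pd pd_commute)

text \<open>Since partial derivatives commute, \<open>grad_y (dx g)\<close> is the \<open>x\<close>
  derivative of \<open>grad_y g\<close>, and on each line in the \<open>x\<close> direction the
  fundamental theorem of calculus applies. The nonlocal term of the norm thus becomes an ordinary
  gradient of the antiderivative \<open>g\<close>.\<close>

lemma Dx_inv_grad_y:
  fixes g :: "real \<times> (real ^ 'n) \<Rightarrow> real"
  assumes "g \<in> test_functions"
  shows "Dx_inv (grad_y (dx g)) = grad_y g"
proof
  fix z :: "real \<times> (real ^ 'n)"
  obtain x y where z: "z = (x, y)" by (cases z)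
  have g: "smooth g" "Cc g" using assms by (auto simp: test_functions_iff)
  have gx: "smooth (dx g)" "Cc (dx g)" unfolding dx_pd using g by (auto intro: smooth_pd smooth_Cc_pd)
  obtain R1 where R1: "\<And>z. norm z > R1 \<Longrightarrow> grad_y (dx g) z = 0"
    using Cc_grad_y[OF gx] unfolding Cc_def by blast
  obtain R2 where R2: "\<And>z. norm z > R2 \<Longrightarrow> grad_y g z = 0"
    using Cc_grad_y[OF g] unfolding Cc_def by blast
  \<comment> \<open>Left of \<open>a\<close> both the integrand and \<open>grad_y g\<close> vanish,
    so the half line may be cut at \<open>a\<close> and there is no boundary term.\<close>
  define a where "a = - (\<bar>R1\<bar> + \<bar>R2\<bar> + \<bar>x\<bar> + 1)"
  have big: "norm (s, y) > R1 \<and> norm (s, y) > R2" if "s \<le> a" for s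
  proof -
    have "\<bar>s\<bar> \<le> norm (s, y)" using norm_fst_le[of s y] by simp
    with that show ?thesis unfolding a_def by linarith
  qed
  have ax: "a \<le> x" unfolding a_def by linarith
  have cont: "continuous_on A (\<lambda>s. grad_y (dx g) (s, y))" for A
  proof -
    have "continuous_on UNIV (grad_y (dx g))" using Cc_grad_y[OF gx] by (simp add: Cc_def)
    then show ?thesis by (rule continuous_on_compose2) (auto intro!: continuous_intros)
  qed
  have der: "((\<lambda>s. grad_y g (s, y)) has_vector_derivative grad_y (dx g) (s, y)) (at s within {a..x})" for s
    unfolding has_vector_derivative_def
  proof (subst has_derivative_componentwise_within, intro ballI)
    fix b :: "real ^ 'n" assume "b \<in> Basis"
    then obtain i where b: "b = axis i 1" by (auto simp: Basis_vec_def)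
    have "((\<lambda>s. pd (0, axis i 1) g ((0, y) + s *\<^sub>R (1, 0))) has_real_derivative
        pd (1, 0) (pd (0, axis i 1) g) ((0, y) + s *\<^sub>R (1, 0))) (at s within {a..x})"
      by (rule DERIV_along_line[OF smooth_pd[OF g(1)]])
    then show "((\<lambda>s. grad_y g (s, y) \<bullet> b) has_derivative (\<lambda>t. (t *\<^sub>R grad_y (dx g) (s, y)) \<bullet> b)) (at s within {a..x})"
      by (simp add: b inner_axis grad_y_nth[of g] grad_y_dx[OF g(1)] has_field_derivative_def mult_commute_abs)
  qed
  have "Dx_inv (grad_y (dx g)) z = (LINT s|lebesgue. indicator {..x} s *\<^sub>R grad_y (dx g) (s, y))"
    by (simp add: Dx_inv_def z set_lebesgue_integral_def)
  also have "\<dots> = (LINT s|lebesgue. indicator {a..x} s *\<^sub>R grad_y (dx g) (s, y))"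
    using big R1 by (intro Bochner_Integration.integral_cong refl) (auto simp: indicator_def not_le intro: less_imp_le)
  also have "\<dots> = (LINT s|lborel. indicator {a..x} s *\<^sub>R grad_y (dx g) (s, y))"
  proof (rule integral_completion)
    have "(\<lambda>s. indicator {a..x} s *\<^sub>R grad_y (dx g) (s, y)) \<in> borel_measurable borel"
      using cont by (intro borel_measurable_continuous_on_indicator) auto
    then show "(\<lambda>s. indicator {a..x} s *\<^sub>R grad_y (dx g) (s, y)) \<in> borel_measurable lborel" by simp
  qed
  also have "\<dots> = grad_y g (x, y) - grad_y g (a, y)"
    by (intro integral_FTC_atLeastAtMost ax der cont)
  also have "grad_y g (a, y) = 0" using big[of a] R2 by auto
  finally show "Dx_inv (grad_y (dx g)) z = grad_y g z" by (simp add: z)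
qed

text \<open>The quantity \<open>T(u)\<close> is the squared \<open>l2\<close> norm of
  \<open>pot u\<close>. Collecting the terms in one vector valued function, and adding
  \<open>u\<close> itself in \<open>jet\<close>, reduces the geometry of \<open>Y\<close> to that of
  \<open>l2\<close>: its inner product is the integral of
  \<open>jet u \<bullet> jet v\<close>.\<close>

definition pot :: "(real \<times> (real ^ 'n) \<Rightarrow> real) \<Rightarrow> real \<times> (real ^ 'n) \<Rightarrow> real \<times> (real ^ 'n)" where
  "pot u z = (dx u z, Dx_inv (grad_y u) z)"

definition jet :: "(real \<times> (real ^ 'n) \<Rightarrow> real) \<Rightarrow> real \<times> (real ^ 'n) \<Rightarrow> (real \<times> (real ^ 'n)) \<times> real" where
  "jet u z = (pot u z, u z)"

lemma pot_dx: "g \<in> test_functions \<Longrightarrow> pot (dx g) = (\<lambda>z. (dx (dx g) z, grad_y g z))"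
  by (auto simp: pot_def Dx_inv_grad_y)

lemma jet_dx: "g \<in> test_functions \<Longrightarrow> jet (dx g) z = ((dx (dx g) z, grad_y g z), dx g z)"
  by (simp add: jet_def pot_dx)

lemma Y_norm_jet: "Y_norm u = l2 lebesgue (jet u)"
proof -
  have "(norm (jet u z))\<^sup>2 = \<bar>dx u z\<bar>\<^sup>2 + (norm (Dx_inv (grad_y u) z))\<^sup>2 + \<bar>u z\<bar>\<^sup>2" for z
    by (simp add: jet_def pot_def norm_Pair)
  then show ?thesis by (simp add: Y_norm_def l2_def)
qed

lemma Y_spaceE:
  assumes "u \<in> Y_space" 
  obtains g where "u = dx g" "g \<in> test_functions"
  using assms unfolding Y_space_def by blast

lemma dx_in_Y: "g \<in> test_functions \<Longrightarrow> dx g \<in> Y_space"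
  unfolding Y_space_def by blast

lemma Y_test: "u \<in> Y_space \<Longrightarrow> u \<in> test_functions"
  by (auto elim!: Y_spaceE simp: dx_pd test_pd)

lemma Cc_Pair: assumes "Cc f" "Cc g" shows "Cc (\<lambda>z. (f z, g z))"
proof -
  have "continuous_on UNIV (\<lambda>z. (f z, g z))"
    using assms by (intro continuous_on_Pair) (auto simp: Cc_def)
  then show ?thesis by (rule Cc_combine[OF assms, of Pair]) (simp add: zero_prod_def)
qed

lemma Y_Cc:
  assumes "u \<in> Y_space"
  shows "Cc u" "Cc (pot u)" "Cc (jet u)"
proof -
  obtain g where g: "u = dx g" "g \<in> test_functions" using assms by (rule Y_spaceE)
  have s: "smooth g" "Cc g" using g(2) by (auto simp: test_functions_iff)
  show 1: "Cc u" using Y_test[OF assms] by (simp add: test_functions_iff)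
  have "Cc (\<lambda>z. (dx (dx g) z, grad_y g z))"
    using s by (auto intro!: Cc_Pair Cc_grad_y simp: dx_pd smooth_Cc_pd smooth_pd)
  then show 2: "Cc (pot u)"
    using pot_dx[OF g(2)] by (simp add: g(1))
  from Cc_Pair[OF 2 1] show "Cc (jet u)" by (simp add: jet_def[abs_def])
qed

lemma Y_norm_lborel: "u \<in> Y_space \<Longrightarrow> Y_norm u = l2 lborel (jet u)"
  by (simp add: Y_norm_jet Cc_sq_int_lebesgue Y_Cc)

lemma Y_norm_split:
  assumes "u \<in> Y_space"
  shows "(Y_norm u)\<^sup>2 = (l2 lborel (pot u))\<^sup>2 + (l2 lborel u)\<^sup>2"
proof -
  have "(norm (jet u z))\<^sup>2 = (norm (pot u z))\<^sup>2 + (norm (u z))\<^sup>2" for z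
    by (simp add: jet_def norm_Pair)
  then show ?thesis
    using sq_int_integrable[OF Cc_sq_int[OF Y_Cc(1)[OF assms]]] sq_int_integrable[OF Cc_sq_int[OF Y_Cc(2)[OF assms]]]
    by (simp add: Y_norm_lborel[OF assms] l2_square)
qed

lemma dx_linear:
  assumes "f \<in> test_functions" "g \<in> test_functions"
  shows "dx (\<lambda>z. f z + g z) = (\<lambda>z. dx f z + dx g z)" "dx (\<lambda>z. c * f z) = (\<lambda>z. c * dx f z)"
    "dx (\<lambda>z. f z - g z) = (\<lambda>z. dx f z - dx g z)" "dx (\<lambda>z. f (z + a)) = (\<lambda>z. dx f (z + a))"
  using assms by (auto simp: dx_pd test_functions_iff pd_add pd_cmult pd_diff pd_translate)

lemma grad_y_linear:
  assumes "f \<in> test_functions" "g \<in> test_functions"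
  shows "grad_y (\<lambda>z. f z + g z) z = grad_y f z + grad_y g z" "grad_y (\<lambda>z. c * f z) z = c *\<^sub>R grad_y f z"
    "grad_y (\<lambda>z. f z - g z) z = grad_y f z - grad_y g z" "grad_y (\<lambda>z. f (z + a)) z = grad_y f (z + a)"
  using assms by (auto simp: vec_eq_iff grad_y_nth test_functions_iff pd_add pd_cmult pd_diff pd_translate)

text \<open>\<open>Dx_inv\<close> is an integral with a default value, so its linearity is not
  automatic. On \<open>Y\<close> it is inherited from the antiderivatives, where
  \<open>Dx_inv\<close> has been replaced by a gradient.\<close>

lemma Y_linear:
  assumes "u \<in> Y_space" "v \<in> Y_space"
  shows "(\<lambda>z. u z + v z) \<in> Y_space" "jet (\<lambda>z. u z + v z) z = jet u z + jet v z"
    "(\<lambda>z. u z - v z) \<in> Y_space" "jet (\<lambda>z. u z - v z) z = jet u z - jet v z"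
    "(\<lambda>z. c * u z) \<in> Y_space" "jet (\<lambda>z. c * u z) z = c *\<^sub>R jet u z"
    "(\<lambda>z. u (z + a)) \<in> Y_space" "jet (\<lambda>z. u (z + a)) z = jet u (z + a)"
proof -
  obtain f where f: "u = dx f" "f \<in> test_functions" using assms(1) by (rule Y_spaceE)
  obtain g where g: "v = dx g" "g \<in> test_functions" using assms(2) by (rule Y_spaceE)
  have fg: "dx f \<in> test_functions" "dx g \<in> test_functions" using f g by (auto simp: dx_pd test_pd)
  have eq: "(\<lambda>z. u z + v z) = dx (\<lambda>z. f z + g z)" "(\<lambda>z. u z - v z) = dx (\<lambda>z. f z - g z)"
    "(\<lambda>z. c * u z) = dx (\<lambda>z. c * f z)" "(\<lambda>z. u (z + a)) = dx (\<lambda>z. f (z + a))"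
    by (simp_all add: dx_linear[OF f(2) g(2)] f(1) g(1))
  note t = test_add[OF f(2) g(2)] test_diff[OF f(2) g(2)] test_cmult[OF f(2), of c] test_translate[OF f(2), of a]
  show "(\<lambda>z. u z + v z) \<in> Y_space" "(\<lambda>z. u z - v z) \<in> Y_space"
    "(\<lambda>z. c * u z) \<in> Y_space" "(\<lambda>z. u (z + a)) \<in> Y_space"
    unfolding eq using t by (auto intro: dx_in_Y)
  show "jet (\<lambda>z. u z + v z) z = jet u z + jet v z" "jet (\<lambda>z. u z - v z) z = jet u z - jet v z"
    "jet (\<lambda>z. c * u z) z = c *\<^sub>R jet u z" "jet (\<lambda>z. u (z + a)) z = jet u (z + a)"
    unfolding eq jet_dx[OF t(1)] jet_dx[OF t(2)] jet_dx[OF t(3)] jet_dx[OF t(4)] 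
    unfolding f(1) g(1) jet_dx[OF f(2)] jet_dx[OF g(2)]
    by (simp_all add: dx_linear[OF f(2) g(2)] dx_linear[OF fg] grad_y_linear[OF f(2) g(2)])
qed

lemma pot_jet: "pot u z = fst (jet u z)"
  by (simp add: jet_def)

lemma l2_jet_parts:
  assumes "u \<in> Y_space"
  shows "l2 lborel u \<le> Y_norm u" "l2 lborel (pot u) \<le> Y_norm u" "0 \<le> Y_norm u"
proof -
  show 0: "0 \<le> Y_norm u" by (simp add: Y_norm_jet l2_nonneg)
  show "l2 lborel u \<le> Y_norm u" "l2 lborel (pot u) \<le> Y_norm u"
    using Y_norm_split[OF assms] 0 by (auto intro!: power2_le_imp_le[OF _ 0])
qed

lemma Y_translate:
  assumes "u \<in> Y_space"
  shows "Y_norm (\<lambda>z. u (z + a)) = Y_norm u" "l2 lborel (pot (\<lambda>z. u (z + a))) = l2 lborel (pot u)"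
proof -
  note Y = Y_linear[OF assms assms] and C = Y_Cc[OF assms]
  have "jet (\<lambda>z. u (z + a)) = (\<lambda>z. jet u (z + a))" using Y(8)[of a] by auto
  then show "Y_norm (\<lambda>z. u (z + a)) = Y_norm u"
    using l2_translate[OF Cc_measurable[OF C(3)], of a] by (simp add: Y_norm_lborel Y assms)
  have "pot (\<lambda>z. u (z + a)) = (\<lambda>z. pot u (z + a))" using Y(8)[of a] by (auto simp: pot_jet)
  then show "l2 lborel (pot (\<lambda>z. u (z + a))) = l2 lborel (pot u)"
    using l2_translate[OF Cc_measurable[OF C(2)], of a] by simp
qed

text \<open>Of the two factors after integration by parts, \<open>k\<close> is of size
  \<open>norm \<eta>\<close> times the \<open>y\<close> gradient of \<open>g\<close>, whereas
  \<open>dx (dx k)\<close> is merely bounded. Hence \<open>u\<close> has only half a derivative in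
  the \<open>y\<close> directions, which is why the boxes are longer in \<open>x\<close> than in
  \<open>y\<close> at small scales.\<close>

lemma l2_increment_y:
  assumes "g \<in> test_functions"
  shows "(l2 lborel (\<lambda>z. dx g (z + (0, \<eta>)) - dx g z))\<^sup>2
    \<le> 2 * norm \<eta> * l2 lborel (grad_y g) * l2 lborel (dx (dx g))"
proof -
  have g: "smooth g" "Cc g" using assms by (auto simp: test_functions_iff)
  define k where "k z = g (z + (0, \<eta>)) - g z" for z
  have k: "k \<in> test_functions" unfolding k_def by (intro test_diff test_translate assms)
  let ?kx = "dx k" and ?kxx = "dx (dx k)"
  have kx: "?kx = (\<lambda>z. dx g (z + (0, \<eta>)) - dx g z)"
    unfolding k_def using assms by (simp add: dx_linear test_translate)
  have gx: "dx g \<in> test_functions" "dx (dx g) \<in> test_functions" using assms by (auto simp: dx_pd test_pd)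
  have kxx: "?kxx = (\<lambda>z. dx (dx g) (z + (0, \<eta>)) - dx (dx g) z)"
    unfolding kx using gx by (simp add: dx_linear test_translate)
  have sq: "sq_int lborel f" if "f \<in> test_functions" for f :: "real \<times> (real ^ 'n) \<Rightarrow> real"
    using that by (intro Cc_sq_int) (simp add: test_functions_iff)
  have kt: "?kx \<in> test_functions" "?kxx \<in> test_functions" using k by (auto simp: dx_pd test_pd)
  have "(l2 lborel ?kx)\<^sup>2 = (LINT z|lborel. ?kx z * ?kx z)"
    unfolding l2_square by (simp add: power2_eq_square)
  also have "\<dots> = - (LINT z|lborel. k z * ?kxx z)"
    using integral_by_parts[OF k kt(1), of "(1, 0)"] by (simp add: dx_pd)
  also have "\<dots> \<le> l2 lborel k * l2 lborel ?kxx"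
    using l2_Cauchy_Schwarz_real[OF sq[OF k] sq[OF kt(2)]] by linarith
  also have "\<dots> \<le> (norm \<eta> * l2 lborel (grad_y g)) * (2 * l2 lborel (dx (dx g)))"
  proof (intro mult_mono l2_nonneg mult_nonneg_nonneg norm_ge_zero)
    have "l2 lborel k \<le> l2 lborel (pd (0, \<eta>) g)"
      unfolding k_def by (rule l2_increment[OF assms])
    also have "\<dots> \<le> l2 lborel (\<lambda>z. norm \<eta> *\<^sub>R grad_y g z)"
    proof (rule l2_mono)
      show "sq_int lborel (\<lambda>z. norm \<eta> *\<^sub>R grad_y g z)"
        by (intro sq_int_scale Cc_sq_int Cc_grad_y g)
      show "norm (pd (0, \<eta>) g z) \<le> norm (norm \<eta> *\<^sub>R grad_y g z)" for z
        using Cauchy_Schwarz_ineq2[of \<eta> "grad_y g z"] by (simp add: pd_y[OF g(1)])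
    qed
    also have "\<dots> = norm \<eta> * l2 lborel (grad_y g)" by (simp add: l2_scale)
    finally show "l2 lborel k \<le> norm \<eta> * l2 lborel (grad_y g)" .
    show "l2 lborel ?kxx \<le> 2 * l2 lborel (dx (dx g))"
      unfolding kxx
      using l2_triangle_diff[OF sq[OF test_translate[OF gx(2), of "(0, \<eta>)"]] sq[OF gx(2)]]
        l2_translate[of "dx (dx g)" "(0, \<eta>)"] gx(2) Cc_measurable[of "dx (dx g)"] 
      by (simp add: test_functions_iff)
  qed
  finally show ?thesis unfolding kx by (simp add: mult_ac)
qed

lemma l2_increment_Y:
  assumes "u \<in> Y_space"
  shows "l2 lborel (\<lambda>z. u (z + (s, \<eta>)) - u z) \<le> (\<bar>s\<bar> + sqrt (2 * norm \<eta>)) * l2 lborel (pot u)"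
proof -
  obtain g where g: "u = dx g" "g \<in> test_functions" using assms by (rule Y_spaceE)
  have gs: "smooth g" "Cc g" using g by (auto simp: test_functions_iff)
  have u: "u \<in> test_functions" by (rule Y_test[OF assms])
  have us: "smooth u" "Cc u" using u by (auto simp: test_functions_iff)
  let ?T = "l2 lborel (pot u)"
  have sq: "sq_int lborel f" if "f \<in> test_functions" for f :: "real \<times> (real ^ 'n) \<Rightarrow> real"
    using that by (intro Cc_sq_int) (simp add: test_functions_iff)
  have pot: "sq_int lborel (pot u)" by (intro Cc_sq_int Y_Cc assms)
  have 1: "l2 lborel (dx u) \<le> ?T" "l2 lborel (grad_y g) \<le> ?T"
  proof -
    have n: "norm (dx u z) \<le> norm (pot u z)" "norm (grad_y g z) \<le> norm (pot u z)" for z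
      unfolding g(1) pot_dx[OF g(2)] by (rule norm_fst_le norm_snd_le)+
    show "l2 lborel (dx u) \<le> ?T" "l2 lborel (grad_y g) \<le> ?T"
      by (rule l2_mono[OF pot], rule n)+
  qed
  have x: "l2 lborel (\<lambda>z. u (z + (s, 0)) - u z) \<le> \<bar>s\<bar> * ?T"
  proof -
    have "l2 lborel (\<lambda>z. u (z + (s, 0)) - u z) \<le> l2 lborel (pd (s, 0) u)"
      by (rule l2_increment[OF u])
    also have "pd (s, 0) u = (\<lambda>z. s * dx u z)"
      using pd_direction(2)[OF us(1), of s "(1, 0)"] by (auto simp: dx_pd)
    also have "l2 lborel \<dots> = \<bar>s\<bar> * l2 lborel (dx u)" by (rule l2_cmult)
    finally show ?thesis using 1(1) by (meson abs_ge_zero mult_left_mono order.trans)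
  qed
  have y: "l2 lborel (\<lambda>z. u (z + (0, \<eta>)) - u z) \<le> sqrt (2 * norm \<eta>) * ?T"
  proof (rule power2_le_imp_le)
    have "(l2 lborel (\<lambda>z. u (z + (0, \<eta>)) - u z))\<^sup>2 \<le> 2 * norm \<eta> * l2 lborel (grad_y g) * l2 lborel (dx u)"
      using l2_increment_y[OF g(2)] by (simp add: g(1))
    also have "\<dots> \<le> 2 * norm \<eta> * ?T * ?T"
      using 1 by (intro mult_mono) (auto intro: l2_nonneg mult_nonneg_nonneg)
    finally show "(l2 lborel (\<lambda>z. u (z + (0, \<eta>)) - u z))\<^sup>2 \<le> (sqrt (2 * norm \<eta>) * ?T)\<^sup>2"
      by (simp add: power_mult_distrib power2_eq_square mult_ac)
  qed (simp add: l2_nonneg)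
  let ?v = "\<lambda>z. u (z + (0, \<eta>))"
  have v: "?v \<in> test_functions" by (rule test_translate[OF u])
  have "l2 lborel (\<lambda>z. u (z + (s, \<eta>)) - u z) \<le>
      l2 lborel (\<lambda>z. u (z + (s, \<eta>)) - ?v z) + l2 lborel (\<lambda>z. ?v z - u z)"
    by (intro l2_triangle3 sq test_translate u)
  also have "l2 lborel (\<lambda>z. u (z + (s, \<eta>)) - ?v z) = l2 lborel (\<lambda>z. u (z + (s, 0)) - u z)"
    using l2_translate[of "\<lambda>z. u (z + (s, 0)) - u z" "(0, \<eta>)"]
      Cc_measurable[OF us(2)] Cc_measurable[OF Cc_translate[OF us(2), of "(s, 0)"]]
    by (simp add: add.assoc)
  finally show ?thesis using x y by (simp add: distrib_right)
qed

section \<open>Averages over anisotropic boxes\<close>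

definition avg :: "'a::euclidean_space set \<Rightarrow> ('a \<Rightarrow> real) \<Rightarrow> 'a \<Rightarrow> real" where
  "avg B f z = (LINT \<zeta>|lborel. indicator B \<zeta> * f (z + \<zeta>)) / measure lborel B"

lemma avg_translate: "avg B (\<lambda>z. f (z + a)) z = avg B f (z + a)"
  by (simp add: avg_def add_ac)

lemma Cc_indicator_sq_int:
  fixes f :: "'a::euclidean_space \<Rightarrow> real"
  assumes "Cc f" "B \<in> sets borel"
  shows "sq_int lborel (\<lambda>\<zeta>. indicator B \<zeta> * f \<zeta>)"
proof (rule sq_int_bound)
  show "integrable lborel (\<lambda>z. (norm (f z))\<^sup>2)" using Cc_sq_int[OF assms(1)] by (rule sq_int_integrable)
qed (use Cc_measurable[OF assms(1)] assms(2) in \<open>auto simp: indicator_def\<close>)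

text \<open>Up to sign, \<open>f - avg B f\<close> is the mean over \<open>B\<close> of the
  increments of \<open>f\<close>. Cauchy-Schwarz in the variable of \<open>B\<close> and Tonelli
  bound its norm by the largest norm of an increment. Square integrability is proved along the way,
  since it is not known beforehand for \<open>avg B f\<close>.\<close>

lemma avg_diff_l2:
  fixes f :: "'a::euclidean_space \<Rightarrow> real"
  assumes f: "Cc f" and B: "compact B" "measure lborel B > 0" and K: "K \<ge> 0"
    and le: "\<And>\<zeta>. \<zeta> \<in> B \<Longrightarrow> l2 lborel (\<lambda>z. f (z + \<zeta>) - f z) \<le> K"
  shows "sq_int lborel (\<lambda>z. f z - avg B f z)" "l2 lborel (\<lambda>z. f z - avg B f z) \<le> K"
proof -
  have [measurable]: "B \<in> sets borel" using B(1) by (rule borel_compact)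
  note [measurable] = Cc_measurable[OF f]
  have fin: "emeasure lborel B < \<infinity>" using B(1) by (rule emeasure_compact_finite)
  define m where "m = measure lborel B"
  have m: "m > 0" "emeasure lborel B = ennreal m" 
    using B(2) fin by (auto simp: m_def emeasure_eq_ennreal_measure)
  have sB: "sq_int lborel (indicator B :: 'a \<Rightarrow> real)" "l2 lborel (indicator B :: 'a \<Rightarrow> real) = sqrt m"
    using fin by (auto simp: sq_int_def l2_def power2_eq_square indicator_inter_arith[symmetric] m_def)
  have [measurable]: "avg B f \<in> borel_measurable borel" unfolding avg_def[abs_def] by measurable
  have pt: "ennreal ((f z - avg B f z)\<^sup>2) \<le> ennreal (1 / m) * (\<integral>\<^sup>+ \<zeta>. ennreal ((indicator B \<zeta> * (f (z + \<zeta>) - f z))\<^sup>2) \<partial>lborel)" for z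
  proof -
    have s1: "sq_int lborel (\<lambda>\<zeta>. indicator B \<zeta> * f (z + \<zeta>))"
      using Cc_indicator_sq_int[OF Cc_translate[OF f, of z], of B] by (simp add: add.commute)
    have s2: "sq_int lborel (\<lambda>\<zeta>. indicator B \<zeta> * f z)"
      using sq_int_cmult[OF sB(1), of "f z"] by (simp add: mult.commute)
    have s: "sq_int lborel (\<lambda>\<zeta>. indicator B \<zeta> * (f (z + \<zeta>) - f z))"
      using sq_int_diff[OF s1 s2] by (simp add: right_diff_distrib)
    have i1: "integrable lborel (\<lambda>\<zeta>. indicator B \<zeta> * f (z + \<zeta>))"
      using sq_int_mult[OF sB(1) s1] by (simp add: mult.assoc[symmetric] indicator_inter_arith[symmetric])
    have i2: "integrable lborel (\<lambda>\<zeta>. indicator B \<zeta> * f z)"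
      using fin by simp
    have "(LINT \<zeta>|lborel. indicator B \<zeta> * (f (z + \<zeta>) - f z)) = m * (avg B f z - f z)"
      using i1 i2 m(1) by (simp add: right_diff_distrib avg_def m_def[symmetric])
    moreover have "\<bar>LINT \<zeta>|lborel. indicator B \<zeta> * (indicator B \<zeta> * (f (z + \<zeta>) - f z))\<bar> \<le> sqrt m * l2 lborel (\<lambda>\<zeta>. indicator B \<zeta> * (f (z + \<zeta>) - f z))"
      using l2_Cauchy_Schwarz_real[OF sB(1) s] by (simp add: sB(2))
    ultimately have "m * \<bar>f z - avg B f z\<bar> \<le> sqrt m * l2 lborel (\<lambda>\<zeta>. indicator B \<zeta> * (f (z + \<zeta>) - f z))"
      using m(1) by (simp add: mult.assoc[symmetric] indicator_inter_arith[symmetric] abs_mult abs_minus_commute)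
    then have "(m * \<bar>f z - avg B f z\<bar>)\<^sup>2 \<le> (sqrt m * l2 lborel (\<lambda>\<zeta>. indicator B \<zeta> * (f (z + \<zeta>) - f z)))\<^sup>2"
      using m(1) by (intro power_mono) auto
    then have "m * (m * (f z - avg B f z)\<^sup>2) \<le> m * (l2 lborel (\<lambda>\<zeta>. indicator B \<zeta> * (f (z + \<zeta>) - f z)))\<^sup>2"
      using m(1) by (simp add: power_mult_distrib power2_eq_square[of m] mult.assoc)
    then have "(f z - avg B f z)\<^sup>2 \<le> (1 / m) * (l2 lborel (\<lambda>\<zeta>. indicator B \<zeta> * (f (z + \<zeta>) - f z)))\<^sup>2"
      using m(1) by (simp add: field_simps)
    then show ?thesis
      using nn_integral_sq_int[OF s] m(1) by (simp add: ennreal_mult'[symmetric] ennreal_leI)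
  qed
  have "(\<integral>\<^sup>+ z. ennreal ((f z - avg B f z)\<^sup>2) \<partial>lborel) \<le> (\<integral>\<^sup>+ z. ennreal (1 / m) * (\<integral>\<^sup>+ \<zeta>. ennreal ((indicator B \<zeta> * (f (z + \<zeta>) - f z))\<^sup>2) \<partial>lborel) \<partial>lborel)"
    by (intro nn_integral_mono pt)
  also have "\<dots> = ennreal (1 / m) * (\<integral>\<^sup>+ z. \<integral>\<^sup>+ \<zeta>. ennreal ((indicator B \<zeta> * (f (z + \<zeta>) - f z))\<^sup>2) \<partial>lborel \<partial>lborel)"
    by (rule nn_integral_cmult) measurable
  also have "(\<integral>\<^sup>+ z. \<integral>\<^sup>+ \<zeta>. ennreal ((indicator B \<zeta> * (f (z + \<zeta>) - f z))\<^sup>2) \<partial>lborel \<partial>lborel)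
      = (\<integral>\<^sup>+ \<zeta>. \<integral>\<^sup>+ z. ennreal ((indicator B \<zeta> * (f (z + \<zeta>) - f z))\<^sup>2) \<partial>lborel \<partial>lborel)"
    by (rule lborel_pair.Fubini') measurable
  also have "\<dots> \<le> (\<integral>\<^sup>+ \<zeta>. indicator B \<zeta> * ennreal (K\<^sup>2) \<partial>lborel)"
  proof (rule nn_integral_mono)
    fix \<zeta> :: 'a
    show "(\<integral>\<^sup>+ z. ennreal ((indicator B \<zeta> * (f (z + \<zeta>) - f z))\<^sup>2) \<partial>lborel) \<le> indicator B \<zeta> * ennreal (K\<^sup>2)"
    proof (cases "\<zeta> \<in> B")
      case True
      have "(\<integral>\<^sup>+ z. ennreal ((f (z + \<zeta>) - f z)\<^sup>2) \<partial>lborel) = ennreal ((l2 lborel (\<lambda>z. f (z + \<zeta>) - f z))\<^sup>2)"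
        using nn_integral_sq_int[OF Cc_sq_int[OF Cc_arith(2)[OF Cc_translate[OF f, of \<zeta>] f]]] by simp
      also have "\<dots> \<le> ennreal (K\<^sup>2)"
        using le[OF True] by (intro ennreal_leI power_mono l2_nonneg)
      finally show ?thesis using True by simp
    qed simp
  qed
  also have "\<dots> = ennreal (K\<^sup>2) * ennreal m"
    by (subst nn_integral_multc) (auto simp: m(2) mult.commute)
  also have "ennreal (1 / m) * (ennreal (K\<^sup>2) * ennreal m) = ennreal (K\<^sup>2)"
    using m(1) by (simp add: ennreal_mult'[symmetric])
  finally have fin2: "(\<integral>\<^sup>+ z. ennreal ((f z - avg B f z)\<^sup>2) \<partial>lborel) \<le> ennreal (K\<^sup>2)"
    by (simp add: mult_left_mono)
  have "integrable lborel (\<lambda>z. (f z - avg B f z)\<^sup>2)"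
    by (rule integrableI_bounded) (use fin2 in \<open>auto simp: order.strict_trans1\<close>)
  then show s: "sq_int lborel (\<lambda>z. f z - avg B f z)"
    by (simp add: sq_int_def)
  have "ennreal ((l2 lborel (\<lambda>z. f z - avg B f z))\<^sup>2) \<le> ennreal (K\<^sup>2)"
    using nn_integral_sq_int[OF s] fin2 by simp
  then have "(l2 lborel (\<lambda>z. f z - avg B f z))\<^sup>2 \<le> K\<^sup>2" by simp
  then show "l2 lborel (\<lambda>z. f z - avg B f z) \<le> K" using K by (rule power2_le_imp_le)
qed

text \<open>The two side lengths balance the terms of \<open>l2_increment_Y\<close>: on
  \<open>Box t\<close> both \<open>\<bar>s\<bar>\<close> and \<open>sqrt (2 * norm \<eta>)\<close>
  are of order \<open>t\<close>.\<close>

definition Box :: "real \<Rightarrow> (real \<times> (real ^ 'n)) set" where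
  "Box t = cbox (- t, - (\<chi> i. t\<^sup>2)) (t, \<chi> i. t\<^sup>2)"

lemma mem_Box: "(s, \<eta>) \<in> Box t \<longleftrightarrow> \<bar>s\<bar> \<le> t \<and> (\<forall>i. \<bar>\<eta> $ i\<bar> \<le> t\<^sup>2)"
  unfolding Box_def cbox_Pair_eq by (auto simp: mem_box_cart abs_le_iff) (metis minus_le_iff)+

lemma measure_Box:
  assumes "t > 0"
  shows "measure lborel (Box t :: (real \<times> (real ^ 'n)) set) = 2 ^ (CARD('n) + 1) * t ^ (2 * CARD('n) + 1)"
proof -
  have "measure lborel (Box t :: (real \<times> (real ^ 'n)) set) = measure lborel (cbox (-t) t) * measure lborel (cbox (- (\<chi> i. t\<^sup>2)) (\<chi> i. t\<^sup>2) :: (real ^ 'n) set)"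
    unfolding Box_def by (simp only: content_Pair)
  also have "measure lborel (cbox (- (\<chi> i. t\<^sup>2)) (\<chi> i. t\<^sup>2) :: (real ^ 'n) set) = (2 * t\<^sup>2) ^ CARD('n)"
    by (subst content_cbox_cart) (auto simp: interval_eq_empty_cart not_less)
  also have "measure lborel (cbox (-t) t) = 2 * t" using assms by simp
  finally show ?thesis by (simp add: power_mult_distrib power_mult[symmetric] mult_ac)
qed

text \<open>An upper bound of \<open>\<bar>s\<bar> + sqrt (2 * norm \<eta>)\<close> on
  \<open>Box 1\<close>, the norm of \<open>\<eta>\<close> being estimated by the sum of its
  \<open>CARD('n)\<close> coordinates.\<close>

definition box_const :: "'n itself \<Rightarrow> real" where
  "box_const _ = 1 + sqrt (2 * real CARD('n))"

lemma box_const_ge_1: "box_const TYPE('n::finite) \<ge> 1"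
  by (simp add: box_const_def)

lemma avg_Box_l2:
  fixes u :: "real \<times> (real ^ 'n) \<Rightarrow> real"
  assumes "u \<in> Y_space" "t > 0"
  shows "sq_int lborel (\<lambda>z. u z - avg (Box t) u z)"
    "l2 lborel (\<lambda>z. u z - avg (Box t) u z) \<le> box_const TYPE('n) * t * l2 lborel (pot u)"
proof -
  have inc: "l2 lborel (\<lambda>z. u (z + \<zeta>) - u z) \<le> box_const TYPE('n) * t * l2 lborel (pot u)" if "\<zeta> \<in> Box t" for \<zeta>
  proof -
    obtain s \<eta> where \<zeta>: "\<zeta> = (s, \<eta>)" by (cases \<zeta>)
    have s: "\<bar>s\<bar> \<le> t" and \<eta>: "\<And>i. \<bar>\<eta> $ i\<bar> \<le> t\<^sup>2" using that by (auto simp: \<zeta> mem_Box)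
    have "norm \<eta> \<le> (\<Sum>i\<in>UNIV. \<bar>\<eta> $ i\<bar>)" by (rule norm_le_l1_cart)
    also have "\<dots> \<le> (\<Sum>i\<in>(UNIV::'n set). t\<^sup>2)" by (intro sum_mono \<eta>)
    finally have "2 * norm \<eta> \<le> (2 * real CARD('n)) * t\<^sup>2" by simp
    then have "sqrt (2 * norm \<eta>) \<le> sqrt (2 * real CARD('n)) * t"
      using assms(2) real_sqrt_le_mono[of "2 * norm \<eta>" "(2 * real CARD('n)) * t\<^sup>2"] by (simp add: real_sqrt_mult)
    with s have "\<bar>s\<bar> + sqrt (2 * norm \<eta>) \<le> box_const TYPE('n) * t"
      by (simp add: box_const_def distrib_right)
    then show ?thesis
      using l2_increment_Y[OF assms(1), of s \<eta>] l2_nonneg[of lborel "pot u"] unfolding \<zeta>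
      by (meson mult_right_mono order.trans)
  qed
  have cB: "compact (Box t :: (real \<times> (real ^ 'n)) set)" by (simp add: Box_def)
  have mB: "measure lborel (Box t :: (real \<times> (real ^ 'n)) set) > 0" using assms(2) by (simp add: measure_Box)
  have K: "box_const TYPE('n) * t * l2 lborel (pot u) \<ge> 0"
    using box_const_ge_1[where 'n='n] assms(2) by (intro mult_nonneg_nonneg l2_nonneg) auto
  show "sq_int lborel (\<lambda>z. u z - avg (Box t) u z)"
    "l2 lborel (\<lambda>z. u z - avg (Box t) u z) \<le> box_const TYPE('n) * t * l2 lborel (pot u)"
    by (rule avg_diff_l2[OF Y_Cc(1)[OF assms(1)] cB mB K inc]; assumption)+
qed

section \<open>The subcritical embedding\<close>

lemma continuous_abs_powr: "r > 0 \<Longrightarrow> continuous_on UNIV (\<lambda>x::real. \<bar>x\<bar> powr r)"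
  by (intro continuous_on_powr' continuous_intros) auto

lemma Cc_abs_powr: "Cc f \<Longrightarrow> r > 0 \<Longrightarrow> Cc (\<lambda>z. \<bar>f z\<bar> powr r)" for f :: "_ \<Rightarrow> real"
  by (rule Cc_compose[of f "\<lambda>x. \<bar>x\<bar> powr r"]) (auto intro: continuous_abs_powr)

lemma abs_le_powr_split:
  fixes a :: real
  assumes "\<mu> > 0" "r \<ge> 1" shows "\<bar>a\<bar> \<le> \<mu> + \<mu> powr (1 - r) * \<bar>a\<bar> powr r"
proof (cases "\<bar>a\<bar> \<le> \<mu>")
  case True
  then show ?thesis by (simp add: add_increasing2)
next
  case False
  then have a: "\<bar>a\<bar> > 0" "\<mu> \<le> \<bar>a\<bar>" using assms by auto
  have "\<bar>a\<bar> = \<bar>a\<bar> powr (1 - r) * \<bar>a\<bar> powr r" using a(1) by (simp add: powr_add[symmetric])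
  also have "\<dots> \<le> \<mu> powr (1 - r) * \<bar>a\<bar> powr r"
    using assms a by (intro mult_right_mono powr_mono2') auto
  finally show ?thesis using assms(1) by linarith
qed

text \<open>Splitting values at the level \<open>\<mu>\<close> takes the place of Hoelder's
  inequality and leaves \<open>\<mu>\<close> free to be chosen by the caller.\<close>

lemma avg_le_powr:
  fixes f :: "'a::euclidean_space \<Rightarrow> real"
  assumes f: "Cc f" and B: "compact B" "measure lborel B > 0" and \<mu>: "\<mu> > 0" and r: "r \<ge> 1"
  shows "\<bar>avg B f z\<bar> \<le> \<mu> + \<mu> powr (1 - r) / measure lborel B * (LINT z|lborel. \<bar>f z\<bar> powr r)"
proof -
  have [measurable]: "B \<in> sets borel" using B(1) by (rule borel_compact)
  note [measurable] = Cc_measurable[OF f]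
  have fin: "emeasure lborel B < \<infinity>" using B(1) by (rule emeasure_compact_finite)
  let ?m = "measure lborel B"
  have C: "Cc (\<lambda>\<zeta>. f (z + \<zeta>))" using Cc_translate[OF f, of z] by (simp add: add.commute)
  have i1: "integrable lborel (\<lambda>\<zeta>. \<bar>f (z + \<zeta>)\<bar> powr r)"
    using r by (intro Cc_integrable Cc_abs_powr C) auto
  have i2: "integrable lborel (\<lambda>\<zeta>. indicator B \<zeta> * f (z + \<zeta>))"
    by (rule Bochner_Integration.integrable_bound[OF Cc_integrable[OF C]]) (auto simp: indicator_def)
  have eq: "(LINT \<zeta>|lborel. \<bar>f (z + \<zeta>)\<bar> powr r) = (LINT z|lborel. \<bar>f z\<bar> powr r)"
    using lborel_integral_translate[of "\<lambda>z. \<bar>f z\<bar> powr r" z] by (simp add: add.commute)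
  have "\<bar>LINT \<zeta>|lborel. indicator B \<zeta> * f (z + \<zeta>)\<bar> \<le> (LINT \<zeta>|lborel. \<bar>indicator B \<zeta> * f (z + \<zeta>)\<bar>)"
    by (rule integral_abs_bound)
  also have "\<dots> \<le> (LINT \<zeta>|lborel. indicator B \<zeta> * \<mu> + \<mu> powr (1 - r) * \<bar>f (z + \<zeta>)\<bar> powr r)"
  proof (rule integral_mono)
    show "integrable lborel (\<lambda>\<zeta>. \<bar>indicator B \<zeta> * f (z + \<zeta>)\<bar>)" using i2 by (rule integrable_abs)
    show "integrable lborel (\<lambda>\<zeta>. indicator B \<zeta> * \<mu> + \<mu> powr (1 - r) * \<bar>f (z + \<zeta>)\<bar> powr r)"
      using fin i1 by (intro Bochner_Integration.integrable_add integrable_mult_right integrable_mult_left) auto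
    show "\<bar>indicator B \<zeta> * f (z + \<zeta>)\<bar> \<le> indicator B \<zeta> * \<mu> + \<mu> powr (1 - r) * \<bar>f (z + \<zeta>)\<bar> powr r" for \<zeta>
      using abs_le_powr_split[OF \<mu> r, of "f (z + \<zeta>)"] by (simp add: indicator_def)
  qed
  also have "\<dots> = ?m * \<mu> + \<mu> powr (1 - r) * (LINT z|lborel. \<bar>f z\<bar> powr r)"
    using fin i1 by (simp add: eq)
  finally have "\<bar>LINT \<zeta>|lborel. indicator B \<zeta> * f (z + \<zeta>)\<bar> / ?m \<le> (?m * \<mu> + \<mu> powr (1 - r) * (LINT z|lborel. \<bar>f z\<bar> powr r)) / ?m"
    using B(2) by (intro divide_right_mono) auto
  then show ?thesis using B(2) by (simp add: avg_def add_divide_distrib)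
qed

text \<open>The homogeneous dimension: the volume of \<open>Box t\<close> is of order
  \<open>t ^ hdim\<close>. With \<open>N = CARD('n) + 1\<close> it equals \<open>2 N - 1\<close>,
  and \<open>critical_exponent N\<close> is \<open>2 D / (D - 2)\<close> for
  \<open>D = hdim\<close>, the Sobolev exponent of a space of dimension \<open>D\<close>.\<close>

abbreviation hdim :: "'n itself \<Rightarrow> nat" where
  "hdim _ \<equiv> 2 * CARD('n) + 1"

lemma hdim_ge_3: "hdim TYPE('n::finite) \<ge> 3"
  using zero_less_card_finite[where 'a='n] by linarith

lemma compact_Box: "compact (Box t)"
  by (simp add: Box_def)

lemma measure_Box_ge:
  assumes "t > 0" shows "t ^ hdim TYPE('n) \<le> measure lborel (Box t :: (real \<times> (real ^ 'n)) set)"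
proof -
  have "1 * t ^ hdim TYPE('n) \<le> 2 ^ (CARD('n) + 1) * t ^ hdim TYPE('n)"
    using assms by (intro mult_right_mono one_le_power) auto
  then show ?thesis using measure_Box[OF assms, where 'n='n] by simp
qed

lemma measure_Box_pos: "t > 0 \<Longrightarrow> measure lborel (Box t :: (real \<times> (real ^ 'n)) set) > 0"
  by (simp add: measure_Box)

lemma half_abs_le_diff: "\<mu> < \<bar>a\<bar> \<Longrightarrow> \<bar>b\<bar> \<le> \<mu> / 2 \<Longrightarrow> \<bar>a\<bar> \<le> 2 * \<bar>a - b\<bar>" for a b \<mu> :: real
  by (auto simp: abs_if split: if_splits)

text \<open>Where \<open>\<bar>u\<bar>\<close> exceeds \<open>\<mu>\<close> although the average is
  at most \<open>\<mu> / 2\<close>, the value of \<open>u\<close> is at most twice its deviation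
  from the average, and the deviation is of order \<open>t\<close> in \<open>l2\<close>.\<close>

lemma superlevel_l2:
  fixes u :: "real \<times> (real ^ 'n) \<Rightarrow> real"
  assumes u: "u \<in> Y_space" and t: "t > 0" and "\<mu> \<ge> 0" and le: "\<And>z. \<bar>avg (Box t) u z\<bar> \<le> \<mu> / 2"
  shows "(LINT z|lborel. indicator {z. \<bar>u z\<bar> > \<mu>} z * (u z)\<^sup>2) \<le> 4 * (box_const TYPE('n) * t * l2 lborel (pot u))\<^sup>2"
proof -
  have c: "Cc u" by (rule Y_Cc[OF u])
  note [measurable] = Cc_measurable[OF c]
  note A = avg_Box_l2[OF u t]
  have "(LINT z|lborel. indicator {z. \<bar>u z\<bar> > \<mu>} z * (u z)\<^sup>2) \<le> (LINT z|lborel. 4 * (u z - avg (Box t) u z)\<^sup>2)"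
  proof (rule integral_mono)
    show "integrable lborel (\<lambda>z. 4 * (u z - avg (Box t) u z)\<^sup>2)"
      using sq_int_integrable[OF A(1)] by simp
    show "integrable lborel (\<lambda>z. indicator {z. \<bar>u z\<bar> > \<mu>} z * (u z)\<^sup>2)"
      by (rule Bochner_Integration.integrable_bound[OF sq_int_integrable[OF Cc_sq_int[OF c]]]) (auto simp: indicator_def)
    show "indicator {z. \<bar>u z\<bar> > \<mu>} z * (u z)\<^sup>2 \<le> 4 * (u z - avg (Box t) u z)\<^sup>2" for z
    proof (cases "\<bar>u z\<bar> > \<mu>")
      case True
      then have "\<bar>u z\<bar> \<le> 2 * \<bar>u z - avg (Box t) u z\<bar>" using le[of z] half_abs_le_diff by blast
      then have "\<bar>u z\<bar>\<^sup>2 \<le> (2 * \<bar>u z - avg (Box t) u z\<bar>)\<^sup>2" by (intro power_mono) auto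
      then show ?thesis using True by (simp add: power_mult_distrib)
    qed simp
  qed
  also have "\<dots> = 4 * (l2 lborel (\<lambda>z. u z - avg (Box t) u z))\<^sup>2"
    using sq_int_integrable[OF A(1)] by (simp add: l2_square)
  also have "\<dots> \<le> 4 * (box_const TYPE('n) * t * l2 lborel (pot u))\<^sup>2"
    using A(2) by (intro mult_left_mono power_mono l2_nonneg) auto
  finally show ?thesis .
qed

text \<open>Stated on the unit ball of \<open>Y\<close> so that only a constant has to be carried
  through the iteration; \<open>embedding\<close> restores homogeneity.\<close>

definition embeds :: "'n::finite itself \<Rightarrow> real \<Rightarrow> bool" where
  "embeds _ r \<longleftrightarrow> (\<exists>C>0. \<forall>u \<in> (Y_space :: (real \<times> (real ^ 'n) \<Rightarrow> real) set).
     Y_norm u \<le> 1 \<longrightarrow> (LINT z|lborel. \<bar>u z\<bar> powr r) \<le> C)"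

text \<open>A bound on the integral of \<open>\<bar>u\<bar> powr r\<close> keeps the averages over
  \<open>Box t\<close> below \<open>\<mu> / 2\<close> once \<open>t ^ hdim\<close> is of order
  \<open>\<mu> powr (- r)\<close>. For this \<open>t\<close> the bound of
  \<open>superlevel_l2\<close> is of order \<open>t\<^sup>2\<close>, which is the stated power of
  \<open>\<mu>\<close>.\<close>

lemma superlevel_decay:
  assumes "embeds TYPE('n::finite) r" "r \<ge> 2"
  obtains C where "C > 0" "\<And>(u :: real \<times> (real ^ 'n) \<Rightarrow> real) \<mu>. u \<in> Y_space \<Longrightarrow> Y_norm u \<le> 1 \<Longrightarrow> \<mu> > 0 \<Longrightarrow>
     (LINT z|lborel. indicator {z. \<bar>u z\<bar> > \<mu>} z * (u z)\<^sup>2) \<le> C * \<mu> powr (- 2 * r / hdim TYPE('n))"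
proof -
  obtain C where C: "C > 0" "\<And>u :: real \<times> (real ^ 'n) \<Rightarrow> real. u \<in> Y_space \<Longrightarrow> Y_norm u \<le> 1 \<Longrightarrow> (LINT z|lborel. \<bar>u z\<bar> powr r) \<le> C"
    using assms(1) unfolding embeds_def by blast
  let ?D = "real (hdim TYPE('n))" and ?\<kappa> = "box_const TYPE('n)"
  define C' where "C' = 4 * ?\<kappa>\<^sup>2 * (C * 4 powr r) powr (2 / ?D)"
  have D: "?D > 0" by simp
  show thesis
  proof (rule that[of C'])
    show "C' > 0" using C(1) box_const_ge_1[where 'n='n] by (simp add: C'_def)
    fix u :: "real \<times> (real ^ 'n) \<Rightarrow> real" and \<mu> :: real
    assume u: "u \<in> Y_space" "Y_norm u \<le> 1" and l: "\<mu> > 0"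
    \<comment> \<open>Chosen so that splitting at the level \<open>\<mu> / 4\<close> in
      \<open>avg_le_powr\<close> costs exactly another \<open>\<mu> / 4\<close>.\<close>
    define t where "t = (C * 4 powr r * \<mu> powr (- r)) powr (1 / ?D)"
    have t: "t > 0" using C(1) l by (simp add: t_def)
    have tD: "t ^ hdim TYPE('n) = C * 4 powr r * \<mu> powr (- r)"
      using t powr_realpow[OF t, of "hdim TYPE('n)"] C(1) l D unfolding t_def powr_powr by (simp add: powr_powr)
    have t2: "t\<^sup>2 = (C * 4 powr r) powr (2 / ?D) * \<mu> powr (- 2 * r / ?D)"
    proof -
      have "t\<^sup>2 = t powr 2" using t by simp
      also have "\<dots> = (C * 4 powr r * \<mu> powr (- r)) powr (2 / ?D)" by (simp add: t_def powr_powr)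
      also have "\<dots> = (C * 4 powr r) powr (2 / ?D) * (\<mu> powr (- r)) powr (2 / ?D)"
        using C(1) l by (intro powr_mult) 
      finally show ?thesis by (simp add: powr_powr mult.commute)
    qed
    have avg: "\<bar>avg (Box t) u z\<bar> \<le> \<mu> / 2" for z
    proof -
      have "\<bar>avg (Box t) u z\<bar> \<le> \<mu>/4 + (\<mu>/4) powr (1 - r) / measure lborel (Box t :: (real \<times> (real ^ 'n)) set) * (LINT z|lborel. \<bar>u z\<bar> powr r)"
        using l assms(2) by (intro avg_le_powr Y_Cc(1)[OF u(1)] compact_Box measure_Box_pos t) auto
      also have "\<dots> \<le> \<mu>/4 + (\<mu>/4) powr (1 - r) / t ^ hdim TYPE('n) * C"
        using measure_Box_ge[OF t, where 'n='n] C(2)[OF u] t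
        by (intro add_left_mono mult_mono divide_left_mono) (auto intro!: mult_pos_pos measure_Box_pos integral_nonneg_AE)
      also have "(\<mu>/4) powr (1 - r) / t ^ hdim TYPE('n) * C = \<mu> / 4"
      proof -
        have "(\<mu>/4) powr (1 - r) = (\<mu>/4) * (4 powr r * \<mu> powr (- r))"
          using l by (simp add: powr_diff powr_divide powr_minus field_simps)
        then show ?thesis unfolding tD using C(1) l by (simp add: field_simps)
      qed
      finally show ?thesis by simp
    qed
    have "(LINT z|lborel. indicator {z. \<bar>u z\<bar> > \<mu>} z * (u z)\<^sup>2) \<le> 4 * (?\<kappa> * t * l2 lborel (pot u))\<^sup>2"
      using l by (intro superlevel_l2 u t avg) auto
    also have "\<dots> \<le> 4 * (?\<kappa> * t * 1)\<^sup>2"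
      using l2_jet_parts(2)[OF u(1)] u(2) t box_const_ge_1[where 'n='n]
      by (intro mult_left_mono power_mono mult_nonneg_nonneg) (auto simp: l2_nonneg)
    also have "\<dots> = C' * \<mu> powr (- 2 * r / ?D)"
      by (simp add: power_mult_distrib t2 C'_def)
    finally show "(LINT z|lborel. indicator {z. \<bar>u z\<bar> > \<mu>} z * (u z)\<^sup>2) \<le> C' * \<mu> powr (- 2 * r / ?D)" .
  qed
qed

text \<open>On the layer between \<open>2 ^ k\<close> and \<open>2 ^ (k + 1)\<close> the factor
  \<open>\<bar>x\<bar> powr (s - 2)\<close> is replaced by its value at the right end; the term
  \<open>x\<^sup>2\<close> covers \<open>\<bar>x\<bar> \<le> 1\<close>. Finitely many layers suffice
  for a bounded function, and the sum will be estimated independently of their number.\<close>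

lemma abs_powr_dyadic:
  fixes x s :: real
  assumes "s \<ge> 2" "\<bar>x\<bar> \<le> 2 ^ K"
  shows "\<bar>x\<bar> powr s \<le> x\<^sup>2 + (\<Sum>k<K. 2 powr ((s - 2) * (real k + 1)) * (indicator {x. \<bar>x\<bar> > 2 ^ k} x * x\<^sup>2))"
  using assms(2)
proof (induction K)
  case 0
  then have "\<bar>x\<bar> \<le> 1" by simp
  show ?case
  proof (cases "x = 0")
    case False
    then have "\<bar>x\<bar> powr s \<le> \<bar>x\<bar> powr 2" using \<open>\<bar>x\<bar> \<le> 1\<close> assms(1) by (intro powr_mono') auto
    then show ?thesis using False by simp
  qed simp
next
  case (Suc K)
  show ?case
  proof (cases "\<bar>x\<bar> \<le> 2 ^ K")
    case True
    then show ?thesis using Suc.IH by (simp add: add_increasing2)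
  next
    case False
    have pos: "\<bar>x\<bar> > 0" using False by (smt (verit) zero_le_power)
    have "\<bar>x\<bar> powr s = x\<^sup>2 * \<bar>x\<bar> powr (s - 2)"
      using pos powr_add[of "\<bar>x\<bar>" 2 "s - 2"] by simp
    also have "\<dots> \<le> x\<^sup>2 * (2 ^ Suc K) powr (s - 2)"
      using Suc.prems assms(1) by (intro mult_left_mono powr_mono2) auto
    also have "(2 ^ Suc K :: real) powr (s - 2) = 2 powr ((s - 2) * (real K + 1))"
    proof -
      have "(2 ^ Suc K :: real) = 2 powr (real K + 1)" using powr_realpow[of "2::real" "Suc K"] by (simp add: add.commute)
      then show ?thesis by (simp only: powr_powr mult.commute)
    qed
    finally have "\<bar>x\<bar> powr s \<le> 2 powr ((s - 2) * (real K + 1)) * (indicator {x. \<bar>x\<bar> > 2 ^ K} x * x\<^sup>2)"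
      using False by (simp add: mult.commute)
    moreover have "0 \<le> (\<Sum>k<K. 2 powr ((s - 2) * (real k + 1)) * (indicator {x. \<bar>x\<bar> > 2 ^ k} x * x\<^sup>2))"
      by (intro sum_nonneg) auto
    ultimately show ?thesis using zero_le_power2[of x] unfolding sum.lessThan_Suc by linarith
  qed
qed

text \<open>Inserting the decay of the superlevel sets into the dyadic sum gives a geometric series,
  whose ratio \<open>\<rho>\<close> is below 1 exactly when
  \<open>s < 2 + 2 * r / hdim\<close>.\<close>

lemma embeds_step:
  assumes r: "embeds TYPE('n::finite) r" "r \<ge> 2" and s: "s \<ge> 2" "s < 2 + 2 * r / hdim TYPE('n)"
  shows "embeds TYPE('n) s"
proof -
  let ?D = "real (hdim TYPE('n))"
  obtain C where C: "C > 0" "\<And>(u :: real \<times> (real ^ 'n) \<Rightarrow> real) \<mu>. u \<in> Y_space \<Longrightarrow> Y_norm u \<le> 1 \<Longrightarrow> \<mu> > 0 \<Longrightarrow>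
     (LINT z|lborel. indicator {z. \<bar>u z\<bar> > \<mu>} z * (u z)\<^sup>2) \<le> C * \<mu> powr (- 2 * r / ?D)"
    by (rule superlevel_decay[OF r]) blast
  define \<rho> where "\<rho> = 2 powr (s - 2 - 2 * r / ?D)"
  have \<rho>: "0 < \<rho>" "\<rho> < 1" using s(2) by (auto simp: \<rho>_def powr_less_one)
  define C' where "C' = 1 + 2 powr (s - 2) * C / (1 - \<rho>)"
  have "(LINT z|lborel. \<bar>u z\<bar> powr s) \<le> C'" if u: "u \<in> Y_space" "Y_norm u \<le> 1" for u :: "real \<times> (real ^ 'n) \<Rightarrow> real"
  proof -
    have c: "Cc u" by (rule Y_Cc[OF u(1)])
    note [measurable] = Cc_measurable[OF c]
    obtain M where "\<And>z. norm (u z) \<le> M" using Cc_bounded[OF c] by blast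
    then have M: "\<And>z. \<bar>u z\<bar> \<le> M" by simp
    obtain K where K: "M < 2 ^ K" using real_arch_pow[of 2 M] by auto
    let ?I = "\<lambda>k z. indicator {z. \<bar>u z\<bar> > 2 ^ k} z * (u z)\<^sup>2 :: real"
    have i: "integrable lborel (?I k)" for k
      by (rule Bochner_Integration.integrable_bound[OF sq_int_integrable[OF Cc_sq_int[OF c]]]) (auto simp: indicator_def)
    have i2: "integrable lborel (\<lambda>z. (u z)\<^sup>2)" using sq_int_integrable[OF Cc_sq_int[OF c]] by simp
    have "(LINT z|lborel. \<bar>u z\<bar> powr s) \<le> (LINT z|lborel. (u z)\<^sup>2 + (\<Sum>k<K. 2 powr ((s - 2) * (real k + 1)) * ?I k z))"
    proof (rule integral_mono)
      show "integrable lborel (\<lambda>z. \<bar>u z\<bar> powr s)" using s by (intro Cc_integrable Cc_abs_powr c) auto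
      show "integrable lborel (\<lambda>z. (u z)\<^sup>2 + (\<Sum>k<K. 2 powr ((s - 2) * (real k + 1)) * ?I k z))"
        by (intro Bochner_Integration.integrable_add Bochner_Integration.integrable_sum integrable_mult_right i i2)
      show "\<bar>u z\<bar> powr s \<le> (u z)\<^sup>2 + (\<Sum>k<K. 2 powr ((s - 2) * (real k + 1)) * ?I k z)" for z
        using abs_powr_dyadic[OF s(1), of "u z" K] M[of z] K by (simp add: indicator_def)
    qed
    also have "\<dots> = (LINT z|lborel. (u z)\<^sup>2) + (\<Sum>k<K. 2 powr ((s - 2) * (real k + 1)) * (LINT z|lborel. ?I k z))"
      by (subst Bochner_Integration.integral_add)
        (auto intro!: i2 Bochner_Integration.integrable_sum integrable_mult_right i simp: Bochner_Integration.integral_sum integrable_mult_right i)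
    also have "\<dots> \<le> 1 + (\<Sum>k<K. 2 powr (s - 2) * C * \<rho> ^ k)"
    proof (intro add_mono sum_mono)
      have "(l2 lborel u)\<^sup>2 \<le> 1\<^sup>2"
        using l2_jet_parts(1)[OF u(1)] u(2) by (intro power_mono l2_nonneg) auto
      then show "(LINT z|lborel. (u z)\<^sup>2) \<le> 1" by (simp add: l2_square)
      fix k
      have "2 powr ((s - 2) * (real k + 1)) * (LINT z|lborel. ?I k z) \<le> 2 powr ((s - 2) * (real k + 1)) * (C * (2 ^ k) powr (- 2 * r / ?D))"
        using C(2)[OF u, of "2 ^ k"] by (intro mult_left_mono) auto
      also have "(2 ^ k :: real) powr (- 2 * r / ?D) = 2 powr (real k * (- 2 * r / ?D))"
      proof -
        have "(2 ^ k :: real) = 2 powr real k" by (simp add: powr_realpow)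
        then show ?thesis by (simp only: powr_powr)
      qed
      also have "2 powr ((s - 2) * (real k + 1)) * (C * 2 powr (real k * (- 2 * r / ?D))) = 2 powr (s - 2) * C * \<rho> ^ k"
      proof -
        have "\<rho> ^ k = 2 powr (real k * (s - 2 - 2 * r / ?D))"
          using powr_realpow[OF \<rho>(1), of k] by (simp add: \<rho>_def powr_powr mult.commute)
        moreover have "(s - 2) * (real k + 1) + real k * (- 2 * r / ?D) = (s - 2) + real k * (s - 2 - 2 * r / ?D)"
          by (simp add: algebra_simps)
        then have "2 powr ((s - 2) * (real k + 1)) * 2 powr (real k * (- 2 * r / ?D)) = 2 powr (s - 2) * 2 powr (real k * (s - 2 - 2 * r / ?D))"
          by (simp only: powr_add[symmetric])
        ultimately show ?thesis by (simp add: mult_ac)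
      qed
      finally show "2 powr ((s - 2) * (real k + 1)) * (LINT z|lborel. ?I k z) \<le> 2 powr (s - 2) * C * \<rho> ^ k" .
    qed
    also have "(\<Sum>k<K. 2 powr (s - 2) * C * \<rho> ^ k) \<le> 2 powr (s - 2) * C * (1 / (1 - \<rho>))"
    proof -
      have "(\<Sum>k<K. \<rho> ^ k) \<le> (\<Sum>k. \<rho> ^ k)" using \<rho> by (intro sum_le_suminf summable_geometric) auto
      also have "\<dots> = 1 / (1 - \<rho>)" using \<rho> by (intro suminf_geometric) auto
      finally show ?thesis using C(1) unfolding sum_distrib_left[symmetric]
        by (intro mult_left_mono) auto
    qed
    finally show ?thesis by (simp add: C'_def)
  qed
  moreover have "C' > 0" using C(1) \<rho> by (simp add: C'_def add_pos_nonneg)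
  ultimately show ?thesis unfolding embeds_def by blast
qed

lemma embeds_2: "embeds TYPE('n::finite) 2"
  unfolding embeds_def
proof (intro exI[of _ 1] conjI ballI impI)
  fix u :: "real \<times> (real ^ 'n) \<Rightarrow> real" assume u: "u \<in> Y_space" "Y_norm u \<le> 1"
  have "(l2 lborel u)\<^sup>2 \<le> 1\<^sup>2"
    using l2_jet_parts(1)[OF u(1)] u(2) by (intro power_mono l2_nonneg) auto
  moreover have "\<bar>x\<bar> powr 2 = x\<^sup>2" for x :: real by (cases "x = 0") auto
  ultimately show "(LINT z|lborel. \<bar>u z\<bar> powr 2) \<le> 1" by (simp add: l2_square)
qed simp

lemma abs_powr_le_sum:
  fixes x :: real assumes "2 \<le> q" "q \<le> r" shows "\<bar>x\<bar> powr q \<le> x\<^sup>2 + \<bar>x\<bar> powr r"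
proof (cases "\<bar>x\<bar> \<le> 1")
  case True
  show ?thesis
  proof (cases "x = 0")
    case False
    then have "\<bar>x\<bar> powr q \<le> \<bar>x\<bar> powr 2" using True assms(1) by (intro powr_mono') auto
    also have "\<bar>x\<bar> powr 2 = x\<^sup>2" using False by simp
    finally show ?thesis by (simp add: add_increasing2)
  qed simp
next
  case False
  then have "\<bar>x\<bar> powr q \<le> \<bar>x\<bar> powr r" using assms by (intro powr_mono) auto
  then show ?thesis by (simp add: add_increasing)
qed

lemma embeds_mono:
  assumes "embeds TYPE('n::finite) r" "2 \<le> q" "q \<le> r" shows "embeds TYPE('n) q"
proof -
  obtain C where C: "C > 0" "\<And>u :: real \<times> (real ^ 'n) \<Rightarrow> real. u \<in> Y_space \<Longrightarrow> Y_norm u \<le> 1 \<Longrightarrow> (LINT z|lborel. \<bar>u z\<bar> powr r) \<le> C"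
    using assms(1) unfolding embeds_def by blast
  have "(LINT z|lborel. \<bar>u z\<bar> powr q) \<le> 1 + C" if u: "u \<in> Y_space" "Y_norm u \<le> 1" for u :: "real \<times> (real ^ 'n) \<Rightarrow> real"
  proof -
    have c: "Cc u" by (rule Y_Cc[OF u(1)])
    have i2: "integrable lborel (\<lambda>z. (u z)\<^sup>2)" using sq_int_integrable[OF Cc_sq_int[OF c]] by simp
    have i: "integrable lborel (\<lambda>z. \<bar>u z\<bar> powr s)" if "s \<ge> 2" for s using that by (intro Cc_integrable Cc_abs_powr c) auto
    have "(LINT z|lborel. \<bar>u z\<bar> powr q) \<le> (LINT z|lborel. (u z)\<^sup>2 + \<bar>u z\<bar> powr r)"
      using assms by (intro integral_mono i Bochner_Integration.integrable_add i2 abs_powr_le_sum) auto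
    also have "\<dots> = (l2 lborel u)\<^sup>2 + (LINT z|lborel. \<bar>u z\<bar> powr r)"
      using i2 i assms by (simp add: l2_square)
    also have "\<dots> \<le> 1\<^sup>2 + C"
      using l2_jet_parts(1)[OF u(1)] u(2) C(2)[OF u] by (intro add_mono power_mono l2_nonneg) auto
    finally show ?thesis by simp
  qed
  then show ?thesis unfolding embeds_def using C(1) by (intro exI[of _ "1 + C"]) auto
qed

text \<open>The map \<open>r \<mapsto> 2 + 2 r / D\<close> has the fixed point
  \<open>2 D / (D - 2)\<close>, so iterating \<open>embeds_step\<close> from the trivial exponent 2
  passes every exponent below it.\<close>

lemma embeds_subcritical:
  assumes q: "2 \<le> q" "q < 2 * real (hdim TYPE('n::finite)) / (real (hdim TYPE('n)) - 2)"
  shows "embeds TYPE('n) q"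
proof -
  let ?D = "real (hdim TYPE('n))"
  have D: "?D \<ge> 3" using hdim_ge_3[where 'n='n] by linarith
  \<comment> \<open>A factor slightly below \<open>2 / D\<close> respects the strict inequality in
    \<open>embeds_step\<close>. Being above \<open>1 - 2 / q\<close>, it still places the fixed
    point \<open>rs\<close> of \<open>r \<mapsto> 2 + \<kappa> r\<close> beyond
    \<open>q\<close>.\<close>
  define \<kappa> where "\<kappa> = ((1 - 2 / q) + 2 / ?D) / 2"
  have "1 - 2 / q < 2 / ?D" using q D by (simp add: field_simps)
  moreover have "1 - 2 / q \<ge> 0" using q by simp
  moreover have "2 / ?D \<le> 2 / 3" using D by (intro divide_left_mono) auto
  ultimately have \<kappa>: "1 - 2 / q < \<kappa>" "\<kappa> < 2 / ?D" "0 < \<kappa>" "\<kappa> < 1" by (auto simp: \<kappa>_def)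
  define rs where "rs = 2 / (1 - \<kappa>)"
  have rs: "rs = 2 + \<kappa> * rs" using \<kappa> by (simp add: rs_def field_simps)
  have rsq: "rs > q" using \<kappa> q by (simp add: rs_def field_simps)
  \<comment> \<open>The \<open>k\<close>-th iterate of \<open>r \<mapsto> 2 + \<kappa> r\<close>,
    started at 2, in closed form.\<close>
  have E: "embeds TYPE('n) (rs - \<kappa> ^ k * (rs - 2)) \<and> rs - \<kappa> ^ k * (rs - 2) \<ge> 2" for k
  proof (induction k)
    case 0
    then show ?case using embeds_2 by simp
  next
    case (Suc k)
    let ?r = "rs - \<kappa> ^ k * (rs - 2)"
    have eq: "rs - \<kappa> ^ Suc k * (rs - 2) = 2 + \<kappa> * ?r" by (subst rs) (simp add: algebra_simps)
    have r: "?r \<ge> 2" using Suc by blast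
    have lt: "\<kappa> * ?r < 2 / ?D * ?r" using \<kappa>(2) r by (intro mult_strict_right_mono) linarith+
    have "0 \<le> \<kappa> * ?r" by (intro mult_nonneg_nonneg) (use \<kappa>(3) r in linarith)+
    then have ge: "2 + \<kappa> * ?r \<ge> 2" by linarith
    have E: "embeds TYPE('n) ?r" using Suc by blast
    have "2 + \<kappa> * ?r < 2 + 2 * ?r / ?D" using lt by (simp only: add_less_cancel_left times_divide_eq_left)
    from embeds_step[OF E r ge this] ge show ?case unfolding eq by blast
  qed
  have "(\<lambda>k. rs - \<kappa> ^ k * (rs - 2)) \<longlonglongrightarrow> rs - 0 * (rs - 2)"
    using \<kappa> by (intro tendsto_intros LIMSEQ_power_zero) auto
  then have "eventually (\<lambda>k. rs - \<kappa> ^ k * (rs - 2) > q) sequentially"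
    using rsq by (intro order_tendstoD) auto
  then obtain k where "rs - \<kappa> ^ k * (rs - 2) > q" by (auto simp: eventually_sequentially)
  then have k: "q \<le> rs - \<kappa> ^ k * (rs - 2)" by simp
  from embeds_mono[OF _ q(1) k] E[of k] show ?thesis by blast
qed

lemma Y_norm_cmult: "u \<in> Y_space \<Longrightarrow> Y_norm (\<lambda>z. c * u z) = \<bar>c\<bar> * Y_norm u"
proof -
  assume u: "u \<in> Y_space"
  have "jet (\<lambda>z. c * u z) = (\<lambda>z. c *\<^sub>R jet u z)" using Y_linear(6)[OF u u, of c] by auto
  then show ?thesis by (simp add: Y_norm_jet l2_scale)
qed

text \<open>The parameter \<open>s\<close> is any positive upper bound of the norm rather than the
  norm itself, so that one can divide by it even when the norm is 0.\<close>

lemma embedding: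
  assumes q: "2 \<le> q" "q < 2 * real (hdim TYPE('n::finite)) / (real (hdim TYPE('n)) - 2)"
  obtains C where "C > 0" "\<And>(u :: real \<times> (real ^ 'n) \<Rightarrow> real) s. u \<in> Y_space \<Longrightarrow> s > 0 \<Longrightarrow> Y_norm u \<le> s \<Longrightarrow>
    (LINT z|lborel. \<bar>u z\<bar> powr q) \<le> C * s powr q"
proof -
  obtain C where C: "C > 0" "\<And>u :: real \<times> (real ^ 'n) \<Rightarrow> real. u \<in> Y_space \<Longrightarrow> Y_norm u \<le> 1 \<Longrightarrow> (LINT z|lborel. \<bar>u z\<bar> powr q) \<le> C"
    using embeds_subcritical[OF q] unfolding embeds_def by blast
  show thesis
  proof (rule that[OF C(1)])
    fix u :: "real \<times> (real ^ 'n) \<Rightarrow> real" and s :: real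
    assume u: "u \<in> Y_space" "s > 0" "Y_norm u \<le> s"
    have "(LINT z|lborel. \<bar>(1 / s) * u z\<bar> powr q) \<le> C"
      using u Y_norm_cmult[OF u(1), of "1 / s"] by (intro C(2) Y_linear(5)[OF u(1) u(1)]) auto
    moreover have "\<bar>(1 / s) * u z\<bar> powr q = (1 / s) powr q * \<bar>u z\<bar> powr q" for z
    proof -
      have "\<bar>(1 / s) * u z\<bar> = (1 / s) * \<bar>u z\<bar>" using u(2) by (simp add: abs_mult)
      then show ?thesis using u(2) by (simp only: powr_mult)
    qed
    ultimately have "(1 / s) powr q * (LINT z|lborel. \<bar>u z\<bar> powr q) \<le> C" by simp
    then show "(LINT z|lborel. \<bar>u z\<bar> powr q) \<le> C * s powr q"
      using u(2) by (simp add: powr_divide field_simps)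
  qed
qed

section \<open>The nonlinearity\<close>

lemma powr_abs_add_le:
  fixes x y :: real assumes "q > 0"
  shows "\<bar>x + y\<bar> powr q \<le> 2 powr q * (\<bar>x\<bar> powr q + \<bar>y\<bar> powr q)"
proof -
  have "\<bar>x + y\<bar> \<le> 2 * max \<bar>x\<bar> \<bar>y\<bar>" by linarith
  then have "\<bar>x + y\<bar> powr q \<le> (2 * max \<bar>x\<bar> \<bar>y\<bar>) powr q" using assms by (intro powr_mono2) auto
  also have "\<dots> = 2 powr q * max \<bar>x\<bar> \<bar>y\<bar> powr q" by (rule powr_mult)
  also have "max \<bar>x\<bar> \<bar>y\<bar> powr q \<le> \<bar>x\<bar> powr q + \<bar>y\<bar> powr q" by (auto simp: max_def)
  finally show ?thesis by simp
qed

lemma abs_powr_mult_split: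
  fixes a b :: real assumes "p > 0"
  shows "\<bar>a\<bar> powr p * \<bar>b\<bar> \<le> \<bar>a\<bar> powr (p + 1) + \<bar>b\<bar> powr (p + 1)"
proof -
  have "\<bar>a\<bar> powr p * \<bar>b\<bar> \<le> (max \<bar>a\<bar> \<bar>b\<bar>) powr p * max \<bar>a\<bar> \<bar>b\<bar>"
    using assms by (intro mult_mono powr_mono2) auto
  also have "\<dots> = (max \<bar>a\<bar> \<bar>b\<bar>) powr (p + 1)" by (simp add: powr_add)
  also have "\<dots> \<le> \<bar>a\<bar> powr (p + 1) + \<bar>b\<bar> powr (p + 1)" by (auto simp: max_def)
  finally show ?thesis .
qed

lemma abs_mult_powr: "\<bar>b\<bar> * \<bar>b\<bar> powr p = \<bar>b\<bar> powr (p + 1)" for b p :: real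
  by (cases "b = 0") (auto simp: powr_add)

lemma abs_mult_le_squares: "\<bar>a\<bar> * \<bar>b\<bar> \<le> a\<^sup>2 + b\<^sup>2" for a b :: real
proof -
  have "0 \<le> \<bar>a\<bar> * \<bar>b\<bar>" by simp
  then show ?thesis using sum_squares_bound[of "\<bar>a\<bar>" "\<bar>b\<bar>"] unfolding power2_abs by linarith
qed

lemma primitive_deriv:
  assumes "continuous_on UNIV f" shows "(primitive f has_real_derivative f t) (at t)"
proof -
  let ?R = "\<bar>t\<bar> + 1"
  have c: "continuous_on {-?R..?R} f" using assms by (rule continuous_on_subset) auto
  have "((\<lambda>u. LBINT y=ereal 0..ereal u. f y) has_vector_derivative f t) (at t within {-?R..?R})"
    by (rule interval_integral_FTC2[OF _ _ c]) auto
  moreover have "at t within {-?R..?R} = at t" by (rule at_within_Icc_at) auto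
  ultimately show ?thesis
    by (simp add: primitive_def[abs_def] has_real_derivative_iff_has_vector_derivative zero_ereal_def)
qed

locale nonlinearity =
  fixes h :: "real \<Rightarrow> real" and p :: real
  assumes cont: "continuous_on UNIV h" and h0: "h 0 = 0" and p: "p > 1"
    and growth: "((\<lambda>t. h t / \<bar>t\<bar> powr p) \<longlongrightarrow> 0) at_infinity"
    and deriv0: "(h has_real_derivative 0) (at 0)"
begin

lemma small: assumes "e > 0" obtains \<delta> where "\<delta> > 0" "\<And>t. \<bar>t\<bar> \<le> \<delta> \<Longrightarrow> \<bar>h t\<bar> \<le> e * \<bar>t\<bar>"
proof -
  have "((\<lambda>t. (h (0 + t) - h 0) / t) \<longlongrightarrow> 0) (at 0)" using deriv0 unfolding DERIV_def .
  then have "eventually (\<lambda>t. dist ((h (0 + t) - h 0) / t) 0 < e) (at 0)" using assms by (rule tendstoD)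
  then obtain d where d: "d > 0" "\<And>t. t \<noteq> 0 \<Longrightarrow> dist t 0 < d \<Longrightarrow> dist ((h (0 + t) - h 0) / t) 0 < e"
    unfolding eventually_at by blast
  show thesis
  proof (rule that[of "d / 2"])
    fix t assume t: "\<bar>t\<bar> \<le> d / 2"
    show "\<bar>h t\<bar> \<le> e * \<bar>t\<bar>"
    proof (cases "t = 0")
      case False
      have "\<bar>h t / t\<bar> < e" using d(2)[OF False] t d(1) by (simp add: h0)
      then show ?thesis using False by (simp add: abs_divide field_simps)
    qed (simp add: h0)
  qed (use d in auto)
qed

lemma large: assumes "e > 0" obtains R where "R > 0" "\<And>t. \<bar>t\<bar> \<ge> R \<Longrightarrow> \<bar>h t\<bar> \<le> e * \<bar>t\<bar> powr p"
proof -
  have "eventually (\<lambda>t. dist (h t / \<bar>t\<bar> powr p) 0 < e) at_infinity" using growth assms by (rule tendstoD)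
  then obtain b where b: "\<And>t. norm t \<ge> b \<Longrightarrow> dist (h t / \<bar>t\<bar> powr p) 0 < e"
    unfolding eventually_at_infinity by blast
  show thesis
  proof (rule that[of "max b 1"])
    fix t assume t: "\<bar>t\<bar> \<ge> max b 1"
    then have "\<bar>t\<bar> powr p > 0" by auto
    moreover have "\<bar>h t / \<bar>t\<bar> powr p\<bar> < e" using b[of t] t by simp
    ultimately show "\<bar>h t\<bar> \<le> e * \<bar>t\<bar> powr p" by (simp add: abs_divide field_simps)
  qed simp
qed

lemma bounded_on: obtains M where "M > 0" "\<And>t. \<bar>t\<bar> \<le> R \<Longrightarrow> \<bar>h t\<bar> \<le> M"
proof -
  have "compact (h ` {-R..R})" using cont by (intro compact_continuous_image) (auto intro: continuous_on_subset)
  then obtain M where M: "\<forall>x \<in> h ` {-R..R}. norm x \<le> M"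
    using compact_imp_bounded bounded_iff by blast
  have "\<bar>h t\<bar> \<le> max M 1" if "\<bar>t\<bar> \<le> R" for t
  proof -
    have "t \<in> {-R..R}" using that by (simp add: abs_le_iff)
    then have "norm (h t) \<le> M" using M by blast
    then show ?thesis by simp
  qed
  then show thesis by (intro that[of "max M 1"]) auto
qed

text \<open>The small constant may sit on the linear term because \<open>h\<close> has derivative 0
  at 0, or on the power, as in \<open>h_bound_1\<close>, because \<open>h\<close> is of smaller
  order than \<open>\<bar>t\<bar> powr p\<close> at infinity. The range between is compact and is
  absorbed by the large constant.\<close>

lemma h_bound_p: 
  assumes "e > 0" obtains C where "C > 0" "\<And>t. \<bar>h t\<bar> \<le> e * \<bar>t\<bar> + C * \<bar>t\<bar> powr p"
proof -
  obtain \<delta> where \<delta>: "\<delta> > 0" "\<And>t. \<bar>t\<bar> \<le> \<delta> \<Longrightarrow> \<bar>h t\<bar> \<le> e * \<bar>t\<bar>" by (rule small[OF assms]) blast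
  obtain R where R: "R > 0" "\<And>t. \<bar>t\<bar> \<ge> R \<Longrightarrow> \<bar>h t\<bar> \<le> 1 * \<bar>t\<bar> powr p" by (rule large[of 1]) auto
  obtain M where M: "M > 0" "\<And>t. \<bar>t\<bar> \<le> R \<Longrightarrow> \<bar>h t\<bar> \<le> M" by (rule bounded_on[of R]) blast
  let ?C = "1 + M / \<delta> powr p"
  have C: "?C > 0" using M(1) by (simp add: add_pos_nonneg)
  have "\<bar>h t\<bar> \<le> e * \<bar>t\<bar> + ?C * \<bar>t\<bar> powr p" for t
  proof -
    consider "\<bar>t\<bar> \<le> \<delta>" | "\<bar>t\<bar> \<ge> R" | "\<delta> \<le> \<bar>t\<bar>" "\<bar>t\<bar> \<le> R" by linarith
    then show ?thesis
    proof cases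
      case 1
      have "0 \<le> ?C * \<bar>t\<bar> powr p" using C by (intro mult_nonneg_nonneg) auto
      then show ?thesis using \<delta>(2)[OF 1] by linarith
    next
      case 2
      have "0 \<le> M / \<delta> powr p * \<bar>t\<bar> powr p" using M(1) by auto
      moreover have "0 \<le> e * \<bar>t\<bar>" using assms by auto
      ultimately show ?thesis using R(2)[OF 2] by (simp add: distrib_right)
    next
      case 3
      have "M = M / \<delta> powr p * \<delta> powr p" using \<delta>(1) by simp
      also have "\<dots> \<le> M / \<delta> powr p * \<bar>t\<bar> powr p"
        using M(1) \<delta>(1) 3 p by (intro mult_left_mono powr_mono2) auto
      finally have "\<bar>h t\<bar> \<le> M / \<delta> powr p * \<bar>t\<bar> powr p" using M(2)[OF 3(2)] by linarith
      moreover have "0 \<le> e * \<bar>t\<bar>" "0 \<le> \<bar>t\<bar> powr p" using assms by auto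
      ultimately show ?thesis unfolding distrib_right by linarith
    qed
  qed
  with C show thesis by (rule that)
qed

lemma h_bound_1:
  assumes "e > 0" obtains C where "C > 0" "\<And>t. \<bar>h t\<bar> \<le> e * \<bar>t\<bar> powr p + C * \<bar>t\<bar>"
proof -
  obtain \<delta> where \<delta>: "\<delta> > 0" "\<And>t. \<bar>t\<bar> \<le> \<delta> \<Longrightarrow> \<bar>h t\<bar> \<le> 1 * \<bar>t\<bar>" by (rule small[of 1]) auto
  obtain R where R: "R > 0" "\<And>t. \<bar>t\<bar> \<ge> R \<Longrightarrow> \<bar>h t\<bar> \<le> e * \<bar>t\<bar> powr p" by (rule large[OF assms]) blast
  obtain M where M: "M > 0" "\<And>t. \<bar>t\<bar> \<le> R \<Longrightarrow> \<bar>h t\<bar> \<le> M" by (rule bounded_on[of R]) blast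
  let ?C = "1 + M / \<delta>"
  have C: "?C > 0" using M(1) \<delta>(1) by (simp add: add_pos_nonneg)
  have "\<bar>h t\<bar> \<le> e * \<bar>t\<bar> powr p + ?C * \<bar>t\<bar>" for t
  proof -
    have nn: "0 \<le> e * \<bar>t\<bar> powr p" "0 \<le> M / \<delta> * \<bar>t\<bar>" using assms M(1) \<delta>(1) by auto
    consider "\<bar>t\<bar> \<le> \<delta>" | "\<bar>t\<bar> \<ge> R" | "\<delta> \<le> \<bar>t\<bar>" "\<bar>t\<bar> \<le> R" by linarith
    then show ?thesis
    proof cases
      case 1
      then show ?thesis using \<delta>(2)[OF 1] nn unfolding distrib_right by linarith
    next
      case 2
      then show ?thesis using R(2)[OF 2] nn unfolding distrib_right by linarith
    next
      case 3
      have "M = M / \<delta> * \<delta>" using \<delta>(1) by simp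
      also have "\<dots> \<le> M / \<delta> * \<bar>t\<bar>" using M(1) \<delta>(1) 3 by (intro mult_left_mono) auto
      finally show ?thesis using M(2)[OF 3(2)] nn unfolding distrib_right by linarith
    qed
  qed
  with C show thesis by (rule that)
qed

text \<open>The growth condition bounds \<open>h\<close> and not its derivative, so a Lipschitz
  estimate is not at hand. If \<open>b\<close> is not small against \<open>a\<close>, both values of
  \<open>h\<close> are bounded in terms of \<open>b\<close> alone. Otherwise the values are
  individually small for \<open>a\<close> near 0 and near infinity, and uniform continuity serves
  for the compact range between.\<close>

lemma h_increment:
  assumes "e > 0"
  obtains C where "C > 0"
    "\<And>a b. \<bar>h (a + b) - h a\<bar> \<le> e * (\<bar>a\<bar> + \<bar>a\<bar> powr p) + C * (\<bar>b\<bar> + \<bar>b\<bar> powr p)"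
proof -
  \<comment> \<open>The two values of \<open>h\<close> together cost the factor \<open>2 + 1\<close>
    near 0 and \<open>2 powr p + 1\<close> near infinity, because
    \<open>\<bar>a + b\<bar> \<le> 2 * \<bar>a\<bar>\<close> there.\<close>
  define e1 where "e1 = e / (3 + 2 powr p)"
  have pp: "2 powr p > 0" by simp
  have e1: "e1 > 0" "e1 * 3 \<le> e" "e1 * (2 powr p + 1) \<le> e"
    using assms pp by (auto simp: e1_def field_simps add_pos_pos)
  obtain C0 where C0: "C0 > 0" "\<And>t. \<bar>h t\<bar> \<le> 1 * \<bar>t\<bar> + C0 * \<bar>t\<bar> powr p" by (rule h_bound_p[of 1]) auto
  obtain \<delta> where \<delta>: "\<delta> > 0" "\<And>t. \<bar>t\<bar> \<le> \<delta> \<Longrightarrow> \<bar>h t\<bar> \<le> e1 * \<bar>t\<bar>" by (rule small[OF e1(1)]) blast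
  obtain R where R: "R > 0" "\<And>t. \<bar>t\<bar> \<ge> R \<Longrightarrow> \<bar>h t\<bar> \<le> e1 * \<bar>t\<bar> powr p" by (rule large[OF e1(1)]) blast
  have "uniformly_continuous_on {-4*R..4*R} h"
    using cont by (intro compact_uniformly_continuous) (auto intro: continuous_on_subset)
  moreover have "e * (\<delta> / 2) > 0" using assms \<delta>(1) by simp
  ultimately obtain \<eta>0 where \<eta>0: "\<eta>0 > 0"
    "\<And>x y. x \<in> {-4*R..4*R} \<Longrightarrow> y \<in> {-4*R..4*R} \<Longrightarrow> dist y x < \<eta>0 \<Longrightarrow> dist (h y) (h x) < e * (\<delta> / 2)"
    unfolding uniformly_continuous_on_def by metis
  \<comment> \<open>For \<open>\<bar>a\<bar> \<le> 2 * R\<close> an increment below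
    \<open>\<eta> * \<bar>a\<bar>\<close> stays below the modulus \<open>\<eta>0\<close>; the bound
    1/2 keeps \<open>a + b\<close> comparable to \<open>a\<close>.\<close>
  define \<eta> where "\<eta> = min (1/2) (\<eta>0 / (2 * R))"
  have \<eta>: "\<eta> > 0" "\<eta> \<le> 1/2" "\<eta> * (2 * R) \<le> \<eta>0"
    using \<eta>0(1) R(1) by (auto simp: \<eta>_def min_def field_simps)
  define L where "L = 1 + 1 / \<eta>"
  have L: "L \<ge> 1" using \<eta>(1) by (simp add: L_def)
  define C where "C = 2 * (1 + C0) * (L + L powr p)"
  have C: "C > 0" using C0(1) L by (simp add: C_def add_pos_nonneg)
  have "\<bar>h (a + b) - h a\<bar> \<le> e * (\<bar>a\<bar> + \<bar>a\<bar> powr p) + C * (\<bar>b\<bar> + \<bar>b\<bar> powr p)" for a b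
  proof -
    have nn: "0 \<le> e * \<bar>a\<bar>" "0 \<le> e * \<bar>a\<bar> powr p" "0 \<le> C * \<bar>b\<bar>" "0 \<le> C * \<bar>b\<bar> powr p"
      using assms C by auto
    have tri: "\<bar>h (a + b) - h a\<bar> \<le> \<bar>h (a + b)\<bar> + \<bar>h a\<bar>" by linarith
    show ?thesis
    proof (cases "\<bar>b\<bar> \<ge> \<eta> * \<bar>a\<bar>")
      case True
      then have ab: "\<bar>a\<bar> \<le> (1 / \<eta>) * \<bar>b\<bar>" using \<eta>(1) by (simp add: field_simps)
      have key: "\<bar>h t\<bar> \<le> (1 + C0) * (L + L powr p) * (\<bar>b\<bar> + \<bar>b\<bar> powr p)" if t: "\<bar>t\<bar> \<le> L * \<bar>b\<bar>" for t
      proof -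
        have "\<bar>t\<bar> powr p \<le> (L * \<bar>b\<bar>) powr p" using t p by (intro powr_mono2) auto
        also have "\<dots> = L powr p * \<bar>b\<bar> powr p" by (rule powr_mult)
        finally have tp: "\<bar>t\<bar> powr p \<le> L powr p * \<bar>b\<bar> powr p" .
        have "\<bar>h t\<bar> \<le> \<bar>t\<bar> + C0 * \<bar>t\<bar> powr p" using C0(2)[of t] by simp
        also have "\<dots> \<le> L * \<bar>b\<bar> + C0 * (L powr p * \<bar>b\<bar> powr p)"
          using t tp C0(1) by (intro add_mono mult_left_mono) auto
        also have "\<dots> \<le> (1 + C0) * (L + L powr p) * (\<bar>b\<bar> + \<bar>b\<bar> powr p)"
        proof -
          have "0 \<le> L * \<bar>b\<bar> powr p" "0 \<le> L powr p * \<bar>b\<bar>" "0 \<le> L powr p * \<bar>b\<bar> powr p" 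
            "0 \<le> C0 * (L * \<bar>b\<bar>)" "0 \<le> C0 * (L * \<bar>b\<bar> powr p)" "0 \<le> C0 * (L powr p * \<bar>b\<bar>)"
            using L C0(1) by auto
          then show ?thesis by (simp add: algebra_simps)
        qed
        finally show ?thesis .
      qed
      have "\<bar>a\<bar> \<le> L * \<bar>b\<bar>" "\<bar>a + b\<bar> \<le> L * \<bar>b\<bar>" using ab by (auto simp: L_def distrib_right)
      from key[OF this(1)] key[OF this(2)] tri
      have "\<bar>h (a + b) - h a\<bar> \<le> 2 * ((1 + C0) * (L + L powr p) * (\<bar>b\<bar> + \<bar>b\<bar> powr p))" by linarith
      then have "\<bar>h (a + b) - h a\<bar> \<le> C * (\<bar>b\<bar> + \<bar>b\<bar> powr p)" by (simp only: C_def mult.assoc)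
      then show ?thesis using nn unfolding distrib_left by linarith
    next
      case False
      then have b: "\<bar>b\<bar> < \<eta> * \<bar>a\<bar>" by simp
      have "\<eta> * \<bar>a\<bar> \<le> (1/2) * \<bar>a\<bar>" using \<eta>(2) by (intro mult_right_mono) auto
      with b have b2: "\<bar>b\<bar> \<le> \<bar>a\<bar> / 2" by simp
      have mid: "\<bar>a\<bar> / 2 \<le> \<bar>a + b\<bar>" "\<bar>a + b\<bar> \<le> 2 * \<bar>a\<bar>" using b2 by linarith+
      have a0: "a \<noteq> 0" using b by auto
      \<comment> \<open>The thresholds leave a factor 2, so that \<open>a + b\<close>, whose modulus
        lies between \<open>\<bar>a\<bar> / 2\<close> and \<open>2 * \<bar>a\<bar>\<close>, is in
        the same regime as \<open>a\<close>.\<close>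
      consider "2 * \<bar>a\<bar> \<le> \<delta>" | "\<bar>a\<bar> \<ge> 2 * R" | "\<delta> / 2 \<le> \<bar>a\<bar>" "\<bar>a\<bar> \<le> 2 * R" by linarith
      then show ?thesis
      proof cases
        case 1
        have "\<bar>h (a + b)\<bar> \<le> e1 * \<bar>a + b\<bar>" "\<bar>h a\<bar> \<le> e1 * \<bar>a\<bar>" using \<delta>(2)[of "a + b"] \<delta>(2)[of a] 1 mid by auto
        moreover have "e1 * \<bar>a + b\<bar> \<le> e1 * (2 * \<bar>a\<bar>)" using mid e1(1) by (intro mult_left_mono) auto
        moreover have "(e1 * 3) * \<bar>a\<bar> \<le> e * \<bar>a\<bar>" using e1(2) by (intro mult_right_mono) auto
        ultimately show ?thesis using tri nn unfolding distrib_left by linarith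
      next
        case 2
        have "\<bar>h (a + b)\<bar> \<le> e1 * \<bar>a + b\<bar> powr p" "\<bar>h a\<bar> \<le> e1 * \<bar>a\<bar> powr p"
          using R(2)[of "a + b"] R(2)[of a] 2 mid R(1) by auto
        moreover have "\<bar>a + b\<bar> powr p \<le> (2 * \<bar>a\<bar>) powr p" using mid p by (intro powr_mono2) auto
        moreover have "(2 * \<bar>a\<bar>) powr p = 2 powr p * \<bar>a\<bar> powr p" by (rule powr_mult)
        ultimately have "\<bar>h (a + b)\<bar> \<le> e1 * (2 powr p * \<bar>a\<bar> powr p)" 
          using e1(1) by (metis mult_left_mono order.trans less_imp_le)
        moreover have "(e1 * (2 powr p + 1)) * \<bar>a\<bar> powr p \<le> e * \<bar>a\<bar> powr p"
          using e1(3) by (intro mult_right_mono) auto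
        ultimately have "\<bar>h (a + b)\<bar> + \<bar>h a\<bar> \<le> e * \<bar>a\<bar> powr p"
          using \<open>\<bar>h a\<bar> \<le> e1 * \<bar>a\<bar> powr p\<close> by (simp add: algebra_simps)
        then show ?thesis using tri nn unfolding distrib_left by linarith
      next
        case 3
        have "\<eta> * \<bar>a\<bar> \<le> \<eta> * (2 * R)" using 3 \<eta>(1) by (intro mult_left_mono) auto
        then have "dist (a + b) a < \<eta>0" using b \<eta>(3) by (simp add: dist_real_def)
        moreover have "a \<in> {-4*R..4*R}" "a + b \<in> {-4*R..4*R}" using 3 mid R(1) by (auto simp: abs_le_iff)
        ultimately have "\<bar>h (a + b) - h a\<bar> < e * (\<delta> / 2)" using \<eta>0(2) by (simp add: dist_real_def)
        also have "\<dots> \<le> e * \<bar>a\<bar>" using 3 assms by (intro mult_left_mono) auto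
        finally show ?thesis using nn unfolding distrib_left by linarith
      qed
    qed
  qed
  with C show thesis by (rule that)
qed

section \<open>The primitive and the differentiability of its integral\<close>

abbreviation "H \<equiv> primitive h"

lemma H_deriv: "(H has_real_derivative h t) (at t)"
  by (rule primitive_deriv[OF cont])

lemma H_0: "H 0 = 0"
  by (simp add: primitive_def zero_ereal_def[symmetric])

lemma H_continuous: "continuous_on UNIV H"
  using H_deriv by (intro continuous_at_imp_continuous_on) (blast intro: DERIV_isCont)

lemma H_mvt: obtains \<theta> where "0 \<le> \<theta>" "\<theta> \<le> 1" "H (a + b) - H a = h (a + \<theta> * b) * b"
proof -
  have "((\<lambda>s. H (a + s * b)) has_real_derivative h (a + s * b) * b) (at s)" for s
    by (rule DERIV_chain2[OF H_deriv]) (auto intro!: derivative_eq_intros)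
  from MVT2[OF zero_less_one this] obtain \<theta> where "0 < \<theta>" "\<theta> < 1"
    "H (a + 1 * b) - H (a + 0 * b) = (1 - 0) * (h (a + \<theta> * b) * b)" by blast
  then show thesis by (intro that[of \<theta>]) auto
qed

text \<open>By the mean value theorem the remainder is
  \<open>(h (a + \<theta> * b) - h a) * b\<close> and inherits the bound for increments of
  \<open>h\<close>. The first term gets a constant as small as desired, the second is at least
  quadratic in small \<open>b\<close>.\<close>

lemma H_increment:
  assumes "e > 0"
  obtains C where "C > 0" "\<And>a b. \<bar>H (a + b) - H a - h a * b\<bar>
      \<le> e * ((\<bar>a\<bar> + \<bar>a\<bar> powr p) * \<bar>b\<bar>) + C * (b\<^sup>2 + \<bar>b\<bar> powr (p + 1))"
proof -
  obtain C where C: "C > 0"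
    "\<And>a b. \<bar>h (a + b) - h a\<bar> \<le> e * (\<bar>a\<bar> + \<bar>a\<bar> powr p) + C * (\<bar>b\<bar> + \<bar>b\<bar> powr p)"
    by (rule h_increment[OF assms]) blast
  have "\<bar>H (a + b) - H a - h a * b\<bar> \<le> e * ((\<bar>a\<bar> + \<bar>a\<bar> powr p) * \<bar>b\<bar>) + C * (b\<^sup>2 + \<bar>b\<bar> powr (p + 1))" for a b
  proof -
    obtain \<theta> where \<theta>: "0 \<le> \<theta>" "\<theta> \<le> 1" "H (a + b) - H a = h (a + \<theta> * b) * b" by (rule H_mvt)
    have tb: "\<bar>\<theta> * b\<bar> \<le> \<bar>b\<bar>" using \<theta> by (simp add: abs_mult mult_left_le_one_le)
    then have "\<bar>\<theta> * b\<bar> powr p \<le> \<bar>b\<bar> powr p" using p by (intro powr_mono2) auto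
    with tb have "C * (\<bar>\<theta> * b\<bar> + \<bar>\<theta> * b\<bar> powr p) \<le> C * (\<bar>b\<bar> + \<bar>b\<bar> powr p)"
      using C(1) by (intro mult_left_mono add_mono) auto
    then have "\<bar>h (a + \<theta> * b) - h a\<bar> \<le> e * (\<bar>a\<bar> + \<bar>a\<bar> powr p) + C * (\<bar>b\<bar> + \<bar>b\<bar> powr p)"
      using C(2)[of a "\<theta> * b"] by linarith
    then have "\<bar>h (a + \<theta> * b) - h a\<bar> * \<bar>b\<bar> \<le> (e * (\<bar>a\<bar> + \<bar>a\<bar> powr p) + C * (\<bar>b\<bar> + \<bar>b\<bar> powr p)) * \<bar>b\<bar>"
      by (intro mult_right_mono) auto
    also have "\<dots> = e * ((\<bar>a\<bar> + \<bar>a\<bar> powr p) * \<bar>b\<bar>) + C * (\<bar>b\<bar> * \<bar>b\<bar> + \<bar>b\<bar> * \<bar>b\<bar> powr p)"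
      by (simp add: algebra_simps)
    also have "\<dots> = e * ((\<bar>a\<bar> + \<bar>a\<bar> powr p) * \<bar>b\<bar>) + C * (b\<^sup>2 + \<bar>b\<bar> powr (p + 1))"
      unfolding abs_mult_powr by (simp add: power2_eq_square)
    also have "\<bar>h (a + \<theta> * b) - h a\<bar> * \<bar>b\<bar> = \<bar>H (a + b) - H a - h a * b\<bar>"
      unfolding \<theta>(3) abs_mult[symmetric] by (simp add: algebra_simps)
    finally show ?thesis .
  qed
  with C(1) show thesis by (rule that)
qed

lemma H_bound_from_h:
  assumes "\<And>t. \<bar>h t\<bar> \<le> c * \<bar>t\<bar> + C * \<bar>t\<bar> powr p" "c \<ge> 0" "C \<ge> 0"
  shows "\<bar>H t\<bar> \<le> c * t\<^sup>2 + C * \<bar>t\<bar> powr (p + 1)"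
proof -
  obtain \<theta> where \<theta>: "0 \<le> \<theta>" "\<theta> \<le> 1" "H (0 + t) - H 0 = h (0 + \<theta> * t) * t" by (rule H_mvt)
  have tb: "\<bar>\<theta> * t\<bar> \<le> \<bar>t\<bar>" using \<theta> by (simp add: abs_mult mult_left_le_one_le)
  then have "\<bar>\<theta> * t\<bar> powr p \<le> \<bar>t\<bar> powr p" using p by (intro powr_mono2) auto
  with tb assms(2,3) have "c * \<bar>\<theta> * t\<bar> + C * \<bar>\<theta> * t\<bar> powr p \<le> c * \<bar>t\<bar> + C * \<bar>t\<bar> powr p"
    by (intro add_mono mult_left_mono) auto
  with assms(1)[of "\<theta> * t"] have "\<bar>h (\<theta> * t)\<bar> * \<bar>t\<bar> \<le> (c * \<bar>t\<bar> + C * \<bar>t\<bar> powr p) * \<bar>t\<bar>"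
    by (intro mult_right_mono) auto
  also have "\<dots> = c * (\<bar>t\<bar> * \<bar>t\<bar>) + C * (\<bar>t\<bar> * \<bar>t\<bar> powr p)" by (simp add: algebra_simps)
  also have "\<dots> = c * t\<^sup>2 + C * \<bar>t\<bar> powr (p + 1)"
    unfolding abs_mult_powr by (simp add: power2_eq_square)
  finally show ?thesis using \<theta>(3) by (simp add: H_0 abs_mult)
qed

lemma H_bound_p:
  assumes "e > 0" obtains C where "C > 0" "\<And>t. \<bar>H t\<bar> \<le> e * t\<^sup>2 + C * \<bar>t\<bar> powr (p + 1)"
proof -
  obtain C where C: "C > 0" "\<And>t. \<bar>h t\<bar> \<le> e * \<bar>t\<bar> + C * \<bar>t\<bar> powr p" by (rule h_bound_p[OF assms]) blast
  show thesis by (rule that[OF C(1)]) (use C assms in \<open>intro H_bound_from_h; simp\<close>)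
qed

lemma H_bound_1:
  assumes "e > 0" obtains C where "C > 0" "\<And>t. \<bar>H t\<bar> \<le> C * t\<^sup>2 + e * \<bar>t\<bar> powr (p + 1)"
proof -
  obtain C where C: "C > 0" "\<And>t. \<bar>h t\<bar> \<le> e * \<bar>t\<bar> powr p + C * \<bar>t\<bar>" by (rule h_bound_1[OF assms]) blast
  show thesis
  proof (rule that[OF C(1)])
    show "\<bar>H t\<bar> \<le> C * t\<^sup>2 + e * \<bar>t\<bar> powr (p + 1)" for t
      by (rule H_bound_from_h) (use C assms in \<open>auto simp: add.commute\<close>)
  qed
qed

text \<open>Small values of a function contribute nothing positive to the integral of
  \<open>H u - u\<^sup>2 / 2\<close>. This limits the loss caused by a low plateau and later
  excludes vanishing sequences.\<close>

lemma H_small: obtains \<epsilon> where "\<epsilon> > 0" "\<And>t. \<bar>t\<bar> \<le> \<epsilon> \<Longrightarrow> \<bar>H t\<bar> \<le> t\<^sup>2 / 2"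
proof -
  obtain \<delta> where \<delta>: "\<delta> > 0" "\<And>t. \<bar>t\<bar> \<le> \<delta> \<Longrightarrow> \<bar>h t\<bar> \<le> 1/2 * \<bar>t\<bar>" by (rule small[of "1/2"]) auto
  have "\<bar>H t\<bar> \<le> t\<^sup>2 / 2" if t: "\<bar>t\<bar> \<le> \<delta>" for t
  proof -
    obtain \<theta> where \<theta>: "0 \<le> \<theta>" "\<theta> \<le> 1" "H (0 + t) - H 0 = h (0 + \<theta> * t) * t" by (rule H_mvt)
    have tb: "\<bar>\<theta> * t\<bar> \<le> \<bar>t\<bar>" using \<theta> by (simp add: abs_mult mult_left_le_one_le)
    then have "\<bar>h (\<theta> * t)\<bar> \<le> 1/2 * \<bar>t\<bar>" using \<delta>(2)[of "\<theta> * t"] t by linarith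
    then have "\<bar>h (\<theta> * t)\<bar> * \<bar>t\<bar> \<le> (1/2 * \<bar>t\<bar>) * \<bar>t\<bar>" by (intro mult_right_mono) auto
    then show ?thesis using \<theta>(3) by (simp add: H_0 abs_mult power2_eq_square)
  qed
  with \<delta>(1) show thesis by (rule that)
qed

definition Lq :: "'a measure \<Rightarrow> ('a \<Rightarrow> real) \<Rightarrow> bool" where
  "Lq M u \<longleftrightarrow> sq_int M u \<and> integrable M (\<lambda>z. \<bar>u z\<bar> powr (p + 1))"

text \<open>A sum of integrals of powers instead of a norm. It is not homogeneous, but it is what
  the pointwise bounds on \<open>h\<close> and \<open>H\<close> produce; where homogeneity matters,
  functions are rescaled into the unit ball first.\<close>

definition mass :: "'a measure \<Rightarrow> ('a \<Rightarrow> real) \<Rightarrow> real" where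
  "mass M u = (LINT z|M. (u z)\<^sup>2) + (LINT z|M. \<bar>u z\<bar> powr (p + 1))"

lemma LqD: assumes "Lq M u" 
  shows "u \<in> borel_measurable M" "integrable M (\<lambda>z. (u z)\<^sup>2)" "integrable M (\<lambda>z. \<bar>u z\<bar> powr (p + 1))" "sq_int M u"
  using assms by (auto simp: Lq_def sq_int_def)

lemma Lq_add: assumes "Lq M u" "Lq M v" shows "Lq M (\<lambda>z. u z + v z)"
proof -
  note u = LqD[OF assms(1)] and v = LqD[OF assms(2)]
  note [measurable] = u(1) v(1)
  have "integrable M (\<lambda>z. \<bar>u z + v z\<bar> powr (p + 1))"
  proof (rule Bochner_Integration.integrable_bound)
    show "integrable M (\<lambda>z. 2 powr (p + 1) * (\<bar>u z\<bar> powr (p + 1) + \<bar>v z\<bar> powr (p + 1)))"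
      using u(3) v(3) by simp
    show "AE z in M. norm (\<bar>u z + v z\<bar> powr (p + 1)) \<le> norm (2 powr (p + 1) * (\<bar>u z\<bar> powr (p + 1) + \<bar>v z\<bar> powr (p + 1)))"
      using powr_abs_add_le[of "p + 1" "u _" "v _"] p by (intro AE_I2) simp
  qed measurable
  then show ?thesis using sq_int_add[OF u(4) v(4)] by (simp add: Lq_def)
qed

lemma Lq_cmult: assumes "Lq M u" shows "Lq M (\<lambda>z. c * u z)"
  using LqD[OF assms] sq_int_cmult[of M u c] by (simp add: Lq_def abs_mult powr_mult)

lemma mass_cmult: assumes "Lq M u" "0 \<le> s" "s \<le> 1" shows "mass M (\<lambda>z. s * u z) \<le> s\<^sup>2 * mass M u"
proof -
  have "s powr (p + 1) \<le> s\<^sup>2"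
  proof (cases "s = 0")
    case False
    then have "s powr (p + 1) \<le> s powr 2" using assms p by (intro powr_mono') auto
    then show ?thesis using assms False by simp
  qed (use p in simp)
  then have "s powr (p + 1) * (LINT z|M. \<bar>u z\<bar> powr (p + 1)) \<le> s\<^sup>2 * (LINT z|M. \<bar>u z\<bar> powr (p + 1))"
    by (intro mult_right_mono) auto
  then show ?thesis using assms by (simp add: mass_def abs_mult powr_mult power_mult_distrib distrib_left)
qed

lemma Lq_h_mult:
  assumes "Lq M u" "Lq M v"
  shows "integrable M (\<lambda>z. h (u z) * v z)"
    and "integrable M (\<lambda>z. (\<bar>u z\<bar> + \<bar>u z\<bar> powr p) * \<bar>v z\<bar>)"
    and "(LINT z|M. (\<bar>u z\<bar> + \<bar>u z\<bar> powr p) * \<bar>v z\<bar>) \<le> mass M u + mass M v"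
proof -
  note u = LqD[OF assms(1)] and v = LqD[OF assms(2)]
  note [measurable] = u(1) v(1) borel_measurable_continuous_onI[OF cont]
  let ?W = "\<lambda>z. ((u z)\<^sup>2 + \<bar>u z\<bar> powr (p + 1)) + ((v z)\<^sup>2 + \<bar>v z\<bar> powr (p + 1))"
  have W: "integrable M ?W" using u v by simp
  have le: "(\<bar>u z\<bar> + \<bar>u z\<bar> powr p) * \<bar>v z\<bar> \<le> ?W z" for z
    using abs_mult_le_squares[of "u z" "v z"] abs_powr_mult_split[of p "u z" "v z"] p by (simp add: distrib_right)
  show i: "integrable M (\<lambda>z. (\<bar>u z\<bar> + \<bar>u z\<bar> powr p) * \<bar>v z\<bar>)"
    by (rule Bochner_Integration.integrable_bound[OF W])
      (use le in \<open>auto intro!: AE_I2 simp: abs_of_nonneg\<close>)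
  have "(LINT z|M. (\<bar>u z\<bar> + \<bar>u z\<bar> powr p) * \<bar>v z\<bar>) \<le> (LINT z|M. ?W z)"
    by (intro integral_mono i W le)
  also have "\<dots> = mass M u + mass M v" using u v by (simp add: mass_def)
  finally show "(LINT z|M. (\<bar>u z\<bar> + \<bar>u z\<bar> powr p) * \<bar>v z\<bar>) \<le> mass M u + mass M v" .
  obtain C where C: "C > 0" "\<And>t. \<bar>h t\<bar> \<le> 1 * \<bar>t\<bar> + C * \<bar>t\<bar> powr p" by (rule h_bound_p[of 1]) auto
  show "integrable M (\<lambda>z. h (u z) * v z)"
  proof (rule Bochner_Integration.integrable_bound)
    show "integrable M (\<lambda>z. (1 + C) * ((\<bar>u z\<bar> + \<bar>u z\<bar> powr p) * \<bar>v z\<bar>))" using i by simp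
    have "\<bar>h (u z)\<bar> \<le> (1 + C) * (\<bar>u z\<bar> + \<bar>u z\<bar> powr p)" for z
    proof -
      have "0 \<le> C * \<bar>u z\<bar>" "0 \<le> \<bar>u z\<bar> powr p" using C(1) by auto
      then show ?thesis using C(2)[of "u z"] unfolding distrib_right distrib_left by linarith
    qed
    then have "\<bar>h (u z)\<bar> * \<bar>v z\<bar> \<le> ((1 + C) * (\<bar>u z\<bar> + \<bar>u z\<bar> powr p)) * \<bar>v z\<bar>" for z
      by (intro mult_right_mono) auto
    then show "AE z in M. norm (h (u z) * v z) \<le> norm ((1 + C) * ((\<bar>u z\<bar> + \<bar>u z\<bar> powr p) * \<bar>v z\<bar>))"
      using C(1) by (intro AE_I2) (simp add: abs_mult mult_ac)
  qed measurable
qed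

lemma h_pairing_le:
  assumes "Lq M u" "Lq M v" "\<And>t. \<bar>h t\<bar> \<le> \<bar>t\<bar> + C * \<bar>t\<bar> powr p" "C \<ge> 0"
  shows "\<bar>LINT z|M. h (u z) * v z\<bar> \<le> (1 + C) * (mass M u + mass M v)"
proof -
  note L = Lq_h_mult[OF assms(1,2)]
  have "\<bar>LINT z|M. h (u z) * v z\<bar> \<le> (LINT z|M. \<bar>h (u z) * v z\<bar>)" by (rule integral_abs_bound)
  also have "\<dots> \<le> (LINT z|M. (1 + C) * ((\<bar>u z\<bar> + \<bar>u z\<bar> powr p) * \<bar>v z\<bar>))"
  proof (rule integral_mono)
    show "integrable M (\<lambda>z. \<bar>h (u z) * v z\<bar>)" using L(1) by (rule integrable_abs)
    show "integrable M (\<lambda>z. (1 + C) * ((\<bar>u z\<bar> + \<bar>u z\<bar> powr p) * \<bar>v z\<bar>))" using L(2) by (rule integrable_mult_right)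
    fix z
    have "0 \<le> C * \<bar>u z\<bar>" "0 \<le> \<bar>u z\<bar> powr p" using assms(4) by auto
    then have "\<bar>h (u z)\<bar> \<le> (1 + C) * (\<bar>u z\<bar> + \<bar>u z\<bar> powr p)"
      using assms(3)[of "u z"] unfolding distrib_right distrib_left by linarith
    then have "\<bar>h (u z)\<bar> * \<bar>v z\<bar> \<le> ((1 + C) * (\<bar>u z\<bar> + \<bar>u z\<bar> powr p)) * \<bar>v z\<bar>"
      by (intro mult_right_mono) auto
    then show "\<bar>h (u z) * v z\<bar> \<le> (1 + C) * ((\<bar>u z\<bar> + \<bar>u z\<bar> powr p) * \<bar>v z\<bar>)"
      by (simp add: abs_mult mult_ac)
  qed
  also have "\<dots> = (1 + C) * (LINT z|M. (\<bar>u z\<bar> + \<bar>u z\<bar> powr p) * \<bar>v z\<bar>)" by simp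
  also have "\<dots> \<le> (1 + C) * (mass M u + mass M v)"
    using L(3) assms(4) by (intro mult_left_mono) auto
  finally show ?thesis .
qed

lemma Lq_H: assumes "Lq M u" shows "integrable M (\<lambda>z. H (u z))"
proof -
  note u = LqD[OF assms]
  note [measurable] = u(1) borel_measurable_continuous_onI[OF H_continuous]
  obtain C where C: "C > 0" "\<And>t. \<bar>H t\<bar> \<le> 1 * t\<^sup>2 + C * \<bar>t\<bar> powr (p + 1)" by (rule H_bound_p[of 1]) auto
  show ?thesis
  proof (rule Bochner_Integration.integrable_bound)
    show "integrable M (\<lambda>z. 1 * (u z)\<^sup>2 + C * \<bar>u z\<bar> powr (p + 1))" using u by simp
    show "AE z in M. norm (H (u z)) \<le> norm (1 * (u z)\<^sup>2 + C * \<bar>u z\<bar> powr (p + 1))"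
      using C by (intro AE_I2) (simp add: order.trans[OF _ abs_ge_self])
  qed measurable
qed

text \<open>Increments are written as \<open>s v\<close> with \<open>v\<close> in a bounded set, so that a single statement
  serves both for difference quotients in a fixed direction and for Frechet differentiability.\<close>

lemma H_functional_diff:
  assumes "K > 0" "e > 0"
  obtains d where "d > 0" "d \<le> 1"
    "\<And>u v s. Lq M u \<Longrightarrow> Lq M v \<Longrightarrow> mass M u \<le> K \<Longrightarrow> mass M v \<le> K \<Longrightarrow> 0 < s \<Longrightarrow> s < d \<Longrightarrow>
      \<bar>(LINT z|M. H (u z + s * v z)) - (LINT z|M. H (u z)) - s * (LINT z|M. h (u z) * v z)\<bar> \<le> e * s"
proof -
  \<comment> \<open>Half of \<open>e\<close> is given to the term linear in the increment through
    \<open>e1\<close>, and half through \<open>d\<close> to the quadratic one, which carries the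
    factor \<open>s\<^sup>2\<close> by \<open>mass_cmult\<close>.\<close>
  define e1 where "e1 = e / (4 * K)"
  have e1: "e1 > 0" using assms by (simp add: e1_def)
  obtain C where C: "C > 0" "\<And>a b. \<bar>H (a + b) - H a - h a * b\<bar>
      \<le> e1 * ((\<bar>a\<bar> + \<bar>a\<bar> powr p) * \<bar>b\<bar>) + C * (b\<^sup>2 + \<bar>b\<bar> powr (p + 1))"
    by (rule H_increment[OF e1]) blast
  define d where "d = min 1 (e / (2 * C * K))"
  have d: "d > 0" "d \<le> 1" "C * K * d \<le> e / 2" using assms C(1) by (auto simp: d_def min_def field_simps)
  have "\<bar>(LINT z|M. H (u z + s * v z)) - (LINT z|M. H (u z)) - s * (LINT z|M. h (u z) * v z)\<bar> \<le> e * s"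
    if u: "Lq M u" "mass M u \<le> K" and v: "Lq M v" "mass M v \<le> K" and s: "0 < s" "s < d" for u v s
  proof -
    have sv: "Lq M (\<lambda>z. s * v z)" by (rule Lq_cmult[OF v(1)])
    note usv = Lq_add[OF u(1) sv]
    note svD = LqD[OF sv]
    have I: "integrable M (\<lambda>z. H (u z + s * v z))" "integrable M (\<lambda>z. H (u z))" "integrable M (\<lambda>z. h (u z) * (s * v z))"
      by (rule Lq_H[OF usv] Lq_H[OF u(1)] Lq_h_mult(1)[OF u(1) sv])+
    have eq: "(LINT z|M. H (u z + s * v z)) - (LINT z|M. H (u z)) - s * (LINT z|M. h (u z) * v z)
      = (LINT z|M. H (u z + s * v z) - H (u z) - h (u z) * (s * v z))"
    proof -
      have "s * (LINT z|M. h (u z) * v z) = (LINT z|M. h (u z) * (s * v z))"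
        by (simp add: mult_ac flip: integral_mult_right_zero)
      then show ?thesis using I by simp
    qed
    have "\<bar>LINT z|M. H (u z + s * v z) - H (u z) - h (u z) * (s * v z)\<bar>
      \<le> (LINT z|M. \<bar>H (u z + s * v z) - H (u z) - h (u z) * (s * v z)\<bar>)"
      by (rule integral_abs_bound)
    also have "\<dots> \<le> (LINT z|M. e1 * ((\<bar>u z\<bar> + \<bar>u z\<bar> powr p) * \<bar>s * v z\<bar>) + C * ((s * v z)\<^sup>2 + \<bar>s * v z\<bar> powr (p + 1)))"
    proof (rule integral_mono)
      show "integrable M (\<lambda>z. \<bar>H (u z + s * v z) - H (u z) - h (u z) * (s * v z)\<bar>)"
        using I by (intro integrable_abs Bochner_Integration.integrable_diff)
      show "integrable M (\<lambda>z. e1 * ((\<bar>u z\<bar> + \<bar>u z\<bar> powr p) * \<bar>s * v z\<bar>) + C * ((s * v z)\<^sup>2 + \<bar>s * v z\<bar> powr (p + 1)))"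
        by (intro Bochner_Integration.integrable_add integrable_mult_right Lq_h_mult(2) u sv svD)
    qed (rule C(2))
    also have "\<dots> = e1 * (LINT z|M. (\<bar>u z\<bar> + \<bar>u z\<bar> powr p) * \<bar>s * v z\<bar>) + C * mass M (\<lambda>z. s * v z)"
      using Lq_h_mult(2)[OF u(1) sv] svD by (simp add: mass_def)
    also have "(LINT z|M. (\<bar>u z\<bar> + \<bar>u z\<bar> powr p) * \<bar>s * v z\<bar>) = s * (LINT z|M. (\<bar>u z\<bar> + \<bar>u z\<bar> powr p) * \<bar>v z\<bar>)"
      using s(1) by (simp add: abs_mult mult_ac flip: integral_mult_right_zero)
    also have "e1 * (s * (LINT z|M. (\<bar>u z\<bar> + \<bar>u z\<bar> powr p) * \<bar>v z\<bar>)) + C * mass M (\<lambda>z. s * v z)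
      \<le> e1 * (s * (K + K)) + C * (s\<^sup>2 * K)"
    proof (intro add_mono mult_left_mono)
      show "(LINT z|M. (\<bar>u z\<bar> + \<bar>u z\<bar> powr p) * \<bar>v z\<bar>) \<le> K + K"
        using Lq_h_mult(3)[OF u(1) v(1)] u(2) v(2) by linarith
      have "mass M (\<lambda>z. s * v z) \<le> s\<^sup>2 * mass M v" using s d(2) by (intro mass_cmult v(1)) auto
      also have "\<dots> \<le> s\<^sup>2 * K" using v(2) by (intro mult_left_mono) auto
      finally show "mass M (\<lambda>z. s * v z) \<le> s\<^sup>2 * K" .
    qed (use e1 C(1) s(1) in auto)
    also have "\<dots> = (e1 * (2 * K) + (C * K * s)) * s" by (simp add: power2_eq_square algebra_simps)
    also have "\<dots> \<le> (e / 2 + e / 2) * s"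
    proof (intro mult_right_mono add_mono)
      show "e1 * (2 * K) \<le> e / 2" using assms by (simp add: e1_def)
      have "C * K * s \<le> C * K * d" using C(1) assms(1) s(2) by (intro mult_left_mono) auto
      then show "C * K * s \<le> e / 2" using d(3) by linarith
    qed (use s in auto)
    finally show ?thesis unfolding eq by simp
  qed
  with d(1,2) show thesis by (intro that[of d]) auto
qed

end

section \<open>A function of positive potential energy\<close>

text \<open>The functions \<open>x powr (- k) * exp (- 1 / x)\<close>, extended by 0. The derivative
  of each is a linear combination of two others, so one induction over the order of differentiation
  proves smoothness for all \<open>k\<close> at once.\<close>

definition flat :: "nat \<Rightarrow> real \<Rightarrow> real" where
  "flat k x = (if x > 0 then (1 / x) ^ k * exp (- (1 / x)) else 0)"

lemma flat_lim: "((\<lambda>x. flat k x) \<longlongrightarrow> 0) (at_right 0)"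
proof -
  have "((\<lambda>x::real. x ^ k / exp x) \<longlongrightarrow> 0) at_top" by (rule tendsto_power_div_exp_0)
  from filterlim_compose[OF this filterlim_inverse_at_top_right]
  have "((\<lambda>x::real. inverse x ^ k / exp (inverse x)) \<longlongrightarrow> 0) (at_right 0)" .
  then show ?thesis
    by (rule Lim_transform_eventually)
      (auto simp: eventually_at_filter flat_def exp_minus inverse_eq_divide field_simps)
qed

lemma flat_deriv: "(flat k has_real_derivative (flat (k + 2) x - real k * flat (k + 1) x)) (at x)"
proof -
  consider "x > 0" | "x < 0" | "x = 0" by linarith
  then show ?thesis
  proof cases
    case 1
    have "((\<lambda>x. (1 / x) ^ k * exp (- (1 / x))) has_real_derivative
        (flat (k + 2) x - real k * flat (k + 1) x)) (at x)"
      using 1 by (auto intro!: derivative_eq_intros simp: flat_def) (cases k; simp add: field_simps power2_eq_square)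
    then show ?thesis
      by (rule has_field_derivative_transform_within_open[where S = "{0<..}"]) (use 1 in \<open>auto simp: flat_def\<close>)
  next
    case 2
    have "((\<lambda>x. 0) has_real_derivative (flat (k + 2) x - real k * flat (k + 1) x)) (at x)"
      using 2 by (simp add: flat_def)
    then show ?thesis
      by (rule has_field_derivative_transform_within_open[where S = "{..<0}"]) (use 2 in \<open>auto simp: flat_def\<close>)
  next
    case 3
    have r: "((\<lambda>t. flat k t / t) \<longlongrightarrow> 0) (at_right 0)"
      using flat_lim[of "Suc k"]
      by (rule Lim_transform_eventually) (auto simp: eventually_at_filter flat_def)
    have l: "((\<lambda>t. flat k t / t) \<longlongrightarrow> 0) (at_left 0)"
      by (rule Lim_transform_eventually[OF tendsto_const]) (auto simp: eventually_at_filter flat_def)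
    have "((\<lambda>t. flat k t / t) \<longlongrightarrow> 0) (at 0)"
      using l r by (rule filterlim_split_at)
    then show ?thesis using 3 by (simp add: DERIV_def flat_def)
  qed
qed

lemma DERIV_imp_pd: "(f has_real_derivative d) (at x) \<Longrightarrow> pd v f x = v * d"
  by (subst pd_eqI[of f "\<lambda>v. d * v"]) (auto simp: has_field_derivative_def mult_commute_abs)

lemma smooth_flat: "smooth (flat k)"
proof -
  have "C_k m (flat k)" for m
  proof (induction m arbitrary: k)
    case 0
    have "isCont (flat k) x" for x by (rule DERIV_isCont[OF flat_deriv])
    then show ?case by (simp add: continuous_on_eq_continuous_at)
  next
    case (Suc m)
    have eq: "pd v (flat k) = (\<lambda>x. v * (flat (k + 2) x + (- real k) * flat (k + 1) x))" for v
      by (rule ext, subst DERIV_imp_pd[OF flat_deriv]) simp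
    have "flat k differentiable (at x)" for x
      by (rule differentiableI[OF has_field_derivative_imp_has_derivative[OF flat_deriv]])
    moreover have "C_k m (\<lambda>x. v * (flat (k + 2) x + (- real k) * flat (k + 1) x))" for v
      by (intro C_k_mult C_k_add C_k_const Suc.IH)
    ultimately show ?case unfolding C_k_Suc_iff eq by blast
  qed
  then show ?thesis by (simp only: smooth_def) blast
qed

lemma flat_0_range: "0 \<le> flat 0 x" "flat 0 x \<le> 1"
  by (auto simp: flat_def)

lemma smooth_affine_real: "smooth f \<Longrightarrow> smooth (\<lambda>x::real. f (c * x + a))"
  using smooth_affine[of f "\<lambda>x. c * x" a] by (simp add: bounded_linear_mult_right)

text \<open>A sequence tending pointwise to the indicator of \<open>{0<..<1}\<close> with values in
  \<open>[0, 1]\<close>. Exact plateaus appear only in the limit, which dominated convergence can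
  handle.\<close>

definition bump :: "nat \<Rightarrow> real \<Rightarrow> real" where
  "bump n x = flat 0 (real (Suc n) * x) * flat 0 (real (Suc n) * (1 - x))"

lemma smooth_bump: "smooth (bump n)"
proof -
  have "smooth (\<lambda>x. flat 0 (real (Suc n) * x + 0) * flat 0 ((- real (Suc n)) * x + real (Suc n)))"
    by (intro smooth_mult smooth_affine_real smooth_flat)
  moreover have "(\<lambda>x. flat 0 (real (Suc n) * x + 0) * flat 0 ((- real (Suc n)) * x + real (Suc n))) = bump n"
    by (auto simp: bump_def algebra_simps)
  ultimately show ?thesis by simp
qed

lemma bump_range: "0 \<le> bump n x" "bump n x \<le> 1"
  using flat_0_range by (auto simp: bump_def intro: mult_le_one)

lemma bump_zero: "x \<le> 0 \<or> x \<ge> 1 \<Longrightarrow> bump n x = 0"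
  by (auto simp: bump_def flat_def mult_le_0_iff zero_less_mult_iff)

lemma flat_scaled_lim: "x > 0 \<Longrightarrow> (\<lambda>n. flat 0 (real (Suc n) * x)) \<longlonglongrightarrow> 1"
proof -
  assume x: "x > 0"
  have "(\<lambda>n. exp (- (inverse (real (Suc n)) * (1 / x)))) \<longlonglongrightarrow> exp (- (0 * (1 / x)))"
    by (intro tendsto_intros LIMSEQ_inverse_real_of_nat)
  moreover have "exp (- (inverse (real (Suc n)) * (1 / x))) = flat 0 (real (Suc n) * x)" for n
  proof -
    have "real (Suc n) * x > 0" using x by simp
    then show ?thesis unfolding flat_def by (simp add: inverse_eq_divide del: of_nat_Suc)
  qed
  ultimately show ?thesis by simp
qed

lemma bump_lim: "(\<lambda>n. bump n x) \<longlonglongrightarrow> indicator {0<..<1} x"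
proof (cases "0 < x \<and> x < 1")
  case True
  then have "(\<lambda>n. bump n x) \<longlonglongrightarrow> 1 * 1" unfolding bump_def
    by (intro tendsto_mult flat_scaled_lim) auto
  then show ?thesis using True by simp
next
  case False
  then have "bump n x = 0" for n by (intro bump_zero) linarith
  then show ?thesis using False by (auto simp: indicator_def)
qed

text \<open>The antiderivative that vanishes left of the support is constant right of it, and that
  constant is the integral of \<open>f\<close>.\<close>

lemma smooth_antiderivative:
  assumes f: "smooth f" and supp: "\<And>x. x \<le> - R \<or> x \<ge> R \<Longrightarrow> f x = 0" and R: "R > 0"
    and int: "(LINT x|lborel. f x) = 0"
  obtains G where "smooth G" "\<And>x v. pd v G x = v * f x" "\<And>x. x \<le> - R \<or> x \<ge> R \<Longrightarrow> G x = 0"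
proof -
  have c: "continuous_on UNIV f" by (rule smooth_continuous[OF f])
  define G where "G x = primitive f x - primitive f (- R)" for x
  have d: "(G has_real_derivative f x) (at x)" for x
    unfolding G_def using DERIV_diff[OF primitive_deriv[OF c, of x] DERIV_const[of "primitive f (- R)"]] by simp
  have pd: "pd v G x = v * f x" for v x using d by (rule DERIV_imp_pd)
  have "C_k (Suc k) G" for k
  proof -
    have "pd v G = (\<lambda>x. v * f x)" for v using pd by auto
    moreover have "C_k k (\<lambda>x. v * f x)" for v
      using f unfolding smooth_def by (intro C_k_mult C_k_const) blast
    moreover have "G differentiable (at x)" for x       by (rule differentiableI[OF has_field_derivative_imp_has_derivative[OF d]])
    ultimately show ?thesis unfolding C_k_Suc_iff by simp
  qed
  then have "smooth G" unfolding smooth_def using C_k_SucD by blast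
  moreover have "G x = 0" if "x \<le> - R \<or> x \<ge> R" for x
    using that
  proof
    assume x: "x \<le> - R"
    show ?thesis
    proof (cases "x = - R")
      case False
      then have "x < - R" using x by simp
      from MVT2[OF this d] obtain z where "x < z" "z < - R" "G (- R) - G x = (- R - x) * f z" by blast
      then show ?thesis using supp[of z] by (simp add: G_def)
    qed (simp add: G_def)
  next
    assume x: "x \<ge> R"
    have le: "- R \<le> x" using x R by simp
    have "integral\<^sup>L lborel (\<lambda>t. indicator {- R..x} t *\<^sub>R f t) = G x - G (- R)"
      using d by (intro integral_FTC_atLeastAtMost le)
        (auto intro: continuous_on_subset[OF c] DERIV_subset simp: has_real_derivative_iff_has_vector_derivative[symmetric] has_field_derivative_at_within)
    moreover have "(\<lambda>t. indicator {- R..x} t *\<^sub>R f t) = f"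
    proof
      show "indicator {- R..x} t *\<^sub>R f t = f t" for t
        using supp[of t] x by (cases "- R \<le> t \<and> t \<le> x") (auto simp: indicator_def)
    qed
    ultimately have "G x - G (- R) = 0" using int by simp
    then show ?thesis by (simp add: G_def)
  qed
  ultimately show thesis using pd by (intro that[of G]) auto
qed

lemma smooth_prod:
  assumes "finite I" "\<And>i. i \<in> I \<Longrightarrow> smooth (f i)" shows "smooth (\<lambda>z. \<Prod>i\<in>I. f i z)"
  using assms by (induction I rule: finite_induct) (auto intro: smooth_const smooth_mult)

text \<open>With \<open>G\<close> the compactly supported antiderivative of \<open>f\<close>, the
  product is the \<open>x\<close> derivative of the test function
  \<open>G (fst z) * B (snd z)\<close>.\<close>

lemma product_in_Y:
  fixes B :: "real ^ 'n \<Rightarrow> real"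
  assumes f: "smooth f" and supp: "\<And>x. x \<le> - R \<or> x \<ge> R \<Longrightarrow> f x = 0" and R: "R > 0"
    and int: "(LINT x|lborel. f x) = 0"
    and B: "smooth B" "\<And>y. norm y > R' \<Longrightarrow> B y = 0"
  shows "(\<lambda>z. f (fst z) * B (snd z)) \<in> Y_space"
proof -
  obtain G where G: "smooth G" "\<And>x v. pd v G x = v * f x" "\<And>x. x \<le> - R \<or> x \<ge> R \<Longrightarrow> G x = 0"
    by (rule smooth_antiderivative[OF f supp R int]) blast+
  define g where "g z = G (fst z) * B (snd z)" for z :: "real \<times> (real ^ 'n)"
  have s1: "smooth (\<lambda>z::real \<times> (real ^ 'n). G (fst z))" by (rule smooth_compose_linear[OF G(1) bounded_linear_fst])
  have s2: "smooth (\<lambda>z::real \<times> (real ^ 'n). B (snd z))" by (rule smooth_compose_linear[OF B(1) bounded_linear_snd])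
  have s: "smooth g" unfolding g_def by (rule smooth_mult[OF s1 s2])
  have "g z = 0" if z: "norm z > R + R'" for z
  proof (rule ccontr)
    assume "g z \<noteq> 0"
    then have "G (fst z) \<noteq> 0" "B (snd z) \<noteq> 0" by (auto simp: g_def)
    then have "\<not> (fst z \<le> - R \<or> fst z \<ge> R)" "\<not> norm (snd z) > R'"
      using G(3)[of "fst z"] B(2)[of "snd z"] by blast+
    then have "\<bar>fst z\<bar> < R" "norm (snd z) \<le> R'" by linarith+
    moreover have "norm z \<le> norm (fst z) + norm (snd z)" using norm_Pair_le[of "fst z" "snd z"] by simp
    ultimately show False using z by simp
  qed
  then have "Cc g" unfolding Cc_def using smooth_continuous[OF s] by blast
  then have "g \<in> test_functions" using s by (simp add: test_functions_iff)
  moreover have "dx g = (\<lambda>z. f (fst z) * B (snd z))"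
  proof
    fix z :: "real \<times> (real ^ 'n)"
    have "pd (1, 0) g z = G (fst z) * pd (1, 0) (\<lambda>z. B (snd z)) z + pd (1, 0) (\<lambda>z. G (fst z)) z * B (snd z)"
      unfolding g_def by (rule pd_mult[OF s1 s2])
    also have "\<dots> = f (fst z) * B (snd z)"
      using pd_compose_linear[OF B(1) bounded_linear_snd, of "(1::real, 0)" z]
        pd_compose_linear[OF G(1) bounded_linear_fst, of "(1, 0::real ^ 'n)" z] pd_direction(3)[OF B(1)]
      by (simp add: G(2))
    finally show "dx g z = f (fst z) * B (snd z)" by (simp add: dx_pd)
  qed
  ultimately show ?thesis using dx_in_Y by metis
qed

context nonlinearity
begin

definition V :: "(real \<times> (real ^ 'n) \<Rightarrow> real) \<Rightarrow> real" where
  "V u = (LINT z|lborel. H (u z) - (u z)\<^sup>2 / 2)"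

text \<open>Functions in \<open>Y\<close> have mean zero on every line in the \<open>x\<close> direction. A plateau of height \<open>\<xi>\<close> and
  length 1 is therefore balanced by one of height \<open>- \<epsilon>\<close> and length \<open>\<xi> / \<epsilon>\<close>, whose contribution to \<open>V\<close>
  is only of order \<open>\<xi> \<epsilon>\<close>.\<close>

lemma exists_V_pos:
  assumes \<xi>: "\<xi> > 0" "2 * H \<xi> - \<xi>\<^sup>2 > 0"
  shows "\<exists>u \<in> (Y_space :: (real \<times> (real ^ 'n) \<Rightarrow> real) set). V u > 0"
proof -
  define F where "F t = H t - t\<^sup>2 / 2" for t
  have F\<xi>: "F \<xi> > 0" using \<xi> by (simp add: F_def)
  have F0: "F 0 = 0" by (simp add: F_def H_0)
  have Fc: "continuous_on UNIV F" unfolding F_def by (intro continuous_intros H_continuous) auto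
  obtain \<epsilon>0 where \<epsilon>0: "\<epsilon>0 > 0" "\<And>t. \<bar>t\<bar> \<le> \<epsilon>0 \<Longrightarrow> \<bar>H t\<bar> \<le> t\<^sup>2 / 2" by (rule H_small) blast
  \<comment> \<open>Small enough for \<open>H_small\<close> to apply on the negative plateau, and
    for the loss there, at most \<open>\<epsilon>\<^sup>2 * c = \<xi> * \<epsilon>\<close>, to stay
    below the gain \<open>F \<xi>\<close>.\<close>
  define \<epsilon> where "\<epsilon> = min \<epsilon>0 (F \<xi> / (2 * \<xi>))"
  have \<epsilon>: "\<epsilon> > 0" "\<epsilon> \<le> \<epsilon>0" "\<xi> * \<epsilon> < F \<xi>"
  proof -
    have "\<xi> * \<epsilon> \<le> \<xi> * (F \<xi> / (2 * \<xi>))" using \<xi> by (intro mult_left_mono) (auto simp: \<epsilon>_def)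
    also have "\<dots> < F \<xi>" using \<xi> F\<xi> by simp
    finally show "\<xi> * \<epsilon> < F \<xi>" .
  qed (use \<epsilon>0 F\<xi> \<xi> in \<open>auto simp: \<epsilon>_def\<close>)
  define c where "c = \<xi> / \<epsilon>"
  have c: "c > 0" using \<xi> \<epsilon> by (simp add: c_def)
  define R where "R = 1 + c"
  have R: "R > 0" using c by (simp add: R_def)
  \<comment> \<open>The second bump is reflected and stretched by \<open>c\<close>. It is supported
    in \<open>{- c..0}\<close>, beside the first, and has \<open>c = \<xi> / \<epsilon>\<close>
    times its integral, so the total integral is 0.\<close>
  define f where "f n x = \<xi> * bump n x + (- \<epsilon>) * bump n ((- 1 / c) * x + 0)" for n x
  define B where "B n y = (\<Prod>i\<in>UNIV. bump n (y $ i))" for n and y :: "real ^ 'n"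
  have f: "smooth (f n)" for n
    unfolding f_def by (intro smooth_add smooth_cmult smooth_affine_real smooth_bump)
  have supp: "f n x = 0" if "x \<le> - R \<or> x \<ge> R" for n x
  proof -
    have "x \<le> 0 \<or> x \<ge> 1" "(- 1 / c) * x + 0 \<le> 0 \<or> (- 1 / c) * x + 0 \<ge> 1"
      using that c by (auto simp: R_def field_simps)
    then show ?thesis by (simp add: f_def bump_zero)
  qed
  have bi: "integrable lborel (bump n)" for n
  proof (rule Cc_integrable)
    have "bump n x = 0" if "norm x > 1" for x using that by (intro bump_zero) (auto simp: abs_if split: if_splits)
    then show "Cc (bump n)" unfolding Cc_def using smooth_continuous[OF smooth_bump] by blast
  qed
  have int: "(LINT x|lborel. f n x) = 0" for n
  proof -
    have "(LINT x|lborel. bump n x) = \<bar>- 1 / c\<bar> *\<^sub>R (LINT x|lborel. bump n (0 + (- 1 / c) * x))"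
      using c by (intro lborel_integral_real_affine) auto
    then have "(LINT x|lborel. bump n ((- 1 / c) * x + 0)) = c * (LINT x|lborel. bump n x)"
      using c by (simp add: field_simps)
    moreover have "integrable lborel (\<lambda>x. bump n ((- 1 / c) * x + 0))"
      using lborel_integrable_real_affine[OF bi[of n], of "- 1 / c" 0] c by (simp add: add.commute)
    ultimately have "(LINT x|lborel. f n x) = \<xi> * (LINT x|lborel. bump n x) + (- \<epsilon>) * (c * (LINT x|lborel. bump n x))"
      unfolding f_def using bi[of n] by simp
    then show ?thesis using \<epsilon> by (simp add: c_def)
  qed
  have B: "smooth (B n)" "\<And>y. norm y > real CARD('n) \<Longrightarrow> B n y = 0" for n
  proof -
    show "smooth (B n)" unfolding B_def
      by (intro smooth_prod smooth_compose_linear[OF smooth_bump] bounded_linear_vec_nth finite)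
    show "B n y = 0" if "norm y > real CARD('n)" for y
    proof (rule ccontr)
      assume "B n y \<noteq> 0"
      then have "bump n (y $ i) \<noteq> 0" for i by (auto simp: B_def)
      then have "\<bar>y $ i\<bar> \<le> 1" for i using bump_zero[of "y $ i" n] by force
      then have "norm y \<le> (\<Sum>i\<in>(UNIV::'n set). 1)"
        by (intro order.trans[OF norm_le_l1_cart] sum_mono) auto
      with that show False by simp
    qed
  qed
  define u where "u n z = f n (fst z) * B n (snd z)" for n and z :: "real \<times> (real ^ 'n)"
  have uY: "u n \<in> Y_space" for n
    unfolding u_def by (rule product_in_Y[OF f supp R int B]) auto
  define A1 where "A1 = box (0 :: real, 0) (1, 1 :: real ^ 'n)"
  define A2 where "A2 = box (- c, 0) (0, 1 :: real ^ 'n)"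
  have mem: "(x, y) \<in> box (a, 0) (b, 1 :: real ^ 'n) \<longleftrightarrow> a < x \<and> x < b \<and> (\<forall>i. 0 < y $ i \<and> y $ i < 1)" for x a b :: real and y
    by (auto simp: mem_box Basis_prod_def Basis_vec_def inner_axis ball_Un)
  have lim: "(\<lambda>n. u n z) \<longlonglongrightarrow> \<xi> * indicator A1 z + (- \<epsilon>) * indicator A2 z" for z
  proof -
    obtain x y where z: "z = (x, y)" by (cases z)
    have "(\<lambda>n. u n z) \<longlonglongrightarrow> (\<xi> * indicator {0<..<1} x + (- \<epsilon>) * indicator {0<..<1} ((- 1 / c) * x + 0)) * (\<Prod>i\<in>UNIV. indicator {0<..<1} (y $ i))"
      unfolding u_def f_def B_def z fst_conv snd_conv by (intro tendsto_intros bump_lim)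
    also have "indicator {0<..<1} ((- 1 / c) * x + 0) = (indicator {- c<..<0} x :: real)"
      using c by (auto simp: indicator_def field_simps)
    also have "(\<Prod>i\<in>UNIV. indicator {0<..<1} (y $ i)) = (if \<forall>i. 0 < y $ i \<and> y $ i < 1 then 1 else (0::real))"
    proof (cases "\<forall>i. 0 < y $ i \<and> y $ i < 1")
      case False
      then obtain i where i: "indicator {0<..<1} (y $ i) = (0::real)" by (auto simp: indicator_def)
      have "(\<Prod>i\<in>UNIV. indicator {0<..<1} (y $ i)) = (0::real)"
        by (rule prod_zero) (use i in auto)
      with False show ?thesis by simp
    qed simp
    also have "(\<xi> * indicator {0<..<1} x + (- \<epsilon>) * indicator {- c<..<0} x) * (if \<forall>i. 0 < y $ i \<and> y $ i < 1 then 1 else (0::real))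
      = \<xi> * indicator A1 z + (- \<epsilon>) * indicator A2 z"
      unfolding A1_def A2_def z by (simp add: indicator_def mem)
    finally show ?thesis .
  qed
  have disj: "A1 \<inter> A2 = {}" unfolding A1_def A2_def by (auto simp: mem)
  have m: "measure lborel A1 = 1" "measure lborel A2 = c"
  proof -
    have "measure lborel (box (a, 0) (b, 1 :: real ^ 'n)) = b - a" if "a \<le> b" for a b :: real
    proof -
      have "measure lborel (box (a :: real, 0) (b, 1 :: real ^ 'n)) = (b - a) * (\<Prod>i\<in>Basis. (1 :: real ^ 'n) \<bullet> i)"
      proof -
        have le: "(a, 0) \<bullet> j \<le> (b, 1 :: real ^ 'n) \<bullet> j" if "j \<in> Basis" for j
          using that \<open>a \<le> b\<close> by (auto simp: Basis_prod_def Basis_vec_def inner_axis)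
        have "prod ((\<bullet>) ((b, 1 :: real ^ 'n) - (a, 0))) (Basis :: (real \<times> (real ^ 'n)) set)
            = prod ((\<bullet>) ((b, 1 :: real ^ 'n) - (a, 0))) ((\<lambda>u. (u, 0)) ` Basis) * prod ((\<bullet>) ((b, 1 :: real ^ 'n) - (a, 0))) ((\<lambda>u. (0, u)) ` Basis)"
          unfolding Basis_prod_def by (rule prod.union_disjoint) auto
        also have "\<dots> = (b - a) * (\<Prod>i\<in>Basis. (1 :: real ^ 'n) \<bullet> i)"
          by (simp add: prod.reindex inj_on_def)
        finally show ?thesis using measure_lborel_box[OF le] by simp
      qed
      also have "(\<Prod>i\<in>Basis. (1 :: real ^ 'n) \<bullet> i) = 1"
        by (rule prod.neutral) (auto simp: Basis_vec_def inner_axis)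
      finally show ?thesis by simp
    qed
    from this[of 0 1] this[of "- c" 0] c show "measure lborel A1 = 1" "measure lborel A2 = c"
      unfolding A1_def A2_def by auto
  qed
  have em: "emeasure lborel A1 < \<infinity>" "emeasure lborel A2 < \<infinity>"
    unfolding A1_def A2_def by (rule emeasure_bounded_finite[OF bounded_box])+
  have [measurable]: "A1 \<in> sets borel" "A2 \<in> sets borel" unfolding A1_def A2_def by auto
  have bd: "\<bar>u n z\<bar> \<le> \<xi> + \<epsilon>" for n z
  proof -
    have "\<bar>f n (fst z)\<bar> \<le> \<bar>\<xi> * bump n (fst z)\<bar> + \<bar>(- \<epsilon>) * bump n ((- 1 / c) * fst z + 0)\<bar>"
      unfolding f_def by (rule abs_triangle_ineq)
    also have "\<dots> \<le> \<xi> * 1 + \<epsilon> * 1"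
      using bump_range \<xi> \<epsilon> unfolding abs_mult by (intro add_mono mult_mono) auto
    finally have f1: "\<bar>f n (fst z)\<bar> \<le> \<xi> + \<epsilon>" by simp
    have "0 \<le> B n (snd z)" "B n (snd z) \<le> 1"
      unfolding B_def using bump_range by (auto intro!: prod_nonneg prod_le_1)
    then have "\<bar>f n (fst z)\<bar> * \<bar>B n (snd z)\<bar> \<le> (\<xi> + \<epsilon>) * 1"
      using f1 \<xi> \<epsilon> by (intro mult_mono) auto
    then show ?thesis by (simp add: u_def abs_mult)
  qed
  have "compact (F ` {- (\<xi> + \<epsilon>)..\<xi> + \<epsilon>})"
    using Fc by (intro compact_continuous_image) (auto intro: continuous_on_subset)
  then obtain Q where "\<forall>x \<in> F ` {- (\<xi> + \<epsilon>)..\<xi> + \<epsilon>}. norm x \<le> Q"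
    using compact_imp_bounded bounded_iff by blast
  then have Q: "\<bar>F (u n z)\<bar> \<le> Q" for n z using bd[of n z] by (auto simp: abs_le_iff)
  have Q0: "Q \<ge> 0" using Q[of 0 0] by linarith
  define K where "K = cball (0 :: real \<times> (real ^ 'n)) (R + real CARD('n))"
  have outK: "u n z = 0" if "z \<notin> K" for n z
  proof (rule ccontr)
    assume "u n z \<noteq> 0"
    then have "f n (fst z) \<noteq> 0" "B n (snd z) \<noteq> 0" by (auto simp: u_def)
    then have "\<not> (fst z \<le> - R \<or> fst z \<ge> R)" "\<not> norm (snd z) > real CARD('n)"
      using supp[of "fst z" n] B(2)[of "snd z" n] by blast+
    then have "\<bar>fst z\<bar> < R" "norm (snd z) \<le> real CARD('n)" by linarith+
    moreover have "norm z \<le> norm (fst z) + norm (snd z)" using norm_Pair_le[of "fst z" "snd z"] by simp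
    ultimately show False using that by (simp add: K_def)
  qed
  \<comment> \<open>The limit is a step function on two disjoint boxes of volume 1 and
    \<open>c\<close>, for which the integral is explicit. Positivity there carries over to some
    \<open>u n\<close>.\<close>
  have "(\<lambda>n. V (u n)) \<longlonglongrightarrow> (LINT z|lborel. F (\<xi> * indicator A1 z + (- \<epsilon>) * indicator A2 z))"
    unfolding V_def F_def[symmetric]
  proof (rule integral_dominated_convergence[where w = "\<lambda>z. Q * indicator K z"])
    have [measurable]: "F \<in> borel_measurable borel" using Fc by (rule borel_measurable_continuous_onI)
    show "(\<lambda>z. F (\<xi> * indicator A1 z + (- \<epsilon>) * indicator A2 z)) \<in> borel_measurable lborel" by measurable
    show "(\<lambda>z. F (u n z)) \<in> borel_measurable lborel" for n
      using Cc_measurable[OF Y_Cc(1)[OF uY]] by measurable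
    show "integrable lborel (\<lambda>z. Q * indicator K z)"
      using emeasure_compact_finite[of K] by (intro integrable_mult_right integrable_real_indicator) (auto simp: K_def)
    show "AE z in lborel. (\<lambda>n. F (u n z)) \<longlonglongrightarrow> F (\<xi> * indicator A1 z + (- \<epsilon>) * indicator A2 z)"
      using Fc by (intro AE_I2 isCont_tendsto_compose[OF _ lim]) (simp add: continuous_on_eq_continuous_at)
    show "AE z in lborel. norm (F (u n z)) \<le> Q * indicator K z" for n
      using Q outK F0 by (intro AE_I2) (auto simp: indicator_def)
  qed
  also have "(LINT z|lborel. F (\<xi> * indicator A1 z + (- \<epsilon>) * indicator A2 z))
      = (LINT z|lborel. F \<xi> * indicator A1 z + F (- \<epsilon>) * indicator A2 z)"
    using disj F0 by (intro Bochner_Integration.integral_cong refl) (auto simp: indicator_def)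
  also have "\<dots> = F \<xi> + F (- \<epsilon>) * c"
    using em m by simp
  finally have L: "(\<lambda>n. V (u n)) \<longlonglongrightarrow> F \<xi> + F (- \<epsilon>) * c" .
  have "\<bar>H (- \<epsilon>)\<bar> \<le> (- \<epsilon>)\<^sup>2 / 2" using \<epsilon> by (intro \<epsilon>0(2)) auto
  then have "F (- \<epsilon>) \<ge> - (\<epsilon>\<^sup>2)" by (simp add: F_def)
  then have "F (- \<epsilon>) * c \<ge> - (\<epsilon>\<^sup>2) * c" using c by (intro mult_right_mono) auto
  moreover have "\<epsilon>\<^sup>2 * c = \<xi> * \<epsilon>" using \<epsilon> by (simp add: c_def power2_eq_square)
  ultimately have "F \<xi> + F (- \<epsilon>) * c > 0" using \<epsilon>(3) by simp
  then have "eventually (\<lambda>n. V (u n) > 0) sequentially" using L by (rule order_tendstoD(1)[rotated])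
  then obtain n where "V (u n) > 0" by (auto simp: eventually_sequentially)
  then show ?thesis using uY by blast
qed

end

section \<open>Scaling and almost minimizing sequences\<close>

definition scl :: "real \<Rightarrow> real \<times> (real ^ 'n) \<Rightarrow> real \<times> (real ^ 'n)" where
  "scl a z = ((1 / a) * fst z, (1 / a\<^sup>2) *\<^sub>R snd z)"

lemma bounded_linear_scl: "bounded_linear (scl a)"
  unfolding scl_def
  by (intro bounded_linear_Pair bounded_linear_const_mult bounded_linear_fst
      bounded_linear_compose[OF bounded_linear_scaleR_right bounded_linear_snd])

lemma scl_measurable [measurable]: "scl a \<in> borel_measurable borel"
  using bounded_linear_scl[of a] by (intro borel_measurable_continuous_onI linear_continuous_on)

lemma integral_scl:
  fixes f :: "real \<times> (real ^ 'n) \<Rightarrow> real"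
  assumes f: "f \<in> borel_measurable borel" and a: "a > 0"
  shows "(LINT z|lborel. f (scl a z)) = a ^ hdim TYPE('n) * (LINT z|lborel. f z)"
proof -
  define c where "c j = (if j = (1, 0) then 1 / a else 1 / a\<^sup>2)" for j :: "real \<times> (real ^ 'n)"
  have c: "c j \<noteq> 0" for j using a by (simp add: c_def)
  have eq: "scl a z = 0 + (\<Sum>j\<in>Basis. (c j * (z \<bullet> j)) *\<^sub>R j)" for z
  proof (rule euclidean_eqI)
    fix b :: "real \<times> (real ^ 'n)" assume b: "b \<in> Basis"
    have "(0 + (\<Sum>j\<in>Basis. (c j * (z \<bullet> j)) *\<^sub>R j)) \<bullet> b = c b * (z \<bullet> b)"
      using b by (simp add: inner_sum_left_Basis)
    also have "\<dots> = scl a z \<bullet> b"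
      using b by (cases z) (auto simp: scl_def c_def Basis_prod_def)
    finally show "scl a z \<bullet> b = (0 + (\<Sum>j\<in>Basis. (c j * (z \<bullet> j)) *\<^sub>R j)) \<bullet> b" by simp
  qed
  have prod: "(\<Prod>j\<in>Basis. \<bar>c j\<bar>) = 1 / a ^ hdim TYPE('n)"
  proof -
    have "(\<Prod>j\<in>Basis. \<bar>c j\<bar>) = (\<Prod>j\<in>(\<lambda>u. (u, 0)) ` Basis. \<bar>c j\<bar>) * (\<Prod>j\<in>(\<lambda>u. (0, u)) ` Basis. \<bar>c j\<bar>)"
      unfolding Basis_prod_def by (rule prod.union_disjoint) auto
    also have "(\<Prod>j\<in>(\<lambda>u. (u, 0)) ` Basis. \<bar>c j\<bar>) = 1 / a" using a by (simp add: c_def)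
    also have "(\<Prod>j\<in>(\<lambda>u. (0, u)) ` Basis. \<bar>c j\<bar>) = (\<Prod>j\<in>(Basis :: (real ^ 'n) set). 1 / a\<^sup>2)"
      using a by (subst prod.reindex) (auto simp: inj_on_def c_def)
    also have "\<dots> = (1 / a\<^sup>2) ^ CARD('n)" by simp
    finally show ?thesis using a by (simp add: power_mult[symmetric] power_one_over power_divide)
  qed
  have "(LINT z|lborel. f z) = integral\<^sup>L (density (distr lborel borel (scl a)) (\<lambda>_. ennreal (\<Prod>j\<in>Basis. \<bar>c j\<bar>))) f"
  proof -
    have "scl a = (\<lambda>z. 0 + (\<Sum>j\<in>Basis. (c j * (z \<bullet> j)) *\<^sub>R j))" by (rule ext) (rule eq)
    moreover have "lborel = density (distr lborel borel (\<lambda>z. 0 + (\<Sum>j\<in>Basis. (c j * (z \<bullet> j)) *\<^sub>R j))) (\<lambda>_. ennreal (\<Prod>j\<in>Basis. \<bar>c j\<bar>))"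
      by (rule lborel_affine_euclidean) (rule c)
    ultimately show ?thesis by simp
  qed
  also have "\<dots> = (LINT z|distr lborel borel (scl a). (\<Prod>j\<in>Basis. \<bar>c j\<bar>) *\<^sub>R f z)"
    using f by (intro integral_density) (auto intro!: prod_nonneg)
  also have "\<dots> = (LINT z|lborel. (\<Prod>j\<in>Basis. \<bar>c j\<bar>) *\<^sub>R f (scl a z))"
    using f by (intro integral_distr) auto
  also have "\<dots> = (1 / a ^ hdim TYPE('n)) * (LINT z|lborel. f (scl a z))"
    unfolding prod by simp
  finally show ?thesis using a by simp
qed

text \<open>The antiderivative of the dilated function is \<open>a * g (scl a z)\<close>, so its
  \<open>y\<close> gradient picks up \<open>a / a\<^sup>2\<close>, the same factor
  \<open>1 / a\<close> as the \<open>x\<close> derivative of \<open>u\<close>. This is why both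
  parts of \<open>kin\<close> scale alike.\<close>

lemma Y_scl:
  fixes u :: "real \<times> (real ^ 'n) \<Rightarrow> real"
  assumes u: "u \<in> Y_space" and a: "a > 0"
  shows "(\<lambda>z. u (scl a z)) \<in> Y_space" "pot (\<lambda>z. u (scl a z)) z = (1 / a) *\<^sub>R pot u (scl a z)"
proof -
  obtain g where g: "u = dx g" "g \<in> test_functions" using u by (rule Y_spaceE)
  have gs: "smooth g" "Cc g" using g by (auto simp: test_functions_iff)
  define k where "k z = a * g (scl a z)" for z
  have s0: "smooth (\<lambda>z. g (scl a z))" by (rule smooth_compose_linear[OF gs(1) bounded_linear_scl])
  have s: "smooth k" unfolding k_def by (rule smooth_cmult[OF s0])
  have pdk: "pd v k z = a * pd (scl a v) g (scl a z)" for v z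
    unfolding k_def by (simp add: pd_cmult[OF s0] pd_compose_linear[OF gs(1) bounded_linear_scl])
  obtain R where R: "\<And>z. norm z > R \<Longrightarrow> g z = 0" using gs(2) unfolding Cc_def by blast
  have "k z = 0" if z: "norm z > (a + a\<^sup>2) * \<bar>R\<bar>" for z
  proof (rule ccontr)
    assume "k z \<noteq> 0"
    then have "g (scl a z) \<noteq> 0" by (auto simp: k_def)
    then have le: "norm (scl a z) \<le> R" using R[of "scl a z"] by (meson not_less)
    have "norm (fst z) = a * norm (fst (scl a z))" "norm (snd z) = a\<^sup>2 * norm (snd (scl a z))"
      using a by (auto simp: scl_def abs_mult)
    moreover have "norm (fst (scl a z)) \<le> \<bar>R\<bar>" "norm (snd (scl a z)) \<le> \<bar>R\<bar>"
      using le norm_fst_le[of "fst (scl a z)" "snd (scl a z)"] norm_snd_le[of "snd (scl a z)" "fst (scl a z)"] by auto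
    ultimately have "norm (fst z) \<le> a * \<bar>R\<bar>" "norm (snd z) \<le> a\<^sup>2 * \<bar>R\<bar>"
      using a by (auto intro: mult_left_mono)
    moreover have "norm z \<le> norm (fst z) + norm (snd z)" using norm_Pair_le[of "fst z" "snd z"] by simp
    ultimately show False using z by (simp add: distrib_right)
  qed
  then have "Cc k" unfolding Cc_def using smooth_continuous[OF s] by blast
  then have k: "k \<in> test_functions" using s by (simp add: test_functions_iff)
  have s1: "scl a (1, 0) = (1 / a) *\<^sub>R (1, 0 :: real ^ 'n)" and s2: "scl a (0, y) = (1 / a\<^sup>2) *\<^sub>R (0, y)" for y :: "real ^ 'n"
    by (simp_all add: scl_def)
  have dk: "dx k = (\<lambda>z. u (scl a z))"
    using a by (intro ext) (simp add: dx_pd pdk s1 pd_direction[OF gs(1)] g(1) del: scaleR_Pair)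
  have gk: "grad_y k z = (1 / a) *\<^sub>R grad_y g (scl a z)" for z
    using a by (simp add: vec_eq_iff grad_y_nth pdk s2 pd_direction[OF gs(1)] power2_eq_square del: scaleR_Pair)
  show 1: "(\<lambda>z. u (scl a z)) \<in> Y_space" using dx_in_Y[OF k] by (simp add: dk)
  have us: "smooth u" using Y_test[OF u] by (simp add: test_functions_iff)
  have "dx (dx k) z = (1 / a) * dx u (scl a z)"
    unfolding dk unfolding dx_pd by (simp add: pd_compose_linear[OF us bounded_linear_scl] s1 pd_direction[OF us] del: scaleR_Pair)
  then show "pot (\<lambda>z. u (scl a z)) z = (1 / a) *\<^sub>R pot u (scl a z)"
    using pot_dx[OF k] pot_dx[OF g(2)] by (simp add: dk gk g(1)[symmetric])
qed

abbreviation kin :: "(real \<times> (real ^ 'n) \<Rightarrow> real) \<Rightarrow> real" where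
  "kin u \<equiv> (l2 lborel (pot u))\<^sup>2"

lemma scl_functionals:
  fixes u :: "real \<times> (real ^ 'n) \<Rightarrow> real"
  assumes u: "u \<in> Y_space" and a: "a > 0"
  shows "kin (\<lambda>z. u (scl a z)) = a ^ hdim TYPE('n) / a\<^sup>2 * kin u"
    "(l2 lborel (\<lambda>z. u (scl a z)))\<^sup>2 = a ^ hdim TYPE('n) * (l2 lborel u)\<^sup>2"
proof -
  note [measurable] = Cc_measurable[OF Y_Cc(1)[OF u]] Cc_measurable[OF Y_Cc(2)[OF u]]
  have "kin (\<lambda>z. u (scl a z)) = (LINT z|lborel. (1 / a\<^sup>2) * (norm (pot u (scl a z)))\<^sup>2)"
    by (simp add: l2_square Y_scl(2)[OF u a] power_divide power_mult_distrib)
  also have "\<dots> = (1 / a\<^sup>2) * (a ^ hdim TYPE('n) * kin u)"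
    using integral_scl[of "\<lambda>z. (norm (pot u z))\<^sup>2", OF _ a] by (simp add: l2_square)
  finally show "kin (\<lambda>z. u (scl a z)) = a ^ hdim TYPE('n) / a\<^sup>2 * kin u" by simp
  show "(l2 lborel (\<lambda>z. u (scl a z)))\<^sup>2 = a ^ hdim TYPE('n) * (l2 lborel u)\<^sup>2"
    using integral_scl[of "\<lambda>z. (u z)\<^sup>2", OF _ a] by (simp add: l2_square)
qed

lemma Cc_disjoint:
  fixes f :: "real \<times> 'b::euclidean_space \<Rightarrow> 'c::real_normed_vector" and g :: "real \<times> 'b \<Rightarrow> 'd::real_normed_vector"
  assumes "Cc f" "Cc g"
  obtains S where "\<And>s z. s > S \<Longrightarrow> f (z + (s, 0)) = 0 \<or> g z = 0"
proof -
  obtain R1 where R1: "\<And>z. norm z > R1 \<Longrightarrow> f z = 0" using assms(1) unfolding Cc_def by blast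
  obtain R2 where R2: "\<And>z. norm z > R2 \<Longrightarrow> g z = 0" using assms(2) unfolding Cc_def by blast
  show thesis
  proof (rule that[of "R1 + R2"])
    fix s z assume s: "s > R1 + R2"
    show "f (z + (s, 0)) = 0 \<or> g z = 0"
    proof (rule ccontr)
      assume "\<not> ?thesis"
      then have "norm (z + (s, 0)) \<le> R1" "norm z \<le> R2" using R1[of "z + (s, 0)"] R2[of z] by (meson not_less)+
      moreover have "norm ((s, 0) :: real \<times> 'b) \<le> norm (z + (s, 0)) + norm z"
        using norm_triangle_ineq4[of "z + (s, 0)" z] by simp
      ultimately show False using s by simp
    qed
  qed
qed

text \<open>A translate of \<open>u\<close> far away in the \<open>x\<close> direction is orthogonal
  to \<open>u\<close>, so the increment has squared norm \<open>2 * (l2 lborel u)\<^sup>2\<close>.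
  On the other hand \<open>l2_increment_Y\<close> bounds the increment by a multiple of the norm of
  \<open>pot u\<close>.\<close>

lemma kin_zero:
  assumes u: "u \<in> Y_space" and 0: "kin u = 0" shows "l2 lborel u = 0"
proof -
  have c: "Cc u" by (rule Y_Cc[OF u])
  obtain S where S: "\<And>s z. s > S \<Longrightarrow> u (z + (s, 0)) = 0 \<or> u z = 0" using Cc_disjoint[OF c c] by blast
  define s where "s = S + 1"
  have z: "u (z + (s, 0)) * u z = 0" for z using S[of s z] by (auto simp: s_def)
  let ?v = "\<lambda>z. u (z + (s, 0))"
  have sq: "sq_int lborel ?v" "sq_int lborel (\<lambda>z. (- 1) * u z)"
    by (rule Cc_sq_int[OF Cc_translate[OF c]], rule sq_int_cmult[OF Cc_sq_int[OF c]])
  have "(l2 lborel (\<lambda>z. ?v z + (- 1) * u z))\<^sup>2 = (l2 lborel ?v)\<^sup>2 + 2 * (LINT z|lborel. ?v z \<bullet> ((- 1) * u z)) + (l2 lborel (\<lambda>z. (- 1) * u z))\<^sup>2"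
    by (rule l2_add_square[OF sq])
  also have "(LINT z|lborel. ?v z \<bullet> ((- 1) * u z)) = 0"
  proof -
    have "(\<lambda>z. ?v z \<bullet> ((- 1) * u z)) = (\<lambda>z. 0)" using z by (intro ext) (simp only: inner_real_def mult_minus_left mult_1 mult_minus_right minus_zero)
    then show ?thesis by simp
  qed
  also have "l2 lborel ?v = l2 lborel u" by (rule l2_translate[OF Cc_measurable[OF c]])
  also have "l2 lborel (\<lambda>z. (- 1) * u z) = l2 lborel u" by (subst l2_cmult) simp
  finally have "(l2 lborel (\<lambda>z. ?v z - u z))\<^sup>2 = 2 * (l2 lborel u)\<^sup>2" by simp
  moreover have "l2 lborel (\<lambda>z. ?v z - u z) = 0"
    using l2_increment_Y[OF u, of s 0] 0 l2_nonneg[of lborel "\<lambda>z. ?v z - u z"] by simp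
  ultimately show ?thesis by simp
qed

lemma Y_inner_integrable:
  assumes "u \<in> Y_space" "v \<in> Y_space"
  shows "integrable lborel (\<lambda>z. pot u z \<bullet> pot v z)" "integrable lborel (\<lambda>z. u z * v z)"
    "integrable lborel (\<lambda>z. jet u z \<bullet> jet v z)"
    "(LINT z|lborel. jet u z \<bullet> jet v z) = (LINT z|lborel. pot u z \<bullet> pot v z) + (LINT z|lborel. u z * v z)"
proof -
  note C = Y_Cc[OF assms(1)] and D = Y_Cc[OF assms(2)]
  show i: "integrable lborel (\<lambda>z. pot u z \<bullet> pot v z)" "integrable lborel (\<lambda>z. u z * v z)"
    "integrable lborel (\<lambda>z. jet u z \<bullet> jet v z)"
    using sq_int_inner(1)[OF Cc_sq_int[OF C(2)] Cc_sq_int[OF D(2)]]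
      sq_int_inner(1)[OF Cc_sq_int[OF C(3)] Cc_sq_int[OF D(3)]]
      sq_int_mult[OF Cc_sq_int[OF C(1)] Cc_sq_int[OF D(1)]] by auto
  show "(LINT z|lborel. jet u z \<bullet> jet v z) = (LINT z|lborel. pot u z \<bullet> pot v z) + (LINT z|lborel. u z * v z)"
    using i by (simp add: jet_def)
qed

lemma kin_add:
  assumes u: "u \<in> Y_space" and v: "v \<in> Y_space"
  shows "kin (\<lambda>z. u z + s * v z) = kin u + 2 * s * (LINT z|lborel. pot u z \<bullet> pot v z) + s\<^sup>2 * kin v"
proof -
  note C = Y_Cc(2)[OF u] and D = Y_Cc(2)[OF v]
  have sv: "(\<lambda>z. s * v z) \<in> Y_space" by (rule Y_linear(5)[OF v v])
  have "pot (\<lambda>z. u z + s * v z) = (\<lambda>z. pot u z + s *\<^sub>R pot v z)"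
    using Y_linear(2)[OF u sv] Y_linear(6)[OF v v, of s] by (auto simp: pot_jet)
  then show ?thesis
    using l2_add_square[OF Cc_sq_int[OF C] sq_int_scale[OF Cc_sq_int[OF D], of s]]
    by (simp add: l2_scale power_mult_distrib)
qed

text \<open>The parameter \<open>dim\<close> ties the type \<open>'n\<close> to the locale, because
  the bound on \<open>p\<close> depends on the dimension.\<close>

locale subcritical = nonlinearity +
  fixes dim :: "'n::finite itself"
  assumes subcrit: "p + 1 < 2 * real (hdim TYPE('n)) / (real (hdim TYPE('n)) - 2)"
begin

abbreviation Y :: "(real \<times> (real ^ 'n) \<Rightarrow> real) set" where "Y \<equiv> Y_space"

lemma hdim_real_ge_3: "real (hdim TYPE('n)) \<ge> 3"
  using hdim_ge_3[where 'n = 'n] by linarith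

lemma Cc_Lq: assumes "Cc u" shows "Lq lborel u"
  using Cc_sq_int[OF assms] Cc_integrable[OF Cc_abs_powr[OF assms, of "p + 1"]] p by (simp add: Lq_def)

lemma Y_Lq: "u \<in> Y \<Longrightarrow> Lq lborel u"
  by (rule Cc_Lq[OF Y_Cc(1)])

lemma Y_embedding:
  obtains C where "C > 0" "\<And>u s. u \<in> Y \<Longrightarrow> s > 0 \<Longrightarrow> Y_norm u \<le> s \<Longrightarrow> (LINT z|lborel. \<bar>u z\<bar> powr (p + 1)) \<le> C * s powr (p + 1)"
  using embedding[of "p + 1", where 'n = 'n] subcrit p by auto

lemma V_eq: "u \<in> Y \<Longrightarrow> V u = (LINT z|lborel. H (u z)) - (l2 lborel u)\<^sup>2 / 2"
  using Lq_H[OF Y_Lq] LqD(2)[OF Y_Lq] by (simp add: V_def l2_square)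

lemma V_scl: "u \<in> Y \<Longrightarrow> a > 0 \<Longrightarrow> V (\<lambda>z. u (scl a z)) = a ^ hdim TYPE('n) * V u"
proof -
  assume u: "u \<in> Y" and a: "a > 0"
  note [measurable] = Cc_measurable[OF Y_Cc(1)[OF u]] borel_measurable_continuous_onI[OF H_continuous]
  show ?thesis unfolding V_def by (rule integral_scl[OF _ a]) measurable
qed

lemma V_pos_imp:
  assumes "u \<in> Y" "V u > 0" shows "kin u > 0" "(l2 lborel u)\<^sup>2 > 0"
proof -
  have "l2 lborel u \<noteq> 0"
  proof
    assume "l2 lborel u = 0"
    then have "(LINT z|lborel. (u z)\<^sup>2) = 0" using l2_square[of lborel u] by simp
    then have "AE z in lborel. (u z)\<^sup>2 = 0"
      using integral_nonneg_eq_0_iff_AE[OF LqD(2)[OF Y_Lq[OF assms(1)]]] by simp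
    then have "AE z in lborel. H (u z) - (u z)\<^sup>2 / 2 = 0" by (auto simp: H_0)
    then have "V u = 0" unfolding V_def by (rule integral_eq_zero_AE)
    with assms(2) show False by simp
  qed
  then show "(l2 lborel u)\<^sup>2 > 0" "kin u > 0" using kin_zero[OF assms(1)] by auto
qed

text \<open>As \<open>V\<close> contains \<open>- u\<^sup>2 / 2\<close>, taking the small constant
  of \<open>H_bound_p\<close> to be 1/4 leaves a quarter of the squared norm on the left. The
  embedding bounds the rest by a power of the full squared norm whose exponent exceeds 1.\<close>

lemma V_bound:
  obtains C where "C > 0" "\<And>u. u \<in> Y \<Longrightarrow> V u > 0 \<Longrightarrow>
    V u + (l2 lborel u)\<^sup>2 / 4 \<le> C * (kin u + (l2 lborel u)\<^sup>2) powr ((p + 1) / 2)"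
proof -
  obtain C1 where C1: "C1 > 0" "\<And>u s. u \<in> Y \<Longrightarrow> s > 0 \<Longrightarrow> Y_norm u \<le> s \<Longrightarrow> (LINT z|lborel. \<bar>u z\<bar> powr (p + 1)) \<le> C1 * s powr (p + 1)"
    by (rule Y_embedding) blast
  obtain C2 where C2: "C2 > 0" "\<And>t. \<bar>H t\<bar> \<le> (1/4) * t\<^sup>2 + C2 * \<bar>t\<bar> powr (p + 1)" by (rule H_bound_p[of "1/4"]) auto
  show thesis
  proof (rule that[of "C2 * C1"])
    fix u assume u: "u \<in> Y" "V u > 0"
    note Lu = LqD[OF Y_Lq[OF u(1)]]
    have "V u \<le> (LINT z|lborel. C2 * \<bar>u z\<bar> powr (p + 1) - (1/4) * (u z)\<^sup>2)"
      unfolding V_def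
    proof (rule integral_mono)
      show "integrable lborel (\<lambda>z. H (u z) - (u z)\<^sup>2 / 2)" using Lq_H[OF Y_Lq[OF u(1)]] Lu by simp
      show "integrable lborel (\<lambda>z. C2 * \<bar>u z\<bar> powr (p + 1) - (1/4) * (u z)\<^sup>2)" using Lu by simp
      show "H (u z) - (u z)\<^sup>2 / 2 \<le> C2 * \<bar>u z\<bar> powr (p + 1) - (1/4) * (u z)\<^sup>2" for z
        using C2(2)[of "u z"] by (simp add: abs_le_iff)
    qed
    also have "\<dots> = C2 * (LINT z|lborel. \<bar>u z\<bar> powr (p + 1)) - (l2 lborel u)\<^sup>2 / 4"
      using Lu by (simp add: l2_square)
    finally have 1: "V u + (l2 lborel u)\<^sup>2 / 4 \<le> C2 * (LINT z|lborel. \<bar>u z\<bar> powr (p + 1))" by simp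
    have Yn: "Y_norm u = sqrt (kin u + (l2 lborel u)\<^sup>2)"
      using Y_norm_split[OF u(1)] l2_jet_parts(3)[OF u(1)] by (metis real_sqrt_unique)
    have pos: "kin u + (l2 lborel u)\<^sup>2 > 0" using V_pos_imp[OF u] by linarith
    have "(LINT z|lborel. \<bar>u z\<bar> powr (p + 1)) \<le> C1 * sqrt (kin u + (l2 lborel u)\<^sup>2) powr (p + 1)"
      using pos Yn by (intro C1(2) u(1)) auto
    also have "sqrt (kin u + (l2 lborel u)\<^sup>2) powr (p + 1) = (kin u + (l2 lborel u)\<^sup>2) powr ((p + 1) / 2)"
      using pos by (simp add: powr_half_sqrt[symmetric] powr_powr)
    finally have "C2 * (LINT z|lborel. \<bar>u z\<bar> powr (p + 1)) \<le> C2 * (C1 * (kin u + (l2 lborel u)\<^sup>2) powr ((p + 1) / 2))"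
      using C2(1) by (intro mult_left_mono) auto
    with 1 show "V u + (l2 lborel u)\<^sup>2 / 4 \<le> C2 * C1 * (kin u + (l2 lborel u)\<^sup>2) powr ((p + 1) / 2)"
      by simp
  qed (use C1 C2 in simp)
qed

text \<open>Both bounds are invariant under dilations, so one may assume \<open>T(u) = \<parallel>u\<parallel>\<^sup>2\<close>; then the subcritical bound keeps this
  common value away from 0.\<close>

lemma kin_controls:
  obtains K where "K > 0" "\<And>u. u \<in> Y \<Longrightarrow> V u > 0 \<Longrightarrow> (l2 lborel u)\<^sup>2 \<le> K * kin u powr (real (hdim TYPE('n)) / (real (hdim TYPE('n)) - 2))"
    "\<And>u. u \<in> Y \<Longrightarrow> V u > 0 \<Longrightarrow> V u \<le> K * kin u powr (real (hdim TYPE('n)) / (real (hdim TYPE('n)) - 2))"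
proof -
  obtain C where C: "C > 0" "\<And>u. u \<in> Y \<Longrightarrow> V u > 0 \<Longrightarrow>
    V u + (l2 lborel u)\<^sup>2 / 4 \<le> C * (kin u + (l2 lborel u)\<^sup>2) powr ((p + 1) / 2)" by (rule V_bound) blast
  define q2 where "q2 = (p + 1) / 2"
  define \<sigma> where "\<sigma> = real (hdim TYPE('n)) / (real (hdim TYPE('n)) - 2)"
  have q2: "q2 > 1" "q2 < \<sigma>" using p subcrit hdim_real_ge_3 by (auto simp: q2_def \<sigma>_def)
  define C' where "C' = C * 2 powr q2"
  have C': "C' > 0" using C by (simp add: C'_def)
  define c1 where "c1 = (1 / (4 * C')) powr (1 / (q2 - 1))"
  have c1: "c1 > 0" using C' by (simp add: c1_def)
  define K where "K = c1 powr (1 - \<sigma>) + C' * c1 powr (q2 - \<sigma>)"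
  have K: "K > 0" using c1 C' by (simp add: K_def add_pos_pos)
  have main: "(l2 lborel u)\<^sup>2 \<le> K * kin u powr \<sigma> \<and> V u \<le> K * kin u powr \<sigma>" if u: "u \<in> Y" "V u > 0" for u
  proof -
    define T where "T = kin u"
    define L where "L = (l2 lborel u)\<^sup>2"
    have T: "T > 0" and L: "L > 0" using V_pos_imp[OF u] by (auto simp: T_def L_def)
    \<comment> \<open>The dilation after which \<open>kin\<close> and the squared norm coincide;
      \<open>A\<close> is its Jacobian and \<open>E\<close> the common value.\<close>
    define a where "a = sqrt (T / L)"
    have a: "a > 0" "a\<^sup>2 = T / L" using T L by (auto simp: a_def)
    define A where "A = a ^ hdim TYPE('n)"
    have A: "A > 0" using a by (simp add: A_def)
    let ?v = "\<lambda>z. u (scl a z)"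
    have v: "?v \<in> Y" by (rule Y_scl[OF u(1) a(1)])
    define E where "E = A * L"
    have E: "E > 0" using A L by (simp add: E_def)
    have f: "kin ?v = E" "(l2 lborel ?v)\<^sup>2 = E" "V ?v = A * V u"
    proof -
      have "kin ?v = A / (T / L) * T"
        unfolding scl_functionals(1)[OF u(1) a(1)] A_def a(2) T_def ..
      then show "kin ?v = E" using T L by (simp add: E_def)
      show "(l2 lborel ?v)\<^sup>2 = E" unfolding scl_functionals(2)[OF u(1) a(1)] A_def E_def L_def ..
      show "V ?v = A * V u" unfolding V_scl[OF u(1) a(1)] A_def ..
    qed
    have Vv: "V ?v > 0" using f(3) A u(2) by simp
    have "(kin ?v + (l2 lborel ?v)\<^sup>2) powr q2 = 2 powr q2 * E powr q2"
      unfolding f(1,2) mult_2[symmetric] by (rule powr_mult)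
    then have ineq: "A * V u + E / 4 \<le> C' * E powr q2"
      using C(2)[OF v Vv] f by (simp add: C'_def q2_def[symmetric] mult.assoc)
    have "A * V u > 0" using A u(2) by simp
    \<comment> \<open>Because \<open>q2 > 1\<close>, this inequality cannot hold for small
      \<open>E\<close>; the resulting lower bound is \<open>c1\<close>.\<close>
    then have "E / 4 \<le> C' * E powr q2" using ineq by linarith
    also have "E powr q2 = E * E powr (q2 - 1)" using E powr_add[of E 1 "q2 - 1"] by simp
    finally have "1 / (4 * C') \<le> E powr (q2 - 1)" using E C' by (simp add: field_simps)
    then have "c1 \<le> (E powr (q2 - 1)) powr (1 / (q2 - 1))"
      unfolding c1_def using C' q2 by (intro powr_mono2) auto
    also have "\<dots> = E" using E q2 by (simp add: powr_powr)
    finally have lc: "c1 \<le> E" .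
    have Ar: "A = a powr real (hdim TYPE('n))" unfolding A_def using powr_realpow[OF a(1), of "hdim TYPE('n)"] by simp
    \<comment> \<open>\<open>T powr \<sigma>\<close> scales like the squared norm and
      \<open>V\<close>. So the bounds for the dilated function, where \<open>E \<ge> c1\<close>
      permits raising exponents to \<open>\<sigma>\<close>, return to \<open>u\<close> after
      division by \<open>A\<close>.\<close>
    have Teq: "T powr \<sigma> = E powr \<sigma> / A"
    proof -
      have "T = a\<^sup>2 * L" using a L by simp
      also have "\<dots> = E * a powr (2 - real (hdim TYPE('n)))"
      proof -
        have "real (hdim TYPE('n)) + (2 - real (hdim TYPE('n))) = 2" by linarith
        then have "a powr real (hdim TYPE('n)) * a powr (2 - real (hdim TYPE('n))) = a powr 2"
          by (simp only: powr_add[symmetric])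
        also have "\<dots> = a\<^sup>2" using a(1) by simp
        finally show ?thesis unfolding E_def Ar by (simp only: mult_ac)
      qed
      finally have "T powr \<sigma> = E powr \<sigma> * (a powr (2 - real (hdim TYPE('n)))) powr \<sigma>" by (simp only: powr_mult)
      also have "(a powr (2 - real (hdim TYPE('n)))) powr \<sigma> = a powr (- real (hdim TYPE('n)))"
      proof -
        have "(2 - x) * (x / (x - 2)) = - x" if "x > 2" for x :: real using that by (simp add: field_simps)
        then have "(2 - real (hdim TYPE('n))) * \<sigma> = - real (hdim TYPE('n))"
          unfolding \<sigma>_def by this (use hdim_real_ge_3 in linarith)
        then show ?thesis by (simp only: powr_powr)
      qed
      finally show ?thesis unfolding Ar powr_minus divide_inverse .
    qed
    have Lb: "L \<le> c1 powr (1 - \<sigma>) * T powr \<sigma>"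
    proof -
      have "E = E powr (1 - \<sigma>) * E powr \<sigma>" using E by (simp add: powr_add[symmetric])
      also have "\<dots> \<le> c1 powr (1 - \<sigma>) * E powr \<sigma>"
        using lc c1 q2 by (intro mult_right_mono powr_mono2') auto
      finally have "E / A \<le> c1 powr (1 - \<sigma>) * E powr \<sigma> / A" using A by (intro divide_right_mono) auto
      then show ?thesis unfolding Teq using A by (simp add: E_def)
    qed
    have Vb: "V u \<le> C' * c1 powr (q2 - \<sigma>) * T powr \<sigma>"
    proof -
      have "A * V u \<le> C' * E powr q2" using ineq E by linarith
      also have "E powr q2 = E powr (q2 - \<sigma>) * E powr \<sigma>" by (simp add: powr_add[symmetric])
      also have "C' * (E powr (q2 - \<sigma>) * E powr \<sigma>) \<le> C' * (c1 powr (q2 - \<sigma>) * E powr \<sigma>)"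
        using lc c1 q2 C' by (intro mult_left_mono mult_right_mono powr_mono2') auto
      finally have "A * V u / A \<le> C' * (c1 powr (q2 - \<sigma>) * E powr \<sigma>) / A" using A by (intro divide_right_mono) auto
      then show ?thesis unfolding Teq using A by simp
    qed
    have "0 \<le> c1 powr (1 - \<sigma>) * T powr \<sigma>" "0 \<le> C' * c1 powr (q2 - \<sigma>) * T powr \<sigma>" using C' by auto
    then show ?thesis using Lb Vb unfolding K_def T_def[symmetric] L_def[symmetric] distrib_right by linarith
  qed
  show thesis by (rule that[OF K]) (use main in \<open>auto simp: \<sigma>_def\<close>)
qed

text \<open>Minus the derivative of the energy at \<open>u\<close> in the direction
  \<open>v\<close>.\<close>

definition energy_gap :: "(real \<times> (real ^ 'n) \<Rightarrow> real) \<Rightarrow> (real \<times> (real ^ 'n) \<Rightarrow> real) \<Rightarrow> real" where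
  "energy_gap u v = (LINT z|lborel. h (u z) * v z) - (LINT z|lborel. jet u z \<bullet> jet v z)"

lemma Y_mass_bound:
  assumes "K > 0"
  obtains K' where "K' > 0" "\<And>u. u \<in> Y \<Longrightarrow> Y_norm u \<le> K \<Longrightarrow> mass lborel u \<le> K'"
proof -
  obtain C1 where C1: "C1 > 0" "\<And>u s. u \<in> Y \<Longrightarrow> s > 0 \<Longrightarrow> Y_norm u \<le> s \<Longrightarrow> (LINT z|lborel. \<bar>u z\<bar> powr (p + 1)) \<le> C1 * s powr (p + 1)"
    by (rule Y_embedding) blast
  show thesis
  proof (rule that[of "K\<^sup>2 + C1 * K powr (p + 1)"])
    show "K\<^sup>2 + C1 * K powr (p + 1) > 0" using C1 assms by (simp add: add_pos_pos)
    fix u assume u: "u \<in> Y" "Y_norm u \<le> K"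
    have "(l2 lborel u)\<^sup>2 \<le> K\<^sup>2"
      using l2_jet_parts(1)[OF u(1)] u(2) by (intro power_mono l2_nonneg) auto
    then show "mass lborel u \<le> K\<^sup>2 + C1 * K powr (p + 1)"
      using C1(2)[OF u(1) assms u(2)] by (simp add: mass_def l2_square)
  qed
qed

lemma V_expand:
  assumes "u \<in> Y" "v \<in> Y"
  shows "V (\<lambda>z. u z + s * v z) - V u - s * ((LINT z|lborel. h (u z) * v z) - (LINT z|lborel. u z * v z)) + s\<^sup>2 * (l2 lborel v)\<^sup>2 / 2
    = (LINT z|lborel. H (u z + s * v z)) - (LINT z|lborel. H (u z)) - s * (LINT z|lborel. h (u z) * v z)"
proof -
  have sv: "(\<lambda>z. s * v z) \<in> Y" by (rule Y_linear(5)[OF assms(2,2)])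
  have "(\<lambda>z. u z + s * v z) \<in> Y" by (rule Y_linear(1)[OF assms(1) sv])
  moreover have "(l2 lborel (\<lambda>z. u z + s * v z))\<^sup>2 = (l2 lborel u)\<^sup>2 + 2 * s * (LINT z|lborel. u z * v z) + s\<^sup>2 * (l2 lborel v)\<^sup>2"
    using l2_add_square[OF Cc_sq_int[OF Y_Cc(1)[OF assms(1)]] Cc_sq_int[OF Y_Cc(1)[OF sv]]]
    by (simp add: l2_cmult power_mult_distrib mult_ac)
  ultimately show ?thesis using assms by (simp add: V_eq field_simps)
qed

text \<open>The inequality \<open>\<Phi> (V w) \<le> kin w / 2\<close> is tested with
  \<open>w = us n + s * v\<close>. To first order in \<open>s\<close>, with slope 1 of
  \<open>\<Phi>\<close>, it bounds \<open>s\<close> times the gap by the defect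
  \<open>kin (us n) / 2 - \<Phi> \<mu>\<close> plus errors of order \<open>e * s\<close>. First
  \<open>s\<close> is fixed, uniformly in \<open>n\<close>, then the defect tends to 0. The opposite
  bound will come from \<open>- v\<close>.\<close>

lemma palais_smale_one_sided:
  assumes us: "\<And>n. us n \<in> Y" "\<And>n. V (us n) = \<mu>" "\<And>n. Y_norm (us n) \<le> K" and K: "K > 0"
    and \<Phi>: "(\<Phi> has_real_derivative 1) (at \<mu>)" and \<mu>: "\<mu> > 0"
    and ge: "\<And>u. u \<in> Y \<Longrightarrow> V u > 0 \<Longrightarrow> \<Phi> (V u) \<le> kin u / 2"
    and lim: "(\<lambda>n. kin (us n) / 2) \<longlonglongrightarrow> \<Phi> \<mu>"
    and v: "v \<in> Y" and e: "e > 0"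
  shows "eventually (\<lambda>n. energy_gap (us n) v \<le> e) sequentially"
proof -
  obtain K' where K': "K' > 0" "\<And>u. u \<in> Y \<Longrightarrow> Y_norm u \<le> max K (Y_norm v) \<Longrightarrow> mass lborel u \<le> K'"
  proof -
    have "max K (Y_norm v) > 0" using K by simp
    from Y_mass_bound[OF this] that show thesis by blast
  qed
  have mu: "mass lborel (us n) \<le> K'" for n using K'(2)[OF us(1)] us(3)[of n] by simp
  have mv: "mass lborel v \<le> K'" by (rule K'(2)[OF v]) simp
  obtain C where C: "C > 0" "\<And>t. \<bar>h t\<bar> \<le> 1 * \<bar>t\<bar> + C * \<bar>t\<bar> powr p" by (rule h_bound_p[of 1]) auto
  define G where "G n = (LINT z|lborel. h (us n z) * v z) - (LINT z|lborel. us n z * v z)" for n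
  define A where "A n = (LINT z|lborel. pot (us n) z \<bullet> pot v z)" for n
  have gap: "energy_gap (us n) v = G n - A n" for n
    using Y_inner_integrable(4)[OF us(1) v, of n] by (simp add: energy_gap_def G_def A_def)
  have int_h: "\<bar>LINT z|lborel. h (us n z) * v z\<bar> \<le> (1 + C) * (2 * K')" for n
  proof -
    have "\<bar>LINT z|lborel. h (us n z) * v z\<bar> \<le> (1 + C) * (mass lborel (us n) + mass lborel v)"
      by (rule h_pairing_le[OF Y_Lq[OF us(1)] Y_Lq[OF v]]) (use C in auto)
    also have "\<dots> \<le> (1 + C) * (2 * K')"
      using mu[of n] mv C(1) by (intro mult_left_mono) auto
    finally show ?thesis .
  qed
  have int_u: "\<bar>LINT z|lborel. us n z * v z\<bar> \<le> K * Y_norm v" for n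
  proof -
    have "\<bar>LINT z|lborel. us n z * v z\<bar> \<le> l2 lborel (us n) * l2 lborel v"
      by (intro l2_Cauchy_Schwarz_real Cc_sq_int Y_Cc us v)
    also have "\<dots> \<le> K * Y_norm v"
      using l2_jet_parts(1)[OF us(1)[of n]] us(3)[of n] l2_jet_parts(1)[OF v] K by (intro mult_mono l2_nonneg) auto
    finally show ?thesis .
  qed
  define Gb where "Gb = (1 + C) * (2 * K') + K * Y_norm v"
  have Gb: "\<bar>G n\<bar> \<le> Gb" for n using int_h[of n] int_u[of n] by (simp add: G_def Gb_def abs_le_iff)
  have Gb0: "Gb \<ge> 0" using Gb[of 0] by linarith
  define Nv where "Nv = (l2 lborel v)\<^sup>2"
  have Nv: "Nv \<ge> 0" by (simp add: Nv_def)
  \<comment> \<open>The denominator is \<open>4 * (1 + W)\<close> with \<open>W\<close> from below.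
    It makes the errors \<open>\<bar>r\<bar> \<le> e1 * s\<close> and
    \<open>e1 * \<bar>\<delta>\<bar> \<le> e1 * s * W\<close> add up to at most
    \<open>s * (e / 4)\<close>.\<close>
  define e1 where "e1 = min 1 (e / (4 * (1 + (Gb + Nv + 1))))"
  have e1: "e1 > 0" "e1 \<le> 1" using e Gb0 Nv by (auto simp: e1_def)
  have e1b: "e1 * (1 + (Gb + Nv + 1)) \<le> e / 4"
  proof -
    have "e1 * (1 + (Gb + Nv + 1)) \<le> (e / (4 * (1 + (Gb + Nv + 1)))) * (1 + (Gb + Nv + 1))"
      using Gb0 Nv by (intro mult_right_mono) (auto simp: e1_def)
    also have "\<dots> = e / 4" using Gb0 Nv by (simp add: field_simps)
    finally show ?thesis .
  qed
  obtain d1 where d1: "d1 > 0" "d1 \<le> 1"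
    "\<And>(u :: real \<times> (real ^ 'n) \<Rightarrow> real) v s. Lq lborel u \<Longrightarrow> Lq lborel v \<Longrightarrow> mass lborel u \<le> K' \<Longrightarrow> mass lborel v \<le> K' \<Longrightarrow> 0 < s \<Longrightarrow> s < d1 \<Longrightarrow>
      \<bar>(LINT z|lborel. H (u z + s * v z)) - (LINT z|lborel. H (u z)) - s * (LINT z|lborel. h (u z) * v z)\<bar> \<le> e1 * s"
    using H_functional_diff[OF K'(1) e1(1), where M = "lborel :: (real \<times> (real ^ 'n)) measure"] by blast
  have "((\<lambda>t. (\<Phi> (\<mu> + t) - \<Phi> \<mu>) / t) \<longlongrightarrow> 1) (at 0)" using \<Phi> unfolding DERIV_def .
  then have "eventually (\<lambda>t. dist ((\<Phi> (\<mu> + t) - \<Phi> \<mu>) / t) 1 < e1) (at 0)" using e1(1) by (rule tendstoD)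
  then obtain d2 where d2: "d2 > 0" "\<And>t. t \<noteq> 0 \<Longrightarrow> dist t 0 < d2 \<Longrightarrow> dist ((\<Phi> (\<mu> + t) - \<Phi> \<mu>) / t) 1 < e1"
    unfolding eventually_at by blast
  have \<Phi>b: "\<Phi> (\<mu> + t) \<ge> \<Phi> \<mu> + t - e1 * \<bar>t\<bar>" if t: "\<bar>t\<bar> < d2" for t
  proof (cases "t = 0")
    case False
    have "\<bar>(\<Phi> (\<mu> + t) - \<Phi> \<mu>) / t - 1\<bar> < e1" using d2(2)[OF False] t by (simp add: dist_real_def)
    then have "\<bar>(\<Phi> (\<mu> + t) - \<Phi> \<mu>) / t - 1\<bar> * \<bar>t\<bar> \<le> e1 * \<bar>t\<bar>" by (intro mult_right_mono) auto
    then have "\<bar>((\<Phi> (\<mu> + t) - \<Phi> \<mu>) / t - 1) * t\<bar> \<le> e1 * \<bar>t\<bar>" by (simp only: abs_mult)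
    moreover have "((\<Phi> (\<mu> + t) - \<Phi> \<mu>) / t - 1) * t = \<Phi> (\<mu> + t) - \<Phi> \<mu> - t" using False by (simp add: field_simps)
    ultimately show ?thesis by linarith
  qed simp
  define W where "W = Gb + Nv + 1"
  have W: "W > 0" using Gb0 Nv by (simp add: W_def)
  define N2 where "N2 = kin v + Nv"
  have N2: "N2 \<ge> 0" using Nv by (simp add: N2_def)
  \<comment> \<open>The four bounds serve, in this order: differentiability of the integral of
    \<open>H\<close>, the linear approximation of \<open>\<Phi>\<close>, positivity of
    \<open>V\<close> at the perturbed function, and smallness of the terms quadratic in
    \<open>s\<close>.\<close>
  define s where "s = min (d1 / 2) (min (min (d2 / (2 * W)) (\<mu> / (2 * W))) (e / (2 * (N2 + 1))))"
  have s: "0 < s" "s < d1" "s * W < d2" "s * W < \<mu>" "s * N2 \<le> e / 2"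
  proof -
    show "0 < s" using d1 d2 W \<mu> e N2 by (simp add: s_def)
    show "s < d1" using d1 by (simp add: s_def min_def)
    have "s \<le> d2 / (2 * W)" "s \<le> \<mu> / (2 * W)" by (auto simp: s_def)
    then have "s * W \<le> d2 / 2" "s * W \<le> \<mu> / 2" using W by (auto simp: field_simps)
    then show "s * W < d2" "s * W < \<mu>" using d2 \<mu> by auto
    have "s * N2 \<le> (e / (2 * (N2 + 1))) * N2" using N2 by (intro mult_right_mono) (auto simp: s_def)
    also have "\<dots> \<le> e / 2" using N2 e by (simp add: field_simps)
    finally show "s * N2 \<le> e / 2" .
  qed
  have bound: "s * (G n - A n) \<le> (kin (us n) / 2 - \<Phi> \<mu>) + s * (e / 4) + s * (e / 4)" for n
  proof -
    define r where "r = (LINT z|lborel. H (us n z + s * v z)) - (LINT z|lborel. H (us n z)) - s * (LINT z|lborel. h (us n z) * v z)"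
    have r: "\<bar>r\<bar> \<le> e1 * s" unfolding r_def
      by (rule d1(3)[OF Y_Lq[OF us(1)] Y_Lq[OF v] mu mv s(1,2)])
    \<comment> \<open>The exact increment of \<open>V\<close> from \<open>us n\<close> to
      \<open>?w\<close>, by \<open>V_expand\<close>.\<close>
    define \<delta> where "\<delta> = s * G n - s\<^sup>2 * Nv / 2 + r"
    let ?w = "\<lambda>z. us n z + s * v z"
    have w: "?w \<in> Y" by (rule Y_linear(1)[OF us(1) Y_linear(5)[OF v v]])
    have Vw: "V ?w = \<mu> + \<delta>"
      using V_expand[OF us(1)[of n] v, of s] unfolding r_def[symmetric] G_def[symmetric] Nv_def[symmetric] \<delta>_def us(2) by linarith
    have \<delta>: "\<bar>\<delta>\<bar> \<le> s * W"
    proof -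
      have s1: "s \<le> 1" using s(2) d1(2) by linarith
      have "\<bar>s * G n\<bar> \<le> s * Gb" using Gb[of n] s(1) by (simp add: abs_mult)
      moreover have "0 \<le> s\<^sup>2 * Nv / 2" using Nv by simp
      moreover have "s\<^sup>2 * Nv / 2 \<le> s * Nv"
      proof -
        have "s\<^sup>2 * Nv \<le> s * Nv" using s1 s(1) Nv by (intro mult_right_mono) (auto simp: power2_eq_square mult_left_le)
        moreover have "0 \<le> s * Nv" using s(1) Nv by simp
        ultimately show ?thesis by linarith
      qed
      moreover have "\<bar>r\<bar> \<le> s * 1" using r e1(2) s(1) mult_right_mono[of e1 1 s] by linarith
      ultimately show ?thesis unfolding \<delta>_def W_def distrib_left by linarith
    qed
    have "V ?w > 0" using Vw \<delta> s(4) by linarith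
    then have "\<Phi> (\<mu> + \<delta>) \<le> kin ?w / 2" using ge[OF w] Vw by simp
    moreover have "\<Phi> \<mu> + \<delta> - e1 * \<bar>\<delta>\<bar> \<le> \<Phi> (\<mu> + \<delta>)" using \<delta> s(3) by (intro \<Phi>b) linarith
    moreover have "kin ?w / 2 = kin (us n) / 2 + s * A n + s\<^sup>2 * kin v / 2"
      using kin_add[OF us(1)[of n] v, of s] by (simp add: A_def)
    ultimately have "s * G n - s * A n \<le> (kin (us n) / 2 - \<Phi> \<mu>) + s\<^sup>2 * Nv / 2 + s\<^sup>2 * kin v / 2 - r + e1 * \<bar>\<delta>\<bar>"
      unfolding \<delta>_def by linarith
    also have "\<dots> \<le> (kin (us n) / 2 - \<Phi> \<mu>) + s * (e / 4) + s * (e / 4)"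
    proof -
      have "s\<^sup>2 * Nv / 2 + s\<^sup>2 * kin v / 2 = s * (s * N2) / 2" by (simp add: N2_def power2_eq_square algebra_simps)
      also have "\<dots> \<le> s * (e / 2) / 2" using s(1,5) by (intro divide_right_mono mult_left_mono) auto
      finally have 1: "s\<^sup>2 * Nv / 2 + s\<^sup>2 * kin v / 2 \<le> s * (e / 4)" by simp
      have "e1 * \<bar>\<delta>\<bar> \<le> e1 * (s * W)" using \<delta> e1 by (intro mult_left_mono) auto
      then have "- r + e1 * \<bar>\<delta>\<bar> \<le> s * (e1 * (1 + W))" using r by (simp add: algebra_simps)
      also have "\<dots> \<le> s * (e / 4)" using e1b s(1) by (intro mult_left_mono) (auto simp: W_def)
      finally show ?thesis using 1 by linarith
    qed
    finally show ?thesis by (simp add: right_diff_distrib)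
  qed
  have "eventually (\<lambda>n. kin (us n) / 2 < \<Phi> \<mu> + s * (e / 2)) sequentially"
    using lim e s(1) by (intro order_tendstoD(2)[OF lim]) auto
  then show ?thesis
  proof (rule eventually_mono)
    fix n assume "kin (us n) / 2 < \<Phi> \<mu> + s * (e / 2)"
    then have "s * (G n - A n) \<le> s * e" using bound[of n] by (simp add: algebra_simps)
    then show "energy_gap (us n) v \<le> e" using s(1) by (simp add: gap)
  qed
qed

lemma V_translate: "u \<in> Y \<Longrightarrow> V (\<lambda>z. u (z + a)) = V u"
proof -
  assume u: "u \<in> Y"
  note [measurable] = Cc_measurable[OF Y_Cc(1)[OF u]] borel_measurable_continuous_onI[OF H_continuous]
  show ?thesis unfolding V_def by (rule lborel_integral_translate) measurable
qed

text \<open>The conclusion allows arbitrary translations because a minimizing sequence will later have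
  to be recentred.\<close>

lemma exists_palais_smale:
  assumes \<xi>: "\<xi> > 0" "2 * H \<xi> - \<xi>\<^sup>2 > 0"
  obtains \<mu> K us where "\<mu> > 0" "K > 0" "\<And>n. us n \<in> Y" "\<And>n. V (us n) = \<mu>" "\<And>n. Y_norm (us n) \<le> K"
    "\<And>v zs. v \<in> Y \<Longrightarrow> (\<lambda>n. energy_gap (\<lambda>z. us n (z + zs n)) v) \<longlonglongrightarrow> 0"
proof -
  obtain K where K: "K > 0" "\<And>u. u \<in> Y \<Longrightarrow> V u > 0 \<Longrightarrow> (l2 lborel u)\<^sup>2 \<le> K * kin u powr (real (hdim TYPE('n)) / (real (hdim TYPE('n)) - 2))"
    "\<And>u. u \<in> Y \<Longrightarrow> V u > 0 \<Longrightarrow> V u \<le> K * kin u powr (real (hdim TYPE('n)) / (real (hdim TYPE('n)) - 2))"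
    by (rule kin_controls) blast
  define \<theta> where "\<theta> = (real (hdim TYPE('n)) - 2) / real (hdim TYPE('n))"
  have \<theta>: "0 < \<theta>" "\<theta> < 1"
    using hdim_real_ge_3 unfolding \<theta>_def by (intro divide_pos_pos, linarith, linarith) simp
  define S where "S = {u. u \<in> Y \<and> V u > 0}"
  have "S \<noteq> {}" using exists_V_pos[OF \<xi>, where 'n = 'n] by (auto simp: S_def)
  define Q where "Q u = kin u / V u powr \<theta>" for u :: "real \<times> (real ^ 'n) \<Rightarrow> real"
  \<comment> \<open>This is \<open>kin_controls\<close> raised to the power \<open>\<theta>\<close>,
    the reciprocal of its exponent. It makes the infimum \<open>m\<close> positive.\<close>
  have Qge: "Q u \<ge> 1 / K powr \<theta>" if "u \<in> S" for u
  proof -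
    have u: "u \<in> Y" "V u > 0" using that by (auto simp: S_def)
    have T: "kin u > 0" by (rule V_pos_imp[OF u])
    have "V u powr \<theta> \<le> (K * kin u powr (real (hdim TYPE('n)) / (real (hdim TYPE('n)) - 2))) powr \<theta>"
      using K(3)[OF u] u \<theta> by (intro powr_mono2) auto
    also have "\<dots> = K powr \<theta> * (kin u powr (real (hdim TYPE('n)) / (real (hdim TYPE('n)) - 2))) powr \<theta>" by (rule powr_mult)
    also have "(kin u powr (real (hdim TYPE('n)) / (real (hdim TYPE('n)) - 2))) powr \<theta> = kin u"
    proof -
      have "x / y * (y / x) = 1" if "x > 0" "y > 0" for x y :: real using that by simp
      then have "real (hdim TYPE('n)) / (real (hdim TYPE('n)) - 2) * \<theta> = 1"
        unfolding \<theta>_def by this (use hdim_real_ge_3 in linarith)+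
      then show ?thesis using T by (simp only: powr_powr powr_one)
    qed
    finally show ?thesis using u K(1) by (simp add: Q_def field_simps)
  qed
  define m where "m = Inf (Q ` S)"
  have bdd: "bdd_below (Q ` S)" by (rule bdd_belowI2) (rule Qge)
  have m: "m > 0"
  proof -
    have "1 / K powr \<theta> \<le> m" unfolding m_def using \<open>S \<noteq> {}\<close> Qge by (intro cINF_greatest) auto
    moreover have "1 / K powr \<theta> > 0" using K(1) by simp
    ultimately show ?thesis by linarith
  qed
  have mQ: "m \<le> Q u" if "u \<in> S" for u unfolding m_def using bdd that by (intro cINF_lower) auto
  \<comment> \<open>The solution of \<open>m * \<theta> / 2 * \<mu> powr (\<theta> - 1) = 1\<close>,
    which says that \<open>\<Phi>\<close>, defined next, has slope 1 at
    \<open>\<mu>\<close>.\<close>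
  define \<mu> where "\<mu> = (m * \<theta> / 2) powr (1 / (1 - \<theta>))"
  have \<mu>: "\<mu> > 0" using m \<theta> by (simp add: \<mu>_def)
  define \<Phi> where "\<Phi> v = m / 2 * v powr \<theta>" for v
  have \<Phi>: "(\<Phi> has_real_derivative 1) (at \<mu>)"
  proof -
    have "(\<Phi> has_real_derivative m / 2 * (\<theta> * \<mu> powr (\<theta> - 1))) (at \<mu>)"
      unfolding \<Phi>_def using \<mu> by (intro DERIV_cmult has_real_derivative_powr)
    moreover have "\<mu> powr (\<theta> - 1) = 1 / (m * \<theta> / 2)"
    proof -
      have "\<mu> powr (\<theta> - 1) = (m * \<theta> / 2) powr (- 1)"
      proof -
        have "1 / (1 - \<theta>) * (\<theta> - 1) = (\<theta> - 1) / (1 - \<theta>)" by simp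
        also have "\<dots> = - 1" using \<theta> by (subst minus_diff_eq[symmetric]) (simp only: minus_divide_left[symmetric], simp)
        finally show ?thesis unfolding \<mu>_def powr_powr by (rule arg_cong)
      qed
      then show ?thesis using m \<theta> by (simp add: powr_minus_divide)
    qed
    ultimately show ?thesis using m \<theta> by (simp add: field_simps)
  qed
  have ge: "\<Phi> (V u) \<le> kin u / 2" if "u \<in> Y" "V u > 0" for u
    using mQ[of u] that by (simp add: S_def \<Phi>_def Q_def field_simps)
  \<comment> \<open>Almost minimizers of \<open>Q\<close> are dilated to the level
    \<open>\<mu>\<close>; \<open>Q\<close> does not change, so the condition on \<open>Q\<close>
    becomes one on \<open>kin\<close>.\<close>
  have "\<exists>u. u \<in> Y \<and> V u = \<mu> \<and> kin u \<le> (m + inverse (real (Suc n))) * \<mu> powr \<theta>" for n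
  proof -
    have "m < m + inverse (real (Suc n))" by simp
    then obtain w where w: "w \<in> S" "Q w < m + inverse (real (Suc n))"
      unfolding m_def using cINF_less_iff[OF \<open>S \<noteq> {}\<close> bdd] by blast
    have wY: "w \<in> Y" "V w > 0" using w by (auto simp: S_def)
    define a where "a = (\<mu> / V w) powr (1 / real (hdim TYPE('n)))"
    have a: "a > 0" using \<mu> wY by (simp add: a_def)
    have aD: "a ^ hdim TYPE('n) = \<mu> / V w"
      using a powr_realpow[OF a, of "hdim TYPE('n)"] \<mu> wY hdim_real_ge_3 by (simp add: a_def powr_powr)
    have aD2: "a ^ hdim TYPE('n) / a\<^sup>2 = (\<mu> / V w) powr \<theta>"
    proof -
      have "a ^ hdim TYPE('n) / a\<^sup>2 = a powr real (hdim TYPE('n)) / a powr 2" using a powr_realpow[OF a, of "hdim TYPE('n)"] by simp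
      also have "\<dots> = a powr (real (hdim TYPE('n)) - 2)" by (rule powr_diff[symmetric])
      also have "\<dots> = (\<mu> / V w) powr \<theta>" by (simp add: a_def powr_powr \<theta>_def)
      finally show ?thesis .
    qed
    have "kin (\<lambda>z. w (scl a z)) = (\<mu> / V w) powr \<theta> * kin w" unfolding scl_functionals(1)[OF wY(1) a] aD2 ..
    also have "\<dots> = \<mu> powr \<theta> * Q w" using \<mu> wY by (simp add: Q_def powr_divide)
    also have "\<dots> \<le> \<mu> powr \<theta> * (m + inverse (real (Suc n)))" using w by (intro mult_left_mono) auto
    finally have "kin (\<lambda>z. w (scl a z)) \<le> (m + inverse (real (Suc n))) * \<mu> powr \<theta>" by (simp add: mult.commute)
    moreover have "V (\<lambda>z. w (scl a z)) = \<mu>" using V_scl[OF wY(1) a] aD wY by simp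
    ultimately show ?thesis using Y_scl(1)[OF wY(1) a] by blast
  qed
  then have "\<exists>us. \<forall>n. us n \<in> Y \<and> V (us n) = \<mu> \<and> kin (us n) \<le> (m + inverse (real (Suc n))) * \<mu> powr \<theta>"
    by (rule choice[OF allI])
  then obtain us where us: "\<And>n. us n \<in> Y" "\<And>n. V (us n) = \<mu>"
    "\<And>n. kin (us n) \<le> (m + inverse (real (Suc n))) * \<mu> powr \<theta>" by blast
  have Vpos: "V (us n) > 0" for n using us(2) \<mu> by simp
  have lim: "(\<lambda>n. kin (us n) / 2) \<longlonglongrightarrow> \<Phi> \<mu>"
  proof (rule tendsto_sandwich)
    show "eventually (\<lambda>n. \<Phi> \<mu> \<le> kin (us n) / 2) sequentially"
      using ge[OF us(1) Vpos] us(2) by auto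
    show "eventually (\<lambda>n. kin (us n) / 2 \<le> (m + inverse (real (Suc n))) * \<mu> powr \<theta> / 2) sequentially"
      using us(3) by (intro always_eventually allI divide_right_mono) auto
    have "(\<lambda>n. (m + inverse (real (Suc n))) * \<mu> powr \<theta> / 2) \<longlonglongrightarrow> (m + 0) * \<mu> powr \<theta> / 2"
      by (intro tendsto_intros LIMSEQ_inverse_real_of_nat) auto
    then show "(\<lambda>n. (m + inverse (real (Suc n))) * \<mu> powr \<theta> / 2) \<longlonglongrightarrow> \<Phi> \<mu>" by (simp add: \<Phi>_def)
  qed (rule tendsto_const)
  define T0 where "T0 = (m + 1) * \<mu> powr \<theta>"
  have T0: "kin (us n) \<le> T0" for n
  proof -
    have "inverse (real (Suc n)) \<le> 1" by (simp add: field_simps)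
    then have "(m + inverse (real (Suc n))) * \<mu> powr \<theta> \<le> T0" unfolding T0_def by (intro mult_right_mono) auto
    then show ?thesis using us(3)[of n] by linarith
  qed
  \<comment> \<open>The dilations fix \<open>V\<close> and bound \<open>kin\<close>; the remaining
    part of the norm is bounded through \<open>kin_controls\<close>. The summand 1 makes
    \<open>K2\<close> positive.\<close>
  define K2 where "K2 = sqrt (T0 + K * T0 powr (real (hdim TYPE('n)) / (real (hdim TYPE('n)) - 2))) + 1"
  have T0p: "T0 \<ge> 0" using T0[of 0] by (smt (verit) zero_le_power2)
  have K2: "K2 > 0" unfolding K2_def using K(1) T0p by (simp add: add_nonneg_pos)
  have nb: "Y_norm (us n) \<le> K2" for n
  proof -
    have "(l2 lborel (us n))\<^sup>2 \<le> K * kin (us n) powr (real (hdim TYPE('n)) / (real (hdim TYPE('n)) - 2))" by (rule K(2)[OF us(1) Vpos])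
    also have "\<dots> \<le> K * T0 powr (real (hdim TYPE('n)) / (real (hdim TYPE('n)) - 2))"
    proof (rule mult_left_mono)
      have "0 \<le> real (hdim TYPE('n)) / (real (hdim TYPE('n)) - 2)"
        using hdim_real_ge_3 by (intro divide_nonneg_nonneg) linarith+
      then show "kin (us n) powr (real (hdim TYPE('n)) / (real (hdim TYPE('n)) - 2)) \<le> T0 powr (real (hdim TYPE('n)) / (real (hdim TYPE('n)) - 2))"
        by (rule powr_mono2[OF _ zero_le_power2 T0])
    qed (use K(1) in simp)
    finally have "(Y_norm (us n))\<^sup>2 \<le> T0 + K * T0 powr (real (hdim TYPE('n)) / (real (hdim TYPE('n)) - 2))"
      using Y_norm_split[OF us(1)[of n]] T0[of n] by linarith
    then have "sqrt ((Y_norm (us n))\<^sup>2) \<le> sqrt (T0 + K * T0 powr (real (hdim TYPE('n)) / (real (hdim TYPE('n)) - 2)))" by (rule real_sqrt_le_mono)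
    then show ?thesis by (simp add: K2_def)
  qed
  have conv: "(\<lambda>n. energy_gap (\<lambda>z. us n (z + zs n)) v) \<longlonglongrightarrow> 0" if v: "v \<in> Y" for v zs
  proof (rule tendstoI)
    fix e :: real assume e: "e > 0"
    define ts where "ts n = (\<lambda>z. us n (z + zs n))" for n
    have ts: "ts n \<in> Y" "V (ts n) = \<mu>" "Y_norm (ts n) \<le> K2" for n
      unfolding ts_def using Y_linear(7)[OF us(1) us(1)] V_translate[OF us(1)] us(2) Y_translate(1)[OF us(1)] nb by simp_all
    have tlim: "(\<lambda>n. kin (ts n) / 2) \<longlonglongrightarrow> \<Phi> \<mu>"
      unfolding ts_def Y_translate(2)[OF us(1)] by (rule lim)
    have mv: "(\<lambda>z. (- 1) * v z) \<in> Y" by (rule Y_linear(5)[OF v v])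
    have neg: "energy_gap u (\<lambda>z. (- 1) * v z) = - energy_gap u v" for u
      using Y_linear(6)[OF v v, of "- 1"] by (simp add: energy_gap_def)
    have "eventually (\<lambda>n. energy_gap (ts n) v \<le> e / 2) sequentially"
      by (rule palais_smale_one_sided[OF ts K2 \<Phi> \<mu> ge tlim v]) (use e in auto)
    moreover have "eventually (\<lambda>n. energy_gap (ts n) (\<lambda>z. (- 1) * v z) \<le> e / 2) sequentially"
      by (rule palais_smale_one_sided[OF ts K2 \<Phi> \<mu> ge tlim mv]) (use e in auto)
    ultimately show "eventually (\<lambda>n. dist (energy_gap (\<lambda>z. us n (z + zs n)) v) 0 < e) sequentially"
      unfolding neg ts_def[symmetric] by eventually_elim (use e in \<open>simp add: abs_le_iff abs_less_iff\<close>)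
  qed
  show thesis by (rule that[OF \<mu> K2 us(1) us(2) nb conv])
qed

end

section \<open>Nonvanishing and local compactness\<close>

context subcritical
begin

text \<open>If all averages were small, \<open>superlevel_l2\<close> would make the part of
  \<open>u\<close> above \<open>\<epsilon>\<close> small in \<open>l2\<close>. Below
  \<open>\<epsilon>\<close> the integrand of \<open>V\<close> is not positive, and above it is
  bounded by a multiple of that part plus a small multiple of the \<open>p + 1\<close> power.
  Together this is less than \<open>\<mu>\<close>.\<close>

lemma nonvanishing:
  assumes K: "K > 0" and \<mu>: "\<mu> > 0"
  obtains t \<delta> where "t > 0" "\<delta> > 0"
    "\<And>u. u \<in> Y \<Longrightarrow> Y_norm u \<le> K \<Longrightarrow> V u = \<mu> \<Longrightarrow> \<exists>z. \<bar>avg (Box t) u z\<bar> > \<delta>"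
proof -
  obtain \<epsilon> where \<epsilon>: "\<epsilon> > 0" "\<And>t. \<bar>t\<bar> \<le> \<epsilon> \<Longrightarrow> \<bar>H t\<bar> \<le> t\<^sup>2 / 2" by (rule H_small) blast
  obtain C1 where C1: "C1 > 0" "\<And>u s. u \<in> Y \<Longrightarrow> s > 0 \<Longrightarrow> Y_norm u \<le> s \<Longrightarrow> (LINT z|lborel. \<bar>u z\<bar> powr (p + 1)) \<le> C1 * s powr (p + 1)"
    by (rule Y_embedding) blast
  define Q where "Q = C1 * K powr (p + 1)"
  have Q: "Q > 0" using C1 K by (simp add: Q_def)
  \<comment> \<open>The integral of the \<open>p + 1\<close> power is at most \<open>Q\<close>, so
    this term costs at most \<open>\<mu> / 2\<close>; \<open>t\<close> is chosen below so that the
    other one costs \<open>\<mu> / 4\<close>.\<close>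
  define \<eta> where "\<eta> = \<mu> / (2 * Q)"
  have \<eta>: "\<eta> > 0" using \<mu> Q by (simp add: \<eta>_def)
  obtain C where C: "C > 0" "\<And>t. \<bar>H t\<bar> \<le> C * t\<^sup>2 + \<eta> * \<bar>t\<bar> powr (p + 1)" by (rule H_bound_1[OF \<eta>]) blast
  define b where "b = box_const TYPE('n) * K"
  have b: "b > 0" using box_const_ge_1[where 'n='n] K by (simp add: b_def)
  define t where "t = sqrt (\<mu> / (16 * C * b\<^sup>2))"
  have t: "t > 0" using \<mu> C b by (simp add: t_def)
  have tb: "C * (4 * (b * t)\<^sup>2) = \<mu> / 4"
    using \<mu> C b by (simp add: t_def power_mult_distrib)
  show thesis
  proof (rule that[OF t])
    show "\<epsilon> / 4 > 0" using \<epsilon> by simp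
    fix u assume u: "u \<in> Y" "Y_norm u \<le> K" "V u = \<mu>"
    show "\<exists>z. \<bar>avg (Box t) u z\<bar> > \<epsilon> / 4"
    proof (rule ccontr)
      assume "\<not> ?thesis"
      then have le4: "\<bar>avg (Box t) u z\<bar> \<le> \<epsilon> / 4" for z by (meson not_less)
      have le: "\<bar>avg (Box t) u z\<bar> \<le> \<epsilon> / 2" for z
        by (rule order.trans[OF le4]) (use \<epsilon>(1) in simp)
      let ?I = "\<lambda>z. indicator {z. \<bar>u z\<bar> > \<epsilon>} z * (u z)\<^sup>2 :: real"
      note Lu = LqD[OF Y_Lq[OF u(1)]]
      note [measurable] = Cc_measurable[OF Y_Cc(1)[OF u(1)]]
      have I: "integrable lborel ?I"
        by (rule Bochner_Integration.integrable_bound[OF Lu(2)]) (auto simp: indicator_def)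
      have "V u \<le> (LINT z|lborel. C * ?I z + \<eta> * \<bar>u z\<bar> powr (p + 1))"
        unfolding V_def
      proof (rule integral_mono)
        show "integrable lborel (\<lambda>z. H (u z) - (u z)\<^sup>2 / 2)" using Lq_H[OF Y_Lq[OF u(1)]] Lu by simp
        show "integrable lborel (\<lambda>z. C * ?I z + \<eta> * \<bar>u z\<bar> powr (p + 1))" using I Lu by simp
        fix z
        have nn: "0 \<le> \<eta> * \<bar>u z\<bar> powr (p + 1)" "0 \<le> (u z)\<^sup>2 / 2" using \<eta> by auto
        show "H (u z) - (u z)\<^sup>2 / 2 \<le> C * ?I z + \<eta> * \<bar>u z\<bar> powr (p + 1)"
        proof (cases "\<bar>u z\<bar> > \<epsilon>")
          case True
          have "H (u z) \<le> C * (u z)\<^sup>2 + \<eta> * \<bar>u z\<bar> powr (p + 1)" using C(2)[of "u z"] by linarith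
          moreover have I: "?I z = (u z)\<^sup>2" using True by simp
          ultimately show ?thesis using nn unfolding I by linarith
        next
          case False
          then have "H (u z) \<le> (u z)\<^sup>2 / 2" using \<epsilon>(2)[of "u z"] by linarith
          moreover have I: "?I z = 0" using False by simp
          ultimately show ?thesis using nn unfolding I by linarith
        qed
      qed
      also have "\<dots> = C * (LINT z|lborel. ?I z) + \<eta> * (LINT z|lborel. \<bar>u z\<bar> powr (p + 1))"
        using I Lu by simp
      also have "\<dots> \<le> C * (4 * (b * t)\<^sup>2) + \<eta> * Q"
      proof (intro add_mono mult_left_mono)
        have "(LINT z|lborel. ?I z) \<le> 4 * (box_const TYPE('n) * t * l2 lborel (pot u))\<^sup>2"
          by (rule superlevel_l2[OF u(1) t _ le]) (use \<epsilon> in simp)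
        also have "\<dots> \<le> 4 * (box_const TYPE('n) * t * K)\<^sup>2"
          using l2_jet_parts(2)[OF u(1)] u(2) t box_const_ge_1[where 'n='n]
          by (intro mult_left_mono power_mono mult_nonneg_nonneg) (auto simp: l2_nonneg)
        also have "\<dots> = 4 * (b * t)\<^sup>2" by (simp add: b_def mult_ac)
        finally show "(LINT z|lborel. ?I z) \<le> 4 * (b * t)\<^sup>2" .
        show "(LINT z|lborel. \<bar>u z\<bar> powr (p + 1)) \<le> Q" unfolding Q_def by (rule C1(2)[OF u(1) K u(2)])
      qed (use C \<eta> in auto)
      also have "\<dots> = \<mu> / 4 + \<mu> / 2" using tb Q by (simp add: \<eta>_def)
      finally show False using u(3) \<mu> by simp
    qed
  qed
qed

end

lemma sq_int_indicator:
  fixes f :: "'a \<Rightarrow> real"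
  assumes "sq_int M f" "S \<in> sets M"
  shows "sq_int M (\<lambda>z. indicator S z * f z)" "l2 M (\<lambda>z. indicator S z * f z) \<le> l2 M f"
proof -
  show "sq_int M (\<lambda>z. indicator S z * f z)"
    by (rule sq_int_bound[OF _ sq_int_integrable[OF assms(1)]])
      (use assms sq_int_measurable[OF assms(1)] in \<open>auto simp: indicator_def\<close>)
  show "l2 M (\<lambda>z. indicator S z * f z) \<le> l2 M f"
    by (rule l2_mono[OF assms(1)]) (simp add: indicator_def)
qed

text \<open>Cauchy-Schwarz on \<open>B\<close>. It converts a lower bound for an average into one
  for the \<open>l2\<close> norm on a ball, a quantity that survives a local limit.\<close>

lemma avg_0_le_l2_indicator:
  fixes f :: "'a::euclidean_space \<Rightarrow> real"
  assumes f: "Cc f" and B: "compact B" "measure lborel B > 0" and S: "B \<subseteq> S" "S \<in> sets borel"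
  shows "\<bar>avg B f 0\<bar> \<le> l2 lborel (\<lambda>z. indicator S z * f z) / sqrt (measure lborel B)"
proof -
  have [measurable]: "B \<in> sets borel" using B(1) by (rule borel_compact)
  have fin: "emeasure lborel B < \<infinity>" using B(1) by (rule emeasure_compact_finite)
  let ?m = "measure lborel B"
  have sB: "sq_int lborel (indicator B :: 'a \<Rightarrow> real)" "l2 lborel (indicator B :: 'a \<Rightarrow> real) = sqrt ?m"
    using fin by (auto simp: sq_int_def l2_def power2_eq_square indicator_inter_arith[symmetric])
  have sS: "sq_int lborel (\<lambda>z. indicator S z * f z)"
    by (rule sq_int_indicator[OF Cc_sq_int[OF f]]) (use S(2) in simp)
  have eq: "indicator B z * f z = indicator B z * (indicator S z * f z)" for z
    using S(1) by (auto simp: indicator_def)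
  have "\<bar>LINT \<zeta>|lborel. indicator B \<zeta> * f \<zeta>\<bar> \<le> sqrt ?m * l2 lborel (\<lambda>z. indicator S z * f z)"
    unfolding eq using l2_Cauchy_Schwarz_real[OF sB(1) sS] by (simp add: sB(2))
  then have "\<bar>avg B f 0\<bar> \<le> sqrt ?m * l2 lborel (\<lambda>z. indicator S z * f z) / ?m"
    using B(2) by (simp add: avg_def divide_right_mono)
  also have "\<dots> = l2 lborel (\<lambda>z. indicator S z * f z) / sqrt ?m"
    using B(2) by (metis real_div_sqrt less_imp_le mult.commute times_divide_eq_right divide_divide_eq_right)
  finally show ?thesis .
qed

lemma avg_le_l2:
  fixes f :: "'a::euclidean_space \<Rightarrow> real"
  assumes f: "Cc f" and B: "compact B" "measure lborel B > 0"
  shows "\<bar>avg B f z\<bar> \<le> l2 lborel f / sqrt (measure lborel B)"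
  using avg_0_le_l2_indicator[OF Cc_translate[OF f, of z] B, of UNIV] avg_translate[of B f z 0]
    l2_translate[OF Cc_measurable[OF f], of z] by simp

lemma avg_diff:
  fixes f :: "'a::euclidean_space \<Rightarrow> real"
  assumes "Cc f" "Cc g" "B \<in> sets borel"
  shows "avg B (\<lambda>z. f z - g z) z = avg B f z - avg B g z"
proof -
  have i: "integrable lborel (\<lambda>\<zeta>. indicator B \<zeta> * f (z + \<zeta>))" if "Cc f" for f :: "'a \<Rightarrow> real"
  proof -
    have C: "Cc (\<lambda>\<zeta>. f (z + \<zeta>))" using Cc_translate[OF that, of z] by (simp add: add.commute)
    show ?thesis
      by (rule Bochner_Integration.integrable_bound[OF Cc_integrable[OF C]])
        (use assms(3) Cc_measurable[OF C] in \<open>auto simp: indicator_def\<close>)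
  qed
  show ?thesis using i[OF assms(1)] i[OF assms(2)] by (simp add: avg_def right_diff_distrib diff_divide_distrib)
qed

text \<open>Averaging commutes with translations, so \<open>l2_increment_Y\<close> applies to the
  increments. At a fixed scale, the averages of a bounded family in \<open>Y\<close> are therefore
  equicontinuous.\<close>

lemma avg_modulus:
  fixes u :: "real \<times> (real ^ 'n) \<Rightarrow> real"
  assumes u: "u \<in> Y_space" "Y_norm u \<le> K" and t: "t > 0"
  shows "\<bar>avg (Box t) u (z + (s, \<eta>)) - avg (Box t) u z\<bar>
    \<le> (\<bar>s\<bar> + sqrt (2 * norm \<eta>)) * K / sqrt (measure lborel (Box t :: (real \<times> (real ^ 'n)) set))"
proof -
  have c: "Cc u" by (rule Y_Cc[OF u(1)])
  have cB: "compact (Box t :: (real \<times> (real ^ 'n)) set)" by (rule compact_Box)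
  have "avg (Box t) u (z + (s, \<eta>)) - avg (Box t) u z = avg (Box t) (\<lambda>z. u (z + (s, \<eta>)) - u z) z"
    using avg_diff[OF Cc_translate[OF c] c borel_compact[OF cB]] by (simp add: avg_translate)
  also have "\<bar>\<dots>\<bar> \<le> l2 lborel (\<lambda>z. u (z + (s, \<eta>)) - u z) / sqrt (measure lborel (Box t :: (real \<times> (real ^ 'n)) set))"
    by (rule avg_le_l2[OF Cc_arith(2)[OF Cc_translate[OF c] c] cB measure_Box_pos[OF t]])
  also have "\<dots> \<le> (\<bar>s\<bar> + sqrt (2 * norm \<eta>)) * K / sqrt (measure lborel (Box t :: (real \<times> (real ^ 'n)) set))"
  proof (rule divide_right_mono)
    have "l2 lborel (\<lambda>z. u (z + (s, \<eta>)) - u z) \<le> (\<bar>s\<bar> + sqrt (2 * norm \<eta>)) * l2 lborel (pot u)"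
      by (rule l2_increment_Y[OF u(1)])
    also have "\<dots> \<le> (\<bar>s\<bar> + sqrt (2 * norm \<eta>)) * K"
      using l2_jet_parts(2)[OF u(1)] u(2) by (intro mult_left_mono) auto
    finally show "l2 lborel (\<lambda>z. u (z + (s, \<eta>)) - u z) \<le> (\<bar>s\<bar> + sqrt (2 * norm \<eta>)) * K" .
  qed simp
  finally show ?thesis .
qed

lemma avg_measurable:
  fixes f :: "'a::euclidean_space \<Rightarrow> real"
  assumes [measurable]: "f \<in> borel_measurable borel" "B \<in> sets borel"
  shows "avg B f \<in> borel_measurable borel"
  unfolding avg_def[abs_def] by measurable

text \<open>Averages over small boxes are bounded and equicontinuous, so one subsequence makes them
  converge pointwise at all scales \<open>1 / (k + 1)\<close>, hence in \<open>l2\<close> on every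
  ball. By \<open>avg_Box_l2\<close> each function is within a multiple of the scale of its
  averages, uniformly along the sequence, which gives the Cauchy property.\<close>

lemma Y_local_compactness:
  fixes us :: "nat \<Rightarrow> real \<times> (real ^ 'n) \<Rightarrow> real"
  assumes us: "\<And>n. us n \<in> Y_space" "\<And>n. Y_norm (us n) \<le> K"
  obtains r :: "nat \<Rightarrow> nat" where "strict_mono r"
    "\<And>R e. e > 0 \<Longrightarrow> \<exists>N. \<forall>m\<ge>N. \<forall>n\<ge>N. l2 lborel (\<lambda>z. indicator (cball 0 R) z * (us (r m) z - us (r n) z)) < e"
proof -
  have K: "K \<ge> 0" using us(2)[of 0] l2_jet_parts(3)[OF us(1)[of 0]] by linarith
  let ?T = "\<lambda>k::nat. 1 / real (Suc k)"
  have T: "?T k > 0" for k by simp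
  let ?m = "\<lambda>k. measure lborel (Box (?T k) :: (real \<times> (real ^ 'n)) set)"
  have m: "?m k > 0" for k by (rule measure_Box_pos[OF T])
  obtain Q :: "(real \<times> (real ^ 'n)) set" where Q: "countable Q" "\<And>X. open X \<Longrightarrow> X \<noteq> {} \<Longrightarrow> \<exists>d\<in>Q. d \<in> X"
    using countable_dense_exists by blast
  \<comment> \<open>The factor \<open>sqrt (?m k)\<close> makes the bound \<open>K\<close>
    independent of the scale, so that the scales and the dense set of points can be treated as one
    countable index set.\<close>
  let ?f = "\<lambda>n (k, z). sqrt (?m k) * avg (Box (?T k)) (us n) z"
  have bd: "\<bar>avg (Box (?T k)) (us n) z\<bar> \<le> K / sqrt (?m k)" for n k z
  proof -
    have "\<bar>avg (Box (?T k)) (us n) z\<bar> \<le> l2 lborel (us n) / sqrt (?m k)"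
      by (rule avg_le_l2[OF Y_Cc(1)[OF us(1)] compact_Box m])
    also have "\<dots> \<le> K / sqrt (?m k)"
      using l2_jet_parts(1)[OF us(1)[of n]] us(2)[of n] by (intro divide_right_mono) auto
    finally show ?thesis .
  qed
  have "norm (?f n x) \<le> K" if "x \<in> (UNIV :: nat set) \<times> Q" for n x
  proof -
    obtain k z where x: "x = (k, z)" by (cases x)
    have "norm (?f n x) = sqrt (?m k) * \<bar>avg (Box (?T k)) (us n) z\<bar>" by (simp add: x abs_mult)
    also have "\<dots> \<le> sqrt (?m k) * (K / sqrt (?m k))" by (intro mult_left_mono bd) simp
    also have "\<dots> = K" using m[of k] by simp
    finally show ?thesis .
  qed
  moreover have "countable ((UNIV :: nat set) \<times> Q)" using Q(1) by simp
  ultimately obtain r where r: "strict_mono (r :: nat \<Rightarrow> nat)"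
    and conv: "\<And>x. x \<in> (UNIV :: nat set) \<times> Q \<Longrightarrow> \<exists>l. (\<lambda>n. ?f (r n) x) \<longlonglongrightarrow> l"
    using function_convergent_subsequence[of "(UNIV :: nat set) \<times> Q" ?f K] by blast
  let ?A = "\<lambda>k n z. avg (Box (?T k)) (us (r n)) z"
  have convQ: "Cauchy (\<lambda>n. ?A k n z)" if zQ: "z \<in> Q" for k z
  proof -
    obtain l where "(\<lambda>n. ?f (r n) (k, z)) \<longlonglongrightarrow> l" using conv[of "(k, z)"] zQ by auto
    then have "(\<lambda>n. sqrt (?m k) * ?A k n z) \<longlonglongrightarrow> l" by simp
    then have "(\<lambda>n. (1 / sqrt (?m k)) * (sqrt (?m k) * ?A k n z)) \<longlonglongrightarrow> (1 / sqrt (?m k)) * l"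
      by (rule tendsto_mult_left)
    moreover have "(1 / sqrt (?m k)) * (sqrt (?m k) * x) = x" for x using m[of k] by simp
    ultimately have "(\<lambda>n. ?A k n z) \<longlonglongrightarrow> (1 / sqrt (?m k)) * l" by simp
    then show ?thesis by (rule LIMSEQ_imp_Cauchy)
  qed
  \<comment> \<open>Convergence spreads from the dense set to all points by equicontinuity.\<close>
  have cauchy: "Cauchy (\<lambda>n. ?A k n z)" for k z
  proof (rule metric_CauchyI)
    fix e :: real assume e: "e > 0"
    let ?M = "\<lambda>s \<eta>. (\<bar>s\<bar> + sqrt (2 * norm (\<eta> :: real ^ 'n))) * K / sqrt (?m k)"
    let ?o = "0 :: real \<times> (real ^ 'n)"
    have "((\<lambda>y. ?M (fst y) (snd y)) \<longlongrightarrow> ?M (fst ?o) (snd ?o)) (nhds ?o)"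
    proof -
      have "isCont (\<lambda>y. ?M (fst y) (snd y)) (0 :: real \<times> (real ^ 'n))"
        using m[of k] by (intro continuous_intros) auto
      then show ?thesis unfolding isCont_def
        using tendsto_at_iff_tendsto_nhds[of "\<lambda>y. ?M (fst y) (snd y)" "0 :: real \<times> (real ^ 'n)"] by blast
    qed
    then have "eventually (\<lambda>y. ?M (fst y) (snd y) < e / 3) (nhds (0 :: real \<times> (real ^ 'n)))"
      by (rule order_tendstoD(2)) (use e in simp)
    then obtain d where d: "d > 0" "\<And>y :: real \<times> (real ^ 'n). dist y 0 < d \<Longrightarrow> ?M (fst y) (snd y) < e / 3"
      unfolding eventually_nhds_metric by blast
    obtain y where y: "y \<in> Q" "y \<in> ball z d" using Q(2)[of "ball z d"] d(1) by auto
    have close: "\<bar>?A k n y - ?A k n z\<bar> < e / 3" for n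
    proof -
      have "\<bar>avg (Box (?T k)) (us (r n)) (z + (fst (y - z), snd (y - z))) - ?A k n z\<bar> \<le> ?M (fst (y - z)) (snd (y - z))"
        by (rule avg_modulus[OF us(1) us(2) T])
      also have "\<dots> < e / 3" using d(2)[of "y - z"] y(2) by (simp add: dist_norm norm_minus_commute)
      also have "z + (fst (y - z), snd (y - z)) = y" by (simp only: prod.collapse) simp
      finally show ?thesis .
    qed
    obtain N where N: "\<And>i j. i \<ge> N \<Longrightarrow> j \<ge> N \<Longrightarrow> dist (?A k i y) (?A k j y) < e / 3"
      using metric_CauchyD[OF convQ[OF y(1), of k], of "e / 3"] e by auto
    have "dist (?A k i z) (?A k j z) < e" if "i \<ge> N" "j \<ge> N" for i j
      using N[OF that] close[of i] close[of j] unfolding dist_real_def by linarith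
    then show "\<exists>N. \<forall>i\<ge>N. \<forall>j\<ge>N. dist (?A k i z) (?A k j z) < e" by blast
  qed
  define a where "a k z = lim (\<lambda>n. ?A k n z)" for k z
  have a: "(\<lambda>n. ?A k n z) \<longlonglongrightarrow> a k z" for k z
    unfolding a_def using cauchy[of k z] by (simp add: Cauchy_convergent_iff convergent_LIMSEQ_iff)
  have Am [measurable]: "?A k n \<in> borel_measurable borel" for k n
    by (rule avg_measurable[OF Cc_measurable[OF Y_Cc(1)[OF us(1)]] borel_compact[OF compact_Box]])
  have am [measurable]: "a k \<in> borel_measurable borel" for k
    by (rule borel_measurable_LIMSEQ_real[OF a Am])
  have ab: "\<bar>a k z\<bar> \<le> K / sqrt (?m k)" for k z
    using tendsto_rabs[OF a[of k z]] by (rule LIMSEQ_le_const2) (use bd in blast)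
  have [measurable]: "cball (0 :: real \<times> (real ^ 'n)) R \<in> sets borel" for R by simp
  have fin: "emeasure lborel (cball (0 :: real \<times> (real ^ 'n)) R) < \<infinity>" for R
    by (rule emeasure_compact_finite[OF compact_cball])
  have sqb: "sq_int lborel (\<lambda>z. indicator (cball 0 R) z * g z)"
    if "g \<in> borel_measurable borel" "\<And>z. \<bar>g z\<bar> \<le> K / sqrt (?m k)" for g :: "real \<times> (real ^ 'n) \<Rightarrow> real" and R k
  proof (rule sq_int_bound)
    show "(\<lambda>z. indicator (cball 0 R) z * g z) \<in> borel_measurable lborel" using that(1)
      by (intro borel_measurable_times borel_measurable_indicator) auto
    show "integrable lborel (\<lambda>z. indicator (cball (0 :: real \<times> (real ^ 'n)) R) z * (K / sqrt (?m k))\<^sup>2)"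
      using fin[of R] by (intro integrable_mult_left integrable_real_indicator) auto
    show "(norm (indicator (cball 0 R) z * g z))\<^sup>2 \<le> indicator (cball 0 R) z * (K / sqrt (?m k))\<^sup>2" for z
      using power_mono[OF that(2)[of z], of 2] by (simp add: indicator_def)
  qed
  have locA: "(\<lambda>n. l2 lborel (\<lambda>z. indicator (cball 0 R) z * (?A k n z - a k z))) \<longlonglongrightarrow> 0" for k R
  proof -
    have "(\<lambda>n. LINT z|lborel. (norm (indicator (cball 0 R) z * (?A k n z - a k z)))\<^sup>2) \<longlonglongrightarrow> (LINT z|(lborel :: (real \<times> (real ^ 'n)) measure). (0 :: real))"
    proof (rule integral_dominated_convergence[where w = "\<lambda>z. indicator (cball 0 R) z * (2 * (K / sqrt (?m k)))\<^sup>2"])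
      show "integrable lborel (\<lambda>z. indicator (cball (0 :: real \<times> (real ^ 'n)) R) z * (2 * (K / sqrt (?m k)))\<^sup>2)"
        using fin[of R] by (intro integrable_mult_left integrable_real_indicator) auto
      show "(\<lambda>z. (norm (indicator (cball 0 R) z * (?A k n z - a k z)))\<^sup>2) \<in> borel_measurable lborel" for n
        by measurable
      have "(\<lambda>n. (norm (indicator (cball 0 R) z * (?A k n z - a k z)))\<^sup>2) \<longlonglongrightarrow> (norm (indicator (cball 0 R) z * (a k z - a k z)))\<^sup>2" for z
        by (intro tendsto_intros a)
      then show "AE z in lborel. (\<lambda>n. (norm (indicator (cball 0 R) z * (?A k n z - a k z)))\<^sup>2) \<longlonglongrightarrow> 0"
        by (intro AE_I2) simp
      have "\<bar>?A k n z - a k z\<bar> \<le> 2 * (K / sqrt (?m k))" for n z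
        using bd[of k "r n" z] ab[of k z] by linarith
      then have "\<bar>?A k n z - a k z\<bar>\<^sup>2 \<le> (2 * (K / sqrt (?m k)))\<^sup>2" for n z
        by (intro power_mono) auto
      then show "AE z in lborel. norm ((norm (indicator (cball 0 R) z * (?A k n z - a k z)))\<^sup>2) \<le> indicator (cball 0 R) z * (2 * (K / sqrt (?m k)))\<^sup>2" for n
        by (intro AE_I2) (simp add: indicator_def)
    qed simp
    then have "(\<lambda>n. sqrt (LINT z|lborel. (norm (indicator (cball 0 R) z * (?A k n z - a k z)))\<^sup>2)) \<longlonglongrightarrow> sqrt 0"
      by (intro tendsto_real_sqrt) simp
    then show ?thesis by (simp add: l2_def)
  qed
  show thesis
  proof (rule that[OF r])
    fix R e :: real assume e: "e > 0"
    let ?b = "box_const TYPE('n) * K"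
    have b: "?b \<ge> 0" using box_const_ge_1[where 'n='n] K by simp
    obtain k :: nat where k: "4 * ?b / e < real k" using reals_Archimedean2 by blast
    have kb: "?b * ?T k < e / 4"
    proof -
      have "4 * ?b < e * real k" using k e by (simp add: field_simps)
      then have "4 * ?b < e * real (Suc k)" using e by (simp add: algebra_simps)
      then show ?thesis by (simp add: field_simps)
    qed
    have "eventually (\<lambda>n. l2 lborel (\<lambda>z. indicator (cball 0 R) z * (?A k n z - a k z)) < e / 4) sequentially"
      by (rule order_tendstoD(2)[OF locA]) (use e in simp)
    then obtain N where N: "\<And>n. n \<ge> N \<Longrightarrow> l2 lborel (\<lambda>z. indicator (cball 0 R) z * (?A k n z - a k z)) < e / 4"
      unfolding eventually_sequentially by blast
    let ?J = "indicator (cball 0 R) :: real \<times> (real ^ 'n) \<Rightarrow> real"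
    have near: "sq_int lborel (\<lambda>z. ?J z * us (r n) z) \<and> l2 lborel (\<lambda>z. ?J z * us (r n) z - ?J z * a k z) < e / 2"
      if "n \<ge> N" for n
    proof -
      note U = avg_Box_l2[OF us(1)[of "r n"] T[of k]]
      have s1: "sq_int lborel (\<lambda>z. ?J z * us (r n) z)" by (rule sq_int_indicator(1)[OF Cc_sq_int[OF Y_Cc(1)[OF us(1)]]]) simp
      have s2: "sq_int lborel (\<lambda>z. ?J z * ?A k n z)" by (rule sqb[OF Am bd])
      have s3: "sq_int lborel (\<lambda>z. ?J z * a k z)" by (rule sqb[OF am ab])
      have "l2 lborel (\<lambda>z. ?J z * us (r n) z - ?J z * a k z) \<le> l2 lborel (\<lambda>z. ?J z * us (r n) z - ?J z * ?A k n z) + l2 lborel (\<lambda>z. ?J z * ?A k n z - ?J z * a k z)"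
        by (rule l2_triangle3[OF s1 s2 s3])
      also have "l2 lborel (\<lambda>z. ?J z * us (r n) z - ?J z * ?A k n z) \<le> l2 lborel (\<lambda>z. us (r n) z - ?A k n z)"
        using sq_int_indicator(2)[OF U(1), of "cball 0 R"] by (simp add: right_diff_distrib)
      also have "\<dots> \<le> box_const TYPE('n) * ?T k * l2 lborel (pot (us (r n)))" by (rule U(2))
      also have "\<dots> \<le> box_const TYPE('n) * ?T k * K"
        using l2_jet_parts(2)[OF us(1)[of "r n"]] us(2)[of "r n"] box_const_ge_1[where 'n='n]
        by (intro mult_left_mono) auto
      also have "\<dots> < e / 4" using kb by (simp only: mult_ac)
      finally have "l2 lborel (\<lambda>z. ?J z * us (r n) z - ?J z * a k z) < e / 2"
        using N[OF that] by (simp add: right_diff_distrib)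
      with s1 show ?thesis by blast
    qed
    have "l2 lborel (\<lambda>z. ?J z * (us (r i) z - us (r j) z)) < e" if "i \<ge> N" "j \<ge> N" for i j
    proof -
      have "l2 lborel (\<lambda>z. ?J z * us (r i) z - ?J z * us (r j) z) \<le> l2 lborel (\<lambda>z. ?J z * us (r i) z - ?J z * a k z) + l2 lborel (\<lambda>z. ?J z * a k z - ?J z * us (r j) z)"
        by (rule l2_triangle3) (use near that sqb[OF am ab] in blast)+
      also have "l2 lborel (\<lambda>z. ?J z * a k z - ?J z * us (r j) z) = l2 lborel (\<lambda>z. ?J z * us (r j) z - ?J z * a k z)"
        by (rule l2_minus)
      finally show ?thesis using near[OF that(1)] near[OF that(2)] by (simp add: right_diff_distrib)
    qed
    then show "\<exists>N. \<forall>i\<ge>N. \<forall>j\<ge>N. l2 lborel (\<lambda>z. ?J z * (us (r i) z - us (r j) z)) < e" by blast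
  qed
qed

section \<open>Completeness and midpoint hulls\<close>

lemma l2_parallelogram:
  assumes "sq_int M f" "sq_int M g"
  shows "(l2 M (\<lambda>z. f z + g z))\<^sup>2 + (l2 M (\<lambda>z. f z - g z))\<^sup>2 = 2 * (l2 M f)\<^sup>2 + 2 * (l2 M g)\<^sup>2"
proof -
  have "(l2 M (\<lambda>z. f z + (- 1) *\<^sub>R g z))\<^sup>2 = (l2 M f)\<^sup>2 + 2 * (LINT z|M. f z \<bullet> ((- 1) *\<^sub>R g z)) + (l2 M (\<lambda>z. (- 1) *\<^sub>R g z))\<^sup>2"
    by (rule l2_add_square[OF assms(1) sq_int_scale[OF assms(2)]])
  also have "l2 M (\<lambda>z. (- 1) *\<^sub>R g z) = l2 M g" by (subst l2_scale) simp
  finally have "(l2 M (\<lambda>z. f z - g z))\<^sup>2 = (l2 M f)\<^sup>2 - 2 * (LINT z|M. f z \<bullet> g z) + (l2 M g)\<^sup>2" by simp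
  then show ?thesis using l2_add_square[OF assms] by simp
qed

text \<open>Fatou's lemma for \<open>fs (r k) - fs n\<close>, with \<open>n\<close> fixed and
  \<open>k\<close> tending to infinity.\<close>

lemma l2_cauchy_AE_limit:
  fixes fs :: "nat \<Rightarrow> 'a \<Rightarrow> 'b::euclidean_space"
  assumes sq: "\<And>n. sq_int M (fs n)"
    and cauchy: "\<And>e. e > 0 \<Longrightarrow> \<exists>N. \<forall>m\<ge>N. \<forall>n\<ge>N. l2 M (\<lambda>z. fs m z - fs n z) < e"
    and r: "strict_mono (r :: nat \<Rightarrow> nat)" and f: "f \<in> borel_measurable M"
    and AE: "AE z in M. (\<lambda>n. fs (r n) z) \<longlonglongrightarrow> f z"
  shows "sq_int M f" "(\<lambda>n. l2 M (\<lambda>z. fs n z - f z)) \<longlonglongrightarrow> 0"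
proof -
  note [measurable] = f sq_int_measurable[OF sq]
  have main: "sq_int M (\<lambda>z. f z - fs n z) \<and> l2 M (\<lambda>z. f z - fs n z) \<le> e"
    if e: "e > 0" and n: "\<And>m. m \<ge> n \<Longrightarrow> l2 M (\<lambda>z. fs m z - fs n z) < e" for e n
  proof -
    have bound: "(\<integral>\<^sup>+ z. ennreal ((norm (f z - fs n z))\<^sup>2) \<partial>M) \<le> ennreal (e\<^sup>2)"
    proof -
      have "(\<integral>\<^sup>+ z. ennreal ((norm (f z - fs n z))\<^sup>2) \<partial>M) = (\<integral>\<^sup>+ z. liminf (\<lambda>k. ennreal ((norm (fs (r k) z - fs n z))\<^sup>2)) \<partial>M)"
      proof (rule nn_integral_cong_AE)
        show "AE z in M. ennreal ((norm (f z - fs n z))\<^sup>2) = liminf (\<lambda>k. ennreal ((norm (fs (r k) z - fs n z))\<^sup>2))"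
          using AE
        proof (eventually_elim)
          case (elim z)
          have "(\<lambda>k. ennreal ((norm (fs (r k) z - fs n z))\<^sup>2)) \<longlonglongrightarrow> ennreal ((norm (f z - fs n z))\<^sup>2)"
            by (intro tendsto_ennrealI tendsto_intros elim)
          then show ?case by (rule lim_imp_Liminf[OF trivial_limit_sequentially, symmetric])
        qed
      qed
      also have "\<dots> \<le> liminf (\<lambda>k. \<integral>\<^sup>+ z. ennreal ((norm (fs (r k) z - fs n z))\<^sup>2) \<partial>M)"
        by (rule nn_integral_liminf) measurable
      also have "\<dots> \<le> liminf (\<lambda>k. ennreal (e\<^sup>2))"
      proof (rule Liminf_mono)
        show "eventually (\<lambda>k. (\<integral>\<^sup>+ z. ennreal ((norm (fs (r k) z - fs n z))\<^sup>2) \<partial>M) \<le> ennreal (e\<^sup>2)) sequentially"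
        proof (rule eventually_sequentiallyI)
          fix k assume "n \<le> k"
          also have "k \<le> r k" by (rule seq_suble[OF r])
          finally have "l2 M (\<lambda>z. fs (r k) z - fs n z) \<le> e" using n[of "r k"] by simp
          then have "(l2 M (\<lambda>z. fs (r k) z - fs n z))\<^sup>2 \<le> e\<^sup>2" by (intro power_mono l2_nonneg)
          then show "(\<integral>\<^sup>+ z. ennreal ((norm (fs (r k) z - fs n z))\<^sup>2) \<partial>M) \<le> ennreal (e\<^sup>2)"
            using nn_integral_sq_int[OF sq_int_diff[OF sq sq], of "r k" n] by (simp add: ennreal_leI)
        qed
      qed
      also have "\<dots> = ennreal (e\<^sup>2)" by (simp add: Liminf_const)
      finally show ?thesis .
    qed
    have "integrable M (\<lambda>z. (norm (f z - fs n z))\<^sup>2)"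
      by (rule integrableI_bounded) (use bound in \<open>auto simp: order.strict_trans1\<close>)
    then have s: "sq_int M (\<lambda>z. f z - fs n z)" by (simp add: sq_int_def)
    have "ennreal ((l2 M (\<lambda>z. f z - fs n z))\<^sup>2) \<le> ennreal (e\<^sup>2)"
      using nn_integral_sq_int[OF s] bound by simp
    then have "(l2 M (\<lambda>z. f z - fs n z))\<^sup>2 \<le> e\<^sup>2" by simp
    then have "l2 M (\<lambda>z. f z - fs n z) \<le> e" by (rule power2_le_imp_le) (use e in simp)
    with s show ?thesis by blast
  qed
  obtain N where "\<forall>m\<ge>N. \<forall>n\<ge>N. l2 M (\<lambda>z. fs m z - fs n z) < 1" using cauchy[of 1] by auto
  then have "sq_int M (\<lambda>z. f z - fs N z)" using main[of 1 N] by auto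
  from sq_int_add[OF this sq[of N]] show "sq_int M f" by simp
  show "(\<lambda>n. l2 M (\<lambda>z. fs n z - f z)) \<longlonglongrightarrow> 0"
  proof (rule tendstoI)
    fix e :: real assume e: "e > 0"
    then obtain N where N: "\<forall>m\<ge>N. \<forall>n\<ge>N. l2 M (\<lambda>z. fs m z - fs n z) < e / 2" using cauchy[of "e / 2"] by auto
    show "eventually (\<lambda>n. dist (l2 M (\<lambda>z. fs n z - f z)) 0 < e) sequentially"
    proof (rule eventually_sequentiallyI)
      fix n assume n: "N \<le> n"
      have "l2 M (\<lambda>z. f z - fs n z) \<le> e / 2" using main[of "e / 2" n] N n e by auto
      then show "dist (l2 M (\<lambda>z. fs n z - f z)) 0 < e"
        using e l2_minus[of M f "fs n"] l2_nonneg[of M "\<lambda>z. fs n z - f z"] by (simp add: dist_real_def)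
    qed
  qed
qed

lemma fast_cauchy_subsequence:
  fixes P :: "nat \<Rightarrow> nat \<Rightarrow> real"
  assumes cauchy: "\<And>e. e > 0 \<Longrightarrow> \<exists>N. \<forall>m\<ge>N. \<forall>n\<ge>N. P m n < e"
  obtains r :: "nat \<Rightarrow> nat" where "strict_mono r" "\<And>k m n. m \<ge> r k \<Longrightarrow> n \<ge> r k \<Longrightarrow> P m n < (1 / 4) ^ k"
proof -
  have "\<forall>k. \<exists>N. \<forall>m\<ge>N. \<forall>n\<ge>N. P m n < (1 / 4) ^ k" using cauchy by simp
  from choice[OF this] obtain N where N: "\<And>k m n. m \<ge> N k \<Longrightarrow> n \<ge> N k \<Longrightarrow> P m n < (1 / 4) ^ k" by blast
  \<comment> \<open>Summing makes \<open>r\<close> strictly increasing while keeping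
    \<open>r k\<close> at least \<open>N k\<close>.\<close>
  define r where "r k = (\<Sum>i\<le>k. Suc (N i))" for k
  have "strict_mono r" by (rule strict_mono_Suc_iff[THEN iffD2]) (simp add: r_def)
  moreover have "N k \<le> r k" for k
  proof -
    have "Suc (N k) \<le> (\<Sum>i\<le>k. Suc (N i))" by (rule member_le_sum) auto
    then show ?thesis by (simp add: r_def)
  qed
  ultimately show thesis using N that[of r] by (meson order.trans)
qed

text \<open>Along a subsequence with increments of norm at most \<open>(1 / 4) ^ k\<close>, the
  series of their squares with weights \<open>2 ^ k\<close> still has a finite integral. Almost
  everywhere the increments are then at most a constant times \<open>(1 / sqrt 2) ^ k\<close>, hence
  summable. Weighting the squares avoids integrating the increments themselves, which need not be
  integrable.\<close>

lemma l2_complete: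
  fixes fs :: "nat \<Rightarrow> 'a \<Rightarrow> 'b::euclidean_space"
  assumes sq: "\<And>n. sq_int M (fs n)"
    and cauchy: "\<And>e. e > 0 \<Longrightarrow> \<exists>N. \<forall>m\<ge>N. \<forall>n\<ge>N. l2 M (\<lambda>z. fs m z - fs n z) < e"
  obtains f r where "sq_int M f" "(\<lambda>n. l2 M (\<lambda>z. fs n z - f z)) \<longlonglongrightarrow> 0" "strict_mono (r :: nat \<Rightarrow> nat)"
    "AE z in M. (\<lambda>n. fs (r n) z) \<longlonglongrightarrow> f z"
proof -
  obtain r :: "nat \<Rightarrow> nat" where r: "strict_mono r"
    "\<And>k m n. m \<ge> r k \<Longrightarrow> n \<ge> r k \<Longrightarrow> l2 M (\<lambda>z. fs m z - fs n z) < (1 / 4) ^ k"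
    by (rule fast_cauchy_subsequence[of "\<lambda>m n. l2 M (\<lambda>z. fs m z - fs n z)"]) (use cauchy in auto)
  note [measurable] = sq_int_measurable[OF sq]
  let ?g = "\<lambda>k z. fs (r (Suc k)) z - fs (r k) z"
  have sg: "sq_int M (?g k)" for k by (rule sq_int_diff[OF sq sq])
  have gl: "l2 M (?g k) \<le> (1 / 4) ^ k" for k
    using r(2)[of k "r (Suc k)" "r k"] strict_monoD[OF r(1), of k "Suc k"] by simp
  have "(\<integral>\<^sup>+ z. (\<Sum>k. ennreal (2 ^ k * (norm (?g k z))\<^sup>2)) \<partial>M) = (\<Sum>k. \<integral>\<^sup>+ z. ennreal (2 ^ k * (norm (?g k z))\<^sup>2) \<partial>M)"
    by (rule nn_integral_suminf) measurable
  also have "\<dots> \<le> (\<Sum>k. ennreal ((1 / 8) ^ k))"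
  proof (rule suminf_le)
    fix k
    have "(\<integral>\<^sup>+ z. ennreal (2 ^ k * (norm (?g k z))\<^sup>2) \<partial>M) = ennreal (2 ^ k) * (\<integral>\<^sup>+ z. ennreal ((norm (?g k z))\<^sup>2) \<partial>M)"
      by (simp add: ennreal_mult nn_integral_cmult)
    also have "\<dots> = ennreal (2 ^ k * (l2 M (?g k))\<^sup>2)"
      unfolding nn_integral_sq_int[OF sg] by (simp add: ennreal_mult)
    also have "\<dots> \<le> ennreal (2 ^ k * ((1 / 4) ^ k)\<^sup>2)"
      by (intro ennreal_leI mult_left_mono power_mono gl l2_nonneg) simp
    also have "(2 :: real) ^ k * ((1 / 4) ^ k)\<^sup>2 = (1 / 8) ^ k"
      by (simp add: power2_eq_square power_mult_distrib[symmetric])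
    finally show "(\<integral>\<^sup>+ z. ennreal (2 ^ k * (norm (?g k z))\<^sup>2) \<partial>M) \<le> ennreal ((1 / 8) ^ k)" .
  qed auto
  also have "\<dots> = ennreal (\<Sum>k. (1 / 8) ^ k)"
    by (rule suminf_ennreal2) (auto intro: summable_geometric)
  finally have "(\<integral>\<^sup>+ z. (\<Sum>k. ennreal (2 ^ k * (norm (?g k z))\<^sup>2)) \<partial>M) \<noteq> \<infinity>"
    by (auto simp: top_unique)
  then have "AE z in M. (\<Sum>k. ennreal (2 ^ k * (norm (?g k z))\<^sup>2)) \<noteq> \<infinity>"
    by (rule nn_integral_noteq_infinite[rotated]) measurable
  then have conv: "AE z in M. convergent (\<lambda>k. fs (r k) z)"
  proof eventually_elim
    case (elim z)
    have sum: "summable (\<lambda>k. 2 ^ k * (norm (?g k z))\<^sup>2)"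
      by (rule summable_suminf_not_top) (use elim in auto)
    then have "(\<lambda>k. 2 ^ k * (norm (?g k z))\<^sup>2) \<longlonglongrightarrow> 0" by (rule summable_LIMSEQ_zero)
    then have "Bseq (\<lambda>k. 2 ^ k * (norm (?g k z))\<^sup>2)" by (intro convergent_imp_Bseq convergentI)
    then obtain B where B: "B > 0" "\<And>k. norm (2 ^ k * (norm (?g k z))\<^sup>2) \<le> B" unfolding Bseq_def by blast
    have gb: "norm (?g k z) \<le> sqrt B * (1 / sqrt 2) ^ k" for k
    proof -
      have "2 ^ k * (norm (?g k z))\<^sup>2 \<le> B" using B(2)[of k] by simp
      then have "(norm (?g k z))\<^sup>2 \<le> B / 2 ^ k" by (simp add: field_simps)
      then have "sqrt ((norm (?g k z))\<^sup>2) \<le> sqrt (B / 2 ^ k)" by (rule real_sqrt_le_mono)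
      also have "sqrt (B / 2 ^ k) = sqrt B * (1 / sqrt 2) ^ k"
        by (simp add: real_sqrt_divide real_sqrt_power power_one_over)
      finally show ?thesis by simp
    qed
    have "summable (\<lambda>k. sqrt B * (1 / sqrt 2) ^ k)"
      by (intro summable_mult summable_geometric) simp
    then have "summable (\<lambda>k. norm (?g k z))"
      by (rule summable_comparison_test[rotated]) (use gb in auto)
    then have "summable (\<lambda>k. ?g k z)" by (rule summable_norm_cancel)
    then have "convergent (\<lambda>n. (\<Sum>k<n. ?g k z))" by (simp add: summable_iff_convergent)
    then have "convergent (\<lambda>n. (\<Sum>k<n. ?g k z) + fs (r 0) z)" by (simp add: convergent_add_const_right_iff)
    moreover have "(\<Sum>k<n. ?g k z) + fs (r 0) z = fs (r n) z" for n
      using sum_lessThan_telescope[of "\<lambda>k. fs (r k) z" n] by simp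
    ultimately show ?case by simp
  qed
  define f where "f z = lim (\<lambda>k. fs (r k) z)" for z
  have f: "f \<in> borel_measurable M" unfolding f_def by (rule borel_measurable_lim_metric) measurable
  have AE: "AE z in M. (\<lambda>n. fs (r n) z) \<longlonglongrightarrow> f z"
    using conv by eventually_elim (simp add: f_def convergent_LIMSEQ_iff)
  note lim = l2_cauchy_AE_limit[OF sq cauchy r(1) f AE]
  show thesis by (rule that[OF lim r(1) AE])
qed

text \<open>Midpoints are the convex combinations that the parallelogram law speaks about, and
  convex conditions pass to this hull by induction. The index \<open>n\<close> restricts it to a
  tail, so that its elements still reflect limits along the sequence.\<close>

inductive midpoint_hull :: "(nat \<Rightarrow> 'a \<Rightarrow> real) \<Rightarrow> nat \<Rightarrow> ('a \<Rightarrow> real) \<Rightarrow> bool"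
  for us :: "nat \<Rightarrow> 'a \<Rightarrow> real" and n :: nat where
  base: "n \<le> k \<Longrightarrow> midpoint_hull us n (us k)"
| mid: "midpoint_hull us n u \<Longrightarrow> midpoint_hull us n v \<Longrightarrow> midpoint_hull us n (\<lambda>z. (1 / 2) * (u z + v z))"

lemma midpoint_hull_antimono:
  assumes "midpoint_hull us m u" "n \<le> m" shows "midpoint_hull us n u"
  using assms(1)
proof induction
  case (base k)
  then show ?case using assms(2) by (intro midpoint_hull.base) simp
next
  case (mid u v)
  show ?case by (rule midpoint_hull.mid[OF mid.IH])
qed

lemma Y_mid:
  assumes "u \<in> Y_space" "v \<in> Y_space"
  shows "(\<lambda>z. (1 / 2) * (u z + v z)) \<in> Y_space"
    "jet (\<lambda>z. (1 / 2) * (u z + v z)) z = (1 / 2) *\<^sub>R (jet u z + jet v z)"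
  using Y_linear(5,6)[OF Y_linear(1)[OF assms] Y_linear(1)[OF assms], of "1 / 2"] Y_linear(2)[OF assms] by auto

lemma Y_mid_norm:
  assumes u: "u \<in> Y_space" and v: "v \<in> Y_space"
  shows "4 * (Y_norm (\<lambda>z. (1 / 2) * (u z + v z)))\<^sup>2 + (Y_norm (\<lambda>z. u z - v z))\<^sup>2 = 2 * (Y_norm u)\<^sup>2 + 2 * (Y_norm v)\<^sup>2"
proof -
  have "jet (\<lambda>z. (1 / 2) * (u z + v z)) = (\<lambda>z. (1 / 2) *\<^sub>R (jet u z + jet v z))" using Y_mid(2)[OF u v] by auto
  then have 1: "Y_norm (\<lambda>z. (1 / 2) * (u z + v z)) = (1 / 2) * l2 lborel (\<lambda>z. jet u z + jet v z)"
    using Y_norm_lborel[OF Y_mid(1)[OF u v]] by (simp add: l2_scale del: scaleR_add_right)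
  have "jet (\<lambda>z. u z - v z) = (\<lambda>z. jet u z - jet v z)" using Y_linear(4)[OF u v] by auto
  then have 2: "Y_norm (\<lambda>z. u z - v z) = l2 lborel (\<lambda>z. jet u z - jet v z)"
    using Y_norm_lborel[OF Y_linear(3)[OF u v]] by simp
  show ?thesis
    using l2_parallelogram[OF Cc_sq_int[OF Y_Cc(3)[OF u]] Cc_sq_int[OF Y_Cc(3)[OF v]]]
    unfolding 1 2 by (simp add: Y_norm_lborel u v power_mult_distrib power_divide)
qed

text \<open>This replaces weak compactness: elements of almost minimal norm in the decreasing midpoint
  hulls of the tails form a Cauchy sequence by the parallelogram law.\<close>

lemma midpoint_hull_cauchy:
  fixes us :: "nat \<Rightarrow> real \<times> (real ^ 'n) \<Rightarrow> real"
  assumes us: "\<And>n. us n \<in> Y_space" "\<And>n. Y_norm (us n) \<le> K"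
  obtains vs where "\<And>n. midpoint_hull us n (vs n)" "\<And>n. vs n \<in> Y_space" 
    "\<And>e. e > 0 \<Longrightarrow> \<exists>N. \<forall>m\<ge>N. \<forall>n\<ge>N. Y_norm (\<lambda>z. vs m z - vs n z) < e"
proof -
  let ?S = "\<lambda>n. {(Y_norm v)\<^sup>2 | v. midpoint_hull us n v}"
  define d where "d n = Inf (?S n)" for n
  have hY: "v \<in> Y_space" if "midpoint_hull us n v" for n v
    using that
  proof induction
    case (mid u v)
    show ?case by (rule Y_mid(1)[OF mid.IH])
  qed (rule us(1))
  have ne: "(Y_norm (us n))\<^sup>2 \<in> ?S n" for n using midpoint_hull.base[of n n us] by auto
  have bdd: "bdd_below (?S n)" for n by (rule bdd_belowI[of _ 0]) auto
  have dle: "d n \<le> (Y_norm v)\<^sup>2" if "midpoint_hull us n v" for n v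
    unfolding d_def using that by (intro cInf_lower bdd) auto
  have dK: "d n \<le> K\<^sup>2" for n
  proof -
    have "d n \<le> (Y_norm (us n))\<^sup>2" by (rule dle) (rule midpoint_hull.base, simp)
    also have "\<dots> \<le> K\<^sup>2" using us(2) l2_jet_parts(3)[OF us(1)] by (intro power_mono) auto
    finally show ?thesis .
  qed
  have dmono: "d n \<le> d m" if "n \<le> m" for n m
    unfolding d_def using ne[of m] midpoint_hull_antimono[OF _ that]
    by (intro cInf_superset_mono bdd) blast+
  have "\<exists>v. midpoint_hull us n v \<and> (Y_norm v)\<^sup>2 < d n + inverse (real (Suc n))" for n
  proof -
    have "Inf (?S n) < d n + inverse (real (Suc n))" by (simp add: d_def)
    then have "\<exists>x\<in>?S n. x < d n + inverse (real (Suc n))"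
      by (subst (asm) cInf_less_iff[OF _ bdd]) (use ne in blast)+
    then show ?thesis by auto
  qed
  then have "\<forall>n. \<exists>v. midpoint_hull us n v \<and> (Y_norm v)\<^sup>2 < d n + inverse (real (Suc n))" by blast
  from choice[OF this] obtain vs where vs: "\<And>n. midpoint_hull us n (vs n)"
    "\<And>n. (Y_norm (vs n))\<^sup>2 < d n + inverse (real (Suc n))" by blast
  have vY: "vs n \<in> Y_space" for n by (rule hY[OF vs(1)])
  \<comment> \<open>Shrinking hulls have increasing infima, bounded by \<open>K\<^sup>2\<close>.
    Their convergence makes \<open>d m - d n\<close> small in the parallelogram estimate
    below.\<close>
  have "incseq d" using dmono by (simp add: incseq_def)
  then obtain l where l: "d \<longlonglongrightarrow> l" by (rule incseq_convergent[OF _ allI[OF dK]]) 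
  have cau: "\<exists>N. \<forall>m\<ge>N. \<forall>n\<ge>N. Y_norm (\<lambda>z. vs m z - vs n z) < e" if e: "e > 0" for e
  proof -
    have "Cauchy d" using l by (rule LIMSEQ_imp_Cauchy)
    then obtain N1 where N1: "\<And>m n. m \<ge> N1 \<Longrightarrow> n \<ge> N1 \<Longrightarrow> dist (d m) (d n) < e\<^sup>2 / 8"
      using metric_CauchyD[of d "e\<^sup>2 / 8"] e by auto
    have "eventually (\<lambda>n. inverse (real (Suc n)) < e\<^sup>2 / 8) sequentially"
      by (rule order_tendstoD(2)[OF LIMSEQ_inverse_real_of_nat]) (use e in simp)
    then obtain N2 where N2: "\<And>n. n \<ge> N2 \<Longrightarrow> inverse (real (Suc n)) < e\<^sup>2 / 8"
      unfolding eventually_sequentially by blast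
    have lt: "Y_norm (\<lambda>z. vs m z - vs n z) < e" if n: "n \<ge> max N1 N2" and nm: "n \<le> m" for m n
    proof -
      have "midpoint_hull us n (\<lambda>z. (1 / 2) * (vs m z + vs n z))"
        by (intro midpoint_hull.mid midpoint_hull_antimono[OF vs(1) nm] vs(1))
      from dle[OF this] have "4 * d n + (Y_norm (\<lambda>z. vs m z - vs n z))\<^sup>2 \<le> 2 * (Y_norm (vs m))\<^sup>2 + 2 * (Y_norm (vs n))\<^sup>2"
        using Y_mid_norm[OF vY[of m] vY[of n]] by linarith
      moreover have "inverse (real (Suc n)) < e\<^sup>2 / 8" "inverse (real (Suc m)) < e\<^sup>2 / 8"
        using N2[of n] N2[of m] n nm by auto
      moreover have "\<bar>d m - d n\<bar> < e\<^sup>2 / 8" using N1[of m n] n nm by (simp add: dist_real_def)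
      ultimately have "(Y_norm (\<lambda>z. vs m z - vs n z))\<^sup>2 < e\<^sup>2"
        using vs(2)[of m] vs(2)[of n] by linarith
      then show ?thesis by (rule power2_less_imp_less) (use e in simp)
    qed
    have sym: "Y_norm (\<lambda>z. vs m z - vs n z) = Y_norm (\<lambda>z. vs n z - vs m z)" for m n
      using Y_norm_cmult[OF Y_linear(3)[OF vY[of n] vY[of m]], of "- 1"] by simp
    have "Y_norm (\<lambda>z. vs m z - vs n z) < e" if "m \<ge> max N1 N2" "n \<ge> max N1 N2" for m n
      using lt[of n m] lt[of m n] sym[of m n] that by (cases "n \<le> m") auto
    then show ?thesis by blast
  qed
  show thesis by (rule that[OF vs(1) vY cau])
qed

section \<open>The space X\<close>

lemma Y_jet_lebesgue:
  assumes "u \<in> Y_space" shows "sq_int lebesgue (jet u)" "sq_int lebesgue u"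
  using Y_Cc[OF assms] by (auto intro: Cc_sq_int_lebesgue)

lemma Y_norm_diff:
  assumes "u \<in> Y_space" "v \<in> Y_space"
  shows "Y_norm (\<lambda>z. u z - v z) = l2 lebesgue (\<lambda>z. jet u z - jet v z)"
proof -
  have "jet (\<lambda>z. u z - v z) = (\<lambda>z. jet u z - jet v z)" using Y_linear(4)[OF assms] by auto
  then show ?thesis by (simp add: Y_norm_jet)
qed

lemma approximatesD:
  assumes "approximates us u"
  shows "us n \<in> Y_space" "AE z in lebesgue. (\<lambda>n. us n z) \<longlonglongrightarrow> u z"
    "e > 0 \<Longrightarrow> \<exists>N. \<forall>m\<ge>N. \<forall>n\<ge>N. Y_norm (\<lambda>z. us m z - us n z) < e"
  using assms unfolding approximates_def by blast+

lemma approximates_jet_cauchy: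
  assumes "approximates us u" "e > 0"
  shows "\<exists>N. \<forall>m\<ge>N. \<forall>n\<ge>N. l2 lebesgue (\<lambda>z. jet (us m) z - jet (us n) z) < e"
  using approximatesD(3)[OF assms] unfolding Y_norm_diff[OF approximatesD(1)[OF assms(1)] approximatesD(1)[OF assms(1)]] .

lemma l2_jet_components:
  fixes F G :: "'a \<Rightarrow> (real \<times> (real ^ 'n)) \<times> real"
  assumes "sq_int M F"
  shows "sq_int M (\<lambda>z. snd (F z))" "sq_int M (\<lambda>z. fst (fst (F z)))" "sq_int M (\<lambda>z. snd (fst (F z)))"
    "l2 M (\<lambda>z. snd (F z)) \<le> l2 M F" "l2 M (\<lambda>z. fst (fst (F z))) \<le> l2 M F" "l2 M (\<lambda>z. snd (fst (F z))) \<le> l2 M F"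
proof -
  have n: "norm (snd x) \<le> norm x" "norm (fst (fst x)) \<le> norm x" "norm (snd (fst x)) \<le> norm x"
    for x :: "(real \<times> (real ^ 'n)) \<times> real"
    using norm_snd_le[of "snd x" "fst x"] norm_fst_le[of "fst x" "snd x"]
      norm_fst_le[of "fst (fst x)" "snd (fst x)"] norm_snd_le[of "snd (fst x)" "fst (fst x)"] by auto
  have m: "F \<in> borel_measurable M" by (rule sq_int_measurable[OF assms])
  have "continuous_on UNIV (\<lambda>x::(real \<times> (real ^ 'n)) \<times> real. snd x)" 
    "continuous_on UNIV (\<lambda>x::(real \<times> (real ^ 'n)) \<times> real. fst (fst x))"
    "continuous_on UNIV (\<lambda>x::(real \<times> (real ^ 'n)) \<times> real. snd (fst x))"
    by (intro continuous_intros)+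
  note mm = borel_measurable_continuous_on[OF this(1) m] borel_measurable_continuous_on[OF this(2) m]
    borel_measurable_continuous_on[OF this(3) m]
  show "sq_int M (\<lambda>z. snd (F z))" "sq_int M (\<lambda>z. fst (fst (F z)))" "sq_int M (\<lambda>z. snd (fst (F z)))"
    by (rule sq_int_bound[OF mm(1) sq_int_integrable[OF assms]], rule power_mono[OF n(1) norm_ge_zero],
        rule sq_int_bound[OF mm(2) sq_int_integrable[OF assms]], rule power_mono[OF n(2) norm_ge_zero],
        rule sq_int_bound[OF mm(3) sq_int_integrable[OF assms]], rule power_mono[OF n(3) norm_ge_zero])
  show "l2 M (\<lambda>z. snd (F z)) \<le> l2 M F" "l2 M (\<lambda>z. fst (fst (F z))) \<le> l2 M F" "l2 M (\<lambda>z. snd (fst (F z))) \<le> l2 M F"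
    by (rule l2_mono[OF assms], rule n)+
qed

lemma l2_cong_AE:
  assumes "f \<in> borel_measurable M" "g \<in> borel_measurable M" "AE z in M. f z = g z"
  shows "l2 M f = l2 M g"
proof -
  have "(LINT z|M. (norm (f z))\<^sup>2) = (LINT z|M. (norm (g z))\<^sup>2)"
    by (rule integral_cong_AE) (use assms in \<open>auto elim: eventually_mono\<close>)
  then show ?thesis by (simp add: l2_def)
qed

lemma sq_int_cong_AE:
  assumes "sq_int M f" "g \<in> borel_measurable M" "AE z in M. f z = g z"
  shows "sq_int M g"
proof -
  have "integrable M (\<lambda>z. (norm (g z))\<^sup>2)"
    by (rule integrable_cong_AE_imp[OF sq_int_integrable[OF assms(1)]])
      (use assms in \<open>auto elim: eventually_mono\<close>)
  then show ?thesis using assms by (simp add: sq_int_def)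
qed

lemma l2_zero_AE:
  assumes "sq_int M f" "l2 M f = 0" shows "AE z in M. f z = 0"
proof -
  have "(LINT z|M. (norm (f z))\<^sup>2) = 0" using assms(2) l2_square[of M f] by simp
  then have "AE z in M. (norm (f z))\<^sup>2 = 0"
    using integral_nonneg_eq_0_iff_AE[OF sq_int_integrable[OF assms(1)]] by simp
  then show ?thesis by eventually_elim simp
qed

text \<open>Completeness of \<open>l2\<close> for the jets. The last component of the limit agrees
  with \<open>u\<close> almost everywhere, which also yields measurability of \<open>u\<close>, so
  far only an almost everywhere limit.\<close>

lemma approximates_jet_limit:
  fixes u :: "real \<times> (real ^ 'n) \<Rightarrow> real"
  assumes a: "approximates us u"
  obtains F where "sq_int lebesgue F" "(\<lambda>n. l2 lebesgue (\<lambda>z. jet (us n) z - F z)) \<longlonglongrightarrow> 0"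
    "AE z in lebesgue. snd (F z) = u z" "u \<in> borel_measurable lebesgue"
proof -
  obtain F r where F: "sq_int lebesgue F" "(\<lambda>n. l2 lebesgue (\<lambda>z. jet (us n) z - F z)) \<longlonglongrightarrow> 0"
    "strict_mono (r :: nat \<Rightarrow> nat)" "AE z in lebesgue. (\<lambda>n. jet (us (r n)) z) \<longlonglongrightarrow> F z"
    by (rule l2_complete[of lebesgue "\<lambda>n. jet (us n)"])
      (use Y_jet_lebesgue(1)[OF approximatesD(1)[OF a]] approximates_jet_cauchy[OF a] in auto)
  have eq: "AE z in lebesgue. snd (F z) = u z"
    using F(4) approximatesD(2)[OF a]
  proof eventually_elim
    case (elim z)
    have "(\<lambda>n. snd (jet (us (r n)) z)) \<longlonglongrightarrow> snd (F z)" by (rule tendsto_snd[OF elim(1)])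
    then have "(\<lambda>n. us (r n) z) \<longlonglongrightarrow> snd (F z)" by (simp add: jet_def)
    moreover have "(\<lambda>n. us (r n) z) \<longlonglongrightarrow> u z"
      using LIMSEQ_subseq_LIMSEQ[OF elim(2) F(3)] by (simp add: o_def)
    ultimately show ?case by (rule LIMSEQ_unique)
  qed
  have "u \<in> borel_measurable lebesgue"
    by (rule borel_measurable_AE[OF sq_int_measurable[OF l2_jet_components(1)[OF F(1)]] eq])
  then show thesis using that F eq by blast
qed

lemma limit_le_imp:
  fixes A B :: real
  assumes "\<And>m. m \<ge> N \<Longrightarrow> A \<le> B + c m" "c \<longlonglongrightarrow> 0" shows "A \<le> B"
proof -
  have "(\<lambda>m. B + c m) \<longlonglongrightarrow> B + 0" by (intro tendsto_intros assms)
  then have "A \<le> B + 0" by (rule LIMSEQ_le_const) (use assms(1) in blast)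
  then show ?thesis by simp
qed

lemma test_sq_int: "f \<in> test_functions \<Longrightarrow> sq_int lborel f"
  by (rule Cc_sq_int) (simp add: test_functions_iff)

lemma square_le_mult_imp: "a\<^sup>2 \<le> a * b \<Longrightarrow> 0 \<le> b \<Longrightarrow> a \<le> b" for a b :: real
  by (cases "a > 0") (auto simp: power2_eq_square)

text \<open>The derivative of \<open>us n\<close>, with \<open>n\<close> fixed, is paired with
  itself. Replacing one factor by the derivative of \<open>us m\<close> costs at most
  \<open>e\<close> times its norm, and integration by parts then frees \<open>us m\<close>, which
  tends to 0.\<close>

lemma closable_dx:
  fixes us :: "nat \<Rightarrow> real \<times> (real ^ 'n) \<Rightarrow> real"
  assumes us: "\<And>n. us n \<in> Y_space" and z: "(\<lambda>n. l2 lborel (us n)) \<longlonglongrightarrow> 0"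
    and e: "e > 0" and c: "\<And>m. m \<ge> N \<Longrightarrow> l2 lborel (\<lambda>z. dx (us n) z - dx (us m) z) \<le> e"
  shows "l2 lborel (dx (us n)) \<le> e"
proof -
  have t: "us n \<in> test_functions" for n by (rule Y_test[OF us])
  have d: "dx (us n) \<in> test_functions" "dx (dx (us n)) \<in> test_functions" for n
    using t by (auto simp: dx_pd test_pd)
  note s = test_sq_int[OF t] test_sq_int[OF d(1)] test_sq_int[OF d(2)]
  have "(l2 lborel (dx (us n)))\<^sup>2 \<le> l2 lborel (dx (us n)) * e"
  proof (rule limit_le_imp[of N])
    show "(\<lambda>m. l2 lborel (dx (dx (us n))) * l2 lborel (us m)) \<longlonglongrightarrow> 0"
      by (rule tendsto_mult_right_zero[OF z])
    fix m assume m: "m \<ge> N"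
    have "(l2 lborel (dx (us n)))\<^sup>2 = (LINT z|lborel. dx (us n) z * dx (us n) z)"
      unfolding l2_square by (simp add: power2_eq_square)
    also have "\<dots> = (LINT z|lborel. dx (us n) z * (dx (us n) z - dx (us m) z) + dx (us n) z * dx (us m) z)"
      by (simp add: algebra_simps)
    also have "\<dots> = (LINT z|lborel. dx (us n) z * (dx (us n) z - dx (us m) z)) + (LINT z|lborel. dx (us n) z * dx (us m) z)"
      by (intro Bochner_Integration.integral_add sq_int_mult sq_int_diff s)
    also have "(LINT z|lborel. dx (us n) z * dx (us m) z) = - (LINT z|lborel. dx (dx (us n)) z * us m z)"
      using integral_by_parts[OF d(1)[of n] t[of m], of "(1, 0)"] by (simp add: dx_pd)
    finally have "(l2 lborel (dx (us n)))\<^sup>2 \<le> \<bar>LINT z|lborel. dx (us n) z * (dx (us n) z - dx (us m) z)\<bar> + \<bar>LINT z|lborel. dx (dx (us n)) z * us m z\<bar>"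
      by linarith
    also have "\<dots> \<le> l2 lborel (dx (us n)) * l2 lborel (\<lambda>z. dx (us n) z - dx (us m) z) + l2 lborel (dx (dx (us n))) * l2 lborel (us m)"
      by (intro add_mono l2_Cauchy_Schwarz_real sq_int_diff s)
    also have "\<dots> \<le> l2 lborel (dx (us n)) * e + l2 lborel (dx (dx (us n))) * l2 lborel (us m)"
      using c[OF m] by (intro add_right_mono mult_left_mono l2_nonneg)
    finally show "(l2 lborel (dx (us n)))\<^sup>2 \<le> l2 lborel (dx (us n)) * e + l2 lborel (dx (dx (us n))) * l2 lborel (us m)" .
  qed
  then show ?thesis by (rule square_le_mult_imp) (use e in simp)
qed

text \<open>Moving \<open>f = \<partial>\<^sub>v g\<^sub>n\<close> far away in the \<open>x\<close> direction makes it orthogonal to itself, while the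
  pairing with \<open>\<partial>\<^sub>v g\<^sub>m\<close> hardly changes, the change being controlled by \<open>\<partial>\<^sub>x g\<^sub>m \<rightarrow> 0\<close>.\<close>

lemma closable_pd:
  fixes gs :: "nat \<Rightarrow> real \<times> (real ^ 'n) \<Rightarrow> real"
  assumes gs: "\<And>n. gs n \<in> test_functions" and z: "(\<lambda>n. l2 lborel (dx (gs n))) \<longlonglongrightarrow> 0"
    and e: "e > 0" and c: "\<And>m. m \<ge> N \<Longrightarrow> l2 lborel (\<lambda>z. pd v (gs n) z - pd v (gs m) z) \<le> e"
  shows "l2 lborel (pd v (gs n)) \<le> 2 * e"
proof -
  define f where "f = pd v (gs n)"
  define k where "k = pd v f"
  have f: "f \<in> test_functions" unfolding f_def by (rule test_pd[OF gs])
  have k: "k \<in> test_functions" unfolding k_def by (rule test_pd[OF f])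
  have fC: "Cc f" "smooth f" using f by (auto simp: test_functions_iff)
  have kC: "Cc k" using k by (auto simp: test_functions_iff)
  obtain S where S: "\<And>s z. s > S \<Longrightarrow> f (z + (s, 0)) = 0 \<or> f z = 0" using Cc_disjoint[OF fC(1) fC(1)] by blast
  define s where "s = S + 1"
  define w :: "real \<times> (real ^ 'n)" where "w = (s, 0)"
  have orth: "f (z + w) * f z = 0" for z using S[of s z] by (auto simp: s_def w_def)
  let ?fs = "\<lambda>z. f (z + w)"
  have fs: "?fs \<in> test_functions" by (rule test_translate[OF f])
  have pds: "pd v (gs m) \<in> test_functions" for m by (rule test_pd[OF gs])
  note sq = test_sq_int[OF f] test_sq_int[OF fs] test_sq_int[OF pds]
  have nfs: "l2 lborel ?fs = l2 lborel f" by (rule l2_translate[OF Cc_measurable[OF fC(1)]])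
  have "(l2 lborel f)\<^sup>2 \<le> l2 lborel f * (2 * e)"
  proof (rule limit_le_imp[of N])
    show "(\<lambda>m. l2 lborel k * (\<bar>s\<bar> * l2 lborel (dx (gs m)))) \<longlonglongrightarrow> 0"
      by (intro tendsto_mult_right_zero z)
    fix m assume m: "m \<ge> N"
    let ?g = "gs m" and ?q = "pd v (gs m)"
    have gC: "Cc ?g" using gs by (simp add: test_functions_iff)
    \<comment> \<open>Integration by parts puts the derivative on \<open>f\<close>, a change of
      variables puts the translation on \<open>gs m\<close>, and the increment of
      \<open>gs m\<close> in the \<open>x\<close> direction is bounded by its \<open>x\<close>
      derivative, the one quantity known to tend to 0.\<close>
    have "(LINT z|lborel. (f z - ?fs z) * ?q z) = - (LINT z|lborel. pd v (\<lambda>z. f z - ?fs z) z * ?g z)"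
      using integral_by_parts[OF test_diff[OF f fs] gs[of m], of v] by simp
    also have "(\<lambda>z. pd v (\<lambda>z. f z - ?fs z) z) = (\<lambda>z. k z - k (z + w))"
      using fC(2) by (intro ext) (simp add: pd_diff smooth_translate pd_translate k_def)
    also have "(LINT z|lborel. (k z - k (z + w)) * ?g z) = (LINT z|lborel. k z * ?g z) - (LINT z|lborel. k (z + w) * ?g z)"
      using sq_int_mult[OF test_sq_int[OF k] test_sq_int[OF gs[of m]]] sq_int_mult[OF test_sq_int[OF test_translate[OF k, of w]] test_sq_int[OF gs[of m]]]
      by (simp add: left_diff_distrib)
    also have "(LINT z|lborel. k (z + w) * ?g z) = (LINT z|lborel. k z * ?g (z + (- w)))"
      using lborel_integral_translate[of "\<lambda>z. k (z + w) * ?g z" "- w"] Cc_measurable[OF kC] Cc_measurable[OF Cc_translate[OF kC, of w]] Cc_measurable[OF gC]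
      by simp
    also have "(LINT z|lborel. k z * ?g z) - (LINT z|lborel. k z * ?g (z + (- w))) = - (LINT z|lborel. k z * (?g (z + (- w)) - ?g z))"
      using sq_int_mult[OF test_sq_int[OF k] test_sq_int[OF gs[of m]]] sq_int_mult[OF test_sq_int[OF k] test_sq_int[OF test_translate[OF gs[of m], of "- w"]]]
      by (simp add: right_diff_distrib)
    finally have "\<bar>LINT z|lborel. (f z - ?fs z) * ?q z\<bar> = \<bar>LINT z|lborel. k z * (?g (z + (- w)) - ?g z)\<bar>" by simp
    also have "\<dots> \<le> l2 lborel k * l2 lborel (\<lambda>z. ?g (z + (- w)) - ?g z)"
      by (intro l2_Cauchy_Schwarz_real test_sq_int k test_diff test_translate gs)
    also have "\<dots> \<le> l2 lborel k * (\<bar>s\<bar> * l2 lborel (dx ?g))"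
    proof (intro mult_left_mono l2_nonneg)
      have "l2 lborel (\<lambda>z. ?g (z + (- w)) - ?g z) \<le> l2 lborel (pd (- w) ?g)" by (rule l2_increment[OF gs])
      also have "pd (- w) ?g = (\<lambda>z. (- s) * dx ?g z)"
      proof
        fix z
        have "pd ((- s) *\<^sub>R (1, 0)) ?g z = (- s) * pd (1, 0) ?g z"
          using gs by (intro pd_direction) (simp add: test_functions_iff)
        then show "pd (- w) ?g z = (- s) * dx ?g z" by (simp add: w_def dx_pd)
      qed
      also have "l2 lborel \<dots> = \<bar>s\<bar> * l2 lborel (dx ?g)" by (subst l2_cmult) simp
      finally show "l2 lborel (\<lambda>z. ?g (z + (- w)) - ?g z) \<le> \<bar>s\<bar> * l2 lborel (dx ?g)" .
    qed
    finally have b2: "\<bar>LINT z|lborel. (f z - ?fs z) * ?q z\<bar> \<le> l2 lborel k * (\<bar>s\<bar> * l2 lborel (dx ?g))" .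
    \<comment> \<open>Orthogonality of \<open>f\<close> and its far translate makes this an
      identity. In every term but the middle one the small difference \<open>f z - ?q z\<close>
      occurs.\<close>
    have eq: "f z * f z = (f z * (f z - ?q z) + (f z - ?fs z) * ?q z) - ?fs z * (f z - ?q z)" for z
      using orth[of z] by (simp add: algebra_simps)
    have "(l2 lborel f)\<^sup>2 = (LINT z|lborel. (f z * (f z - ?q z) + (f z - ?fs z) * ?q z) - ?fs z * (f z - ?q z))"
      unfolding l2_square eq[symmetric] by (simp add: power2_eq_square)
    also have "\<dots> = (LINT z|lborel. f z * (f z - ?q z)) + (LINT z|lborel. (f z - ?fs z) * ?q z) - (LINT z|lborel. ?fs z * (f z - ?q z))"
    proof -
      have "integrable lborel (\<lambda>z. f z * (f z - ?q z))" "integrable lborel (\<lambda>z. (f z - ?fs z) * ?q z)" "integrable lborel (\<lambda>z. ?fs z * (f z - ?q z))"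
        by (intro sq_int_mult sq_int_diff sq)+
      then show ?thesis by simp
    qed
    finally have "(l2 lborel f)\<^sup>2 \<le> \<bar>LINT z|lborel. f z * (f z - ?q z)\<bar> + \<bar>LINT z|lborel. (f z - ?fs z) * ?q z\<bar> + \<bar>LINT z|lborel. ?fs z * (f z - ?q z)\<bar>"
      by linarith
    also have "\<dots> \<le> l2 lborel f * e + l2 lborel k * (\<bar>s\<bar> * l2 lborel (dx ?g)) + l2 lborel f * e"
    proof (intro add_mono b2)
      have d: "l2 lborel (\<lambda>z. f z - ?q z) \<le> e" using c[OF m] by (simp add: f_def)
      have "\<bar>LINT z|lborel. f z * (f z - ?q z)\<bar> \<le> l2 lborel f * l2 lborel (\<lambda>z. f z - ?q z)"
        by (intro l2_Cauchy_Schwarz_real sq_int_diff sq)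
      also have "\<dots> \<le> l2 lborel f * e" by (intro mult_left_mono d l2_nonneg)
      finally show "\<bar>LINT z|lborel. f z * (f z - ?q z)\<bar> \<le> l2 lborel f * e" .
      have "\<bar>LINT z|lborel. ?fs z * (f z - ?q z)\<bar> \<le> l2 lborel ?fs * l2 lborel (\<lambda>z. f z - ?q z)"
        by (intro l2_Cauchy_Schwarz_real sq_int_diff sq)
      also have "\<dots> \<le> l2 lborel f * e" unfolding nfs by (intro mult_left_mono d l2_nonneg)
      finally show "\<bar>LINT z|lborel. ?fs z * (f z - ?q z)\<bar> \<le> l2 lborel f * e" .
    qed
    finally show "(l2 lborel f)\<^sup>2 \<le> l2 lborel f * (2 * e) + l2 lborel k * (\<bar>s\<bar> * l2 lborel (dx ?g))"
      by (simp add: algebra_simps)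
  qed
  then have "l2 lborel f \<le> 2 * e" by (rule square_le_mult_imp) (use e in simp)
  then show ?thesis by (simp add: f_def)
qed

text \<open>Closability, the reason why the extended norm does not depend on the approximating
  sequence. The \<open>x\<close> derivative is handled through \<open>us n\<close> itself. The
  \<open>y\<close> gradient belongs to the antiderivatives \<open>gs n\<close>, of which only the
  \<open>x\<close> derivatives are known to tend to 0, hence the detour in
  \<open>closable_pd\<close>.\<close>

lemma approximates_zero:
  fixes us :: "nat \<Rightarrow> real \<times> (real ^ 'n) \<Rightarrow> real"
  assumes a: "approximates us (\<lambda>z. 0)"
  shows "(\<lambda>n. Y_norm (us n)) \<longlonglongrightarrow> 0"
proof -
  obtain F where F: "sq_int lebesgue F" "(\<lambda>n. l2 lebesgue (\<lambda>z. jet (us n) z - F z)) \<longlonglongrightarrow> 0"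
    "AE z in lebesgue. snd (F z) = 0"
    by (rule approximates_jet_limit[OF a]) blast
  note us = approximatesD(1)[OF a]
  have usC: "Cc (us n)" for n by (rule Y_Cc[OF us])
  have z: "(\<lambda>n. l2 lborel (us n)) \<longlonglongrightarrow> 0"
  proof (rule tendsto_sandwich[OF _ _ tendsto_const F(2)])
    show "eventually (\<lambda>n. 0 \<le> l2 lborel (us n)) sequentially" by (simp add: l2_nonneg)
    show "eventually (\<lambda>n. l2 lborel (us n) \<le> l2 lebesgue (\<lambda>z. jet (us n) z - F z)) sequentially"
    proof (intro always_eventually allI)
      fix n
      note D = sq_int_diff[OF Y_jet_lebesgue(1)[OF us[of n]] F(1)]
      have "l2 lborel (us n) = l2 lebesgue (us n)" using Cc_sq_int_lebesgue(2)[OF usC] by simp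
      also have "\<dots> = l2 lebesgue (\<lambda>z. snd (jet (us n) z - F z))"
      proof (rule l2_cong_AE)
        show "us n \<in> borel_measurable lebesgue" by (rule sq_int_measurable[OF Y_jet_lebesgue(2)[OF us]])
        show "(\<lambda>z. snd (jet (us n) z - F z)) \<in> borel_measurable lebesgue"
          by (rule sq_int_measurable[OF l2_jet_components(1)[OF D]])
        show "AE z in lebesgue. us n z = snd (jet (us n) z - F z)"
          using F(3) by eventually_elim (simp add: jet_def)
      qed
      also have "\<dots> \<le> l2 lebesgue (\<lambda>z. jet (us n) z - F z)" by (rule l2_jet_components(4)[OF D])
      finally show "l2 lborel (us n) \<le> l2 lebesgue (\<lambda>z. jet (us n) z - F z)" .
    qed
  qed
  have "\<exists>g. us n = dx g \<and> g \<in> test_functions" for n using us[of n] by (blast elim: Y_spaceE)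
  then have "\<exists>gs. \<forall>n. us n = dx (gs n) \<and> gs n \<in> test_functions" by (intro choice) blast
  then obtain gs where gs: "\<And>n. us n = dx (gs n)" "\<And>n. gs n \<in> test_functions" by blast
  show ?thesis
  proof (rule tendstoI)
    fix e :: real assume e: "e > 0"
    \<comment> \<open>Both \<open>us n\<close> and its \<open>x\<close> derivative contribute
      \<open>e1\<^sup>2\<close>, and each of the \<open>CARD('n)\<close> components of the gradient
      contributes \<open>(2 * e1)\<^sup>2\<close>; the sum is
      \<open>(c * e1)\<^sup>2\<close>.\<close>
    define c where "c = sqrt (2 + 4 * real CARD('n))"
    have c: "c > 0" by (simp add: c_def add_pos_nonneg)
    define e1 where "e1 = e / (2 * c)"
    have e1: "e1 > 0" using e c by (simp add: e1_def)
    obtain N1 where N1: "\<forall>m\<ge>N1. \<forall>n\<ge>N1. Y_norm (\<lambda>z. us m z - us n z) < e1" using approximatesD(3)[OF a e1] by blast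
    obtain N2 where N2: "\<And>n. n \<ge> N2 \<Longrightarrow> l2 lborel (us n) < e1"
      using order_tendstoD(2)[OF z e1] unfolding eventually_sequentially by blast
    show "eventually (\<lambda>n. dist (Y_norm (us n)) 0 < e) sequentially"
    proof (rule eventually_sequentiallyI[of "max N1 N2"])
      fix n assume n: "max N1 N2 \<le> n"
      have pot: "l2 lborel (\<lambda>z. pot (us n) z - pot (us m) z) \<le> e1" if "m \<ge> N1" for m
      proof -
        have "pot (\<lambda>z. us n z - us m z) = (\<lambda>z. pot (us n) z - pot (us m) z)"
          using Y_linear(4)[OF us[of n] us[of m]] by (auto simp: pot_jet)
        then have "l2 lborel (\<lambda>z. pot (us n) z - pot (us m) z) \<le> Y_norm (\<lambda>z. us n z - us m z)"
          using l2_jet_parts(2)[OF Y_linear(3)[OF us[of n] us[of m]]] by simp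
        also have "\<dots> < e1" using N1 n that by simp
        finally show ?thesis by simp
      qed
      have psq: "sq_int lborel (\<lambda>z. pot (us n) z - pot (us m) z)" for m
        by (intro sq_int_diff Cc_sq_int Y_Cc us)
      have potg: "pot (us m) = (\<lambda>z. (dx (us m) z, grad_y (gs m) z))" for m
        using pot_dx[OF gs(2)[of m]] by (simp add: gs(1)[symmetric])
      have dx: "l2 lborel (dx (us n)) \<le> e1"
      proof (rule closable_dx[OF us z e1])
        fix m assume m: "N1 \<le> m"
        have "l2 lborel (\<lambda>z. dx (us n) z - dx (us m) z) \<le> l2 lborel (\<lambda>z. pot (us n) z - pot (us m) z)"
          by (rule l2_mono[OF psq]) (simp add: potg norm_fst_le del: real_norm_def)
        then show "l2 lborel (\<lambda>z. dx (us n) z - dx (us m) z) \<le> e1" using pot[OF m] by linarith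
      qed
      have pdi: "l2 lborel (pd (0, axis i 1) (gs n)) \<le> 2 * e1" for i
      proof (rule closable_pd[OF gs(2) _ e1])
        show "(\<lambda>n. l2 lborel (dx (gs n))) \<longlonglongrightarrow> 0" using z by (simp add: gs(1))
        fix m assume m: "N1 \<le> m"
        have "l2 lborel (\<lambda>z. pd (0, axis i 1) (gs n) z - pd (0, axis i 1) (gs m) z) \<le> l2 lborel (\<lambda>z. pot (us n) z - pot (us m) z)"
        proof (rule l2_mono[OF psq])
          fix z
          have "norm (pd (0, axis i 1) (gs n) z - pd (0, axis i 1) (gs m) z) \<le> norm (grad_y (gs n) z - grad_y (gs m) z)"
            using component_le_norm_cart[of "grad_y (gs n) z - grad_y (gs m) z" i] by (simp add: grad_y_nth)
          also have "\<dots> \<le> norm (pot (us n) z - pot (us m) z)" by (simp add: potg norm_snd_le)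
          finally show "norm (pd (0, axis i 1) (gs n) z - pd (0, axis i 1) (gs m) z) \<le> norm (pot (us n) z - pot (us m) z)" .
        qed
        then show "l2 lborel (\<lambda>z. pd (0, axis i 1) (gs n) z - pd (0, axis i 1) (gs m) z) \<le> e1" using pot[OF m] by linarith
      qed
      have tsq: "integrable lborel (\<lambda>z. (f z)\<^sup>2)" if "f \<in> test_functions" for f :: "real \<times> (real ^ 'n) \<Rightarrow> real"
        using sq_int_integrable[OF test_sq_int[OF that]] by simp
      have t: "dx (us n) \<in> test_functions" "pd (0, axis i 1) (gs n) \<in> test_functions" for i
        using Y_test[OF us] gs(2) by (auto simp: dx_pd test_pd)
      have grad_sq: "(norm (grad_y (gs n) z))\<^sup>2 = (\<Sum>i\<in>UNIV. (pd (0, axis i 1) (gs n) z)\<^sup>2)" for z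
        unfolding power2_norm_eq_inner by (simp add: inner_vec_def grad_y_nth power2_eq_square)
      have "(l2 lborel (pot (us n)))\<^sup>2 = (LINT z|lborel. (dx (us n) z)\<^sup>2 + (\<Sum>i\<in>UNIV. (pd (0, axis i 1) (gs n) z)\<^sup>2))"
        unfolding l2_square potg
        by (intro Bochner_Integration.integral_cong refl)
          (simp add: norm_Pair grad_sq sum_nonneg)
      also have "\<dots> = (l2 lborel (dx (us n)))\<^sup>2 + (\<Sum>i\<in>UNIV. (l2 lborel (pd (0, axis i 1) (gs n)))\<^sup>2)"
        using tsq[OF t(1)] tsq[OF t(2)] by (simp add: l2_square)
      also have "\<dots> \<le> e1\<^sup>2 + (\<Sum>i\<in>(UNIV :: 'n set). (2 * e1)\<^sup>2)"
        by (intro add_mono sum_mono power_mono dx pdi l2_nonneg)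
      finally have "(Y_norm (us n))\<^sup>2 \<le> e1\<^sup>2 + real CARD('n) * (2 * e1)\<^sup>2 + (l2 lborel (us n))\<^sup>2"
        using Y_norm_split[OF us[of n]] by simp
      also have "(l2 lborel (us n))\<^sup>2 \<le> e1\<^sup>2" using N2[of n] n by (intro power_mono l2_nonneg) auto
      also have "e1\<^sup>2 + real CARD('n) * (2 * e1)\<^sup>2 + e1\<^sup>2 = (c * e1)\<^sup>2"
        by (simp add: c_def power_mult_distrib algebra_simps)
      finally have "(Y_norm (us n))\<^sup>2 \<le> (c * e1)\<^sup>2" by simp
      then have "Y_norm (us n) \<le> c * e1" by (rule power2_le_imp_le) (use c e1 in simp)
      also have "\<dots> = e / 2" using c by (simp add: e1_def)
      finally show "dist (Y_norm (us n)) 0 < e" using e l2_jet_parts(3)[OF us[of n]] by (simp add: dist_real_def)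
    qed
  qed
qed

section \<open>The linear structure, derivatives and norm of X\<close>

lemma Y_norm_add_le:
  assumes "u \<in> Y_space" "v \<in> Y_space" shows "Y_norm (\<lambda>z. u z + v z) \<le> Y_norm u + Y_norm v"
proof -
  have "jet (\<lambda>z. u z + v z) = (\<lambda>z. jet u z + jet v z)" using Y_linear(2)[OF assms] by auto
  then show ?thesis
    using l2_triangle[OF Y_jet_lebesgue(1)[OF assms(1)] Y_jet_lebesgue(1)[OF assms(2)]] by (simp add: Y_norm_jet)
qed

lemma approximates_add:
  assumes a: "approximates us u" and b: "approximates vs v"
  shows "approximates (\<lambda>n z. us n z + vs n z) (\<lambda>z. u z + v z)"
  unfolding approximates_def
proof (intro conjI allI impI)
  note us = approximatesD(1)[OF a] and vs = approximatesD(1)[OF b]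
  show "(\<lambda>z. us n z + vs n z) \<in> Y_space" for n by (rule Y_linear(1)[OF us vs])
  show "AE z in lebesgue. (\<lambda>n. us n z + vs n z) \<longlonglongrightarrow> u z + v z"
    using approximatesD(2)[OF a] approximatesD(2)[OF b] by eventually_elim (rule tendsto_add)
  fix e :: real assume e: "e > 0"
  obtain N1 where N1: "\<forall>m\<ge>N1. \<forall>n\<ge>N1. Y_norm (\<lambda>z. us m z - us n z) < e / 2" using approximatesD(3)[OF a, of "e / 2"] e by auto
  obtain N2 where N2: "\<forall>m\<ge>N2. \<forall>n\<ge>N2. Y_norm (\<lambda>z. vs m z - vs n z) < e / 2" using approximatesD(3)[OF b, of "e / 2"] e by auto
  have "Y_norm (\<lambda>z. (us j z + vs j z) - (us k z + vs k z)) < e" if "j \<ge> max N1 N2" "k \<ge> max N1 N2" for j k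
  proof -
    have "Y_norm (\<lambda>z. (us j z - us k z) + (vs j z - vs k z)) \<le> Y_norm (\<lambda>z. us j z - us k z) + Y_norm (\<lambda>z. vs j z - vs k z)"
      by (intro Y_norm_add_le Y_linear(3) us vs)
    moreover have "Y_norm (\<lambda>z. us j z - us k z) < e / 2" "Y_norm (\<lambda>z. vs j z - vs k z) < e / 2" using N1 N2 that by auto
    ultimately show ?thesis by (simp add: algebra_simps)
  qed
  then show "\<exists>M. \<forall>j\<ge>M. \<forall>k\<ge>M. Y_norm (\<lambda>z. us j z + vs j z - (us k z + vs k z)) < e" by blast
qed

lemma approximates_cmult:
  assumes a: "approximates us u"
  shows "approximates (\<lambda>n z. c * us n z) (\<lambda>z. c * u z)"
  unfolding approximates_def
proof (intro conjI allI impI)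
  note us = approximatesD(1)[OF a]
  show "(\<lambda>z. c * us n z) \<in> Y_space" for n by (rule Y_linear(5)[OF us us])
  show "AE z in lebesgue. (\<lambda>n. c * us n z) \<longlonglongrightarrow> c * u z"
    using approximatesD(2)[OF a] by eventually_elim (rule tendsto_mult_left)
  fix e :: real assume e: "e > 0"
  have c1: "\<bar>c\<bar> + 1 > 0" by simp
  obtain N where N: "\<forall>m\<ge>N. \<forall>n\<ge>N. Y_norm (\<lambda>z. us m z - us n z) < e / (\<bar>c\<bar> + 1)" using approximatesD(3)[OF a, of "e / (\<bar>c\<bar> + 1)"] e c1 by auto
  have "Y_norm (\<lambda>z. c * us j z - c * us k z) < e" if "j \<ge> N" "k \<ge> N" for j k
  proof -
    have Y: "(\<lambda>z. us j z - us k z) \<in> Y_space" by (rule Y_linear(3)[OF us us])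
    have "Y_norm (\<lambda>z. c * us j z - c * us k z) = \<bar>c\<bar> * Y_norm (\<lambda>z. us j z - us k z)"
      using Y_norm_cmult[OF Y, of c] by (simp add: right_diff_distrib)
    also have "\<dots> \<le> (\<bar>c\<bar> + 1) * Y_norm (\<lambda>z. us j z - us k z)"
      using l2_jet_parts(3)[OF Y] by (intro mult_right_mono) auto
    also have "\<dots> < (\<bar>c\<bar> + 1) * (e / (\<bar>c\<bar> + 1))" using N that c1 by (intro mult_strict_left_mono) auto
    finally show ?thesis using c1 by simp
  qed
  then show "\<exists>M. \<forall>j\<ge>M. \<forall>k\<ge>M. Y_norm (\<lambda>z. c * us j z - c * us k z) < e" by blast
qed

lemma approximates_Y:
  assumes "u \<in> Y_space" shows "approximates (\<lambda>n. u) u"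
proof -
  have "Y_norm (\<lambda>z. u z - u z) = 0"
    using Y_norm_diff[OF assms assms] by (simp add: l2_def)
  then show ?thesis using assms by (simp add: approximates_def)
qed

lemma approximates_unique:
  assumes a: "approximates us u" and b: "approximates vs u"
  shows "(\<lambda>n. Y_norm (\<lambda>z. us n z - vs n z)) \<longlonglongrightarrow> 0"
proof -
  have "approximates (\<lambda>n z. us n z + (- 1) * vs n z) (\<lambda>z. u z + (- 1) * u z)"
    by (intro approximates_add approximates_cmult a b)
  then have "approximates (\<lambda>n z. us n z - vs n z) (\<lambda>z. 0)" by simp
  then show ?thesis by (rule approximates_zero)
qed

lemma L2_limit_iff: "L2_limit fs f \<longleftrightarrow> sq_int lebesgue f \<and> (\<lambda>n. (l2 lebesgue (\<lambda>z. fs n z - f z))\<^sup>2) \<longlonglongrightarrow> 0"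
  by (simp add: L2_limit_def sq_int_def l2_square)

lemma tendsto_square_zeroD: "(\<lambda>n. (f n)\<^sup>2) \<longlonglongrightarrow> 0 \<Longrightarrow> f \<longlonglongrightarrow> (0 :: real)"
  using tendsto_real_sqrt[of "\<lambda>n. (f n)\<^sup>2" 0 sequentially] by (simp add: tendsto_rabs_zero_iff)

lemma l2_limit_le:
  assumes "(\<lambda>n. l2 M (\<lambda>z. F n z - G z)) \<longlonglongrightarrow> 0" "\<And>n. l2 M (\<lambda>z. f n z - g z) \<le> l2 M (\<lambda>z. F n z - G z)"
  shows "(\<lambda>n. l2 M (\<lambda>z. f n z - g z)) \<longlonglongrightarrow> 0"
  by (rule tendsto_sandwich[OF _ _ tendsto_const assms(1)]) (use assms(2) in \<open>auto simp: l2_nonneg\<close>)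

lemma L2_limit_component:
  fixes u :: "real \<times> (real ^ 'n) \<Rightarrow> real" and P :: "(real \<times> (real ^ 'n)) \<times> real \<Rightarrow> 'b::euclidean_space"
  assumes a: "approximates us u"
    and comp: "\<And>n. fs n = (\<lambda>z. P (jet (us n) z))"
    and P: "\<And>F :: real \<times> (real ^ 'n) \<Rightarrow> _. sq_int lebesgue F \<Longrightarrow> sq_int lebesgue (\<lambda>z. P (F z)) \<and> l2 lebesgue (\<lambda>z. P (F z)) \<le> l2 lebesgue F"
    and lin: "\<And>x y. P (x - y) = P x - P y"
  shows "\<exists>w. L2_limit fs w"
proof -
  obtain F where F: "sq_int lebesgue F" "(\<lambda>n. l2 lebesgue (\<lambda>z. jet (us n) z - F z)) \<longlonglongrightarrow> 0"
    by (rule approximates_jet_limit[OF a]) blast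
  have "(\<lambda>n. l2 lebesgue (\<lambda>z. P (jet (us n) z) - P (F z))) \<longlonglongrightarrow> 0"
    using P[OF sq_int_diff[OF Y_jet_lebesgue(1)[OF approximatesD(1)[OF a]] F(1)]]
    by (intro l2_limit_le[OF F(2)]) (simp add: lin)
  then have "(\<lambda>n. (l2 lebesgue (\<lambda>z. P (jet (us n) z) - P (F z)))\<^sup>2) \<longlonglongrightarrow> 0\<^sup>2" by (rule tendsto_power)
  then have "L2_limit fs (\<lambda>z. P (F z))" using P[OF F(1)] by (simp add: L2_limit_iff comp)
  then show ?thesis by blast
qed

text \<open>\<open>X_dx\<close> and \<open>X_Dx_inv_grad\<close> are chosen by \<open>SOME\<close>,
  each with an approximating sequence of its own. By \<open>approximates_unique\<close> two such
  sequences differ by a null sequence in norm, so the limit may be used along any of them.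
  \<open>P\<close> is a projection of the jet, to cover both cases.\<close>

lemma L2_limit_transfer:
  fixes u :: "real \<times> (real ^ 'n) \<Rightarrow> real" and P :: "(real \<times> (real ^ 'n)) \<times> real \<Rightarrow> 'b::euclidean_space"
  assumes a: "approximates us u" and b: "approximates vs u"
    and lim: "L2_limit (\<lambda>n z. P (jet (vs n) z)) w"
    and P: "\<And>F :: real \<times> (real ^ 'n) \<Rightarrow> _. sq_int lebesgue F \<Longrightarrow> sq_int lebesgue (\<lambda>z. P (F z)) \<and> l2 lebesgue (\<lambda>z. P (F z)) \<le> l2 lebesgue F"
    and lin: "\<And>x y. P (x - y) = P x - P y"
  shows "sq_int lebesgue w" "(\<lambda>n. l2 lebesgue (\<lambda>z. P (jet (us n) z) - w z)) \<longlonglongrightarrow> 0"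
proof -
  show w: "sq_int lebesgue w" using lim by (simp add: L2_limit_iff)
  have l: "(\<lambda>n. l2 lebesgue (\<lambda>z. P (jet (vs n) z) - w z)) \<longlonglongrightarrow> 0"
    by (rule tendsto_square_zeroD) (use lim in \<open>simp add: L2_limit_iff\<close>)
  note us = approximatesD(1)[OF a] and vs = approximatesD(1)[OF b]
  have "(\<lambda>n. Y_norm (\<lambda>z. us n z - vs n z) + l2 lebesgue (\<lambda>z. P (jet (vs n) z) - w z)) \<longlonglongrightarrow> 0 + 0"
    by (intro tendsto_add approximates_unique[OF a b] l)
  then have lim0: "(\<lambda>n. Y_norm (\<lambda>z. us n z - vs n z) + l2 lebesgue (\<lambda>z. P (jet (vs n) z) - w z)) \<longlonglongrightarrow> 0" by simp
  show "(\<lambda>n. l2 lebesgue (\<lambda>z. P (jet (us n) z) - w z)) \<longlonglongrightarrow> 0"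
  proof (rule tendsto_sandwich[OF _ _ tendsto_const lim0])
    show "eventually (\<lambda>n. l2 lebesgue (\<lambda>z. P (jet (us n) z) - w z) \<le> Y_norm (\<lambda>z. us n z - vs n z) + l2 lebesgue (\<lambda>z. P (jet (vs n) z) - w z)) sequentially"
    proof (intro always_eventually allI)
      fix n
      note ju = Y_jet_lebesgue(1)[OF us[of n]] and jv = Y_jet_lebesgue(1)[OF vs[of n]]
      have "l2 lebesgue (\<lambda>z. P (jet (us n) z) - w z) \<le> l2 lebesgue (\<lambda>z. P (jet (us n) z) - P (jet (vs n) z)) + l2 lebesgue (\<lambda>z. P (jet (vs n) z) - w z)"
        using P[OF ju] P[OF jv] by (intro l2_triangle3 w) auto
      also have "l2 lebesgue (\<lambda>z. P (jet (us n) z) - P (jet (vs n) z)) \<le> Y_norm (\<lambda>z. us n z - vs n z)"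
        using P[OF sq_int_diff[OF ju jv]] by (simp add: lin Y_norm_diff[OF us vs])
      finally show "l2 lebesgue (\<lambda>z. P (jet (us n) z) - w z) \<le> Y_norm (\<lambda>z. us n z - vs n z) + l2 lebesgue (\<lambda>z. P (jet (vs n) z) - w z)"
        by simp
    qed
  qed (auto simp: l2_nonneg)
qed

text \<open>The counterpart of \<open>jet\<close> on \<open>X\<close>; the integral of
  \<open>X_jet u \<bullet> X_jet v\<close> is the inner product occurring in
  \<open>weak_solution\<close>. Two components are determined only up to null sets, so its algebraic
  rules hold almost everywhere.\<close>

definition X_jet :: "(real \<times> (real ^ 'n) \<Rightarrow> real) \<Rightarrow> real \<times> (real ^ 'n) \<Rightarrow> (real \<times> (real ^ 'n)) \<times> real" where
  "X_jet u z = ((X_dx u z, X_Dx_inv_grad u z), u z)"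

lemma X_jet_limit:
  fixes u :: "real \<times> (real ^ 'n) \<Rightarrow> real"
  assumes a: "approximates us u"
  shows "sq_int lebesgue (X_jet u)" "(\<lambda>n. l2 lebesgue (\<lambda>z. jet (us n) z - X_jet u z)) \<longlonglongrightarrow> 0"
proof -
  have P1: "sq_int lebesgue F \<Longrightarrow> sq_int lebesgue (\<lambda>z. fst (fst (F z))) \<and> l2 lebesgue (\<lambda>z. fst (fst (F z))) \<le> l2 lebesgue F"
    and P2: "sq_int lebesgue F \<Longrightarrow> sq_int lebesgue (\<lambda>z. snd (fst (F z))) \<and> l2 lebesgue (\<lambda>z. snd (fst (F z))) \<le> l2 lebesgue F"
    for F :: "real \<times> (real ^ 'n) \<Rightarrow> (real \<times> (real ^ 'n)) \<times> real"
    using l2_jet_components by blast+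
  have j1: "dx v = (\<lambda>z. fst (fst (jet v z)))" and j2: "Dx_inv (grad_y v) = (\<lambda>z. snd (fst (jet v z)))"
    for v :: "real \<times> (real ^ 'n) \<Rightarrow> real"
    by (auto simp: jet_def pot_def)
  have "\<exists>w. L2_limit (\<lambda>n. dx (us n)) w"
    by (rule L2_limit_component[OF a j1 P1]) auto
  then have "\<exists>w us. approximates us u \<and> L2_limit (\<lambda>n. dx (us n)) w" using a by blast
  then have "\<exists>us. approximates us u \<and> L2_limit (\<lambda>n. dx (us n)) (X_dx u)"
    unfolding X_dx_def by (rule someI_ex)
  then obtain vs where vs: "approximates vs u" "L2_limit (\<lambda>n z. fst (fst (jet (vs n) z))) (X_dx u)"
    unfolding j1 by blast
  note t1 = L2_limit_transfer[OF a vs P1, simplified]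
  have "\<exists>w. L2_limit (\<lambda>n. Dx_inv (grad_y (us n))) w"
    by (rule L2_limit_component[OF a j2 P2]) auto
  then have "\<exists>w us. approximates us u \<and> L2_limit (\<lambda>n. Dx_inv (grad_y (us n))) w" using a by blast
  then have "\<exists>us. approximates us u \<and> L2_limit (\<lambda>n. Dx_inv (grad_y (us n))) (X_Dx_inv_grad u)"
    unfolding X_Dx_inv_grad_def by (rule someI_ex)
  then obtain ws where ws: "approximates ws u" "L2_limit (\<lambda>n z. snd (fst (jet (ws n) z))) (X_Dx_inv_grad u)"
    unfolding j2 by blast
  note t2 = L2_limit_transfer[OF a ws P2, simplified]
  obtain F where F: "sq_int lebesgue F" "(\<lambda>n. l2 lebesgue (\<lambda>z. jet (us n) z - F z)) \<longlonglongrightarrow> 0"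
    "AE z in lebesgue. snd (F z) = u z" "u \<in> borel_measurable lebesgue"
    by (rule approximates_jet_limit[OF a]) blast
  have us: "us n \<in> Y_space" for n by (rule approximatesD(1)[OF a])
  have u: "sq_int lebesgue u" by (rule sq_int_cong_AE[OF l2_jet_components(1)[OF F(1)] F(4,3)])
  have t3: "(\<lambda>n. l2 lebesgue (\<lambda>z. us n z - u z)) \<longlonglongrightarrow> 0"
  proof (rule l2_limit_le[OF F(2)])
    fix n
    note D = sq_int_diff[OF Y_jet_lebesgue(1)[OF us[of n]] F(1)]
    have "l2 lebesgue (\<lambda>z. us n z - u z) = l2 lebesgue (\<lambda>z. snd (jet (us n) z - F z))"
    proof (rule l2_cong_AE)
      show "(\<lambda>z. us n z - u z) \<in> borel_measurable lebesgue"
        by (rule sq_int_measurable[OF sq_int_diff[OF Y_jet_lebesgue(2)[OF us] u]])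
      show "(\<lambda>z. snd (jet (us n) z - F z)) \<in> borel_measurable lebesgue"
        by (rule sq_int_measurable[OF l2_jet_components(1)[OF D]])
      show "AE z in lebesgue. us n z - u z = snd (jet (us n) z - F z)"
        using F(3) by eventually_elim (simp add: jet_def)
    qed
    also have "\<dots> \<le> l2 lebesgue (\<lambda>z. jet (us n) z - F z)" by (rule l2_jet_components(4)[OF D])
    finally show "l2 lebesgue (\<lambda>z. us n z - u z) \<le> l2 lebesgue (\<lambda>z. jet (us n) z - F z)" .
  qed
  have pair_sq: "sq_int lebesgue (\<lambda>z. (f z, g z))" "(l2 lebesgue (\<lambda>z. (f z, g z)))\<^sup>2 = (l2 lebesgue f)\<^sup>2 + (l2 lebesgue g)\<^sup>2"
    if "sq_int lebesgue f" "sq_int lebesgue g"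
    for f :: "real \<times> (real ^ 'n) \<Rightarrow> 'c::euclidean_space" and g :: "real \<times> (real ^ 'n) \<Rightarrow> 'd::euclidean_space"
  proof -
    have n: "(norm (f z, g z))\<^sup>2 = (norm (f z))\<^sup>2 + (norm (g z))\<^sup>2" for z by (simp add: norm_Pair)
    show "sq_int lebesgue (\<lambda>z. (f z, g z))"
      using that unfolding sq_int_def n by (auto intro: borel_measurable_Pair)
    show "(l2 lebesgue (\<lambda>z. (f z, g z)))\<^sup>2 = (l2 lebesgue f)\<^sup>2 + (l2 lebesgue g)\<^sup>2"
      using that by (simp add: l2_square n sq_int_def)
  qed
  show X: "sq_int lebesgue (X_jet u)"
    unfolding X_jet_def by (intro pair_sq t1(1) t2(1) u)
  have eq: "(l2 lebesgue (\<lambda>z. jet (us n) z - X_jet u z))\<^sup>2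
      = (l2 lebesgue (\<lambda>z. fst (fst (jet (us n) z)) - X_dx u z))\<^sup>2 + (l2 lebesgue (\<lambda>z. snd (fst (jet (us n) z)) - X_Dx_inv_grad u z))\<^sup>2
        + (l2 lebesgue (\<lambda>z. us n z - u z))\<^sup>2" for n
  proof -
    note J = Y_jet_lebesgue[OF us[of n]]
    have s: "sq_int lebesgue (\<lambda>z. fst (fst (jet (us n) z)) - X_dx u z)" "sq_int lebesgue (\<lambda>z. snd (fst (jet (us n) z)) - X_Dx_inv_grad u z)"
      "sq_int lebesgue (\<lambda>z. us n z - u z)"
      using P1[OF J(1)] P2[OF J(1)] by (intro sq_int_diff t1(1) t2(1) u J; blast)+
    have "(\<lambda>z. jet (us n) z - X_jet u z) = (\<lambda>z. ((fst (fst (jet (us n) z)) - X_dx u z, snd (fst (jet (us n) z)) - X_Dx_inv_grad u z), us n z - u z))"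
      by (auto simp: X_jet_def jet_def pot_def)
    then show ?thesis using pair_sq(2)[OF pair_sq(1)[OF s(1,2)] s(3)] pair_sq(2)[OF s(1,2)] by simp
  qed
  have "(\<lambda>n. (l2 lebesgue (\<lambda>z. jet (us n) z - X_jet u z))\<^sup>2) \<longlonglongrightarrow> 0\<^sup>2 + 0\<^sup>2 + 0\<^sup>2"
    unfolding eq by (intro tendsto_add tendsto_power t1(2) t2(2) t3)
  then show "(\<lambda>n. l2 lebesgue (\<lambda>z. jet (us n) z - X_jet u z)) \<longlonglongrightarrow> 0"
    using tendsto_square_zeroD[of "\<lambda>n. l2 lebesgue (\<lambda>z. jet (us n) z - X_jet u z)"] by simp
qed

lemma l2_tendsto_norm:
  assumes "\<And>n. sq_int M (F n)" "sq_int M G" "(\<lambda>n. l2 M (\<lambda>z. F n z - G z)) \<longlonglongrightarrow> 0"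
  shows "(\<lambda>n. l2 M (F n)) \<longlonglongrightarrow> l2 M G"
proof -
  have "(\<lambda>n. l2 M (F n) - l2 M G) \<longlonglongrightarrow> 0"
    by (rule Lim_null_comparison[OF _ assms(3)])
      (use l2_reverse_triangle[OF assms(1,2)] in \<open>auto intro: always_eventually\<close>)
  then show ?thesis by (simp add: LIM_zero_iff)
qed

lemma l2_tendsto_inner:
  assumes "\<And>n. sq_int M (F n)" "sq_int M F'" "sq_int M G" "(\<lambda>n. l2 M (\<lambda>z. F n z - F' z)) \<longlonglongrightarrow> 0"
  shows "(\<lambda>n. LINT z|M. F n z \<bullet> G z) \<longlonglongrightarrow> (LINT z|M. F' z \<bullet> G z)"
proof -
  have "(\<lambda>n. (LINT z|M. F n z \<bullet> G z) - (LINT z|M. F' z \<bullet> G z)) \<longlonglongrightarrow> 0"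
  proof (rule Lim_null_comparison)
    show "(\<lambda>n. l2 M (\<lambda>z. F n z - F' z) * l2 M G) \<longlonglongrightarrow> 0" by (rule tendsto_mult_left_zero[OF assms(4)])
    show "eventually (\<lambda>n. norm ((LINT z|M. F n z \<bullet> G z) - (LINT z|M. F' z \<bullet> G z)) \<le> l2 M (\<lambda>z. F n z - F' z) * l2 M G) sequentially"
    proof (intro always_eventually allI)
      fix n
      have "(LINT z|M. F n z \<bullet> G z) - (LINT z|M. F' z \<bullet> G z) = (LINT z|M. (F n z - F' z) \<bullet> G z)"
        using sq_int_inner(1)[OF assms(1,3)] sq_int_inner(1)[OF assms(2,3)] by (simp add: inner_diff_left)
      then show "norm ((LINT z|M. F n z \<bullet> G z) - (LINT z|M. F' z \<bullet> G z)) \<le> l2 M (\<lambda>z. F n z - F' z) * l2 M G"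
        using l2_Cauchy_Schwarz[OF sq_int_diff[OF assms(1,2)] assms(3)] by simp
    qed
  qed
  then show ?thesis by (simp add: LIM_zero_iff)
qed

lemma l2_limit_unique:
  assumes "\<And>n. sq_int M (F n)" "sq_int M G" "sq_int M G'"
    "(\<lambda>n. l2 M (\<lambda>z. F n z - G z)) \<longlonglongrightarrow> 0" "(\<lambda>n. l2 M (\<lambda>z. F n z - G' z)) \<longlonglongrightarrow> 0"
  shows "AE z in M. G z = G' z"
proof -
  have "(\<lambda>n. l2 M (\<lambda>z. F n z - G z) + l2 M (\<lambda>z. F n z - G' z)) \<longlonglongrightarrow> 0 + 0"
    by (intro tendsto_add assms)
  moreover have "l2 M (\<lambda>z. G z - G' z) \<le> l2 M (\<lambda>z. F n z - G z) + l2 M (\<lambda>z. F n z - G' z)" for n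
    using l2_triangle3[OF assms(2,1,3), of n] l2_minus[of M G "F n"] by simp
  ultimately have "l2 M (\<lambda>z. G z - G' z) \<le> 0 + 0"
    by (intro LIMSEQ_le_const) auto
  then have "l2 M (\<lambda>z. G z - G' z) = 0" using l2_nonneg[of M "\<lambda>z. G z - G' z"] by simp
  from l2_zero_AE[OF sq_int_diff[OF assms(2,3)] this] show ?thesis by eventually_elim simp
qed

lemma X_spaceE: assumes "u \<in> X_space" obtains us where "approximates us u"
  using assms unfolding X_space_def by blast

lemma X_spaceI: "approximates us u \<Longrightarrow> u \<in> X_space"
  unfolding X_space_def by blast

lemma X_jet_sq_int: "u \<in> X_space \<Longrightarrow> sq_int lebesgue (X_jet u)"
  by (erule X_spaceE) (rule X_jet_limit(1))

lemma X_sq_int: assumes "u \<in> X_space" shows "sq_int lebesgue u" "l2 lebesgue u \<le> l2 lebesgue (X_jet u)"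
  using l2_jet_components(1,4)[OF X_jet_sq_int[OF assms]] by (simp_all add: X_jet_def)

text \<open>Along every approximating sequence the jets converge to the same \<open>X_jet u\<close>,
  so the definite description in \<open>X_norm\<close> has a unique candidate.\<close>

lemma X_norm_eq:
  assumes "approximates us u"
  shows "X_norm u = l2 lebesgue (X_jet u)" "(\<lambda>n. Y_norm (us n)) \<longlonglongrightarrow> X_norm u"
proof -
  have lim: "(\<lambda>n. Y_norm (us n)) \<longlonglongrightarrow> l2 lebesgue (X_jet u)" if "approximates us u" for us
    unfolding Y_norm_jet
    by (rule l2_tendsto_norm[OF Y_jet_lebesgue(1)[OF approximatesD(1)[OF that]] X_jet_limit[OF that]])
  show eq: "X_norm u = l2 lebesgue (X_jet u)"
    unfolding X_norm_def
  proof (rule the_equality)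
    show "\<forall>us. approximates us u \<longrightarrow> (\<lambda>n. Y_norm (us n)) \<longlonglongrightarrow> l2 lebesgue (X_jet u)" using lim by blast
    fix c assume "\<forall>us. approximates us u \<longrightarrow> (\<lambda>n. Y_norm (us n)) \<longlonglongrightarrow> c"
    then have "(\<lambda>n. Y_norm (us n)) \<longlonglongrightarrow> c" using assms by blast
    then show "c = l2 lebesgue (X_jet u)" using lim[OF assms] by (rule LIMSEQ_unique)
  qed
  show "(\<lambda>n. Y_norm (us n)) \<longlonglongrightarrow> X_norm u" unfolding eq by (rule lim[OF assms])
qed

lemma X_norm_l2: "u \<in> X_space \<Longrightarrow> X_norm u = l2 lebesgue (X_jet u)"
  by (erule X_spaceE) (rule X_norm_eq(1))

lemma X_jet_unique:
  assumes "approximates us u" "sq_int lebesgue G" "(\<lambda>n. l2 lebesgue (\<lambda>z. jet (us n) z - G z)) \<longlonglongrightarrow> 0"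
  shows "AE z in lebesgue. X_jet u z = G z"
  by (rule l2_limit_unique[OF Y_jet_lebesgue(1)[OF approximatesD(1)[OF assms(1)]] X_jet_limit(1)[OF assms(1)] assms(2)
        X_jet_limit(2)[OF assms(1)] assms(3)])

lemma X_add:
  assumes "u \<in> X_space" "v \<in> X_space"
  shows "(\<lambda>z. u z + v z) \<in> X_space" "AE z in lebesgue. X_jet (\<lambda>z. u z + v z) z = X_jet u z + X_jet v z"
proof -
  obtain us where us: "approximates us u" using assms(1) by (rule X_spaceE)
  obtain vs where vs: "approximates vs v" using assms(2) by (rule X_spaceE)
  note a = approximates_add[OF us vs]
  show "(\<lambda>z. u z + v z) \<in> X_space" using a by (rule X_spaceI)
  note ju = X_jet_limit[OF us] and jv = X_jet_limit[OF vs]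
  note yu = approximatesD(1)[OF us] and yv = approximatesD(1)[OF vs]
  show "AE z in lebesgue. X_jet (\<lambda>z. u z + v z) z = X_jet u z + X_jet v z"
  proof (rule X_jet_unique[OF a sq_int_add[OF ju(1) jv(1)]])
    have l0: "(\<lambda>n. l2 lebesgue (\<lambda>z. jet (us n) z - X_jet u z) + l2 lebesgue (\<lambda>z. jet (vs n) z - X_jet v z)) \<longlonglongrightarrow> 0"
      using tendsto_add[OF ju(2) jv(2)] by simp
    show "(\<lambda>n. l2 lebesgue (\<lambda>z. jet (\<lambda>z. us n z + vs n z) z - (X_jet u z + X_jet v z))) \<longlonglongrightarrow> 0"
    proof (rule tendsto_sandwich[OF _ _ tendsto_const l0])
      show "eventually (\<lambda>n. l2 lebesgue (\<lambda>z. jet (\<lambda>z. us n z + vs n z) z - (X_jet u z + X_jet v z))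
          \<le> l2 lebesgue (\<lambda>z. jet (us n) z - X_jet u z) + l2 lebesgue (\<lambda>z. jet (vs n) z - X_jet v z)) sequentially"
      proof (intro always_eventually allI)
        fix n
        have "l2 lebesgue (\<lambda>z. (jet (us n) z - X_jet u z) + (jet (vs n) z - X_jet v z)) \<le>
          l2 lebesgue (\<lambda>z. jet (us n) z - X_jet u z) + l2 lebesgue (\<lambda>z. jet (vs n) z - X_jet v z)"
          by (intro l2_triangle sq_int_diff Y_jet_lebesgue yu yv ju jv)
        then show "l2 lebesgue (\<lambda>z. jet (\<lambda>z. us n z + vs n z) z - (X_jet u z + X_jet v z))
          \<le> l2 lebesgue (\<lambda>z. jet (us n) z - X_jet u z) + l2 lebesgue (\<lambda>z. jet (vs n) z - X_jet v z)"
          by (simp add: Y_linear(2)[OF yu yv] add_diff_add)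
      qed
    qed (auto simp: l2_nonneg)
  qed
qed

lemma X_cmult:
  assumes "u \<in> X_space"
  shows "(\<lambda>z. c * u z) \<in> X_space" "AE z in lebesgue. X_jet (\<lambda>z. c * u z) z = c *\<^sub>R X_jet u z"
    "X_norm (\<lambda>z. c * u z) = \<bar>c\<bar> * X_norm u"
proof -
  obtain us where us: "approximates us u" using assms(1) by (rule X_spaceE)
  note a = approximates_cmult[OF us, of c]
  show X: "(\<lambda>z. c * u z) \<in> X_space" using a by (rule X_spaceI)
  note ju = X_jet_limit[OF us]
  note yu = approximatesD(1)[OF us]
  show AE: "AE z in lebesgue. X_jet (\<lambda>z. c * u z) z = c *\<^sub>R X_jet u z"
  proof (rule X_jet_unique[OF a sq_int_scale[OF ju(1)]])
    have "l2 lebesgue (\<lambda>z. jet (\<lambda>z. c * us n z) z - c *\<^sub>R X_jet u z) = \<bar>c\<bar> * l2 lebesgue (\<lambda>z. jet (us n) z - X_jet u z)" for n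
      using l2_scale[of lebesgue c "\<lambda>z. jet (us n) z - X_jet u z"]
      by (simp add: Y_linear(6)[OF yu yu] scaleR_diff_right)
    then show "(\<lambda>n. l2 lebesgue (\<lambda>z. jet (\<lambda>z. c * us n z) z - c *\<^sub>R X_jet u z)) \<longlonglongrightarrow> 0"
      using tendsto_mult_right_zero[OF ju(2), of "\<bar>c\<bar>"] by simp
  qed
  have "l2 lebesgue (X_jet (\<lambda>z. c * u z)) = l2 lebesgue (\<lambda>z. c *\<^sub>R X_jet u z)"
    by (rule l2_cong_AE[OF sq_int_measurable[OF X_jet_sq_int[OF X]] sq_int_measurable[OF sq_int_scale[OF ju(1)]] AE])
  then show "X_norm (\<lambda>z. c * u z) = \<bar>c\<bar> * X_norm u"
    by (simp add: X_norm_l2[OF X] X_norm_l2[OF assms] l2_scale)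
qed

lemma X_norm_add_square:
  assumes "u \<in> X_space" "v \<in> X_space"
  shows "(X_norm (\<lambda>z. u z + v z))\<^sup>2 = (X_norm u)\<^sup>2 + 2 * (LINT z|lebesgue. X_jet u z \<bullet> X_jet v z) + (X_norm v)\<^sup>2"
proof -
  note ju = X_jet_sq_int[OF assms(1)] and jv = X_jet_sq_int[OF assms(2)] and uv = X_add[OF assms]
  have "l2 lebesgue (X_jet (\<lambda>z. u z + v z)) = l2 lebesgue (\<lambda>z. X_jet u z + X_jet v z)"
    by (rule l2_cong_AE[OF sq_int_measurable[OF X_jet_sq_int[OF uv(1)]] sq_int_measurable[OF sq_int_add[OF ju jv]] uv(2)])
  then show ?thesis
    using l2_add_square[OF ju jv] by (simp add: X_norm_l2 uv(1) assms)
qed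

lemma Y_in_X: "u \<in> Y_space \<Longrightarrow> u \<in> X_space"
  by (rule X_spaceI[OF approximates_Y])

lemma X_approx_norm:
  assumes a: "approximates us u"
  shows "(\<lambda>n. X_norm (\<lambda>z. us n z - u z)) \<longlonglongrightarrow> 0" "(\<lambda>z. us n z - u z) \<in> X_space"
proof -
  have X: "(\<lambda>z. us n z + (- 1) * u z) \<in> X_space" for n
    using X_add(1)[OF Y_in_X[OF approximatesD(1)[OF a]] X_cmult(1)[OF X_spaceI[OF a], of "- 1"]] .
  then show "(\<lambda>z. us n z - u z) \<in> X_space" for n using X[of n] by simp
  have "X_norm (\<lambda>z. us n z - u z) = l2 lebesgue (\<lambda>z. jet (us n) z - X_jet u z)" for n
  proof -
    have y: "us n \<in> Y_space" by (rule approximatesD(1)[OF a])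
    have "AE z in lebesgue. X_jet (us n) z = jet (us n) z"
      by (rule X_jet_unique[OF approximates_Y[OF y] Y_jet_lebesgue(1)[OF y]]) (simp add: l2_def)
    then have "AE z in lebesgue. X_jet (\<lambda>z. us n z + (- 1) * u z) z = jet (us n) z - X_jet u z"
      using X_add(2)[OF Y_in_X[OF y] X_cmult(1)[OF X_spaceI[OF a], of "- 1"]] X_cmult(2)[OF X_spaceI[OF a], of "- 1"]
      by eventually_elim simp
    then have "l2 lebesgue (X_jet (\<lambda>z. us n z + (- 1) * u z)) = l2 lebesgue (\<lambda>z. jet (us n) z - X_jet u z)"
      by (rule l2_cong_AE[OF sq_int_measurable[OF X_jet_sq_int[OF X]] sq_int_measurable[OF sq_int_diff[OF Y_jet_lebesgue(1)[OF y] X_jet_limit(1)[OF a]]]])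
    then show ?thesis using X_norm_l2[OF X[of n]] by simp
  qed
  then show "(\<lambda>n. X_norm (\<lambda>z. us n z - u z)) \<longlonglongrightarrow> 0" using X_jet_limit(2)[OF a] by simp
qed

lemma l2_indicator_lebesgue:
  fixes f :: "'a::euclidean_space \<Rightarrow> real"
  assumes "Cc f" "S \<in> sets borel"
  shows "l2 lborel (\<lambda>z. indicator S z * f z) = l2 lebesgue (\<lambda>z. indicator S z * f z)"
proof -
  have "(\<lambda>z. indicator S z * f z) \<in> borel_measurable lborel"
    using assms Cc_measurable[OF assms(1)] by (intro borel_measurable_times borel_measurable_indicator) auto
  then show ?thesis unfolding l2_def by (subst integral_completion) auto
qed

lemma midpoint_hull_induct_conv:
  assumes hull: "midpoint_hull us N v" and mid: "\<And>u v. P u \<Longrightarrow> P v \<Longrightarrow> P (\<lambda>z. (1 / 2) * (u z + v z))"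
    and base: "\<And>k. k \<ge> N \<Longrightarrow> P (us k)"
  shows "P v"
  using hull by induction (auto intro: base mid simp del: times_divide_eq_left mult_1)

section \<open>Integrability and the energy functional on X\<close>

context subcritical
begin

text \<open>The embedding passes from \<open>Y\<close> to \<open>X\<close> by Fatou's lemma along an
  approximating sequence. The strict bound on \<open>X_norm u\<close> ensures that the approximating
  functions eventually obey it too.\<close>

lemma X_mass_bound:
  assumes K: "K > 0"
  obtains K' where "K' > 0" "\<And>u :: real \<times> (real ^ 'n) \<Rightarrow> real. u \<in> X_space \<Longrightarrow> X_norm u < K \<Longrightarrow> Lq lebesgue u \<and> mass lebesgue u \<le> K'"
proof -
  obtain C1 where C1: "C1 > 0" "\<And>u s. u \<in> Y \<Longrightarrow> s > 0 \<Longrightarrow> Y_norm u \<le> s \<Longrightarrow> (LINT z|lborel. \<bar>u z\<bar> powr (p + 1)) \<le> C1 * s powr (p + 1)"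
    by (rule Y_embedding) blast
  let ?Q = "C1 * K powr (p + 1)"
  have Q: "?Q > 0" using C1 K by simp
  have "Lq lebesgue u \<and> mass lebesgue u \<le> K\<^sup>2 + ?Q" if u: "u \<in> X_space" "X_norm u < K" for u :: "real \<times> (real ^ 'n) \<Rightarrow> real"
  proof -
    obtain us where a: "approximates us u" using u(1) by (rule X_spaceE)
    note us = approximatesD(1)[OF a]
    note s = X_sq_int[OF u(1)]
    note [measurable] = sq_int_measurable[OF s(1)] sq_int_measurable[OF Y_jet_lebesgue(2)[OF us]]
    have "eventually (\<lambda>n. Y_norm (us n) < K) sequentially" by (rule order_tendstoD(2)[OF X_norm_eq(2)[OF a] u(2)])
    then have ev: "eventually (\<lambda>n. (\<integral>\<^sup>+ z. ennreal (\<bar>us n z\<bar> powr (p + 1)) \<partial>lebesgue) \<le> ennreal ?Q) sequentially"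
    proof eventually_elim
      case (elim n)
      have Cq: "Cc (\<lambda>z. \<bar>us n z\<bar> powr (p + 1))" using p by (intro Cc_abs_powr Y_Cc us) auto
      have "(\<integral>\<^sup>+ z. ennreal (\<bar>us n z\<bar> powr (p + 1)) \<partial>lebesgue) = ennreal (LINT z|lborel. \<bar>us n z\<bar> powr (p + 1))"
        using nn_integral_eq_integral[OF Cc_lebesgue(1)[OF Cq]] Cc_lebesgue(2)[OF Cq] by simp
      also have "\<dots> \<le> ennreal ?Q" using elim by (intro ennreal_leI C1(2) us K) auto
      finally show ?case .
    qed
    have "(\<integral>\<^sup>+ z. ennreal (\<bar>u z\<bar> powr (p + 1)) \<partial>lebesgue) = (\<integral>\<^sup>+ z. liminf (\<lambda>n. ennreal (\<bar>us n z\<bar> powr (p + 1))) \<partial>lebesgue)"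
    proof (rule nn_integral_cong_AE)
      show "AE z in lebesgue. ennreal (\<bar>u z\<bar> powr (p + 1)) = liminf (\<lambda>n. ennreal (\<bar>us n z\<bar> powr (p + 1)))"
        using approximatesD(2)[OF a]
      proof eventually_elim
        case (elim z)
        have "isCont (\<lambda>x::real. \<bar>x\<bar> powr (p + 1)) (u z)"
          using continuous_abs_powr[of "p + 1"] p by (simp add: continuous_on_eq_continuous_at)
        from isCont_tendsto_compose[OF this elim]
        have "(\<lambda>n. ennreal (\<bar>us n z\<bar> powr (p + 1))) \<longlonglongrightarrow> ennreal (\<bar>u z\<bar> powr (p + 1))" by (rule tendsto_ennrealI)
        then show ?case by (rule lim_imp_Liminf[OF trivial_limit_sequentially, symmetric])
      qed
    qed
    also have "\<dots> \<le> liminf (\<lambda>n. \<integral>\<^sup>+ z. ennreal (\<bar>us n z\<bar> powr (p + 1)) \<partial>lebesgue)"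
      by (rule nn_integral_liminf) measurable
    also have "\<dots> \<le> liminf (\<lambda>n. ennreal ?Q)" by (rule Liminf_mono[OF ev])
    also have "\<dots> = ennreal ?Q" by (simp add: Liminf_const)
    finally have b: "(\<integral>\<^sup>+ z. ennreal (\<bar>u z\<bar> powr (p + 1)) \<partial>lebesgue) \<le> ennreal ?Q" .
    have i: "integrable lebesgue (\<lambda>z. \<bar>u z\<bar> powr (p + 1))"
      by (rule integrableI_bounded) (use b in \<open>auto simp: order.strict_trans1\<close>)
    have L: "Lq lebesgue u" using s(1) i by (simp add: Lq_def)
    have "ennreal (LINT z|lebesgue. \<bar>u z\<bar> powr (p + 1)) \<le> ennreal ?Q"
      using b nn_integral_eq_integral[OF i] by simp
    then have b2: "(LINT z|lebesgue. \<bar>u z\<bar> powr (p + 1)) \<le> ?Q" using Q by simp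
    have "(l2 lebesgue u)\<^sup>2 \<le> K\<^sup>2"
      using s(2) u(2) X_norm_l2[OF u(1)] by (intro power_mono l2_nonneg) auto
    with b2 L show ?thesis by (simp add: mass_def l2_square)
  qed
  then show thesis using Q by (intro that[of "K\<^sup>2 + ?Q"]) (auto simp: add_nonneg_pos)
qed

lemma X_Lq: "u \<in> X_space \<Longrightarrow> Lq lebesgue u" for u :: "real \<times> (real ^ 'n) \<Rightarrow> real"
proof -
  assume u: "u \<in> X_space"
  have "X_norm u + 1 > 0" using X_norm_l2[OF u] l2_nonneg[of lebesgue "X_jet u"] by linarith
  from X_mass_bound[OF this] u show ?thesis by (metis less_add_one)
qed

lemma X_h_pairing_limit:
  fixes u v :: "real \<times> (real ^ 'n) \<Rightarrow> real"
  assumes u: "u \<in> X_space" and a: "approximates vs v"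
  shows "(\<lambda>n. LINT z|lebesgue. h (u z) * vs n z) \<longlonglongrightarrow> (LINT z|lebesgue. h (u z) * v z)"
proof -
  obtain C where C: "C > 0" "\<And>t. \<bar>h t\<bar> \<le> 1 * \<bar>t\<bar> + C * \<bar>t\<bar> powr p" by (rule h_bound_p[of 1]) auto
  obtain K where K: "K > 0" "\<And>u :: real \<times> (real ^ 'n) \<Rightarrow> real. u \<in> X_space \<Longrightarrow> X_norm u < 1 \<Longrightarrow> Lq lebesgue u \<and> mass lebesgue u \<le> K"
    by (rule X_mass_bound[of 1]) auto
  have uL: "Lq lebesgue u" by (rule X_Lq[OF u])
  have vX: "v \<in> X_space" by (rule X_spaceI[OF a])
  let ?B = "(1 + C) * (mass lebesgue u + K)"
  \<comment> \<open>\<open>mass\<close> is not homogeneous, so the linear dependence on the norm is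
    obtained by rescaling \<open>w\<close> into the unit ball.\<close>
  have bound: "\<bar>LINT z|lebesgue. h (u z) * w z\<bar> \<le> ?B * s" if w: "w \<in> X_space" "X_norm w < s" for w s
  proof -
    have s: "s > 0" using w X_norm_l2[OF w(1)] l2_nonneg[of lebesgue "X_jet w"] by linarith
    let ?w = "\<lambda>z. (1 / s) * w z"
    have W: "?w \<in> X_space" "X_norm ?w < 1" using X_cmult(1,3)[OF w(1), of "1 / s"] w(2) s by auto
    have "\<bar>LINT z|lebesgue. h (u z) * ?w z\<bar> \<le> (1 + C) * (mass lebesgue u + mass lebesgue ?w)"
      by (rule h_pairing_le[OF uL X_Lq[OF W(1)]]) (use C in auto)
    also have "\<dots> \<le> ?B" using K(2)[OF W] C(1) by (intro mult_left_mono) auto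
    also have "(LINT z|lebesgue. h (u z) * ?w z) = (1 / s) * (LINT z|lebesgue. h (u z) * w z)"
      by (simp add: mult_ac)
    finally show ?thesis using s by (simp add: abs_mult field_simps)
  qed
  have mB: "?B \<ge> 0" using bound[OF Y_in_X, of "\<lambda>z. 0" 1] C(1) K(1) LqD[OF uL]
    by (intro mult_nonneg_nonneg add_nonneg_nonneg) (auto simp: mass_def intro!: integral_nonneg_AE)
  have "(\<lambda>n. (LINT z|lebesgue. h (u z) * vs n z) - (LINT z|lebesgue. h (u z) * v z)) \<longlonglongrightarrow> 0"
  proof (rule tendstoI)
    fix e :: real assume e: "e > 0"
    define s where "s = e / (2 * (?B + 1))"
    have s: "s > 0" using e mB by (simp add: s_def)
    have Bs: "?B * s < e"
    proof -
      have "?B * s \<le> (?B + 1) * s" using s by (intro mult_right_mono) auto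
      also have "\<dots> = e / 2" using mB by (simp add: s_def field_simps)
      finally show ?thesis using e by simp
    qed
    have "eventually (\<lambda>n. X_norm (\<lambda>z. vs n z - v z) < s) sequentially"
      by (rule order_tendstoD(2)[OF X_approx_norm(1)[OF a] s])
    then show "eventually (\<lambda>n. dist ((LINT z|lebesgue. h (u z) * vs n z) - (LINT z|lebesgue. h (u z) * v z)) 0 < e) sequentially"
    proof eventually_elim
      case (elim n)
      have "(LINT z|lebesgue. h (u z) * vs n z) - (LINT z|lebesgue. h (u z) * v z) = (LINT z|lebesgue. h (u z) * (vs n z - v z))"
        using Lq_h_mult(1)[OF uL X_Lq[OF Y_in_X[OF approximatesD(1)[OF a]]]] Lq_h_mult(1)[OF uL X_Lq[OF vX]]
        by (simp add: right_diff_distrib)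
      then show ?case using bound[OF X_approx_norm(2)[OF a] elim] Bs by simp
    qed
  qed
  then show ?thesis by (simp add: LIM_zero_iff)
qed

text \<open>The squared norm is expanded exactly and its linear term cancels against that of the
  integral of \<open>H\<close> by the equation. What is left is half the squared norm of the
  increment and a remainder that \<open>H_functional_diff\<close> makes small uniformly in the
  direction.\<close>

lemma critical_pointI:
  fixes u :: "real \<times> (real ^ 'n) \<Rightarrow> real"
  assumes u: "u \<in> X_space"
    and eq: "\<And>v. v \<in> X_space \<Longrightarrow> (LINT z|lebesgue. X_jet u z \<bullet> X_jet v z) = (LINT z|lebesgue. h (u z) * v z)"
  shows "critical_point (energy h) u"
  unfolding critical_point_def
proof (intro conjI u allI impI)
  fix e :: real assume e: "e > 0"
  obtain K where K: "K > 0" "\<And>u :: real \<times> (real ^ 'n) \<Rightarrow> real. u \<in> X_space \<Longrightarrow> X_norm u < 1 \<Longrightarrow> Lq lebesgue u \<and> mass lebesgue u \<le> K"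
    by (rule X_mass_bound[of 1]) auto
  have uL: "Lq lebesgue u" by (rule X_Lq[OF u])
  define K1 where "K1 = max K (mass lebesgue u)"
  have K1: "K1 > 0" "K \<le> K1" "mass lebesgue u \<le> K1" using K(1) by (auto simp: K1_def)
  have e4: "e / 4 > 0" using e by simp
  obtain d where d: "d > 0" "d \<le> 1"
    "\<And>(u :: real \<times> (real ^ 'n) \<Rightarrow> real) v s. Lq lebesgue u \<Longrightarrow> Lq lebesgue v \<Longrightarrow> mass lebesgue u \<le> K1 \<Longrightarrow> mass lebesgue v \<le> K1 \<Longrightarrow> 0 < s \<Longrightarrow> s < d \<Longrightarrow>
      \<bar>(LINT z|lebesgue. H (u z + s * v z)) - (LINT z|lebesgue. H (u z)) - s * (LINT z|lebesgue. h (u z) * v z)\<bar> \<le> e / 4 * s"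
    using H_functional_diff[OF K1(1) e4, where M = "lebesgue :: (real \<times> (real ^ 'n)) measure"] by blast
  show "\<exists>d>0. \<forall>\<phi>\<in>X_space. X_norm \<phi> < d \<longrightarrow> \<bar>energy h (\<lambda>z. u z + \<phi> z) - energy h u\<bar> \<le> e * X_norm \<phi>"
  proof (intro exI[of _ "min (d / 2) e"] conjI ballI impI)
    show "min (d / 2) e > 0" using d e by simp
    fix \<phi> :: "real \<times> (real ^ 'n) \<Rightarrow> real" assume \<phi>: "\<phi> \<in> X_space" "X_norm \<phi> < min (d / 2) e"
    have n0: "X_norm \<phi> \<ge> 0" using X_norm_l2[OF \<phi>(1)] l2_nonneg[of lebesgue "X_jet \<phi>"] by simp
    let ?r = "(LINT z|lebesgue. H (u z + \<phi> z)) - (LINT z|lebesgue. H (u z)) - (LINT z|lebesgue. h (u z) * \<phi> z)"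
    \<comment> \<open>The increment is \<open>s\<close> times a function of norm strictly below 1,
      which is what \<open>X_mass_bound\<close> asks for; so \<open>s\<close> must be strictly above
      the norm of \<open>\<phi>\<close>.\<close>
    have r: "\<bar>?r\<bar> \<le> e / 4 * s" if s: "X_norm \<phi> < s" "s < d" for s
    proof -
      have s0: "s > 0" using s n0 by linarith
      let ?w = "\<lambda>z. (1 / s) * \<phi> z"
      have W: "?w \<in> X_space" "X_norm ?w < 1" using X_cmult(1,3)[OF \<phi>(1), of "1 / s"] s s0 by auto
      have "\<bar>(LINT z|lebesgue. H (u z + s * ?w z)) - (LINT z|lebesgue. H (u z)) - s * (LINT z|lebesgue. h (u z) * ?w z)\<bar> \<le> e / 4 * s"
        using K(2)[OF W] K1 s s0 by (intro d(3) uL) auto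
      moreover have "s * ?w z = \<phi> z" for z using s0 by simp
      moreover have "s * (LINT z|lebesgue. h (u z) * ?w z) = (LINT z|lebesgue. h (u z) * \<phi> z)"
        using s0 by simp
      ultimately show ?thesis by simp
    qed
    \<comment> \<open>If the norm is 0, \<open>s\<close> may be arbitrarily small; otherwise
      \<open>s\<close> is twice the norm.\<close>
    have r2: "\<bar>?r\<bar> \<le> e / 2 * X_norm \<phi>"
    proof (cases "X_norm \<phi> = 0")
      case True
      have "\<bar>?r\<bar> \<le> 0 + x" if "x > 0" for x
      proof -
        have "e / 4 * min (d / 2) (x * 4 / e) \<le> e / 4 * (x * 4 / e)" using e by (intro mult_left_mono) auto
        also have "\<dots> = x" using e by simp
        finally have le: "e / 4 * min (d / 2) (x * 4 / e) \<le> x" .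
        have "X_norm \<phi> < min (d / 2) (x * 4 / e)" "min (d / 2) (x * 4 / e) < d"
          using True d(1) that e by (auto simp: min_def)
        from order.trans[OF r[OF this] le] show ?thesis by simp
      qed
      then have "\<bar>?r\<bar> \<le> 0" by (rule field_le_epsilon)
      then show ?thesis using True by simp
    next
      case False
      have "\<bar>?r\<bar> \<le> e / 4 * (2 * X_norm \<phi>)" using r[of "2 * X_norm \<phi>"] \<phi>(2) n0 False by simp
      then show ?thesis by simp
    qed
    have "energy h (\<lambda>z. u z + \<phi> z) - energy h u = 1 / 2 * (X_norm \<phi>)\<^sup>2 - ?r"
      unfolding energy_def X_norm_add_square[OF u \<phi>(1)] eq[OF \<phi>(1)] by (simp add: algebra_simps)
    moreover have "\<bar>a - b\<bar> \<le> a + \<bar>b\<bar>" if "0 \<le> a" for a b :: real using that by linarith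
    ultimately have "\<bar>energy h (\<lambda>z. u z + \<phi> z) - energy h u\<bar> \<le> 1 / 2 * (X_norm \<phi>)\<^sup>2 + \<bar>?r\<bar>" by simp
    also have "\<dots> \<le> 1 / 2 * (e * X_norm \<phi>) + e / 2 * X_norm \<phi>"
      using \<phi>(2) n0 r2 by (intro add_mono mult_left_mono) (auto simp: power2_eq_square mult_right_mono)
    finally show "\<bar>energy h (\<lambda>z. u z + \<phi> z) - energy h u\<bar> \<le> e * X_norm \<phi>" by simp
  qed
qed

lemma weak_solutionI:
  fixes u :: "real \<times> (real ^ 'n) \<Rightarrow> real"
  assumes u: "u \<in> X_space"
    and eq: "\<And>v. v \<in> X_space \<Longrightarrow> (LINT z|lebesgue. X_jet u z \<bullet> X_jet v z) = (LINT z|lebesgue. h (u z) * v z)"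
  shows "weak_solution h u"
  unfolding weak_solution_def
proof (intro conjI u ballI)
  fix v :: "real \<times> (real ^ 'n) \<Rightarrow> real" assume v: "v \<in> X_space"
  show "integrable lebesgue (\<lambda>z. h (u z) * v z)" by (rule Lq_h_mult(1)[OF X_Lq[OF u] X_Lq[OF v]])
  show "(LINT z|lebesgue. X_dx u z * X_dx v z + X_Dx_inv_grad u z \<bullet> X_Dx_inv_grad v z + u z * v z) = (LINT z|lebesgue. h (u z) * v z)"
    using eq[OF v] by (simp add: X_jet_def)
qed

lemma extend_to_X:
  fixes u :: "real \<times> (real ^ 'n) \<Rightarrow> real"
  assumes u: "u \<in> X_space"
    and eq: "\<And>v. v \<in> Y \<Longrightarrow> (LINT z|lebesgue. X_jet u z \<bullet> jet v z) = (LINT z|lebesgue. h (u z) * v z)"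
    and v: "v \<in> X_space"
  shows "(LINT z|lebesgue. X_jet u z \<bullet> X_jet v z) = (LINT z|lebesgue. h (u z) * v z)"
proof -
  obtain vs where a: "approximates vs v" using v by (rule X_spaceE)
  have "(\<lambda>n. LINT z|lebesgue. jet (vs n) z \<bullet> X_jet u z) \<longlonglongrightarrow> (LINT z|lebesgue. X_jet v z \<bullet> X_jet u z)"
    by (rule l2_tendsto_inner[OF Y_jet_lebesgue(1)[OF approximatesD(1)[OF a]] X_jet_limit(1)[OF a] X_jet_sq_int[OF u] X_jet_limit(2)[OF a]])
  then have "(\<lambda>n. LINT z|lebesgue. h (u z) * vs n z) \<longlonglongrightarrow> (LINT z|lebesgue. X_jet u z \<bullet> X_jet v z)"
    using eq[OF approximatesD(1)[OF a]] by (simp add: inner_commute)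
  then show ?thesis using X_h_pairing_limit[OF u a] by (rule LIMSEQ_unique)
qed

end

section \<open>Existence of a solution\<close>

text \<open>Local convergence is known in \<open>l2\<close> only. The power \<open>p\<close> is
  therefore split into a small multiple of the \<open>p + 1\<close> power, whose integral is
  bounded, and a multiple of \<open>\<bar>b\<bar>\<close>, which can be paired by
  Cauchy-Schwarz.\<close>

lemma abs_powr_le_interpolate:
  fixes b :: real assumes "e > 0" "p > 1"
  shows "\<bar>b\<bar> powr p \<le> e * \<bar>b\<bar> powr (p + 1) + (1 / e) powr (p - 1) * \<bar>b\<bar>"
proof (cases "\<bar>b\<bar> \<le> 1 / e")
  case True
  have "\<bar>b\<bar> powr p = \<bar>b\<bar> * \<bar>b\<bar> powr (p - 1)" using abs_mult_powr[of b "p - 1"] by simp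
  also have "\<dots> \<le> \<bar>b\<bar> * (1 / e) powr (p - 1)" using True assms by (intro mult_left_mono powr_mono2) auto
  finally have "\<bar>b\<bar> powr p \<le> (1 / e) powr (p - 1) * \<bar>b\<bar>" by (simp only: mult.commute)
  moreover have "0 \<le> e * \<bar>b\<bar> powr (p + 1)" using assms by simp
  ultimately show ?thesis by linarith
next
  case False
  then have "1 \<le> e * \<bar>b\<bar>" using assms by (simp add: field_simps)
  then have "1 * \<bar>b\<bar> powr p \<le> (e * \<bar>b\<bar>) * \<bar>b\<bar> powr p" by (intro mult_right_mono) auto
  also have "\<dots> = e * \<bar>b\<bar> powr (p + 1)" using abs_mult_powr[of b p] by (simp only: mult.assoc)
  finally have "\<bar>b\<bar> powr p \<le> e * \<bar>b\<bar> powr (p + 1)" by (simp only: mult_1)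
  moreover have "0 \<le> (1 / e) powr (p - 1) * \<bar>b\<bar>" by simp
  ultimately show ?thesis by linarith
qed

context subcritical
begin

text \<open>\<open>h_increment\<close> bounds the difference by a small multiple of a bounded
  quantity plus powers of \<open>b = ws n - u\<close>. After interpolation the linear term in
  \<open>b\<close> is multiplied by \<open>v\<close>, which is supported in one ball, and there
  \<open>b\<close> tends to 0 in \<open>l2\<close>.\<close>

lemma h_pairing_local_limit:
  fixes u v :: "real \<times> (real ^ 'n) \<Rightarrow> real"
  assumes ws: "\<And>n. Lq lebesgue (ws n)" "\<And>n. mass lebesgue (ws n) \<le> K" and u: "Lq lebesgue u" "mass lebesgue u \<le> K"
    and loc: "\<And>R. (\<lambda>n. l2 lebesgue (\<lambda>z. indicator (cball 0 R) z * (ws n z - u z))) \<longlonglongrightarrow> 0"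
    and v: "Cc v" "Lq lebesgue v" "mass lebesgue v \<le> K" and K: "K > 0"
  shows "(\<lambda>n. LINT z|lebesgue. h (ws n z) * v z) \<longlonglongrightarrow> (LINT z|lebesgue. h (u z) * v z)"
proof -
  obtain R where R: "\<And>z. norm z > R \<Longrightarrow> v z = 0" using v(1) unfolding Cc_def by blast
  obtain A0 where A0: "A0 \<ge> 0" "\<And>z. norm (v z) \<le> A0" using Cc_bounded[OF v(1)] by blast
  define A where "A = A0 + 1"
  have A: "A > 0" "\<And>z. \<bar>v z\<bar> \<le> A" using A0 by (auto simp: A_def add_increasing2)
  define Kb where "Kb = 2 powr (p + 1) * (K + K)"
  have Kb: "Kb > 0" using K by (simp add: Kb_def)
  have "(\<lambda>n. (LINT z|lebesgue. h (ws n z) * v z) - (LINT z|lebesgue. h (u z) * v z)) \<longlonglongrightarrow> 0"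
  proof (rule tendstoI)
    fix e :: real assume e: "e > 0"
    define e1 where "e1 = e / (8 * K)"
    have e1: "e1 > 0" "e1 * (K + K) = e / 4" using e K by (auto simp: e1_def)
    obtain C where C: "C > 0" "\<And>a b. \<bar>h (a + b) - h a\<bar> \<le> e1 * (\<bar>a\<bar> + \<bar>a\<bar> powr p) + C * (\<bar>b\<bar> + \<bar>b\<bar> powr p)"
      by (rule h_increment[OF e1(1)]) blast
    \<comment> \<open>\<open>e1\<close> and \<open>e2\<close> spend \<open>e / 4\<close> each, on
      the term in \<open>u\<close> and on the \<open>p + 1\<close> power of \<open>b\<close>; the
      other half of \<open>e\<close> is left for the local term.\<close>
    define e2 where "e2 = e / (4 * (C * A * Kb))"
    have e2: "e2 > 0" "C * A * e2 * Kb = e / 4" using e C(1) A(1) Kb by (auto simp: e2_def)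
    define C2 where "C2 = C * (1 + (1 / e2) powr (p - 1))"
    have C2: "C2 \<ge> 0" using C(1) by (simp add: C2_def)
    define P where "P n = l2 lebesgue (\<lambda>z. indicator (cball 0 R) z * (ws n z - u z))" for n
    have main: "\<bar>(LINT z|lebesgue. h (ws n z) * v z) - (LINT z|lebesgue. h (u z) * v z)\<bar> \<le> e / 4 + e / 4 + C2 * (P n * l2 lebesgue v)" for n
    proof -
      define b where "b z = ws n z - u z" for z
      have bL: "Lq lebesgue b"
        using Lq_add[OF ws(1)[of n] Lq_cmult[OF u(1), of "- 1"]] by (simp add: b_def[abs_def])
      note bD = LqD[OF bL]
      have bq: "(LINT z|lebesgue. \<bar>b z\<bar> powr (p + 1)) \<le> Kb"
      proof -
        note wD = LqD[OF ws(1)[of n]] and uD = LqD[OF u(1)]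
        have "(LINT z|lebesgue. \<bar>b z\<bar> powr (p + 1)) \<le> (LINT z|lebesgue. 2 powr (p + 1) * (\<bar>ws n z\<bar> powr (p + 1) + \<bar>u z\<bar> powr (p + 1)))"
        proof (rule integral_mono[OF bD(3)])
          show "integrable lebesgue (\<lambda>z. 2 powr (p + 1) * (\<bar>ws n z\<bar> powr (p + 1) + \<bar>u z\<bar> powr (p + 1)))" using wD uD by simp
          show "\<bar>b z\<bar> powr (p + 1) \<le> 2 powr (p + 1) * (\<bar>ws n z\<bar> powr (p + 1) + \<bar>u z\<bar> powr (p + 1))" for z
            using powr_abs_add_le[of "p + 1" "ws n z" "- u z"] p by (simp add: b_def)
        qed
        also have "\<dots> = 2 powr (p + 1) * ((LINT z|lebesgue. \<bar>ws n z\<bar> powr (p + 1)) + (LINT z|lebesgue. \<bar>u z\<bar> powr (p + 1)))"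
          using wD uD by simp
        also have "\<dots> \<le> Kb"
        proof -
          have "(LINT z|lebesgue. \<bar>w z\<bar> powr (p + 1)) \<le> mass lebesgue w" for w :: "real \<times> (real ^ 'n) \<Rightarrow> real"
            by (simp add: mass_def)
          from this[of "ws n"] this[of u] show ?thesis unfolding Kb_def
            using ws(2)[of n] u(2) by (intro mult_left_mono add_mono) auto
        qed
        finally show ?thesis .
      qed
      let ?J = "indicator (cball 0 R) :: real \<times> (real ^ 'n) \<Rightarrow> real"
      have sJ: "sq_int lebesgue (\<lambda>z. ?J z * b z)" by (rule sq_int_indicator(1)[OF bD(4)]) simp
      have sJ': "sq_int lebesgue (\<lambda>z. \<bar>?J z * b z\<bar>)" "l2 lebesgue (\<lambda>z. \<bar>?J z * b z\<bar>) = P n"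
        using sJ by (auto simp: sq_int_def P_def l2_def b_def)
      have sv: "sq_int lebesgue (\<lambda>z. \<bar>v z\<bar>)" "l2 lebesgue (\<lambda>z. \<bar>v z\<bar>) = l2 lebesgue v"
        using LqD(4)[OF v(2)] by (auto simp: sq_int_def l2_def)
      note Lu = Lq_h_mult[OF u(1) v(2)] and Lw = Lq_h_mult[OF ws(1)[of n] v(2)]
      have pt: "\<bar>h (ws n z) * v z - h (u z) * v z\<bar> \<le> e1 * ((\<bar>u z\<bar> + \<bar>u z\<bar> powr p) * \<bar>v z\<bar>) + C * A * e2 * \<bar>b z\<bar> powr (p + 1) + C2 * (\<bar>?J z * b z\<bar> * \<bar>v z\<bar>)" for z
      proof -
        have "\<bar>h (ws n z) - h (u z)\<bar> \<le> e1 * (\<bar>u z\<bar> + \<bar>u z\<bar> powr p) + C * (\<bar>b z\<bar> + \<bar>b z\<bar> powr p)"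
          using C(2)[of "u z" "b z"] by (simp add: b_def)
        also have "\<dots> \<le> e1 * (\<bar>u z\<bar> + \<bar>u z\<bar> powr p) + C * (\<bar>b z\<bar> + (e2 * \<bar>b z\<bar> powr (p + 1) + (1 / e2) powr (p - 1) * \<bar>b z\<bar>))"
          using abs_powr_le_interpolate[OF e2(1) p, of "b z"] C(1) by (intro add_left_mono mult_left_mono) auto
        also have "\<dots> = e1 * (\<bar>u z\<bar> + \<bar>u z\<bar> powr p) + (C * e2 * \<bar>b z\<bar> powr (p + 1) + C2 * \<bar>b z\<bar>)"
          by (simp add: C2_def algebra_simps)
        finally have "\<bar>h (ws n z) - h (u z)\<bar> * \<bar>v z\<bar> \<le> (e1 * (\<bar>u z\<bar> + \<bar>u z\<bar> powr p) + (C * e2 * \<bar>b z\<bar> powr (p + 1) + C2 * \<bar>b z\<bar>)) * \<bar>v z\<bar>"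
          by (intro mult_right_mono) auto
        also have "\<dots> = e1 * ((\<bar>u z\<bar> + \<bar>u z\<bar> powr p) * \<bar>v z\<bar>) + C * e2 * \<bar>b z\<bar> powr (p + 1) * \<bar>v z\<bar> + C2 * (\<bar>b z\<bar> * \<bar>v z\<bar>)"
          by (simp add: algebra_simps)
        also have "\<bar>b z\<bar> * \<bar>v z\<bar> = \<bar>?J z * b z\<bar> * \<bar>v z\<bar>" using R[of z] by (cases "norm z \<le> R") auto
        also have "C * e2 * \<bar>b z\<bar> powr (p + 1) * \<bar>v z\<bar> \<le> C * e2 * \<bar>b z\<bar> powr (p + 1) * A"
          using A(2)[of z] C(1) e2(1) by (intro mult_left_mono) auto
        also have "C * e2 * \<bar>b z\<bar> powr (p + 1) * A = C * A * e2 * \<bar>b z\<bar> powr (p + 1)" by (simp only: mult_ac)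
        finally show ?thesis by (simp add: left_diff_distrib[symmetric] abs_mult)
      qed
      have iJ: "integrable lebesgue (\<lambda>z. \<bar>?J z * b z\<bar> * \<bar>v z\<bar>)" by (rule sq_int_mult[OF sJ'(1) sv(1)])
      have "(LINT z|lebesgue. h (ws n z) * v z) - (LINT z|lebesgue. h (u z) * v z) = (LINT z|lebesgue. h (ws n z) * v z - h (u z) * v z)"
        using Lu(1) Lw(1) by simp
      also have "\<bar>\<dots>\<bar> \<le> (LINT z|lebesgue. \<bar>h (ws n z) * v z - h (u z) * v z\<bar>)" by (rule integral_abs_bound)
      also have "\<dots> \<le> (LINT z|lebesgue. e1 * ((\<bar>u z\<bar> + \<bar>u z\<bar> powr p) * \<bar>v z\<bar>) + C * A * e2 * \<bar>b z\<bar> powr (p + 1) + C2 * (\<bar>?J z * b z\<bar> * \<bar>v z\<bar>))"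
      proof (rule integral_mono[OF _ _ pt])
        show "integrable lebesgue (\<lambda>z. \<bar>h (ws n z) * v z - h (u z) * v z\<bar>)"
          by (intro integrable_abs Bochner_Integration.integrable_diff Lu(1) Lw(1))
        show "integrable lebesgue (\<lambda>z. e1 * ((\<bar>u z\<bar> + \<bar>u z\<bar> powr p) * \<bar>v z\<bar>) + C * A * e2 * \<bar>b z\<bar> powr (p + 1) + C2 * (\<bar>?J z * b z\<bar> * \<bar>v z\<bar>))"
          by (intro Bochner_Integration.integrable_add integrable_mult_right Lu(2) bD(3) iJ)
      qed
      also have "\<dots> = e1 * (LINT z|lebesgue. (\<bar>u z\<bar> + \<bar>u z\<bar> powr p) * \<bar>v z\<bar>) + C * A * e2 * (LINT z|lebesgue. \<bar>b z\<bar> powr (p + 1))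
          + C2 * (LINT z|lebesgue. \<bar>?J z * b z\<bar> * \<bar>v z\<bar>)"
      proof -
        have "integrable lebesgue (\<lambda>z. e1 * ((\<bar>u z\<bar> + \<bar>u z\<bar> powr p) * \<bar>v z\<bar>))" "integrable lebesgue (\<lambda>z. C * A * e2 * \<bar>b z\<bar> powr (p + 1))"
          "integrable lebesgue (\<lambda>z. C2 * (\<bar>?J z * b z\<bar> * \<bar>v z\<bar>))"
          by (intro integrable_mult_right Lu(2) bD(3) iJ)+
        then show ?thesis by (simp only: Bochner_Integration.integral_add Bochner_Integration.integrable_add integral_mult_right_zero)
      qed
      also have "\<dots> \<le> e1 * (K + K) + C * A * e2 * Kb + C2 * (P n * l2 lebesgue v)"
      proof (intro add_mono mult_left_mono)
        show "(LINT z|lebesgue. (\<bar>u z\<bar> + \<bar>u z\<bar> powr p) * \<bar>v z\<bar>) \<le> K + K" using Lu(3) u(2) v(3) by linarith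
        show "(LINT z|lebesgue. \<bar>?J z * b z\<bar> * \<bar>v z\<bar>) \<le> P n * l2 lebesgue v"
          using l2_Cauchy_Schwarz_real[OF sJ'(1) sv(1)] unfolding sJ'(2) sv(2) by linarith
      qed (use e1 e2 C C2 A bq in auto)
      also have "\<dots> = e / 4 + e / 4 + C2 * (P n * l2 lebesgue v)" unfolding e1(2) e2(2) ..
      finally show ?thesis .
    qed
    have "P \<longlonglongrightarrow> 0" unfolding P_def by (rule loc)
    then have "(\<lambda>n. C2 * (P n * l2 lebesgue v)) \<longlonglongrightarrow> 0"
      by (intro tendsto_mult_right_zero tendsto_mult_left_zero)
    then have "eventually (\<lambda>n. C2 * (P n * l2 lebesgue v) < e / 2) sequentially"
      by (rule order_tendstoD(2)) (use e in simp)
    then show "eventually (\<lambda>n. dist ((LINT z|lebesgue. h (ws n z) * v z) - (LINT z|lebesgue. h (u z) * v z)) 0 < e) sequentially"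
    proof eventually_elim
      case (elim n)
      then show ?case using main[of n] by (simp add: dist_real_def)
    qed
  qed
  then show ?thesis by (simp add: LIM_zero_iff)
qed

lemma mass_lebesgue:
  assumes "Cc u" shows "Lq lebesgue u" "mass lebesgue u = mass lborel u"
proof -
  have C: "Cc (\<lambda>z. \<bar>u z\<bar> powr (p + 1))" "Cc (\<lambda>z. (u z)\<^sup>2)"
    using Cc_abs_powr[OF assms, of "p + 1"] Cc_norm_square[OF assms] p by auto
  show "Lq lebesgue u" using Cc_sq_int_lebesgue(1)[OF assms] Cc_lebesgue(1)[OF C(1)] by (simp add: Lq_def)
  show "mass lebesgue u = mass lborel u" by (simp add: mass_def Cc_lebesgue(2)[OF C(1)] Cc_lebesgue(2)[OF C(2)])
qed

lemma energy_gap_lebesgue: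
  assumes "u \<in> Y" "v \<in> Y"
  shows "energy_gap u v = (LINT z|lebesgue. h (u z) * v z) - (LINT z|lebesgue. jet u z \<bullet> jet v z)"
proof -
  note u = Y_Cc[OF assms(1)] and v = Y_Cc[OF assms(2)]
  have "continuous_on UNIV (\<lambda>z. h (u z))"
    using u(1) by (intro continuous_on_compose2[OF cont]) (auto simp: Cc_def)
  then have 1: "Cc (\<lambda>z. h (u z) * v z)" by (rule Cc_mult_right(2)[OF v(1)])
  have "continuous_on UNIV (\<lambda>z. jet u z \<bullet> jet v z)" using u(3) v(3) by (intro continuous_intros) (auto simp: Cc_def)
  then have 2: "Cc (\<lambda>z. jet u z \<bullet> jet v z)" by (rule Cc_combine[OF u(3) v(3), of inner]) simp
  show ?thesis by (simp add: energy_gap_def Cc_lebesgue(2)[OF 1] Cc_lebesgue(2)[OF 2])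
qed

text \<open>Lying within \<open>e\<close> of \<open>ws i\<close> in a seminorm is a convex
  condition, so it passes from a tail to its hull. In this way the norm limit of hull elements is
  recognized as the local limit of \<open>ws\<close>.\<close>

lemma midpoint_hull_near:
  assumes ws: "\<And>n. ws n \<in> Y"
    and close: "\<And>i j. i \<ge> N \<Longrightarrow> j \<ge> N \<Longrightarrow> l2 lborel (\<lambda>z. indicator (cball 0 R) z * (ws i z - ws j z)) \<le> e"
    and hull: "midpoint_hull ws N v" and i: "i \<ge> N"
  shows "v \<in> Y \<and> l2 lborel (\<lambda>z. indicator (cball 0 R) z * (ws i z - v z)) \<le> e"
  using hull
proof (rule midpoint_hull_induct_conv)
  show "ws k \<in> Y \<and> l2 lborel (\<lambda>z. indicator (cball 0 R) z * (ws i z - ws k z)) \<le> e" if "k \<ge> N" for k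
    using ws close[OF i that] by blast
  fix a b assume a: "a \<in> Y \<and> l2 lborel (\<lambda>z. indicator (cball 0 R) z * (ws i z - a z)) \<le> e"
    and b: "b \<in> Y \<and> l2 lborel (\<lambda>z. indicator (cball 0 R) z * (ws i z - b z)) \<le> e"
  let ?J = "indicator (cball 0 R) :: real \<times> (real ^ 'n) \<Rightarrow> real"
  have s: "sq_int lborel (\<lambda>z. ?J z * (ws i z - a z))" "sq_int lborel (\<lambda>z. ?J z * (ws i z - b z))"
  proof -
    have "sq_int lborel (\<lambda>z. ?J z * (ws i z - f z))" if "f \<in> Y" for f
      by (rule sq_int_indicator(1)[OF Cc_sq_int[OF Cc_arith(2)[OF Y_Cc(1)[OF ws] Y_Cc(1)[OF that]]]]) simp
    then show "sq_int lborel (\<lambda>z. ?J z * (ws i z - a z))" "sq_int lborel (\<lambda>z. ?J z * (ws i z - b z))"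
      using a b by blast+
  qed
  have "l2 lborel (\<lambda>z. ?J z * (ws i z - (1 / 2) * (a z + b z)))
      = l2 lborel (\<lambda>z. (1 / 2) * (?J z * (ws i z - a z) + ?J z * (ws i z - b z)))"
    by (rule arg_cong[of _ _ "l2 lborel"]) (auto simp: field_simps)
  also have "\<dots> = (1 / 2) * l2 lborel (\<lambda>z. ?J z * (ws i z - a z) + ?J z * (ws i z - b z))"
    by (subst l2_cmult) simp
  also have "\<dots> \<le> (1 / 2) * (e + e)"
    using l2_triangle[OF s] a b by (intro mult_left_mono) auto
  finally show "(\<lambda>z. (1 / 2) * (a z + b z)) \<in> Y \<and> l2 lborel (\<lambda>z. ?J z * (ws i z - (1 / 2) * (a z + b z))) \<le> e"
    using Y_mid(1) a b by auto
qed

text \<open>Pairing with \<open>v\<close> is linear, so an interval containing its values on a tail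
  also contains its values on the hull.\<close>

lemma midpoint_hull_pairing:
  assumes ws: "\<And>n. ws n \<in> Y" and v: "v \<in> Y"
    and close: "\<And>k. k \<ge> N \<Longrightarrow> \<bar>(LINT z|lebesgue. jet (ws k) z \<bullet> jet v z) - c\<bar> \<le> e"
    and hull: "midpoint_hull ws N u"
  shows "u \<in> Y \<and> \<bar>(LINT z|lebesgue. jet u z \<bullet> jet v z) - c\<bar> \<le> e"
  using hull
proof (rule midpoint_hull_induct_conv)
  show "ws k \<in> Y \<and> \<bar>(LINT z|lebesgue. jet (ws k) z \<bullet> jet v z) - c\<bar> \<le> e" if "k \<ge> N" for k
    using ws close[OF that] by blast
  fix a b assume a: "a \<in> Y \<and> \<bar>(LINT z|lebesgue. jet a z \<bullet> jet v z) - c\<bar> \<le> e"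
    and b: "b \<in> Y \<and> \<bar>(LINT z|lebesgue. jet b z \<bullet> jet v z) - c\<bar> \<le> e"
  have aY: "a \<in> Y" and bY: "b \<in> Y" using a b by auto
  note i = sq_int_inner(1)[OF Y_jet_lebesgue(1)[OF aY] Y_jet_lebesgue(1)[OF v]]
    sq_int_inner(1)[OF Y_jet_lebesgue(1)[OF bY] Y_jet_lebesgue(1)[OF v]]
  have "(LINT z|lebesgue. jet (\<lambda>z. (1 / 2) * (a z + b z)) z \<bullet> jet v z) = (LINT z|lebesgue. (1 / 2) * (jet a z \<bullet> jet v z + jet b z \<bullet> jet v z))"
    unfolding Y_mid(2)[OF aY bY] by (simp add: inner_add_left)
  also have "\<dots> = (1 / 2) * ((LINT z|lebesgue. jet a z \<bullet> jet v z) + (LINT z|lebesgue. jet b z \<bullet> jet v z))"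
    using i by simp
  finally have E: "(LINT z|lebesgue. jet (\<lambda>z. (1 / 2) * (a z + b z)) z \<bullet> jet v z)
      = (1 / 2) * ((LINT z|lebesgue. jet a z \<bullet> jet v z) + (LINT z|lebesgue. jet b z \<bullet> jet v z))" .
  have "\<bar>(1 / 2) * (x + y) - c\<bar> \<le> e" if "\<bar>x - c\<bar> \<le> e" "\<bar>y - c\<bar> \<le> e" for x y :: real
    using that unfolding abs_le_iff by (auto simp: field_simps)
  then have "\<bar>(LINT z|lebesgue. jet (\<lambda>z. (1 / 2) * (a z + b z)) z \<bullet> jet v z) - c\<bar> \<le> e"
    unfolding E using a b by blast
  then show "(\<lambda>z. (1 / 2) * (a z + b z)) \<in> Y \<and> \<bar>(LINT z|lebesgue. jet (\<lambda>z. (1 / 2) * (a z + b z)) z \<bullet> jet v z) - c\<bar> \<le> e"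
    using Y_mid(1)[OF aY bY] by blast
qed

lemma exists_solution:
  assumes \<xi>: "\<xi> > 0" "2 * H \<xi> - \<xi>\<^sup>2 > 0"
  shows "\<exists>u \<in> (X_space :: (real \<times> (real ^ 'n) \<Rightarrow> real) set).
    \<not> (AE z in lebesgue. u z = 0) \<and> critical_point (energy h) u \<and> weak_solution h u"
proof -
  obtain \<mu> K us where ps: "\<mu> > 0" "K > 0" "\<And>n. us n \<in> Y" "\<And>n. V (us n) = \<mu>" "\<And>n. Y_norm (us n) \<le> K"
    "\<And>v zs. v \<in> Y \<Longrightarrow> (\<lambda>n. energy_gap (\<lambda>z. us n (z + zs n)) v) \<longlonglongrightarrow> 0"
    by (rule exists_palais_smale[OF \<xi>]) blast
  obtain t \<delta> where nv: "t > 0" "\<delta> > 0"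
    "\<And>u. u \<in> Y \<Longrightarrow> Y_norm u \<le> K \<Longrightarrow> V u = \<mu> \<Longrightarrow> \<exists>z. \<bar>avg (Box t) u z\<bar> > \<delta>"
    by (rule nonvanishing[OF ps(2) ps(1)]) blast
  have "\<forall>n. \<exists>z. \<bar>avg (Box t) (us n) z\<bar> > \<delta>" using nv(3)[OF ps(3) ps(5) ps(4)] by blast
  from choice[OF this] obtain zs where zs: "\<And>n. \<bar>avg (Box t) (us n) (zs n)\<bar> > \<delta>" by blast
  define ts where "ts n = (\<lambda>z. us n (z + zs n))" for n
  have ts: "ts n \<in> Y" "Y_norm (ts n) \<le> K" for n
    unfolding ts_def using Y_linear(7)[OF ps(3) ps(3)] Y_translate(1)[OF ps(3)] ps(5) by simp_all
  obtain r :: "nat \<Rightarrow> nat" where r: "strict_mono r"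
    "\<And>R e. e > 0 \<Longrightarrow> \<exists>N. \<forall>m\<ge>N. \<forall>n\<ge>N. l2 lborel (\<lambda>z. indicator (cball 0 R) z * (ts (r m) z - ts (r n) z)) < e"
    by (rule Y_local_compactness[where us = ts, OF ts]) blast
  define ws where "ws n = ts (r n)" for n
  have ws: "ws n \<in> Y" "Y_norm (ws n) \<le> K" for n unfolding ws_def using ts by blast+
  have wsC: "Cc (ws n)" for n by (rule Y_Cc[OF ws(1)])
  have gap: "(\<lambda>n. energy_gap (ws n) v) \<longlonglongrightarrow> 0" if "v \<in> Y" for v
    using LIMSEQ_subseq_LIMSEQ[OF ps(6)[OF that, of zs] r(1)] by (simp add: ws_def ts_def o_def)
  have big: "\<bar>avg (Box t) (ws n) 0\<bar> > \<delta>" for n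
    using zs[of "r n"] avg_translate[of "Box t" "us (r n)" "zs (r n)" 0] by (simp add: ws_def ts_def)
  obtain vs where vs: "\<And>n. midpoint_hull ws n (vs n)" "\<And>n. vs n \<in> Y"
    "\<And>e. e > 0 \<Longrightarrow> \<exists>N. \<forall>m\<ge>N. \<forall>n\<ge>N. Y_norm (\<lambda>z. vs m z - vs n z) < e"
    by (rule midpoint_hull_cauchy[where us = ws, OF ws]) blast
  obtain F r' where F: "sq_int lebesgue F" "(\<lambda>n. l2 lebesgue (\<lambda>z. jet (vs n) z - F z)) \<longlonglongrightarrow> 0"
    "strict_mono (r' :: nat \<Rightarrow> nat)" "AE z in lebesgue. (\<lambda>n. jet (vs (r' n)) z) \<longlonglongrightarrow> F z"
    by (rule l2_complete[of lebesgue "\<lambda>n. jet (vs n)"])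
      (use Y_jet_lebesgue(1)[OF vs(2)] vs(3) in \<open>auto simp: Y_norm_diff[OF vs(2) vs(2)]\<close>)
  define u where "u z = snd (F z)" for z
  \<comment> \<open>\<open>approximates\<close> asks for convergence almost everywhere, which
    completeness provides along the subsequence \<open>r'\<close>.\<close>
  define ys where "ys n = vs (r' n)" for n
  have ysY: "ys n \<in> Y" for n unfolding ys_def by (rule vs(2))
  have a: "approximates ys u"
    unfolding approximates_def
  proof (intro conjI allI impI)
    show "ys n \<in> Y" for n by (rule ysY)
    show "AE z in lebesgue. (\<lambda>n. ys n z) \<longlonglongrightarrow> u z"
      using F(4)
    proof eventually_elim
      case (elim z)
      from tendsto_snd[OF this] show ?case by (simp add: ys_def u_def jet_def)
    qed
    fix e :: real assume "e > 0"
    then obtain N where "\<forall>m\<ge>N. \<forall>n\<ge>N. Y_norm (\<lambda>z. vs m z - vs n z) < e" using vs(3) by blast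
    then have "\<forall>m\<ge>N. \<forall>n\<ge>N. Y_norm (\<lambda>z. ys m z - ys n z) < e"
      unfolding ys_def using seq_suble[OF F(3)] by (meson order.trans)
    then show "\<exists>M. \<forall>j\<ge>M. \<forall>k\<ge>M. Y_norm (\<lambda>z. ys j z - ys k z) < e" by blast
  qed
  have u: "u \<in> X_space" by (rule X_spaceI[OF a])
  have hull: "midpoint_hull ws n (ys n)" for n
    unfolding ys_def by (rule midpoint_hull_antimono[OF vs(1) seq_suble[OF F(3)]])
  have ylim: "(\<lambda>n. l2 lebesgue (\<lambda>z. ys n z - u z)) \<longlonglongrightarrow> 0"
  proof (rule l2_limit_le[OF X_jet_limit(2)[OF a]])
    fix n
    show "l2 lebesgue (\<lambda>z. ys n z - u z) \<le> l2 lebesgue (\<lambda>z. jet (ys n) z - X_jet u z)"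
      using l2_jet_components(4)[OF sq_int_diff[OF Y_jet_lebesgue(1)[OF ysY[of n]] X_jet_limit(1)[OF a]]]
      by (simp add: jet_def X_jet_def)
  qed
  \<comment> \<open>All late \<open>ws n\<close> are compared with a single hull element
    \<open>ys k\<close>, locally, and \<open>ys k\<close> with \<open>u\<close> in the full
    norm.\<close>
  have loc: "(\<lambda>n. l2 lebesgue (\<lambda>z. indicator (cball 0 R) z * (ws n z - u z))) \<longlonglongrightarrow> 0" for R
  proof (rule tendstoI)
    fix e :: real assume e: "e > 0"
    let ?J = "indicator (cball 0 R) :: real \<times> (real ^ 'n) \<Rightarrow> real"
    obtain N where N: "\<forall>m\<ge>N. \<forall>n\<ge>N. l2 lborel (\<lambda>z. ?J z * (ws m z - ws n z)) < e / 4"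
    proof -
      have "e / 4 > 0" using e by simp
      from r(2)[OF this, of R] that show thesis unfolding ws_def by blast
    qed
    have "eventually (\<lambda>n. l2 lebesgue (\<lambda>z. ys n z - u z) < e / 4) sequentially"
      by (rule order_tendstoD(2)[OF ylim]) (use e in simp)
    then obtain N' where N': "\<And>n. n \<ge> N' \<Longrightarrow> l2 lebesgue (\<lambda>z. ys n z - u z) < e / 4"
      unfolding eventually_sequentially by blast
    define k where "k = max N N'"
    show "eventually (\<lambda>n. dist (l2 lebesgue (\<lambda>z. ?J z * (ws n z - u z))) 0 < e) sequentially"
    proof (rule eventually_sequentiallyI[of N])
      fix n assume n: "N \<le> n"
      have "midpoint_hull ws N (ys k)" by (rule midpoint_hull_antimono[OF hull]) (simp add: k_def)
      then have 1: "l2 lborel (\<lambda>z. ?J z * (ws n z - ys k z)) \<le> e / 4"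
        using midpoint_hull_near[where ws = ws and R = R and e = "e / 4" and v = "ys k", OF ws(1) _ _ n] N
        by (simp add: less_imp_le)
      have 1: "l2 lebesgue (\<lambda>z. ?J z * (ws n z - ys k z)) \<le> e / 4"
        using 1 l2_indicator_lebesgue[OF Cc_arith(2)[OF wsC[of n] Y_Cc(1)[OF ysY[of k]]], of "cball 0 R"] by simp
      have sJ: "sq_int lebesgue (\<lambda>z. ?J z * f z)" if "sq_int lebesgue f" for f
        by (rule sq_int_indicator(1)[OF that]) simp
      note s = sJ[OF Y_jet_lebesgue(2)[OF ws(1)[of n]]] sJ[OF Y_jet_lebesgue(2)[OF ysY[of k]]] sJ[OF X_sq_int(1)[OF u]]
      have "l2 lebesgue (\<lambda>z. ?J z * (ys k z - u z)) \<le> l2 lebesgue (\<lambda>z. ys k z - u z)"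
        by (rule sq_int_indicator(2)[OF sq_int_diff[OF Y_jet_lebesgue(2)[OF ysY] X_sq_int(1)[OF u]]]) simp
      also have "\<dots> < e / 4" by (rule N') (simp add: k_def)
      finally have "l2 lebesgue (\<lambda>z. ?J z * (ws n z - u z)) \<le> e / 4 + e / 4"
        using l2_triangle3[OF s] 1 by (simp add: right_diff_distrib)
      then show "dist (l2 lebesgue (\<lambda>z. ?J z * (ws n z - u z))) 0 < e"
        using e l2_nonneg[of lebesgue "\<lambda>z. ?J z * (ws n z - u z)"] by (simp add: dist_real_def)
    qed
  qed
  \<comment> \<open>Recentring has placed an average above \<open>\<delta>\<close> at the origin,
    and it is bounded by the norm of \<open>ws n\<close> on a fixed ball. If \<open>u\<close>
    vanished, these norms would tend to 0.\<close>
  have nontrivial: "\<not> (AE z in lebesgue. u z = 0)"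
  proof
    assume AE: "AE z in lebesgue. u z = 0"
    let ?m = "measure lborel (Box t :: (real \<times> (real ^ 'n)) set)"
    have m: "?m > 0" by (rule measure_Box_pos[OF nv(1)])
    obtain R where R: "(Box t :: (real \<times> (real ^ 'n)) set) \<subseteq> cball 0 R"
    proof -
      have "bounded (Box t :: (real \<times> (real ^ 'n)) set)" by (rule compact_imp_bounded[OF compact_Box])
      then obtain R where "\<forall>z\<in>(Box t :: (real \<times> (real ^ 'n)) set). norm z \<le> R" unfolding bounded_iff ..
      then have "(Box t :: (real \<times> (real ^ 'n)) set) \<subseteq> cball 0 R" by auto
      then show thesis by (rule that)
    qed
    let ?J = "indicator (cball 0 R) :: real \<times> (real ^ 'n) \<Rightarrow> real"
    have "l2 lebesgue (\<lambda>z. ?J z * (ws n z - u z)) \<ge> \<delta> * sqrt ?m" for n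
    proof -
      have sJ: "sq_int lebesgue (\<lambda>z. ?J z * f z)" if "sq_int lebesgue f" for f
        by (rule sq_int_indicator(1)[OF that]) simp
      note wsq = Y_jet_lebesgue(2)[OF ws(1)[of n]]
      have "l2 lebesgue (\<lambda>z. ?J z * (ws n z - u z)) = l2 lebesgue (\<lambda>z. ?J z * ws n z)"
      proof (rule l2_cong_AE)
        show "(\<lambda>z. ?J z * (ws n z - u z)) \<in> borel_measurable lebesgue"
          by (rule sq_int_measurable[OF sJ[OF sq_int_diff[OF wsq X_sq_int(1)[OF u]]]])
        show "(\<lambda>z. ?J z * ws n z) \<in> borel_measurable lebesgue" by (rule sq_int_measurable[OF sJ[OF wsq]])
        show "AE z in lebesgue. ?J z * (ws n z - u z) = ?J z * ws n z" using AE by eventually_elim simp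
      qed
      also have "\<dots> = l2 lborel (\<lambda>z. ?J z * ws n z)" by (rule l2_indicator_lebesgue[OF wsC, symmetric]) simp
      finally have "\<bar>avg (Box t) (ws n) 0\<bar> \<le> l2 lebesgue (\<lambda>z. ?J z * (ws n z - u z)) / sqrt ?m"
        using avg_0_le_l2_indicator[OF wsC compact_Box m R, of n] by simp
      then have "\<delta> \<le> l2 lebesgue (\<lambda>z. ?J z * (ws n z - u z)) / sqrt ?m" using big[of n] by linarith
      then show ?thesis using m by (simp add: pos_le_divide_eq)
    qed
    then have "\<delta> * sqrt ?m \<le> 0" by (intro LIMSEQ_le_const[OF loc[of R]]) blast
    moreover have "\<delta> * sqrt ?m > 0" using nv(2) m by simp
    ultimately show False by linarith
  qed
  have eq: "(LINT z|lebesgue. X_jet u z \<bullet> jet v z) = (LINT z|lebesgue. h (u z) * v z)" if v: "v \<in> Y" for v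
  proof -
    obtain K1 where K1: "K1 > 0" "\<And>u. u \<in> Y \<Longrightarrow> Y_norm u \<le> K \<Longrightarrow> mass lborel u \<le> K1" by (rule Y_mass_bound[OF ps(2)]) blast
    define K2 where "K2 = max K1 (max (mass lebesgue u) (mass lebesgue v))"
    have K2: "K2 > 0" using K1(1) by (simp add: K2_def)
    have vC: "Cc v" by (rule Y_Cc[OF v])
    have mw: "mass lebesgue (ws n) \<le> K2" for n
      using K1(2)[OF ws] mass_lebesgue(2)[OF wsC] by (simp add: K2_def max.coboundedI1)
    let ?c = "LINT z|lebesgue. h (u z) * v z"
    have "(\<lambda>n. LINT z|lebesgue. h (ws n z) * v z) \<longlonglongrightarrow> ?c"
      by (rule h_pairing_local_limit[OF mass_lebesgue(1)[OF wsC] mw X_Lq[OF u] _ loc vC mass_lebesgue(1)[OF vC] _ K2])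
        (simp_all add: K2_def)
    from tendsto_diff[OF this gap[OF v]]
    have lim: "(\<lambda>n. LINT z|lebesgue. jet (ws n) z \<bullet> jet v z) \<longlonglongrightarrow> ?c"
      by (simp add: energy_gap_lebesgue[OF ws(1) v])
    \<comment> \<open>\<open>ws\<close> is not known to converge in norm, and \<open>h\<close> is
      not affine and cannot be carried over to the hulls. So the limit of the \<open>h\<close> term
      is found along \<open>ws\<close> by local convergence, and only the linear pairing is
      transferred to \<open>ys\<close>, where norm convergence identifies its limit a second
      time.\<close>
    have "(\<lambda>n. LINT z|lebesgue. jet (ys n) z \<bullet> jet v z) \<longlonglongrightarrow> ?c"
    proof (rule tendstoI)
      fix e :: real assume e: "e > 0"
      have "eventually (\<lambda>n. dist (LINT z|lebesgue. jet (ws n) z \<bullet> jet v z) ?c < e / 2) sequentially"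
        by (rule tendstoD[OF lim]) (use e in simp)
      then obtain N where N: "\<And>n. n \<ge> N \<Longrightarrow> dist (LINT z|lebesgue. jet (ws n) z \<bullet> jet v z) ?c < e / 2"
        unfolding eventually_sequentially by blast
      show "eventually (\<lambda>n. dist (LINT z|lebesgue. jet (ys n) z \<bullet> jet v z) ?c < e) sequentially"
      proof (rule eventually_sequentiallyI[of N])
        fix n assume n: "N \<le> n"
        have "ys n \<in> Y \<and> \<bar>(LINT z|lebesgue. jet (ys n) z \<bullet> jet v z) - ?c\<bar> \<le> e / 2"
          by (rule midpoint_hull_pairing[where ws = ws, OF ws(1) v _ midpoint_hull_antimono[OF hull n]])
            (use N in \<open>simp add: dist_real_def less_imp_le\<close>)
        then show "dist (LINT z|lebesgue. jet (ys n) z \<bullet> jet v z) ?c < e" using e by (simp add: dist_real_def)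
      qed
    qed
    moreover have "(\<lambda>n. LINT z|lebesgue. jet (ys n) z \<bullet> jet v z) \<longlonglongrightarrow> (LINT z|lebesgue. X_jet u z \<bullet> jet v z)"
      by (rule l2_tendsto_inner[OF Y_jet_lebesgue(1)[OF ysY] X_jet_limit(1)[OF a] Y_jet_lebesgue(1)[OF v] X_jet_limit(2)[OF a]])
    ultimately show ?thesis by (rule LIMSEQ_unique[symmetric])
  qed
  have eqX: "(LINT z|lebesgue. X_jet u z \<bullet> X_jet v z) = (LINT z|lebesgue. h (u z) * v z)" if "v \<in> X_space" for v
    by (rule extend_to_X[OF u eq that])
  show ?thesis
    using u nontrivial critical_pointI[OF u eqX] weak_solutionI[OF u eqX] by blast
qed

end

theorem theorem1p1:
  fixes N :: nat and h :: "real \<Rightarrow> real" and p \<xi> :: real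
  assumes "N \<ge> 2" and "CARD('n::finite) = N - 1"
    and "h C1_differentiable_on UNIV" and "h 0 = 0"
    and "1 < p" and "p < critical_exponent N - 1"
    and "((\<lambda>t. h t / \<bar>t\<bar> powr p) \<longlongrightarrow> 0) at_infinity"
    and "deriv h 0 = 0"
    and "\<xi> > 0" and "2 * primitive h \<xi> - \<xi>\<^sup>2 > 0"
  shows "\<exists>u \<in> (X_space :: (real \<times> (real ^ 'n) \<Rightarrow> real) set).
           \<not> (AE z in lebesgue. u z = 0) \<and> critical_point (energy h) u \<and> weak_solution h u"
proof -
  \<comment> \<open>For \<open>D = 2 N - 1\<close> the critical exponent reads
    \<open>2 D / (D - 2)\<close>, which turns the bound on \<open>p\<close> into the locale
    assumption \<open>subcrit\<close>.\<close>
  have dim: "real (hdim TYPE('n)) = 2 * real N - 1"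
    using assms(1,2) by (simp add: of_nat_diff)
  obtain D where D: "\<And>x. (h has_vector_derivative D x) (at x)"
    using assms(3) unfolding C1_differentiable_on_def by auto
  have der: "(h has_real_derivative D x) (at x)" for x
    using D[of x] by (simp add: has_real_derivative_iff_has_vector_derivative)
  interpret subcritical h p "TYPE('n)"
  proof
    have "isCont h x" for x by (rule DERIV_isCont[OF der])
    then show "continuous_on UNIV h" by (simp add: continuous_on_eq_continuous_at)
    show "(h has_real_derivative 0) (at 0)" using der[of 0] DERIV_imp_deriv[OF der[of 0]] assms(8) by simp
    show "p + 1 < 2 * real (hdim TYPE('n)) / (real (hdim TYPE('n)) - 2)"
      using assms(6) unfolding dim critical_exponent_def by (simp add: algebra_simps)
  qed (use assms in auto)
  show ?thesis by (rule exists_solution[OF assms(9,10)])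
qed

end
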